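(* Let $s>0$, $\rho\in\mathcal{H}_s$, $M$ a $d\times d$ dilation matrix, and $\alpha\in\mathcal{A}_M$. Suppose that $\widetilde\varphi\in\mathcal{S}'_{\alpha;M}$ and $\varphi\in\mathcal{L}C$ satisfy the following conditions: \begin{enumerate} \item[1)] $\operatorname{supp}\widehat\varphi\subset\mathbb{T}^d$; \item[2)] $\eta\,\dfrac{\rho}{1-\widehat\varphi\,\overline{\widehat{\widetilde\varphi}}}\in W_0$. \end{enumerate} Then there is a constant $c$, independent of $f$ and $j$, such that for every $f\in\mathbb{B}_M^{\alpha(\cdot)}$ and every $j\in\mathbb{Z}_+$ $$ \mathcal{R}_\rho(f,M^{-j})\le c\,\|f-Q_j(f,\varphi,\widetilde\varphi)\|+c\sum_{\nu=j}^\infty\alpha(M^{\nu-j})\,E_{M^\nu}(f). $$ Moreover, if $\widetilde\varphi\in\mathcal{S}'_{\mathrm{const};M}$, then there is a constant $c$, independent of $f$ and $j$, such that for every $f\in C$ and every $j\in\mathbb{Z}_+$ $$ \mathcal{R}_\rho(f,M^{-j})\le c\,\|f-Q_j(f,\varphi,\widetilde\varphi)\|. $$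
   Context: Basic notation. $\mathbb{Z}_+=\{0,1,2,\dots\}$. $\mathbb{T}^d$, viewed as a subset of $\mathbb{R}^d$, is the unit cube $[-1/2,1/2]^d$. $M^*$ is the conjugate (transpose) of $M$, $m=|\det M|$. A dilation matrix is a real $d\times d$ matrix all of whose eigenvalues are bigger than $1$ in modulus. $C$ is the space of bounded uniformly continuous functions on $\mathbb{R}^d$; $\|\cdot\|$ is the sup norm on $\mathbb{R}^d$. $\widehat f(\xi)=\mathcal{F}f(\xi)=\int_{\mathbb{R}^d}f(x)e^{-2\pi i(x,\xi)}dx$, extended to tempered distributions. For $f\in\mathcal S$ (Schwartz class) and $\psi\in\mathcal S'$, $\langle f,\psi\rangle:=\psi(f)$, where a function $g$ is identified with the functional $f\mapsto\int f\overline g$; $\widehat\psi$ is defined by $\langle\widehat f,\widehat\psi\rangle=\langle f,\psi\rangle$. For a function, $f^-(x)=\overline{f(-x)}$; for $\psi\in\mathcal S'$, $\psi^-$ is defined by $\langle f,\psi^-\rangle=\overline{\langle f^-,\psi\rangle}$, so that $\widehat{\psi^-}=\overline{\widehat\psi}$ when $\widehat\psi$ is a function. Wiener's algebra: $W_0$ is the set of $f$ of the form $f(x)=\int_{\mathbb{R}^d}g(\xi)e^{i(x,\xi)}d\xi$ with $g\in L_1(\mathbb{R}^d)$. $\mathcal{L}C$ is the set of continuous functions $\varphi$ on $\mathbb{R}^d$ such that $\sum_{k\in\mathbb{Z}^d}|\varphi(\cdot+k)|$ converges uniformly on every compact set. Cut-offs: $\eta\in C^\infty(\mathbb{R}^d)$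 is a fixed real-valued function with $\eta=1$ on $\mathbb{T}^d$ and $\eta=0$ outside $2\mathbb{T}^d$; for an invertible matrix $A$, $\eta_A=\eta((A^* )^{-1}\cdot)$, $\mathcal{N}_A=\mathcal{F}^{-1}\eta_A$. Also $\mathcal{N}_A*\widetilde\varphi^-:=\mathcal{F}^{-1}\big(\eta_A\,\overline{\widehat{\widetilde\varphi}}\big)$. Best approximation and Besov space: $\mathcal{B}_A=\{g\in L_\infty(\mathbb{R}^d):\operatorname{supp}\widehat g\subset A^*\mathbb{T}^d\}$ (elements are identified with their continuous representatives), $E_A(f)=\inf\{\|f-g\|:g\in\mathcal{B}_A\}$. For a positive function $\alpha$ on the set of real $d\times d$ matrices, $\mathbb{B}_M^{\alpha(\cdot)}$ is the set of $f\in C$ with $\|f\|+\sum_{\nu=1}^\infty\alpha(M^\nu)E_{M^\nu}(f)<\infty$. $\mathcal{A}_M$ is the set of positive functions $\alpha$ on $\mathbb{R}^{d\times d}$ with $\alpha(M^{\mu+1})\le c(M)\alpha(M^\mu)$ for all $\mu\in\mathbb{Z}_+$. Class $\mathcal{S}'_{\alpha;M}$: tempered distributions $\widetilde\varphi$ whose Fourier transform is a measurable locally bounded function and such that for all $\nu\in\mathbb{Z}_+$ the function $\mathcal{N}_{M^\nu}*\widetilde\varphi^-$ is in $L_1(\mathbb{R}^d)$ with $\|\mathcal{N}_{M^\nu}*\widetilde\varphi^-\|_1\le c\,\alpha(M^\nu)$, $c$ independent of $\nu$. $\mathcal{S}'_{\mathrm{const};M}$ is this class with $\alpha$ a constant function.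 Quasi-projection operators: let $\widetilde\varphi\in\mathcal{S}'_{\alpha;M}$, $\alpha\in\mathcal{A}_M$. For $f\in\mathbb{B}_M^{\alpha(\cdot)}$, or for $f\in C$ when $\alpha$ is constant, choose any $\delta'\in(0,1]$ and functions $T_\mu\in\mathcal{B}_{\delta'M^\mu}$, $\mu\in\mathbb{Z}_+$, with $\|f-T_\mu\|\le c(d)E_{\delta'M^\mu}(f)$, and set $$\langle f,\widetilde\varphi_{0k}\rangle:=\lim_{\mu\to\infty}\big(T_\mu*(\mathcal{N}_{M^\mu}*\widetilde\varphi^-)\big)(-k),\quad k\in\mathbb{Z}^d,$$ (the limit exists and does not depend on $\delta'$ and the $T_\mu$), and $\langle f,\widetilde\varphi_{jk}\rangle:=m^{-j/2}\langle f(M^{-j}\cdot),\widetilde\varphi_{0k}\rangle$, $j\in\mathbb{Z}_+$. With $\varphi_{jk}(x)=m^{j/2}\varphi(M^jx+k)$, $$Q_j(f,\varphi,\widetilde\varphi)=\sum_{k\in\mathbb{Z}^d}\langle f,\widetilde\varphi_{jk}\rangle\varphi_{jk}.$$ Realization of the $K$-functional: $\mathcal{H}_s$, $s>0$, is the class of (complex-valued) functions $\rho\in C^\infty(\mathbb{R}^d\setminus\{\mathbf 0\})$ that are homogeneous of degree $s$, i.e. $\rho(\tau\xi)=\tau^s\rho(\xi)$ for $\tau>0$. Put $\mathcal{D}(\rho)g=\mathcal{F}^{-1}(\rho\,\widehat g)$ for $g\in\mathcal S$, and for $T\in\mathcal{B}_{M^j}$ put $\mathcal{D}(\rho)T:=(\mathcal{D}(\rho)\mathcal{N}_{M^j})*T$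 (here $\mathcal{D}(\rho)\mathcal{N}_{M^j}\in L_1$). Then $$\mathcal{R}_\rho(f,M^{-j})=\inf_{T\in\mathcal{B}_{M^j}}\big\{\|f-T\|+\|\mathcal{D}(\rho((M^* )^{-j}\cdot))T\|\big\}.$$ *)

theory Defs
  imports "HOL-Analysis.Analysis"
begin

subsection \<open>Matrices and lattice points\<close>

text \<open>The library power on \<open>real^'n^'n\<close> is componentwise, so it is not the matrix power.\<close>

primrec mat_power :: "real^'n^'n \<Rightarrow> nat \<Rightarrow> real^'n^'n" where
  "mat_power A 0 = mat 1"
| "mat_power A (Suc k) = A ** mat_power A k"

definition complex_eigenvalue :: "real^'n^'n \<Rightarrow> complex \<Rightarrow> bool" where
  "complex_eigenvalue A l \<longleftrightarrow>
    (\<exists>v :: complex^'n. v \<noteq> 0 \<and> (\<chi> i j. complex_of_real (A $ i $ j)) *v v = l *s v)"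

definition dilation_matrix :: "real^'n^'n \<Rightarrow> bool" where
  "dilation_matrix M \<longleftrightarrow> (\<forall>l. complex_eigenvalue M l \<longrightarrow> norm l > 1)"

definition lattice_vec :: "int^'n \<Rightarrow> real^'n" where
  "lattice_vec k = (\<chi> i. real_of_int (k $ i))"

definition unit_cube :: "(real^'n) set" where
  "unit_cube = {x. \<forall>i. \<bar>x $ i\<bar> \<le> 1/2}"


subsection \<open>Smooth functions, Schwartz functions, test functions\<close>

text \<open>\<open>partials [i, j, \<dots>] f\<close> is the iterated partial derivative of \<open>f\<close> along the listed coordinates.
  Differentiability of all of them on an open set is the same as \<open>C\<^sup>\<infinity>\<close>, since it makes
  them all continuous.\<close>

primrec partials :: "'n list \<Rightarrow> (real^'n \<Rightarrow> 'b::real_normed_vector) \<Rightarrow> real^'n \<Rightarrow> 'b" where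
  "partials [] f = f"
| "partials (i # is) f = (\<lambda>x. frechet_derivative (partials is f) (at x) (axis i 1))"

definition smooth_on :: "(real^'n) set \<Rightarrow> (real^'n \<Rightarrow> 'b::real_normed_vector) \<Rightarrow> bool" where
  "smooth_on S f \<longleftrightarrow> (\<forall>is. \<forall>x\<in>S. partials is f differentiable (at x))"

definition fun_support :: "(real^'n \<Rightarrow> 'b::zero) \<Rightarrow> (real^'n) set" where
  "fun_support f = closure {x. f x \<noteq> 0}"

definition schwartz :: "(real^'n \<Rightarrow> complex) set" where
  "schwartz = {f. smooth_on UNIV f \<and>
     (\<forall>k is. bounded (range (\<lambda>x. norm x ^ k *\<^sub>R partials is f x)))}"

definition schwartz_null_seq :: "(nat \<Rightarrow> real^'n \<Rightarrow> complex) \<Rightarrow> bool" where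
  "schwartz_null_seq F \<longleftrightarrow> (\<forall>n. F n \<in> schwartz) \<and>
     (\<forall>k is. uniform_limit UNIV (\<lambda>n x. norm x ^ k *\<^sub>R partials is (F n) x) (\<lambda>x. 0) sequentially)"

definition test_functions :: "(real^'n \<Rightarrow> complex) set" where
  "test_functions = {h. smooth_on UNIV h \<and> compact (fun_support h)}"


subsection \<open>Fourier transform and tempered distributions\<close>

definition fourier :: "(real^'n \<Rightarrow> complex) \<Rightarrow> real^'n \<Rightarrow> complex" where
  "fourier f \<xi> = (\<integral>x. f x * cis (- 2 * pi * (x \<bullet> \<xi>)) \<partial>lebesgue)"

definition inv_fourier :: "(real^'n \<Rightarrow> complex) \<Rightarrow> real^'n \<Rightarrow> complex" where
  "inv_fourier f x = (\<integral>\<xi>. f \<xi> * cis (2 * pi * (x \<bullet> \<xi>)) \<partial>lebesgue)"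

definition conv :: "(real^'n \<Rightarrow> complex) \<Rightarrow> (real^'n \<Rightarrow> complex) \<Rightarrow> real^'n \<Rightarrow> complex" where
  "conv f g x = (\<integral>y. f (x - y) * g y \<partial>lebesgue)"

text \<open>A tempered distribution is a functional \<open>\<psi>\<close> with \<open>\<langle>f, \<psi>\<rangle> = \<psi> f\<close>; its values outside the
  Schwartz class are irrelevant. Since the Schwartz space is metrizable, continuity is
  sequential continuity.\<close>

definition tempered :: "((real^'n \<Rightarrow> complex) \<Rightarrow> complex) set" where
  "tempered = {\<psi>.
     (\<forall>f\<in>schwartz. \<forall>g\<in>schwartz. \<psi> (\<lambda>x. f x + g x) = \<psi> f + \<psi> g) \<and>
     (\<forall>f\<in>schwartz. \<forall>a. \<psi> (\<lambda>x. a * f x) = a * \<psi> f) \<and>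
     (\<forall>F. schwartz_null_seq F \<longrightarrow> (\<lambda>n. \<psi> (F n)) \<longlonglongrightarrow> 0)}"

text \<open>Functions act with a complex conjugation: \<open>\<langle>f, g\<rangle> = \<integral> f cnj g\<close>. The Fourier transform of a
  distribution is characterised by \<open>\<langle>fourier f, dist_fourier \<psi>\<rangle> = \<langle>f, \<psi>\<rangle>\<close>.\<close>

definition fun_dist :: "(real^'n \<Rightarrow> complex) \<Rightarrow> (real^'n \<Rightarrow> complex) \<Rightarrow> complex" where
  "fun_dist g f = (\<integral>x. f x * cnj (g x) \<partial>lebesgue)"

definition dist_fourier ::
  "((real^'n \<Rightarrow> complex) \<Rightarrow> complex) \<Rightarrow> (real^'n \<Rightarrow> complex) \<Rightarrow> complex" where
  "dist_fourier \<psi> h = \<psi> (inv_fourier h)"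

definition dist_support :: "((real^'n \<Rightarrow> complex) \<Rightarrow> complex) \<Rightarrow> (real^'n) set" where
  "dist_support \<psi> =
     - \<Union>{U. open U \<and> (\<forall>h\<in>test_functions. fun_support h \<subseteq> U \<longrightarrow> \<psi> h = 0)}"

definition represents :: "(real^'n \<Rightarrow> complex) \<Rightarrow> ((real^'n \<Rightarrow> complex) \<Rightarrow> complex) \<Rightarrow> bool" where
  "represents g \<psi> \<longleftrightarrow>
     (\<forall>h\<in>schwartz. integrable lebesgue (\<lambda>x. h x * cnj (g x)) \<and> \<psi> h = fun_dist g h)"

definition locally_bounded_measurable :: "(real^'n \<Rightarrow> complex) \<Rightarrow> bool" where
  "locally_bounded_measurable g \<longleftrightarrow>
     g \<in> borel_measurable lebesgue \<and> (\<forall>K. compact K \<longrightarrow> bounded (g ` K))"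

definition has_fourier_fun :: "((real^'n \<Rightarrow> complex) \<Rightarrow> complex) \<Rightarrow> (real^'n \<Rightarrow> complex) \<Rightarrow> bool" where
  "has_fourier_fun \<psi> g \<longleftrightarrow> locally_bounded_measurable g \<and> represents g (dist_fourier \<psi>)"

text \<open>The Fourier transform of \<open>\<psi>\<close> as a function, for \<open>\<psi>\<close> satisfying \<open>\<exists>g. has_fourier_fun \<psi> g\<close>.
  It is determined up to a null set, and it is used below only under integrals and in
  almost-everywhere statements.\<close>

definition fourier_fun :: "((real^'n \<Rightarrow> complex) \<Rightarrow> complex) \<Rightarrow> real^'n \<Rightarrow> complex" where
  "fourier_fun \<psi> = (SOME g. has_fourier_fun \<psi> g)"


subsection \<open>Function spaces\<close>

text \<open>Norms take values in \<^typ>\<open>ennreal\<close>, so that unbounded functions have norm \<open>\<infinity>\<close>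
  and divergent series have sum \<open>\<infinity>\<close>.\<close>

definition sup_norm :: "(real^'n \<Rightarrow> complex) \<Rightarrow> ennreal" where
  "sup_norm f = (SUP x. ennreal (norm (f x)))"

definition BUC :: "(real^'n \<Rightarrow> complex) set" where
  "BUC = {f. bounded (range f) \<and> uniformly_continuous_on UNIV f}"

definition wiener :: "(real^'n \<Rightarrow> complex) set" where
  "wiener = {f. \<exists>g. integrable lebesgue g \<and> (\<forall>x. f x = (\<integral>\<xi>. g \<xi> * cis (x \<bullet> \<xi>) \<partial>lebesgue))}"

definition LC :: "(real^'n \<Rightarrow> complex) set" where
  "LC = {\<phi>. continuous_on UNIV \<phi> \<and>
     (\<forall>K. compact K \<longrightarrow> (\<exists>l. uniform_limit K
        (\<lambda>F x. \<Sum>k\<in>F. norm (\<phi> (x + lattice_vec k))) l (finite_subsets_at_top (UNIV :: (int^'n) set))))}"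

text \<open>Band-limited bounded functions, given by their continuous representatives.\<close>

definition band :: "real^'n^'n \<Rightarrow> (real^'n \<Rightarrow> complex) set" where
  "band A = {g. continuous_on UNIV g \<and> bounded (range g) \<and>
     dist_support (dist_fourier (fun_dist g)) \<subseteq> (\<lambda>x. transpose A *v x) ` unit_cube}"

definition best_approx :: "real^'n^'n \<Rightarrow> (real^'n \<Rightarrow> complex) \<Rightarrow> ennreal" where
  "best_approx A f = (INF g\<in>band A. sup_norm (\<lambda>x. f x - g x))"

definition growth_class :: "real^'n^'n \<Rightarrow> (real^'n^'n \<Rightarrow> real) set" where
  "growth_class M = {\<alpha>. (\<forall>A. \<alpha> A > 0) \<and>
     (\<exists>c. \<forall>k. \<alpha> (mat_power M (k + 1)) \<le> c * \<alpha> (mat_power M k))}"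

definition besov :: "real^'n^'n \<Rightarrow> (real^'n^'n \<Rightarrow> real) \<Rightarrow> (real^'n \<Rightarrow> complex) set" where
  "besov M \<alpha> = {f \<in> BUC. sup_norm f +
     (\<Sum>\<^sub>\<infinity>n\<in>{1..}. ennreal (\<alpha> (mat_power M n)) * best_approx (mat_power M n) f) < \<infinity>}"


subsection \<open>Cut-offs and the distribution classes\<close>

definition cutoff :: "(real^'n \<Rightarrow> real) \<Rightarrow> bool" where
  "cutoff \<eta> \<longleftrightarrow> smooth_on UNIV \<eta> \<and> (\<forall>x\<in>unit_cube. \<eta> x = 1) \<and>
     (\<forall>x. x \<notin> (\<lambda>y. 2 *\<^sub>R y) ` unit_cube \<longrightarrow> \<eta> x = 0)"

definition cutoff_scaled :: "(real^'n \<Rightarrow> real) \<Rightarrow> real^'n^'n \<Rightarrow> real^'n \<Rightarrow> complex" where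
  "cutoff_scaled \<eta> A \<xi> = complex_of_real (\<eta> (matrix_inv (transpose A) *v \<xi>))"

definition kernel_N :: "(real^'n \<Rightarrow> real) \<Rightarrow> real^'n^'n \<Rightarrow> real^'n \<Rightarrow> complex" where
  "kernel_N \<eta> A = inv_fourier (cutoff_scaled \<eta> A)"

text \<open>The function \<open>N\<^sub>A * \<psi>\<^sup>-\<close>, where the transform of \<open>\<psi>\<^sup>-\<close> is the conjugate of that of \<open>\<psi>\<close>.\<close>

definition N_conv ::
  "(real^'n \<Rightarrow> real) \<Rightarrow> real^'n^'n \<Rightarrow> ((real^'n \<Rightarrow> complex) \<Rightarrow> complex) \<Rightarrow> real^'n \<Rightarrow> complex" where
  "N_conv \<eta> A \<psi> = inv_fourier (\<lambda>\<xi>. cutoff_scaled \<eta> A \<xi> * cnj (fourier_fun \<psi> \<xi>))"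

definition distr_class ::
  "(real^'n \<Rightarrow> real) \<Rightarrow> real^'n^'n \<Rightarrow> (real^'n^'n \<Rightarrow> real) \<Rightarrow> ((real^'n \<Rightarrow> complex) \<Rightarrow> complex) set" where
  "distr_class \<eta> M \<alpha> = {\<psi> \<in> tempered. (\<exists>g. has_fourier_fun \<psi> g) \<and>
     (\<exists>c. \<forall>n. integrable lebesgue (N_conv \<eta> (mat_power M n) \<psi>) \<and>
        (\<integral>x. norm (N_conv \<eta> (mat_power M n) \<psi> x) \<partial>lebesgue) \<le> c * \<alpha> (mat_power M n))}"

definition distr_class_const ::
  "(real^'n \<Rightarrow> real) \<Rightarrow> real^'n^'n \<Rightarrow> ((real^'n \<Rightarrow> complex) \<Rightarrow> complex) set" where
  "distr_class_const \<eta> M = (\<Union>a\<in>{0<..}. distr_class \<eta> M (\<lambda>_. a))"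


subsection \<open>Quasi-projection operators\<close>

text \<open>\<open>near_best M f \<delta> T\<close>: the \<open>T \<mu>\<close> are near-best approximants, with some constant not
  depending on \<open>\<mu>\<close>.\<close>

definition near_best ::
  "real^'n^'n \<Rightarrow> (real^'n \<Rightarrow> complex) \<Rightarrow> real \<Rightarrow> (nat \<Rightarrow> real^'n \<Rightarrow> complex) \<Rightarrow> bool" where
  "near_best M f \<delta> T \<longleftrightarrow> (\<exists>c::real. \<forall>\<mu>. T \<mu> \<in> band (\<delta> *\<^sub>R mat_power M \<mu>) \<and>
     sup_norm (\<lambda>x. f x - T \<mu> x) \<le> ennreal c * best_approx (\<delta> *\<^sub>R mat_power M \<mu>) f)"

text \<open>\<open>\<langle>f, \<psi>\<^sub>0\<^sub>k\<rangle>\<close>: the common limit for all admissible choices of \<open>\<delta>\<close> and \<open>T\<close>.\<close>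

definition pairing0 ::
  "(real^'n \<Rightarrow> real) \<Rightarrow> real^'n^'n \<Rightarrow> (real^'n \<Rightarrow> complex) \<Rightarrow>
    ((real^'n \<Rightarrow> complex) \<Rightarrow> complex) \<Rightarrow> int^'n \<Rightarrow> complex" where
  "pairing0 \<eta> M f \<psi> k = (THE L. \<forall>\<delta> T. 0 < \<delta> \<and> \<delta> \<le> 1 \<and> near_best M f \<delta> T \<longrightarrow>
     (\<lambda>\<mu>. conv (T \<mu>) (N_conv \<eta> (mat_power M \<mu>) \<psi>) (- lattice_vec k)) \<longlonglongrightarrow> L)"

definition pairing ::
  "(real^'n \<Rightarrow> real) \<Rightarrow> real^'n^'n \<Rightarrow> nat \<Rightarrow> (real^'n \<Rightarrow> complex) \<Rightarrow>
    ((real^'n \<Rightarrow> complex) \<Rightarrow> complex) \<Rightarrow> int^'n \<Rightarrow> complex" where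
  "pairing \<eta> M j f \<psi> k = complex_of_real (\<bar>det M\<bar> powr (- real j / 2)) *
     pairing0 \<eta> M (\<lambda>x. f (matrix_inv (mat_power M j) *v x)) \<psi> k"

definition shifted_dilate ::
  "real^'n^'n \<Rightarrow> (real^'n \<Rightarrow> complex) \<Rightarrow> nat \<Rightarrow> int^'n \<Rightarrow> real^'n \<Rightarrow> complex" where
  "shifted_dilate M \<phi> j k x =
     complex_of_real (\<bar>det M\<bar> powr (real j / 2)) * \<phi> (mat_power M j *v x + lattice_vec k)"

definition quasi_proj ::
  "(real^'n \<Rightarrow> real) \<Rightarrow> real^'n^'n \<Rightarrow> nat \<Rightarrow> (real^'n \<Rightarrow> complex) \<Rightarrow> (real^'n \<Rightarrow> complex) \<Rightarrow>
    ((real^'n \<Rightarrow> complex) \<Rightarrow> complex) \<Rightarrow> real^'n \<Rightarrow> complex" where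
  "quasi_proj \<eta> M j f \<phi> \<psi> x =
     (\<Sum>\<^sub>\<infinity>k\<in>UNIV. pairing \<eta> M j f \<psi> k * shifted_dilate M \<phi> j k x)"


subsection \<open>Realization of the K-functional\<close>

text \<open>Elements of \<open>homogeneous_smooth s\<close> are functions on the complement of the origin; the value at
  \<open>0\<close> is arbitrary and never matters.\<close>

definition homogeneous_smooth :: "real \<Rightarrow> (real^'n \<Rightarrow> complex) set" where
  "homogeneous_smooth s = {\<rho>. smooth_on (- {0}) \<rho> \<and>
     (\<forall>\<tau> \<xi>. \<tau> > 0 \<and> \<xi> \<noteq> 0 \<longrightarrow> \<rho> (\<tau> *\<^sub>R \<xi>) = complex_of_real (\<tau> powr s) * \<rho> \<xi>)}"

definition diff_op :: "(real^'n \<Rightarrow> complex) \<Rightarrow> (real^'n \<Rightarrow> complex) \<Rightarrow> real^'n \<Rightarrow> complex" where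
  "diff_op \<rho> g = inv_fourier (\<lambda>\<xi>. \<rho> \<xi> * fourier g \<xi>)"

definition diff_op_band ::
  "(real^'n \<Rightarrow> real) \<Rightarrow> real^'n^'n \<Rightarrow> (real^'n \<Rightarrow> complex) \<Rightarrow> (real^'n \<Rightarrow> complex) \<Rightarrow>
    real^'n \<Rightarrow> complex" where
  "diff_op_band \<eta> A \<rho> T = conv (diff_op \<rho> (kernel_N \<eta> A)) T"

definition realization ::
  "(real^'n \<Rightarrow> real) \<Rightarrow> real^'n^'n \<Rightarrow> (real^'n \<Rightarrow> complex) \<Rightarrow> (real^'n \<Rightarrow> complex) \<Rightarrow> nat \<Rightarrow> ennreal" where
  "realization \<eta> M \<rho> f j = (INF T\<in>band (mat_power M j).
     sup_norm (\<lambda>x. f x - T x) +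
     sup_norm (diff_op_band \<eta> (mat_power M j)
       (\<lambda>\<xi>. \<rho> (matrix_inv (transpose (mat_power M j)) *v \<xi>)) T))"

end

theory Submission
  imports Defs "HOL-Probability.Probability" "HOL-Computational_Algebra.Fundamental_Theorem_Algebra"
begin

text \<open>Put \<open>F x = f (M\<^sup>-\<^sup>j x)\<close>; substituting \<open>x \<mapsto> M\<^sup>j x\<close> turns the claim for \<open>f\<close> and \<open>j\<close> into the one
  for \<open>F\<close> at scale zero. Let \<open>g\<close> be a near-best approximation of \<open>F\<close> with spectrum in the unit cube and
  \<open>S g = (\<Sum>k. (N * \<psi>\<^sup>- * g)(-k) \<phi>(\<cdot> + k))\<close>. Since the spectrum of \<open>\<phi>\<close> lies in the unit cube, a Poisson summation
  argument gives \<open>S g = \<phi> * (N * \<psi>\<^sup>- * g)\<close>, so on band-limited functions \<open>S\<close> is the Fourier multiplier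
  given by the transform of \<open>\<phi>\<close> times the conjugate of that of \<open>\<psi>\<close>. By condition 2) \<open>D(\<rho>) g\<close> is then an
  \<open>L\<^sub>1\<close> kernel convolved with \<open>g - S g\<close>, whence \<open>\<parallel>D(\<rho>) g\<parallel> \<le> c \<parallel>g - S g\<parallel>\<close>.

  In \<open>g - S g = (g - F) + (F - Q F) + (Q F - S g)\<close> the last term is controlled by the difference between the
  coefficient functionals of \<open>F\<close> and those of \<open>g\<close>. Telescoping the limit which defines the former bounds
  that difference by a multiple of the sum of the \<open>\<alpha>(M\<^sup>\<nu>) E(M\<^sup>\<nu>, F)\<close>. If \<open>\<alpha>\<close> is constant, the limit can be
  compared with its first term in one step, because \<open>E(M\<^sup>\<nu>, F)\<close> tends to \<open>0\<close>; this leaves a multiple of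
  \<open>E(1, F)\<close>, which is at most \<open>\<parallel>F - Q F\<parallel>\<close> because \<open>Q F\<close> is itself band-limited.\<close>

subsection \<open>Integration and linear changes of variables\<close>

text \<open>Spectral information enters in one form only: if an integrable symbol \<open>l\<close>
  of bounded support, with integrable inverse transform, vanishes on the spectral cube of
  \<open>g\<close>, then \<open>conv (inv_fourier l) g\<close> is 0. Multipliers that agree on the
  cube can thus be exchanged, which allows a cut-off to be replaced by a wider one and kills the
  modulated terms in the Poisson summation. Membership in \<open>band A\<close> speaks only of test
  functions supported off the closed cube, so the passage to integrable symbols that vanish on the
  cube and no further is the analytic core.

  The obstacle behind the limit is that eigenvalues of modulus above 1 make M expanding only in the
  long run: the cubes of M^\<nu> and M^(\<nu>+1) need not be nested. They are nested over N or more
  steps, and this gap is the origin of the factor \<open>c1 ^ (N + 1)\<close> in the constant.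

  In the first estimate j enters only through E(M^\<nu>, F) \<le> E(M^(\<nu>+j), f), so the
  constants depend on neither f nor j. That E(M^\<nu>, F) tends to 0 rests on uniform continuity of
  F and on M^(-\<nu>) tending to 0.\<close>

lemma integrable_bounded_mult:
  fixes f g :: "'a \<Rightarrow> complex"
  assumes "integrable M f" "g \<in> borel_measurable M" "\<And>x. norm (g x) \<le> B"
  shows "integrable M (\<lambda>x. f x * g x)"
proof (rule Bochner_Integration.integrable_bound[where f="\<lambda>x. B * norm (f x)"])
  show "(\<lambda>x. f x * g x) \<in> borel_measurable M" using assms by (intro borel_measurable_times) auto
  show "AE x in M. norm (f x * g x) \<le> norm (B * norm (f x))"
  proof (rule AE_I2)
    fix x
    have "0 \<le> B" using assms(3)[of x] norm_ge_zero order_trans by blast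
    then show "norm (f x * g x) \<le> norm (B * norm (f x))"
      using mult_right_mono[OF assms(3)[of x], of "norm (f x)"] by (simp add: norm_mult mult.commute)
  qed
qed (use assms(1) in simp)

lemma norm_integral_mult_le:
  fixes f g :: "'a \<Rightarrow> complex"
  assumes "integrable M f" "\<And>x. norm (g x) \<le> B"
  shows "norm (\<integral>x. f x * g x \<partial>M) \<le> B * (\<integral>x. norm (f x) \<partial>M)"
proof (cases "integrable M (\<lambda>x. f x * g x)")
  case True
  have "norm (\<integral>x. f x * g x \<partial>M) \<le> (\<integral>x. norm (f x * g x) \<partial>M)" by simp
  also have "\<dots> \<le> (\<integral>x. B * norm (f x) \<partial>M)"
  proof (intro integral_mono)
    show "norm (f x * g x) \<le> B * norm (f x)" for x
      using mult_left_mono[OF assms(2)[of x], of "norm (f x)"] by (simp add: norm_mult mult.commute)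
  qed (use True assms in auto)
  finally show ?thesis by simp
next
  case False
  have "0 \<le> B" using assms(2)[of undefined] norm_ge_zero order_trans by blast
  then show ?thesis using False by (simp add: not_integrable_integral_eq)
qed

lemma integral_lebesgue_borel:
  fixes f :: "'a::euclidean_space \<Rightarrow> 'b::{banach,second_countable_topology}"
  shows "f \<in> borel_measurable borel \<Longrightarrow> integral\<^sup>L lebesgue f = integral\<^sup>L lborel f"
  by (rule integral_completion) simp

lemma integrable_lebesgue_borel:
  fixes f :: "'a::euclidean_space \<Rightarrow> 'b::{banach,second_countable_topology}"
  shows "f \<in> borel_measurable borel \<Longrightarrow> integrable lebesgue f \<longleftrightarrow> integrable lborel f"
  by (rule integrable_completion) simp

text \<open>The definitions integrate over \<open>lebesgue\<close>, while Fubini and substitution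
  are carried out over \<open>lborel\<close>. This is the bridge for the two functions that are only
  Lebesgue measurable: the density of an element of \<open>wiener\<close> and the transform of
  \<psi>.\<close>

lemma lebesgue_borel_representative:
  fixes f :: "'a::euclidean_space \<Rightarrow> complex"
  assumes f: "f \<in> borel_measurable lebesgue"
  obtains g where "g \<in> borel_measurable borel" "AE x in lebesgue. f x = g x"
proof -
  obtain a where a: "a \<in> borel_measurable lborel" "AE x in lborel. Re (f x) = a x"
    using completion_ex_borel_measurable_real[of "\<lambda>x. Re (f x)" lborel] f by auto
  obtain b where b: "b \<in> borel_measurable lborel" "AE x in lborel. Im (f x) = b x"
    using completion_ex_borel_measurable_real[of "\<lambda>x. Im (f x)" lborel] f by auto
  show thesis
  proof (rule that)
    show "(\<lambda>x. Complex (a x) (b x)) \<in> borel_measurable borel"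
      using a(1) b(1) by (simp add: borel_measurable_complex_iff)
    show "AE x in lebesgue. f x = Complex (a x) (b x)"
      using a(2)[THEN AE_completion] b(2)[THEN AE_completion] by eventually_elim (auto simp: complex_eq_iff)
  qed
qed

lemma integrable_scaleR_iff:
  fixes f :: "'a \<Rightarrow> complex"
  assumes "r \<noteq> 0"
  shows "integrable M (\<lambda>x. r *\<^sub>R f x) \<longleftrightarrow> integrable M f"
proof
  assume "integrable M (\<lambda>x. r *\<^sub>R f x)"
  from integrable_scaleR_right[OF this, of "inverse r"] show "integrable M f" using assms by simp
qed simp

section \<open>Affine and linear substitutions\<close>

lemma matrix_inv_mult:
  fixes A :: "real^'n^'n"
  assumes "det A \<noteq> 0"
  shows "A ** matrix_inv A = mat 1" "matrix_inv A ** A = mat 1"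
proof -
  have "\<exists>B. A ** B = mat 1 \<and> B ** A = mat 1"
    using assms by (simp add: invertible_det_nz[symmetric] invertible_def)
  then have "A ** matrix_inv A = mat 1 \<and> matrix_inv A ** A = mat 1"
    unfolding matrix_inv_def by (rule someI_ex)
  then show "A ** matrix_inv A = mat 1" "matrix_inv A ** A = mat 1" by auto
qed

lemma lborel_integral_affine:
  fixes f :: "'a::euclidean_space \<Rightarrow> complex"
  assumes c: "c \<noteq> 0" and [measurable]: "f \<in> borel_measurable borel"
  shows "(\<integral>x. f (t + c *\<^sub>R x) \<partial>lborel) = (\<integral>x. f x \<partial>lborel) / complex_of_real (\<bar>c\<bar> ^ DIM('a))"
    and "integrable lborel (\<lambda>x. f (t + c *\<^sub>R x)) \<longleftrightarrow> integrable lborel f"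
proof -
  have "(\<integral>x. f x \<partial>lborel) = (\<integral>x. f x \<partial>density (distr lborel borel (\<lambda>x. t + c *\<^sub>R x)) (\<lambda>_. \<bar>c\<bar>^DIM('a)))"
    by (subst lborel_affine[OF c, of t]) simp
  also have "\<dots> = (\<bar>c\<bar>^DIM('a)) *\<^sub>R (\<integral>x. f (t + c *\<^sub>R x) \<partial>lborel)"
    by (subst integral_density) (auto simp: integral_distr)
  finally show "(\<integral>x. f (t + c *\<^sub>R x) \<partial>lborel) = (\<integral>x. f x \<partial>lborel) / complex_of_real (\<bar>c\<bar> ^ DIM('a))"
    using c by (simp add: scaleR_conv_of_real)
  have "integrable lborel f \<longleftrightarrow> integrable (density (distr lborel borel (\<lambda>x. t + c *\<^sub>R x)) (\<lambda>_. \<bar>c\<bar>^DIM('a))) f"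
    by (subst lborel_affine[OF c, of t]) simp
  also have "\<dots> \<longleftrightarrow> integrable lborel (\<lambda>x. f (t + c *\<^sub>R x))"
    using c by (subst integrable_density) (auto simp: integrable_distr_eq integrable_scaleR_iff)
  finally show "integrable lborel (\<lambda>x. f (t + c *\<^sub>R x)) \<longleftrightarrow> integrable lborel f" by simp
qed

lemma lborel_integral_shift:
  fixes f :: "'a::euclidean_space \<Rightarrow> complex"
  assumes "f \<in> borel_measurable borel"
  shows "(\<integral>x. f (t - x) \<partial>lborel) = (\<integral>x. f x \<partial>lborel)"
    and "integrable lborel (\<lambda>x. f (t - x)) \<longleftrightarrow> integrable lborel f"
    and "(\<integral>x. f (x - t) \<partial>lborel) = (\<integral>x. f x \<partial>lborel)"
    and "integrable lborel (\<lambda>x. f (x - t)) \<longleftrightarrow> integrable lborel f"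
    and "(\<integral>x. f (x + t) \<partial>lborel) = (\<integral>x. f x \<partial>lborel)"
    and "integrable lborel (\<lambda>x. f (x + t)) \<longleftrightarrow> integrable lborel f"
    and "(\<integral>x. f (- x) \<partial>lborel) = (\<integral>x. f x \<partial>lborel)"
    and "integrable lborel (\<lambda>x. f (- x)) \<longleftrightarrow> integrable lborel f"
  using lborel_integral_affine[of "-1" f t] lborel_integral_affine[of 1 f "-t"] lborel_integral_affine[of 1 f t]
    lborel_integral_affine[of "-1" f 0] assms
  by (auto simp: algebra_simps)

lemma measurable_matrix_vector [measurable]:
  "(\<lambda>x. (A :: real^'n^'m) *v x) \<in> borel \<rightarrow>\<^sub>M borel"
  by (intro borel_measurable_continuous_onI continuous_intros matrix_vector_mult_linear_continuous_on)

lemma matrix_inv_vector: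
  fixes A :: "real^'n^'n"
  assumes "det A \<noteq> 0"
  shows "A *v (matrix_inv A *v x) = x" "matrix_inv A *v (A *v x) = x"
  using matrix_inv_mult[OF assms] by (simp_all add: matrix_vector_mul_assoc)

text \<open>The image of Lebesgue measure under \<open>A\<close> is again translation invariant,
  hence a multiple of it: the double integral of f(Ax) g(y - Ax), with \<open>g\<close> the even
  indicator of a ball, is evaluated in both orders. Integrating over y first gives the mass of the
  ball; substituting x + A^(-1) y first turns the integrand into f(Ax + y) g(Ax). So
  \<open>c\<close> is the volume of the preimage \<open>S\<close> of the ball divided by that of the
  ball.\<close>

lemma nn_integral_lborel_matrix:
  fixes A :: "real^'n^'n"
  assumes A: "det A \<noteq> 0"
  obtains c :: real where "c > 0"
    "\<And>f. f \<in> borel_measurable borel \<Longrightarrow> (\<integral>\<^sup>+x. f (A *v x) \<partial>lborel) = ennreal c * (\<integral>\<^sup>+x. f x \<partial>lborel)"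
proof -
  define g :: "real^'n \<Rightarrow> ennreal" where "g = indicator (cball 0 1)"
  have g[measurable]: "g \<in> borel_measurable borel" unfolding g_def by (intro borel_measurable_indicator) auto
  have gs: "g (- x) = g x" for x unfolding g_def by (auto simp: indicator_def)
  define S where "S = (\<lambda>x. matrix_inv A *v x) ` cball 0 1"
  have S: "g (A *v x) = indicator S x" for x
  proof -
    have "A *v x \<in> cball 0 1 \<longleftrightarrow> x \<in> S"
    proof
      assume "A *v x \<in> cball 0 1"
      then show "x \<in> S" unfolding S_def by (rule rev_image_eqI) (simp add: matrix_inv_vector[OF A])
    next
      assume "x \<in> S"
      then obtain y where "y \<in> cball 0 1" "x = matrix_inv A *v y" unfolding S_def by blast
      then show "A *v x \<in> cball 0 1" by (simp add: matrix_inv_vector[OF A])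
    qed
    then show ?thesis by (auto simp: g_def indicator_def)
  qed
  have cS: "compact S" unfolding S_def
    by (intro compact_continuous_image matrix_vector_mult_linear_continuous_on) auto
  then have [measurable]: "S \<in> sets borel" by (rule borel_compact)
  have Sf: "emeasure lborel S < \<infinity>" using cS by (intro emeasure_bounded_finite compact_imp_bounded)
  have ball0: "emeasure lborel (ball (0::real^'n) e) > 0" if "e > 0" for e
    using content_ball_pos[OF that, of "0::real^'n"] by (auto simp: measure_def enn2real_positive_iff)
  have Sp: "emeasure lborel S > 0"
  proof -
    have "open ((\<lambda>x. A *v x) -` ball 0 1)"
      by (intro open_vimage matrix_vector_mult_linear_continuous_on) auto
    moreover have "0 \<in> ((\<lambda>x. A *v x) -` ball 0 1)" by simp
    ultimately obtain e where e: "e > 0" "ball 0 e \<subseteq> (\<lambda>x. A *v x) -` ball 0 1" by (meson open_contains_ball)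
    have "ball 0 e \<subseteq> S"
    proof
      fix x :: "real^'n" assume "x \<in> ball 0 e"
      then have "A *v x \<in> cball 0 1" using e by force
      then show "x \<in> S" using S[of x] by (auto simp: g_def indicator_def split: if_splits)
    qed
    then have "emeasure lborel (ball (0::real^'n) e) \<le> emeasure lborel S" by (rule emeasure_mono) simp
    moreover have "emeasure lborel (ball (0::real^'n) e) > 0" using e(1) by (rule ball0)
    ultimately show ?thesis by simp
  qed
  have Kf: "emeasure lborel (cball (0::real^'n) 1) < \<infinity>" by (intro emeasure_bounded_finite) auto
  have Kp: "emeasure lborel (cball (0::real^'n) 1) > 0"
  proof -
    have "emeasure lborel (ball (0::real^'n) 1) \<le> emeasure lborel (cball (0::real^'n) 1)" by (intro emeasure_mono) auto
    moreover have "emeasure lborel (ball (0::real^'n) 1) > 0" by (rule ball0) simp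
    ultimately show ?thesis by simp
  qed
  have tr: "(\<integral>\<^sup>+x. f (x + t) \<partial>lborel) = (\<integral>\<^sup>+x. f x \<partial>lborel)" if [measurable]: "f \<in> borel_measurable borel"
    for f :: "real^'n \<Rightarrow> ennreal" and t
  proof -
    have "(\<integral>\<^sup>+x. f x \<partial>lborel) = (\<integral>\<^sup>+x. f x \<partial>distr lborel borel ((+) t))"
      by (simp add: lborel_distr_plus)
    also have "\<dots> = (\<integral>\<^sup>+x. f (t + x) \<partial>lborel)" by (subst nn_integral_distr) auto
    finally show ?thesis by (simp add: add.commute)
  qed
  have eq: "(\<integral>\<^sup>+x. f (A *v x) \<partial>lborel) * emeasure lborel (cball (0::real^'n) 1) = emeasure lborel S * (\<integral>\<^sup>+x. f x \<partial>lborel)"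
    if f[measurable]: "f \<in> borel_measurable borel" for f
  proof -
    have "(\<integral>\<^sup>+x. f (A *v x) \<partial>lborel) * emeasure lborel (cball (0::real^'n) 1) = (\<integral>\<^sup>+x. f (A *v x) * (\<integral>\<^sup>+y. g y \<partial>lborel) \<partial>lborel)"
      by (simp add: g_def nn_integral_multc)
    also have "\<dots> = (\<integral>\<^sup>+x. \<integral>\<^sup>+y. f (A *v x) * g (y - A *v x) \<partial>lborel \<partial>lborel)"
      using tr[of g "- (A *v x)" for x] by (simp add: nn_integral_cmult)
    also have "\<dots> = (\<integral>\<^sup>+y. \<integral>\<^sup>+x. f (A *v x) * g (y - A *v x) \<partial>lborel \<partial>lborel)"
      by (rule lborel_pair.Fubini') measurable
    also have "\<dots> = (\<integral>\<^sup>+y. \<integral>\<^sup>+x. f (A *v x + y) * g (A *v x) \<partial>lborel \<partial>lborel)"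
    proof (rule nn_integral_cong)
      fix y :: "real^'n"
      have "(\<integral>\<^sup>+x. f (A *v x) * g (y - A *v x) \<partial>lborel) =
         (\<integral>\<^sup>+x. f (A *v (x + matrix_inv A *v y)) * g (y - A *v (x + matrix_inv A *v y)) \<partial>lborel)"
        by (rule tr[symmetric]) measurable
      also have "\<dots> = (\<integral>\<^sup>+x. f (A *v x + y) * g (A *v x) \<partial>lborel)"
        using gs[of "A *v x" for x] by (simp add: matrix_vector_right_distrib matrix_inv_vector[OF A])
      finally show "(\<integral>\<^sup>+x. f (A *v x) * g (y - A *v x) \<partial>lborel) = (\<integral>\<^sup>+x. f (A *v x + y) * g (A *v x) \<partial>lborel)" .
    qed
    also have "\<dots> = (\<integral>\<^sup>+x. \<integral>\<^sup>+y. f (A *v x + y) * g (A *v x) \<partial>lborel \<partial>lborel)"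
      by (rule lborel_pair.Fubini') measurable
    also have "\<dots> = (\<integral>\<^sup>+x. (\<integral>\<^sup>+y. f y \<partial>lborel) * indicator S x \<partial>lborel)"
      using tr[OF f, of "A *v x" for x] by (simp add: nn_integral_multc add.commute S)
    also have "\<dots> = emeasure lborel S * (\<integral>\<^sup>+x. f x \<partial>lborel)"
      by (subst nn_integral_cmult_indicator) (auto simp: mult.commute)
    finally show ?thesis .
  qed
  define K where "K = measure lborel (cball (0::real^'n) 1)"
  define s where "s = measure lborel S"
  have K: "emeasure lborel (cball (0::real^'n) 1) = ennreal K" "K > 0"
    using Kf Kp by (auto simp: K_def emeasure_eq_ennreal_measure)
  have s: "emeasure lborel S = ennreal s" "s > 0"
    using Sf Sp by (auto simp: s_def emeasure_eq_ennreal_measure)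
  show thesis
  proof (rule that[of "s / K"])
    fix f :: "real^'n \<Rightarrow> ennreal" assume f: "f \<in> borel_measurable borel"
    have "ennreal K * ennreal (1 / K) = 1" using K(2) by (simp flip: ennreal_mult')
    then have "(\<integral>\<^sup>+x. f (A *v x) \<partial>lborel) = ((\<integral>\<^sup>+x. f (A *v x) \<partial>lborel) * ennreal K) * ennreal (1 / K)"
      by (simp add: mult.assoc)
    also have "\<dots> = ennreal s * ennreal (1 / K) * (\<integral>\<^sup>+x. f x \<partial>lborel)"
      using eq[OF f] by (simp add: K s mult_ac)
    also have "ennreal s * ennreal (1 / K) = ennreal (s / K)"
      using s(2) K(2) by (simp flip: ennreal_mult')
    finally show "(\<integral>\<^sup>+x. f (A *v x) \<partial>lborel) = ennreal (s / K) * (\<integral>\<^sup>+x. f x \<partial>lborel)" .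
  qed (use K s in auto)
qed

lemma lborel_integral_matrix_const:
  fixes A :: "real^'n^'n"
  assumes A: "det A \<noteq> 0"
  obtains c :: real where "c > 0"
    "\<And>f :: real^'n \<Rightarrow> complex. f \<in> borel_measurable borel \<Longrightarrow> (\<integral>x. f (A *v x) \<partial>lborel) = c *\<^sub>R (\<integral>x. f x \<partial>lborel)"
    "\<And>f :: real^'n \<Rightarrow> complex. f \<in> borel_measurable borel \<Longrightarrow> integrable lborel (\<lambda>x. f (A *v x)) \<longleftrightarrow> integrable lborel f"
proof -
  obtain c where c: "c > 0"
    "\<And>f. f \<in> borel_measurable borel \<Longrightarrow> (\<integral>\<^sup>+x. f (A *v x) \<partial>lborel) = ennreal c * (\<integral>\<^sup>+x. f x \<partial>lborel)"
    using nn_integral_lborel_matrix[OF A] by blast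
  have d: "distr lborel borel (\<lambda>x. A *v x) = density lborel (\<lambda>_. ennreal c)"
  proof (rule measure_eqI)
    fix S :: "(real^'n) set" assume "S \<in> sets (distr lborel borel (\<lambda>x. A *v x))"
    then have [measurable]: "S \<in> sets borel" by simp
    have "emeasure (distr lborel borel (\<lambda>x. A *v x)) S = (\<integral>\<^sup>+x. indicator S x \<partial>distr lborel borel (\<lambda>x. A *v x))"
      by simp
    also have "\<dots> = (\<integral>\<^sup>+x. indicator S (A *v x) \<partial>lborel)" by (subst nn_integral_distr) auto
    also have "\<dots> = ennreal c * emeasure lborel S" by (subst c(2)) auto
    finally show "emeasure (distr lborel borel (\<lambda>x. A *v x)) S = emeasure (density lborel (\<lambda>_. ennreal c)) S"
      by (simp add: emeasure_density_const)
  qed simp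
  show thesis
  proof (rule that[OF c(1)])
    fix f :: "real^'n \<Rightarrow> complex" assume [measurable]: "f \<in> borel_measurable borel"
    have "(\<integral>x. f (A *v x) \<partial>lborel) = (\<integral>x. f x \<partial>distr lborel borel (\<lambda>x. A *v x))"
      by (subst integral_distr) auto
    also have "\<dots> = c *\<^sub>R (\<integral>x. f x \<partial>lborel)"
      unfolding d using c(1) by (subst integral_density) auto
    finally show "(\<integral>x. f (A *v x) \<partial>lborel) = c *\<^sub>R (\<integral>x. f x \<partial>lborel)" .
    have "integrable lborel (\<lambda>x. f (A *v x)) \<longleftrightarrow> integrable (distr lborel borel (\<lambda>x. A *v x)) f"
      by (subst integrable_distr_eq) auto
    also have "\<dots> \<longleftrightarrow> integrable lborel f"
      unfolding d using c(1) by (subst integrable_density) (auto simp: integrable_scaleR_iff)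
    finally show "integrable lborel (\<lambda>x. f (A *v x)) \<longleftrightarrow> integrable lborel f" .
  qed
qed

subsection \<open>Fourier integrals and convolutions\<close>

lemma measurable_cis [measurable]:
  assumes [measurable]: "f \<in> borel_measurable M"
  shows "(\<lambda>x. cis (f x)) \<in> borel_measurable M"
proof -
  have "cis \<in> borel \<rightarrow>\<^sub>M borel"
    by (intro borel_measurable_continuous_onI continuous_intros)
  then show ?thesis by (rule measurable_compose[rotated]) simp
qed

lemma measurable_cis_inner:
  "(\<lambda>\<xi>::'a::euclidean_space. cis (c * (x \<bullet> \<xi>))) \<in> borel_measurable borel" "(\<lambda>x::'a. cis (c * (x \<bullet> \<xi>))) \<in> borel_measurable borel"
  by (intro borel_measurable_continuous_onI continuous_intros)+

lemma inv_fourier_eq: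
  "l \<in> borel_measurable borel \<Longrightarrow> inv_fourier l x = (\<integral>\<xi>. l \<xi> * cis (2 * pi * (x \<bullet> \<xi>)) \<partial>lborel)"
  unfolding inv_fourier_def by (intro integral_lebesgue_borel borel_measurable_times measurable_cis_inner)

lemma fourier_eq_inv_fourier: "fourier f \<xi> = inv_fourier f (- \<xi>)"
  unfolding fourier_def inv_fourier_def by (simp add: inner_commute)

lemma fourier_eq:
  "f \<in> borel_measurable borel \<Longrightarrow> fourier f \<xi> = (\<integral>x. f x * cis (- 2 * pi * (x \<bullet> \<xi>)) \<partial>lborel)"
  unfolding fourier_def by (intro integral_lebesgue_borel borel_measurable_times measurable_cis_inner)

lemma conv_eq:
  fixes f g :: "real^'n \<Rightarrow> complex"
  assumes [measurable]: "f \<in> borel_measurable borel" "g \<in> borel_measurable borel"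
  shows "conv f g x = (\<integral>y. f (x - y) * g y \<partial>lborel)"
  unfolding conv_def by (rule integral_lebesgue_borel) measurable

lemma conv_eq':
  fixes f g :: "real^'n \<Rightarrow> complex"
  assumes [measurable]: "f \<in> borel_measurable borel" "g \<in> borel_measurable borel"
  shows "conv f g x = (\<integral>y. f y * g (x - y) \<partial>lborel)"
  using lborel_integral_shift(1)[of "\<lambda>y. f y * g (x - y)" x] by (simp add: conv_eq)

lemma conv_commute:
  fixes f g :: "real^'n \<Rightarrow> complex"
  assumes "f \<in> borel_measurable borel" "g \<in> borel_measurable borel"
  shows "conv f g = conv g f"
  using assms by (intro ext) (simp add: conv_eq[of f g] conv_eq'[of g f] mult.commute)

lemma borel_measurable_conv [measurable]:
  fixes f g :: "real^'n \<Rightarrow> complex"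
  assumes [measurable]: "f \<in> borel_measurable borel" "g \<in> borel_measurable borel"
  shows "conv f g \<in> borel_measurable borel"
proof -
  have "conv f g = (\<lambda>x. \<integral>y. f (x - y) * g y \<partial>lborel)" by (intro ext) (simp add: conv_eq)
  then show ?thesis by simp
qed

lemma continuous_on_integral_kernel:
  fixes f :: "'a \<Rightarrow> complex" and k :: "'b::metric_space \<Rightarrow> 'a \<Rightarrow> complex"
  assumes f: "integrable M f" and [measurable]: "\<And>x. k x \<in> borel_measurable M"
    and B: "\<And>x y. norm (k x y) \<le> B" and c: "\<And>y. continuous_on UNIV (\<lambda>x. k x y)"
  shows "continuous_on UNIV (\<lambda>x. \<integral>y. f y * k x y \<partial>M)"
  unfolding continuous_on_sequentially
proof (intro allI ballI impI)
  fix u :: "nat \<Rightarrow> 'b" and a assume u: "(\<forall>n. u n \<in> UNIV) \<and> u \<longlonglongrightarrow> a"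
  have [measurable]: "f \<in> borel_measurable M" using f by auto
  have "(\<lambda>n. \<integral>y. f y * k (u n) y \<partial>M) \<longlonglongrightarrow> (\<integral>y. f y * k a y \<partial>M)"
  proof (rule integral_dominated_convergence[where w="\<lambda>y. B * norm (f y)"])
    show "AE y in M. (\<lambda>n. f y * k (u n) y) \<longlonglongrightarrow> f y * k a y"
    proof (rule AE_I2)
      fix y
      have "(\<lambda>n. k (u n) y) \<longlonglongrightarrow> k a y"
        using c[of y] u unfolding continuous_on_sequentially by (auto simp: o_def)
      then show "(\<lambda>n. f y * k (u n) y) \<longlonglongrightarrow> f y * k a y" by (intro tendsto_intros)
    qed
    show "AE y in M. norm (f y * k (u n) y) \<le> B * norm (f y)" for n
    proof (rule AE_I2)
      fix y show "norm (f y * k (u n) y) \<le> B * norm (f y)"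
        using mult_left_mono[OF B[of "u n" y], of "norm (f y)"] by (simp add: norm_mult mult.commute)
    qed
  qed (use f in auto)
  then show "((\<lambda>x. \<integral>y. f y * k x y \<partial>M) \<circ> u) \<longlonglongrightarrow> (\<integral>y. f y * k a y \<partial>M)" by (simp add: o_def)
qed

lemma continuous_on_inv_fourier:
  fixes l :: "real^'n \<Rightarrow> complex"
  assumes "integrable lborel l"
  shows "continuous_on UNIV (inv_fourier l)"
proof -
  have [measurable]: "l \<in> borel_measurable borel" using assms by auto
  have "inv_fourier l = (\<lambda>x. \<integral>\<xi>. l \<xi> * cis (2 * pi * (x \<bullet> \<xi>)) \<partial>lborel)"
    by (intro ext) (simp add: inv_fourier_eq)
  moreover have "continuous_on UNIV \<dots>"
    using assms by (intro continuous_on_integral_kernel[where B=1]) (auto intro!: continuous_intros)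
  ultimately show ?thesis by simp
qed

lemma borel_measurable_inv_fourier [measurable]:
  fixes l :: "real^'n \<Rightarrow> complex"
  assumes [measurable]: "l \<in> borel_measurable borel"
  shows "inv_fourier l \<in> borel_measurable borel"
proof -
  have "inv_fourier l = (\<lambda>x. \<integral>\<xi>. l \<xi> * cis (2 * pi * (x \<bullet> \<xi>)) \<partial>lborel)"
    by (intro ext) (simp add: inv_fourier_eq)
  then show ?thesis by simp
qed

lemma norm_inv_fourier_le:
  fixes l :: "real^'n \<Rightarrow> complex"
  assumes "integrable lborel l"
  shows "norm (inv_fourier l x) \<le> (\<integral>\<xi>. norm (l \<xi>) \<partial>lborel)"
  using norm_integral_mult_le[OF assms, of "\<lambda>\<xi>. cis (2 * pi * (x \<bullet> \<xi>))" 1] assms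
  by (simp add: inv_fourier_eq)

lemma continuous_on_fourier:
  fixes f :: "real^'n \<Rightarrow> complex"
  assumes "integrable lborel f"
  shows "continuous_on UNIV (fourier f)"
proof -
  have "fourier f = inv_fourier f \<circ> uminus" by (auto simp: fourier_eq_inv_fourier)
  moreover have "continuous_on UNIV (inv_fourier f \<circ> uminus)"
    using continuous_on_inv_fourier[OF assms]
    by (intro continuous_on_compose continuous_intros) (auto intro: continuous_on_subset)
  ultimately show ?thesis by simp
qed

lemma borel_measurable_fourier [measurable]:
  fixes f :: "real^'n \<Rightarrow> complex"
  assumes [measurable]: "f \<in> borel_measurable borel"
  shows "fourier f \<in> borel_measurable borel"
  unfolding fourier_eq_inv_fourier[abs_def] by measurable

lemma norm_fourier_le:
  fixes f :: "real^'n \<Rightarrow> complex"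
  assumes "integrable lborel f"
  shows "norm (fourier f \<xi>) \<le> (\<integral>x. norm (f x) \<partial>lborel)"
  using norm_inv_fourier_le[OF assms] by (simp add: fourier_eq_inv_fourier)

section \<open>Convolution of an integrable with a bounded function\<close>

lemma norm_conv_le:
  fixes f g :: "real^'n \<Rightarrow> complex"
  assumes "integrable lborel f" "g \<in> borel_measurable borel" "\<And>x. norm (g x) \<le> B"
  shows "norm (conv f g x) \<le> B * (\<integral>x. norm (f x) \<partial>lborel)"
  using norm_integral_mult_le[OF assms(1), of "\<lambda>y. g (x - y)" B] assms by (simp add: conv_eq')

lemma continuous_on_conv:
  fixes f g :: "real^'n \<Rightarrow> complex"
  assumes "integrable lborel f" "continuous_on UNIV g" "\<And>x. norm (g x) \<le> B"
  shows "continuous_on UNIV (conv f g)"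
proof -
  have [measurable]: "f \<in> borel_measurable borel" using assms by auto
  have [measurable]: "g \<in> borel_measurable borel" using assms by (intro borel_measurable_continuous_onI)
  have "conv f g = (\<lambda>x. \<integral>y. f y * g (x - y) \<partial>lborel)"
    by (intro ext) (simp add: conv_eq')
  moreover have "continuous_on UNIV \<dots>"
    using assms by (intro continuous_on_integral_kernel[where B=B])
      (auto intro!: continuous_intros continuous_on_compose2[OF assms(2)])
  ultimately show ?thesis by simp
qed

text \<open>In every application \<open>k\<close> is a character, which is only bounded; all decay
  has to come from \<open>a\<close> and \<open>b\<close>. One statement then serves inversion, the
  convolution theorem and the averaging over a spectrum.\<close>

lemma Fubini_kernel:
  fixes a :: "'a::euclidean_space \<Rightarrow> complex" and b :: "'b::euclidean_space \<Rightarrow> complex"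
  assumes a: "integrable lborel a" and b: "integrable lborel b"
    and k[measurable]: "case_prod k \<in> borel_measurable (borel \<Otimes>\<^sub>M borel)"
    and B: "\<And>x y. norm (k x y) \<le> B"
  shows "(\<integral>x. a x * (\<integral>y. b y * k x y \<partial>lborel) \<partial>lborel) = (\<integral>y. b y * (\<integral>x. a x * k x y \<partial>lborel) \<partial>lborel)"
proof -
  have [measurable]: "a \<in> borel_measurable borel" "b \<in> borel_measurable borel" using a b by auto
  have k2: "(\<lambda>y. k x y) \<in> borel_measurable lborel" for x
    using measurable_Pair2[OF k, of x] by simp
  have "integrable (lborel \<Otimes>\<^sub>M lborel) (\<lambda>(x, y). a x * (b y * k x y))"
  proof (rule lborel_pair.Fubini_integrable)
    show "(\<lambda>(x, y). a x * (b y * k x y)) \<in> borel_measurable (lborel \<Otimes>\<^sub>M lborel)" by measurable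
    show "AE x in lborel. integrable lborel (\<lambda>y. (case (x, y) of (x, y) \<Rightarrow> a x * (b y * k x y)))"
      using integrable_bounded_mult[OF b k2 B] by auto
    have le: "norm (\<integral>y. norm (a x * (b y * k x y)) \<partial>lborel) \<le> norm (B * (\<integral>y. norm (b y) \<partial>lborel) * norm (a x))" for x
    proof -
      have B0: "0 \<le> B" using B[of undefined undefined] norm_ge_zero order_trans by blast
      have i: "integrable lborel (\<lambda>y. norm (a x * (b y * k x y)))"
        using integrable_bounded_mult[OF b k2 B] by auto
      have "(\<integral>y. norm (a x * (b y * k x y)) \<partial>lborel) \<le> (\<integral>y. norm (a x) * (norm (b y) * B) \<partial>lborel)"
        using i b B by (intro integral_mono) (auto simp: norm_mult intro!: mult_left_mono)
      then show ?thesis using B0 by (simp add: mult_ac)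
    qed
    have m: "(\<lambda>x. \<integral>y. norm (a x * (b y * k x y)) \<partial>lborel) \<in> borel_measurable lborel"
    proof (rule lborel.borel_measurable_lebesgue_integral)
      have [measurable]: "(\<lambda>p. k (fst p) (snd p)) \<in> borel_measurable (lborel \<Otimes>\<^sub>M lborel)"
        using k by (simp add: split_beta')
      show "(\<lambda>(x, y). norm (a x * (b y * k x y))) \<in> borel_measurable (lborel \<Otimes>\<^sub>M lborel)"
        unfolding split_beta' by measurable
    qed
    have "integrable lborel (\<lambda>x. \<integral>y. norm (a x * (b y * k x y)) \<partial>lborel)"
    proof (rule Bochner_Integration.integrable_bound[OF _ m])
      show "integrable lborel (\<lambda>x. B * (\<integral>y. norm (b y) \<partial>lborel) * norm (a x))"
        using a by (intro integrable_mult_right integrable_norm)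
      show "AE x in lborel. norm (\<integral>y. norm (a x * (b y * k x y)) \<partial>lborel) \<le> norm (B * (\<integral>y. norm (b y) \<partial>lborel) * norm (a x))"
        by (rule AE_I2) (rule le)
    qed
    then show "integrable lborel (\<lambda>x. \<integral>y. norm (case (x, y) of (x, y) \<Rightarrow> a x * (b y * k x y)) \<partial>lborel)"
      by (simp only: split_conv)
  qed
  then have 1: "(\<integral>y. \<integral>x. a x * (b y * k x y) \<partial>lborel \<partial>lborel) = (\<integral>x. \<integral>y. a x * (b y * k x y) \<partial>lborel \<partial>lborel)"
    by (rule lborel_pair.Fubini_integral)
  have "a x * (b y * k x y) = b y * (a x * k x y)" for x y by (rule mult.left_commute)
  then have 2: "(\<integral>x. a x * (b y * k x y) \<partial>lborel) = b y * (\<integral>x. a x * k x y \<partial>lborel)" for y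
    by (simp only: integral_mult_right_zero)
  have 3: "(\<integral>y. a x * (b y * k x y) \<partial>lborel) = a x * (\<integral>y. b y * k x y \<partial>lborel)" for x
    by (simp only: integral_mult_right_zero)
  show ?thesis using 1 unfolding 2 3 by (rule sym)
qed

lemma integrable_conv_pair:
  fixes a b :: "real^'n \<Rightarrow> complex"
  assumes a: "integrable lborel a" and b: "integrable lborel b"
  shows "integrable (lborel \<Otimes>\<^sub>M lborel) (\<lambda>(y, z). b y * a (z - y))"
proof (rule lborel_pair.Fubini_integrable)
  have [measurable]: "a \<in> borel_measurable borel" "b \<in> borel_measurable borel" using a b by auto
  show "(\<lambda>(y, z). b y * a (z - y)) \<in> borel_measurable (lborel \<Otimes>\<^sub>M lborel)" by measurable
  have i: "integrable lborel (\<lambda>z. a (z - y))" for y using a by (simp add: lborel_integral_shift)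
  then show "AE y in lborel. integrable lborel (\<lambda>z. case (y, z) of (y, z) \<Rightarrow> b y * a (z - y))" by simp
  have "(\<integral>z. norm (a (z - y)) \<partial>lborel) = (\<integral>z. norm (a z) \<partial>lborel)" for y
  proof -
    have "complex_of_real (\<integral>z. norm (a (z - y)) \<partial>lborel) = complex_of_real (\<integral>z. norm (a z) \<partial>lborel)"
      using lborel_integral_shift(3)[of "\<lambda>z. complex_of_real (norm (a z))" y]
      by (simp add: integral_complex_of_real)
    then show ?thesis by simp
  qed
  then show "integrable lborel (\<lambda>y. \<integral>z. norm (case (y, z) of (y, z) \<Rightarrow> b y * a (z - y)) \<partial>lborel)"
    using b by (simp add: norm_mult)
qed

lemma integrable_conv:
  fixes a b :: "real^'n \<Rightarrow> complex"
  assumes a: "integrable lborel a" and b: "integrable lborel b"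
  shows "integrable lborel (conv a b)"
proof -
  have [measurable]: "a \<in> borel_measurable borel" "b \<in> borel_measurable borel" using a b by auto
  have "integrable lborel (\<lambda>z. \<integral>y. b y * a (z - y) \<partial>lborel)"
    using lborel_pair.integrable_snd[of "\<lambda>y z. b y * a (z - y)"] integrable_conv_pair[OF a b] by simp
  moreover have "conv a b = (\<lambda>z. \<integral>y. b y * a (z - y) \<partial>lborel)"
    by (intro ext) (simp add: conv_eq mult.commute)
  ultimately show ?thesis by simp
qed

text \<open>\<open>g\<close> is only bounded, so the double integral is dominated through |a(z - y)|
  |b(y)|, integrable by \<open>integrable_conv_pair\<close>. The computation naturally ends with
  \<open>g\<close> and \<open>b\<close> interchanged; commutativity then restores
  associativity.\<close>

lemma conv_assoc_swap:
  fixes a b g :: "real^'n \<Rightarrow> complex"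
  assumes a: "integrable lborel a" and b: "integrable lborel b"
    and g[measurable]: "g \<in> borel_measurable borel" and B: "\<And>x. norm (g x) \<le> B"
  shows "conv (conv a b) g x = conv (conv a g) b x"
proof -
  have [measurable]: "a \<in> borel_measurable borel" "b \<in> borel_measurable borel" using a b by auto
  have int: "integrable (lborel \<Otimes>\<^sub>M lborel) (\<lambda>(y, z). b y * a (z - y) * g (x - z))"
    using integrable_bounded_mult[OF integrable_conv_pair[OF a b], of "\<lambda>(y, z). g (x - z)" B] B
    by (simp add: split_beta')
  have "conv (conv a b) g x = (\<integral>z. (\<integral>y. a (z - y) * b y \<partial>lborel) * g (x - z) \<partial>lborel)"
    by (simp add: conv_eq' [of "conv a b"] conv_eq[of a b])
  also have "\<dots> = (\<integral>z. \<integral>y. b y * a (z - y) * g (x - z) \<partial>lborel \<partial>lborel)"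
  proof (rule Bochner_Integration.integral_cong[OF refl])
    show "(\<integral>y. a (z - y) * b y \<partial>lborel) * g (x - z) = (\<integral>y. b y * a (z - y) * g (x - z) \<partial>lborel)" for z
      by (subst integral_mult_left_zero[symmetric]) (simp only: mult.commute)
  qed
  also have "\<dots> = (\<integral>y. \<integral>z. b y * a (z - y) * g (x - z) \<partial>lborel \<partial>lborel)"
    using lborel_pair.Fubini_integral[OF int] by simp
  also have "\<dots> = (\<integral>y. (\<integral>z. a z * g (x - y - z) \<partial>lborel) * b y \<partial>lborel)"
  proof (rule Bochner_Integration.integral_cong[OF refl])
    fix y :: "real^'n"
    have "(\<integral>z. b y * a (z - y) * g (x - z) \<partial>lborel) = b y * (\<integral>z. a (z - y) * g (x - y - (z - y)) \<partial>lborel)"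
      by (subst integral_mult_right_zero[symmetric]) (simp add: mult.assoc)
    also have "(\<integral>z. a (z - y) * g (x - y - (z - y)) \<partial>lborel) = (\<integral>z. a z * g (x - y - z) \<partial>lborel)"
      by (rule lborel_integral_shift(3)[of "\<lambda>z. a z * g (x - y - z)" y]) measurable
    finally show "(\<integral>z. b y * a (z - y) * g (x - z) \<partial>lborel) = (\<integral>z. a z * g (x - y - z) \<partial>lborel) * b y"
      by (simp add: mult.commute)
  qed
  also have "\<dots> = conv (conv a g) b x"
    by (simp add: conv_eq[of "conv a g"] conv_eq'[of a g])
  finally show ?thesis .
qed

lemma conv_assoc:
  fixes a b g :: "real^'n \<Rightarrow> complex"
  assumes a: "integrable lborel a" and b: "integrable lborel b"
    and g: "g \<in> borel_measurable borel" and B: "\<And>x. norm (g x) \<le> B"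
  shows "conv (conv a b) g = conv a (conv b g)"
proof -
  have [measurable]: "a \<in> borel_measurable borel" "b \<in> borel_measurable borel" "g \<in> borel_measurable borel"
    using a b g by auto
  have "conv (conv a b) g = conv (conv b a) g" by (subst conv_commute) auto
  also have "\<dots> = conv (conv b g) a" by (intro ext conv_assoc_swap[OF b a g B])
  also have "\<dots> = conv a (conv b g)" by (rule conv_commute) auto
  finally show ?thesis .
qed

text \<open>Fubini alone: the transform of \<open>f\<close> is expanded under the integral over
  \<xi>, so no inversion formula is presupposed and \<open>inv_fourier v\<close> may fail to be
  integrable.\<close>

lemma inv_fourier_fourier_mult:
  fixes f v :: "real^'n \<Rightarrow> complex"
  assumes f: "integrable lborel f" and v: "integrable lborel v"
  shows "inv_fourier (\<lambda>\<xi>. fourier f \<xi> * v \<xi>) = conv f (inv_fourier v)"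
proof
  fix x
  have [measurable]: "f \<in> borel_measurable borel" "v \<in> borel_measurable borel" using f v by auto
  have "inv_fourier (\<lambda>\<xi>. fourier f \<xi> * v \<xi>) x = (\<integral>\<xi>. v \<xi> * (\<integral>y. f y * cis (2 * pi * ((x - y) \<bullet> \<xi>)) \<partial>lborel) \<partial>lborel)"
  proof -
    have "fourier f \<xi> * v \<xi> * cis (2 * pi * (x \<bullet> \<xi>)) = v \<xi> * (\<integral>y. f y * cis (2 * pi * ((x - y) \<bullet> \<xi>)) \<partial>lborel)" for \<xi>
    proof -
      have "(\<integral>y. f y * cis (2 * pi * ((x - y) \<bullet> \<xi>)) \<partial>lborel) = (\<integral>y. (f y * cis (- 2 * pi * (y \<bullet> \<xi>))) * cis (2 * pi * (x \<bullet> \<xi>)) \<partial>lborel)"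
        by (simp add: inner_diff_left right_diff_distrib mult.assoc cis_mult)
      also have "\<dots> = fourier f \<xi> * cis (2 * pi * (x \<bullet> \<xi>))"
        by (simp add: fourier_eq)
      finally show ?thesis by (simp add: mult_ac)
    qed
    then show ?thesis by (simp only: inv_fourier_eq[OF borel_measurable_times[OF borel_measurable_fourier]] \<open>f \<in> borel_measurable borel\<close> \<open>v \<in> borel_measurable borel\<close>)
  qed
  also have "\<dots> = (\<integral>y. f y * (\<integral>\<xi>. v \<xi> * cis (2 * pi * ((x - y) \<bullet> \<xi>)) \<partial>lborel) \<partial>lborel)"
    using v f by (intro Fubini_kernel[where B=1]) auto
  also have "\<dots> = conv f (inv_fourier v) x"
    by (simp add: conv_eq' inv_fourier_eq)
  finally show "inv_fourier (\<lambda>\<xi>. fourier f \<xi> * v \<xi>) x = conv f (inv_fourier v) x" .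
qed

lemma conv_diff_left:
  fixes a b g :: "real^'n \<Rightarrow> complex"
  assumes a: "integrable lborel a" and b: "integrable lborel b"
    and g: "g \<in> borel_measurable borel" and B: "\<And>x. norm (g x) \<le> B"
  shows "conv (\<lambda>x. a x - b x) g x = conv a g x - conv b g x"
proof -
  have [measurable]: "a \<in> borel_measurable borel" "b \<in> borel_measurable borel" "g \<in> borel_measurable borel"
    using a b g by auto
  have i: "integrable lborel (\<lambda>y. a y * g (x - y))" "integrable lborel (\<lambda>y. b y * g (x - y))"
    using a b B by (auto intro!: integrable_bounded_mult)
  show ?thesis by (simp add: conv_eq' left_diff_distrib i)
qed

lemma conv_diff_right:
  fixes a g h :: "real^'n \<Rightarrow> complex"
  assumes a: "integrable lborel a"
    and g: "g \<in> borel_measurable borel" and B: "\<And>x. norm (g x) \<le> B"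
    and h: "h \<in> borel_measurable borel" and C: "\<And>x. norm (h x) \<le> C"
  shows "conv a (\<lambda>x. g x - h x) x = conv a g x - conv a h x"
proof -
  have [measurable]: "a \<in> borel_measurable borel" "h \<in> borel_measurable borel" "g \<in> borel_measurable borel"
    using a h g by auto
  have i: "integrable lborel (\<lambda>y. a y * g (x - y))" "integrable lborel (\<lambda>y. a y * h (x - y))"
    using a C B by (auto intro!: integrable_bounded_mult)
  show ?thesis by (simp add: conv_eq' right_diff_distrib i)
qed

subsection \<open>Fourier inversion\<close>

lemma integral_gaussian_1:
  "(\<integral>x. complex_of_real (exp (- (x\<^sup>2 / 2))) * cis (t * x) \<partial>lborel) = complex_of_real (sqrt (2 * pi) * exp (- (t\<^sup>2 / 2)))"
  "integrable lborel (\<lambda>x::real. complex_of_real (exp (- (x\<^sup>2 / 2))) * cis (t * x))"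
proof -
  have e: "exp (- (x\<^sup>2 / 2)) = sqrt (2 * pi) * std_normal_density x" for x
    by (simp add: std_normal_density_def)
  have d: "integrable lborel (\<lambda>x. complex_of_real (std_normal_density x) * cis (t * x))"
    by (rule integrable_bounded_mult[where B=1]) auto
  then show "integrable lborel (\<lambda>x::real. complex_of_real (exp (- (x\<^sup>2 / 2))) * cis (t * x))"
    by (simp add: e mult.assoc)
  have "char std_normal_distribution t = (\<integral>x. std_normal_density x *\<^sub>R cis (t * x) \<partial>lborel)"
    unfolding char_def by (subst integral_density) (auto simp: cis_conv_exp)
  then have "(\<integral>x. complex_of_real (std_normal_density x) * cis (t * x) \<partial>lborel) = complex_of_real (exp (- (t\<^sup>2 / 2)))"
    by (simp add: char_std_normal_distribution scaleR_conv_of_real)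
  then show "(\<integral>x. complex_of_real (exp (- (x\<^sup>2 / 2))) * cis (t * x) \<partial>lborel) = complex_of_real (sqrt (2 * pi) * exp (- (t\<^sup>2 / 2)))"
    by (simp add: e mult.assoc)
qed

lemma cis_sum: "finite I \<Longrightarrow> cis (sum f I) = (\<Prod>i\<in>I. cis (f i))"
  by (induction I rule: finite_induct) (auto simp: cis_mult[symmetric])

lemma lborel_prod_integral:
  fixes h :: "'a::euclidean_space \<Rightarrow> real \<Rightarrow> complex"
  assumes h: "\<And>b. b \<in> Basis \<Longrightarrow> integrable lborel (h b)"
  shows "(\<integral>x. (\<Prod>b\<in>Basis. h b (x \<bullet> b)) \<partial>(lborel :: 'a measure)) = (\<Prod>b\<in>Basis. \<integral>x. h b x \<partial>lborel)"
    and "integrable (lborel :: 'a measure) (\<lambda>x. \<Prod>b\<in>Basis. h b (x \<bullet> b))"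
proof -
  interpret product_sigma_finite "\<lambda>b::'a. lborel :: real measure" ..
  have [measurable]: "h b \<in> borel_measurable borel" if "b \<in> Basis" for b using h[OF that] by auto
  have c: "(\<Sum>a\<in>Basis. f a *\<^sub>R a) \<bullet> b = f b" if "b \<in> Basis" for f :: "'a \<Rightarrow> real" and b
    using that by (simp add: inner_sum_left inner_Basis if_distrib cong: if_cong)
  have m: "(\<lambda>x::'a. \<Prod>b\<in>Basis. h b (x \<bullet> b)) \<in> borel_measurable borel"
    by measurable
  have m2: "(\<lambda>f. \<Sum>b\<in>Basis. f b *\<^sub>R b) \<in> (\<Pi>\<^sub>M b\<in>Basis. lborel) \<rightarrow>\<^sub>M (borel :: 'a measure)"
    by measurable
  have "(\<integral>x. (\<Prod>b\<in>Basis. h b (x \<bullet> b)) \<partial>(lborel :: 'a measure)) = (\<integral>f. (\<Prod>b\<in>Basis. h b (f b)) \<partial>(\<Pi>\<^sub>M b\<in>Basis. lborel))"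
    by (subst lborel_eq, subst integral_distr[OF m2 m]) (simp add: c cong: prod.cong)
  also have "\<dots> = (\<Prod>b\<in>Basis. \<integral>x. h b x \<partial>lborel)"
    by (rule product_integral_prod) (auto simp: h)
  finally show "(\<integral>x. (\<Prod>b\<in>Basis. h b (x \<bullet> b)) \<partial>(lborel :: 'a measure)) = (\<Prod>b\<in>Basis. \<integral>x. h b x \<partial>lborel)" .
  have "integrable (\<Pi>\<^sub>M b\<in>Basis. lborel) (\<lambda>f. \<Prod>b\<in>Basis. h b (f b))"
    by (rule product_integrable_prod) (auto simp: h)
  then show "integrable (lborel :: 'a measure) (\<lambda>x. \<Prod>b\<in>Basis. h b (x \<bullet> b))"
    by (subst lborel_eq, subst integrable_distr_eq[OF m2 m]) (simp add: c cong: prod.cong)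
qed

lemma integral_gaussian:
  fixes t :: "'a::euclidean_space"
  shows "(\<integral>x. complex_of_real (exp (- ((norm x)\<^sup>2 / 2))) * cis (t \<bullet> x) \<partial>lborel)
      = complex_of_real (sqrt (2 * pi) ^ DIM('a) * exp (- ((norm t)\<^sup>2 / 2)))" (is ?I)
    and "integrable lborel (\<lambda>x::'a. complex_of_real (exp (- ((norm x)\<^sup>2 / 2))) * cis (t \<bullet> x))" (is ?J)
proof -
  have n: "(norm x)\<^sup>2 = (\<Sum>b\<in>Basis. (x \<bullet> b)\<^sup>2)" for x :: 'a
    by (subst power2_norm_eq_inner, subst euclidean_inner) (simp add: power2_eq_square)
  have e: "exp (- ((norm x)\<^sup>2 / 2)) = (\<Prod>b\<in>Basis. exp (- ((x \<bullet> b)\<^sup>2 / 2)))" for x :: 'a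
    by (simp add: n exp_sum[symmetric] sum_divide_distrib sum_negf)
  have c: "cis (t \<bullet> x) = (\<Prod>b\<in>Basis. cis ((t \<bullet> b) * (x \<bullet> b)))" for x :: 'a
    by (subst euclidean_inner) (simp add: cis_sum)
  have p: "complex_of_real (exp (- ((norm x)\<^sup>2 / 2))) * cis (t \<bullet> x) =
    (\<Prod>b\<in>Basis. complex_of_real (exp (- ((x \<bullet> b)\<^sup>2 / 2))) * cis ((t \<bullet> b) * (x \<bullet> b)))" for x :: 'a
    by (simp only: e c prod.distrib of_real_prod)
  show ?I unfolding p
    by (subst lborel_prod_integral) (simp_all only: integral_gaussian_1 prod.distrib e[of t] of_real_mult of_real_prod prod_constant of_real_power)
  show ?J unfolding p
    by (rule lborel_prod_integral(2)) (rule integral_gaussian_1)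
qed

text \<open>Gaussian summation. The factor \<open>G (r n *\<^sub>R x)\<close> tends to 1 on the
  transform side; by Fubini the damped integral equals a Gaussian average of \<open>f\<close> around
  \<xi> of width r n / (2 pi), and continuity together with boundedness makes that average tend to
  f(\<xi>).\<close>

theorem fourier_inversion:
  fixes f :: "real^'n \<Rightarrow> complex"
  assumes f: "integrable lborel f" and c: "continuous_on UNIV f" and B: "\<And>x. norm (f x) \<le> B"
    and i: "integrable lborel (inv_fourier f)"
  shows "fourier (inv_fourier f) \<xi> = f \<xi>"
proof -
  have [measurable]: "f \<in> borel_measurable borel" "inv_fourier f \<in> borel_measurable borel" using f i by auto
  define G where "G = (\<lambda>x::real^'n. complex_of_real (exp (- ((norm x)\<^sup>2 / 2))))"
  have Gm[measurable]: "G \<in> borel_measurable borel" unfolding G_def by measurable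
  have Gi: "integrable lborel G" using integral_gaussian(2)[of "0::real^'n"] by (simp add: G_def)
  define r where "r = (\<lambda>n. inverse (real (Suc n)))"
  have r: "r n > 0" for n by (simp add: r_def)
  have r0: "r \<longlonglongrightarrow> 0" unfolding r_def by (rule LIMSEQ_inverse_real_of_nat)
  define I where "I = (\<lambda>n. \<integral>x. inv_fourier f x * cis (- 2 * pi * (x \<bullet> \<xi>)) * G (r n *\<^sub>R x) \<partial>lborel)"
  have Gb: "norm (G x) \<le> 1" for x unfolding G_def by simp
  have Gc: "continuous_on UNIV G" unfolding G_def by (auto intro!: continuous_intros)
  have lim1: "I \<longlonglongrightarrow> fourier (inv_fourier f) \<xi>"
  proof -
    have "I \<longlonglongrightarrow> (\<integral>x. inv_fourier f x * cis (- 2 * pi * (x \<bullet> \<xi>)) * G 0 \<partial>lborel)"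
      unfolding I_def
    proof (rule integral_dominated_convergence[where w="\<lambda>x. norm (inv_fourier f x)"])
      show "AE x in lborel. (\<lambda>n. inv_fourier f x * cis (- 2 * pi * (x \<bullet> \<xi>)) * G (r n *\<^sub>R x))
         \<longlonglongrightarrow> inv_fourier f x * cis (- 2 * pi * (x \<bullet> \<xi>)) * G 0"
      proof (intro AE_I2 tendsto_mult tendsto_const)
        fix x :: "real^'n"
        have "(\<lambda>n. r n *\<^sub>R x) \<longlonglongrightarrow> 0 *\<^sub>R x" using r0 by (intro tendsto_intros)
        then show "(\<lambda>n. G (r n *\<^sub>R x)) \<longlonglongrightarrow> G 0"
          using Gc by (intro continuous_on_tendsto_compose[OF Gc]) auto
      qed
      show "AE x in lborel. norm (inv_fourier f x * cis (- 2 * pi * (x \<bullet> \<xi>)) * G (r n *\<^sub>R x)) \<le> norm (inv_fourier f x)" for n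
        using Gb by (intro AE_I2) (auto simp: norm_mult mult_left_le)
    qed (use i in auto)
    moreover have "G 0 = 1" by (simp add: G_def)
    ultimately show ?thesis by (simp add: fourier_eq)
  qed
  let ?K = "complex_of_real (sqrt (2 * pi) ^ CARD('n))"
  have I_eq: "I n = inverse ?K * (\<integral>s. f (\<xi> + (r n / (2 * pi)) *\<^sub>R s) * G s \<partial>lborel)" for n
  proof -
    have Gri: "integrable lborel (\<lambda>x. G (r n *\<^sub>R x))"
      using lborel_integral_affine(2)[of "r n" G 0] r[of n] Gi by simp
    have inner: "(\<integral>x. G (r n *\<^sub>R x) * cis (2 * pi * (x \<bullet> (\<zeta> - \<xi>))) \<partial>lborel)
        = ?K / complex_of_real (r n ^ CARD('n)) * G ((2 * pi / r n) *\<^sub>R (\<zeta> - \<xi>))" for \<zeta>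
    proof -
      have "(\<integral>x. G (r n *\<^sub>R x) * cis (2 * pi * (x \<bullet> (\<zeta> - \<xi>))) \<partial>lborel) =
         (\<integral>x. G (0 + r n *\<^sub>R x) * cis (((2 * pi / r n) *\<^sub>R (\<zeta> - \<xi>)) \<bullet> (0 + r n *\<^sub>R x)) \<partial>lborel)"
        using r[of n] by (simp add: inner_commute mult.assoc)
      also have "\<dots> = (\<integral>x. G x * cis (((2 * pi / r n) *\<^sub>R (\<zeta> - \<xi>)) \<bullet> x) \<partial>lborel) / complex_of_real (\<bar>r n\<bar> ^ CARD('n))"
        using r[of n] by (subst lborel_integral_affine) auto
      also have "(\<integral>x. G x * cis (((2 * pi / r n) *\<^sub>R (\<zeta> - \<xi>)) \<bullet> x) \<partial>lborel) = ?K * G ((2 * pi / r n) *\<^sub>R (\<zeta> - \<xi>))"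
        unfolding G_def by (subst integral_gaussian) simp
      finally show ?thesis using r[of n] by simp
    qed
    have "I n = (\<integral>x. G (r n *\<^sub>R x) * (\<integral>\<zeta>. f \<zeta> * cis (2 * pi * (x \<bullet> (\<zeta> - \<xi>))) \<partial>lborel) \<partial>lborel)"
    proof -
      have "inv_fourier f x * cis (- 2 * pi * (x \<bullet> \<xi>)) = (\<integral>\<zeta>. f \<zeta> * cis (2 * pi * (x \<bullet> (\<zeta> - \<xi>))) \<partial>lborel)" for x
      proof -
        have "(\<integral>\<zeta>. f \<zeta> * cis (2 * pi * (x \<bullet> (\<zeta> - \<xi>))) \<partial>lborel) = (\<integral>\<zeta>. (f \<zeta> * cis (2 * pi * (x \<bullet> \<zeta>))) * cis (- 2 * pi * (x \<bullet> \<xi>)) \<partial>lborel)"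
          by (simp add: inner_diff_right right_diff_distrib mult.assoc cis_mult)
        also have "\<dots> = inv_fourier f x * cis (- 2 * pi * (x \<bullet> \<xi>))"
          by (simp add: inv_fourier_eq)
        finally show ?thesis by simp
      qed
      then show ?thesis unfolding I_def by (simp add: mult.commute)
    qed
    also have "\<dots> = (\<integral>\<zeta>. f \<zeta> * (\<integral>x. G (r n *\<^sub>R x) * cis (2 * pi * (x \<bullet> (\<zeta> - \<xi>))) \<partial>lborel) \<partial>lborel)"
      using Gri f by (intro Fubini_kernel[where B=1]) auto
    also have "\<dots> = ?K / complex_of_real (r n ^ CARD('n)) * (\<integral>\<zeta>. f \<zeta> * G ((2 * pi / r n) *\<^sub>R (\<zeta> - \<xi>)) \<partial>lborel)"
      unfolding inner by (simp only: mult.left_commute[of "f _"] integral_mult_right_zero)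
    also have "(\<integral>\<zeta>. f \<zeta> * G ((2 * pi / r n) *\<^sub>R (\<zeta> - \<xi>)) \<partial>lborel) =
       complex_of_real ((r n / (2 * pi)) ^ CARD('n)) * (\<integral>s. f (\<xi> + (r n / (2 * pi)) *\<^sub>R s) * G s \<partial>lborel)"
      using lborel_integral_affine(1)[of "r n / (2 * pi)" "\<lambda>\<zeta>. f \<zeta> * G ((2 * pi / r n) *\<^sub>R (\<zeta> - \<xi>))" \<xi>] r[of n]
      by (simp add: field_simps)
    \<comment> \<open>Two factors sqrt(2 pi)^n make (2 pi)^n, which cancels the Jacobian of the
      substitution and leaves 1 / \<open>?K\<close>, the normalization of the Gaussian.\<close>
    also have "?K / complex_of_real (r n ^ CARD('n)) * (complex_of_real ((r n / (2 * pi)) ^ CARD('n)) * X) = inverse ?K * X" for X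
    proof -
      have "sqrt (2 * pi) ^ CARD('n) * sqrt (2 * pi) ^ CARD('n) = (2 * pi) ^ CARD('n)"
        by (subst power_mult_distrib[symmetric]) simp
      then have "sqrt (2 * pi) ^ CARD('n) / r n ^ CARD('n) * (r n / (2 * pi)) ^ CARD('n) = inverse (sqrt (2 * pi) ^ CARD('n))"
        using r[of n] by (simp add: field_simps power_divide)
      then have "complex_of_real (sqrt (2 * pi) ^ CARD('n) / r n ^ CARD('n) * (r n / (2 * pi)) ^ CARD('n)) = complex_of_real (inverse (sqrt (2 * pi) ^ CARD('n)))"
        by simp
      then show ?thesis by (simp only: of_real_mult of_real_divide of_real_inverse mult.assoc[symmetric])
    qed
    finally show ?thesis .
  qed
  have "(\<lambda>n. \<integral>s. f (\<xi> + (r n / (2 * pi)) *\<^sub>R s) * G s \<partial>lborel) \<longlonglongrightarrow> (\<integral>s. f \<xi> * G s \<partial>lborel)"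
  proof (rule integral_dominated_convergence[where w="\<lambda>s. B * norm (G s)"])
    show "AE s in lborel. (\<lambda>n. f (\<xi> + (r n / (2 * pi)) *\<^sub>R s) * G s) \<longlonglongrightarrow> f \<xi> * G s"
    proof (intro AE_I2 tendsto_mult tendsto_const)
      fix s :: "real^'n"
      have "(\<lambda>n. \<xi> + (r n / (2 * pi)) *\<^sub>R s) \<longlonglongrightarrow> \<xi> + (0 / (2 * pi)) *\<^sub>R s" using r0 by (intro tendsto_intros) auto
      then show "(\<lambda>n. f (\<xi> + (r n / (2 * pi)) *\<^sub>R s)) \<longlonglongrightarrow> f \<xi>"
        by (intro continuous_on_tendsto_compose[OF c]) auto
    qed
    show "AE s in lborel. norm (f (\<xi> + (r n / (2 * pi)) *\<^sub>R s) * G s) \<le> B * norm (G s)" for n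
      using B by (intro AE_I2) (auto simp: norm_mult intro!: mult_right_mono)
  qed (use Gi in auto)
  moreover have "(\<integral>s. G s \<partial>lborel) = ?K"
    using integral_gaussian(1)[of "0::real^'n"] by (simp add: G_def)
  ultimately have "I \<longlonglongrightarrow> inverse ?K * (f \<xi> * ?K)"
    unfolding I_eq by (intro tendsto_mult tendsto_const) simp
  moreover have "inverse ?K * (f \<xi> * ?K) = f \<xi>" by (simp add: field_simps)
  ultimately have "I \<longlonglongrightarrow> f \<xi>" by metis
  then show ?thesis using lim1 LIMSEQ_unique by blast
qed

corollary inv_fourier_fourier:
  fixes f :: "real^'n \<Rightarrow> complex"
  assumes f: "integrable lborel f" and c: "continuous_on UNIV f" and B: "\<And>x. norm (f x) \<le> B"
    and i: "integrable lborel (fourier f)"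
  shows "inv_fourier (fourier f) = f"
proof
  fix x
  have [measurable]: "f \<in> borel_measurable borel" using f by auto
  have "integrable lborel (\<lambda>x. fourier f (- x))" using i by (simp add: lborel_integral_shift)
  then have i': "integrable lborel (inv_fourier f)" by (simp add: fourier_eq_inv_fourier)
  have "inv_fourier (fourier f) x = (\<integral>\<xi>. inv_fourier f (- \<xi>) * cis (2 * pi * (x \<bullet> \<xi>)) \<partial>lborel)"
    by (simp add: inv_fourier_eq[of "fourier f"] fourier_eq_inv_fourier)
  also have "\<dots> = (\<integral>\<xi>. inv_fourier f \<xi> * cis (- 2 * pi * (\<xi> \<bullet> x)) \<partial>lborel)"
    using lborel_integral_shift(7)[of "\<lambda>\<xi>. inv_fourier f \<xi> * cis (- 2 * pi * (\<xi> \<bullet> x))"]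
    by (simp add: inner_commute)
  also have "\<dots> = f x" using fourier_inversion[OF f c B i', of x] by (simp add: fourier_eq)
  finally show "inv_fourier (fourier f) x = f x" .
qed

section \<open>The Jacobian constant of the inverse transpose\<close>

lemma inner_matrix_vector:
  fixes A :: "real^'n^'m"
  shows "x \<bullet> (A *v y) = (transpose A *v x) \<bullet> y"
  by (simp add: dot_lmul_matrix)

lemma det_matrix_inv_transpose:
  fixes A :: "real^'n^'n"
  assumes "det A \<noteq> 0"
  shows "det (matrix_inv (transpose A)) \<noteq> 0"
proof -
  have "det (transpose A ** matrix_inv (transpose A)) = 1"
    using matrix_inv_mult(1)[of "transpose A"] assms by (simp add: det_transpose)
  then show ?thesis by (auto simp: det_mul)
qed

text \<open>The constants \<open>c\<close> of \<open>A\<close> and \<open>d\<close> of its inverse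
  transpose are reciprocal. This is read off at a single point: the transform of a Gaussian composed
  with \<open>A\<close> is \<open>c\<close> times the transformed Gaussian composed with the inverse
  transpose, and Fourier inversion at 0 then gives 1 = c d.\<close>

lemma lborel_integral_matrix:
  fixes A :: "real^'n^'n"
  assumes A: "det A \<noteq> 0"
  obtains c :: real where "c > 0"
    "\<And>f :: real^'n \<Rightarrow> complex. f \<in> borel_measurable borel \<Longrightarrow> (\<integral>x. f (A *v x) \<partial>lborel) = c *\<^sub>R (\<integral>x. f x \<partial>lborel)"
    "\<And>f :: real^'n \<Rightarrow> complex. f \<in> borel_measurable borel \<Longrightarrow> integrable lborel (\<lambda>x. f (A *v x)) \<longleftrightarrow> integrable lborel f"
    "\<And>f :: real^'n \<Rightarrow> complex. f \<in> borel_measurable borel \<Longrightarrow>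
       (\<integral>x. f (matrix_inv (transpose A) *v x) \<partial>lborel) = (1 / c) *\<^sub>R (\<integral>x. f x \<partial>lborel)"
    "\<And>f :: real^'n \<Rightarrow> complex. f \<in> borel_measurable borel \<Longrightarrow>
       integrable lborel (\<lambda>x. f (matrix_inv (transpose A) *v x)) \<longleftrightarrow> integrable lborel f"
proof -
  define B where "B = matrix_inv (transpose A)"
  have At: "det (transpose A) \<noteq> 0" using A by (simp add: det_transpose)
  obtain c where c: "c > 0"
    "\<And>f :: real^'n \<Rightarrow> complex. f \<in> borel_measurable borel \<Longrightarrow> (\<integral>x. f (A *v x) \<partial>lborel) = c *\<^sub>R (\<integral>x. f x \<partial>lborel)"
    "\<And>f :: real^'n \<Rightarrow> complex. f \<in> borel_measurable borel \<Longrightarrow> integrable lborel (\<lambda>x. f (A *v x)) \<longleftrightarrow> integrable lborel f"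
    using lborel_integral_matrix_const[OF A] by blast
  obtain d where d: "d > 0"
    "\<And>f :: real^'n \<Rightarrow> complex. f \<in> borel_measurable borel \<Longrightarrow> (\<integral>x. f (B *v x) \<partial>lborel) = d *\<^sub>R (\<integral>x. f x \<partial>lborel)"
    "\<And>f :: real^'n \<Rightarrow> complex. f \<in> borel_measurable borel \<Longrightarrow> integrable lborel (\<lambda>x. f (B *v x)) \<longleftrightarrow> integrable lborel f"
    using lborel_integral_matrix_const[OF det_matrix_inv_transpose[OF A]] unfolding B_def by blast
  define G where "G = (\<lambda>x::real^'n. complex_of_real (exp (- ((norm x)\<^sup>2 / 2))))"
  have [measurable]: "G \<in> borel_measurable borel" unfolding G_def by measurable
  have Gi: "integrable lborel G" using integral_gaussian(2)[of "0::real^'n"] by (simp add: G_def)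
  have Gc: "continuous_on UNIV G" unfolding G_def by (auto intro!: continuous_intros)
  have Gb: "norm (G x) \<le> 1" for x unfolding G_def by simp
  have FG: "inv_fourier G x = complex_of_real (sqrt (2 * pi) ^ CARD('n)) * G ((2 * pi) *\<^sub>R x)" for x
    using integral_gaussian(1)[of "(2 * pi) *\<^sub>R x"] unfolding G_def by (simp add: inv_fourier_eq mult.assoc)
  have "integrable lborel (\<lambda>x. complex_of_real (sqrt (2 * pi) ^ CARD('n)) * G (0 + (2 * pi) *\<^sub>R x))"
    using Gi by (intro integrable_mult_right) (simp only: lborel_integral_affine(2)[OF _ \<open>G \<in> borel_measurable borel\<close>] pi_neq_zero mult_eq_0_iff zero_neq_numeral[symmetric] not_False_eq_True de_Morgan_disj simp_thms)
  then have iG: "integrable lborel (inv_fourier G)" by (simp add: FG[abs_def])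
  define f where "f = (\<lambda>\<xi>. G (A *v \<xi>))"
  have fi: "integrable lborel f" unfolding f_def using c(3)[of G] Gi by simp
  have fc: "continuous_on UNIV f" unfolding f_def
    by (rule continuous_on_compose2[OF Gc]) (auto intro: matrix_vector_mult_linear_continuous_on)
  have "inv_fourier f x = c *\<^sub>R inv_fourier G (B *v x)" for x
  proof -
    have "x \<bullet> \<xi> = (B *v x) \<bullet> (A *v \<xi>)" for \<xi>
      using matrix_inv_vector(1)[OF At, of x] by (simp only: inner_matrix_vector B_def)
    then have "inv_fourier f x = (\<integral>\<xi>. G (A *v \<xi>) * cis (2 * pi * ((B *v x) \<bullet> (A *v \<xi>))) \<partial>lborel)"
      using fi unfolding f_def by (subst inv_fourier_eq) auto
    also have "\<dots> = c *\<^sub>R (\<integral>\<xi>. G \<xi> * cis (2 * pi * ((B *v x) \<bullet> \<xi>)) \<partial>lborel)"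
      by (rule c(2)[of "\<lambda>y. G y * cis (2 * pi * ((B *v x) \<bullet> y))"]) measurable
    finally show ?thesis by (simp add: inv_fourier_eq)
  qed
  then have If: "inv_fourier f = (\<lambda>x. c *\<^sub>R inv_fourier G (B *v x))" by auto
  have Ifi: "integrable lborel (inv_fourier f)"
    unfolding If using iG d(3)[of "inv_fourier G"] by (intro integrable_scaleR_right) simp
  have "f 0 = fourier (inv_fourier f) 0"
    using fourier_inversion[OF fi fc _ Ifi, of 1] Gb by (simp add: f_def)
  also have "\<dots> = (\<integral>x. inv_fourier f x \<partial>lborel)"
    using Ifi by (subst fourier_eq) auto
  also have "\<dots> = c *\<^sub>R d *\<^sub>R (\<integral>x. inv_fourier G x \<partial>lborel)"
    unfolding If using d(2)[of "inv_fourier G"] by simp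
  also have "(\<integral>x. inv_fourier G x \<partial>lborel) = fourier (inv_fourier G) 0"
    by (subst fourier_eq) auto
  also have "\<dots> = G 0" by (rule fourier_inversion[OF Gi Gc Gb iG])
  finally have "complex_of_real (c * d) = 1" by (simp add: f_def G_def scaleR_conv_of_real)
  then have "c * d = 1" by (simp only: of_real_eq_1_iff)
  then have dd: "d = 1 / c" using c(1) by (simp add: field_simps)
  show thesis
    by (rule that[OF c, folded B_def, OF _ _ d(2)[unfolded dd] d(3)])
qed

subsection \<open>Smooth functions\<close>

lemma smooth_on_partials:
  "smooth_on UNIV f \<Longrightarrow> (partials is f has_derivative frechet_derivative (partials is f) (at x)) (at x)"
  by (simp add: smooth_on_def frechet_derivative_works[symmetric])

lemma continuous_on_partials:
  assumes "smooth_on UNIV f"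
  shows "continuous_on UNIV (partials is f)"
  by (intro continuous_at_imp_continuous_on ballI has_derivative_continuous[OF smooth_on_partials[OF assms]])

lemma partials_eqI:
  assumes "partials is f = g" "\<And>x. (g has_derivative D x) (at x)"
  shows "partials (i # is) f = (\<lambda>x. D x (axis i 1))"
proof
  show "partials (i # is) f x = D x (axis i 1)" for x
    using fun_cong[OF frechet_derivative_at[OF assms(2)[of x]], of "axis i 1"] by (simp add: assms(1))
qed

lemma partials_affine:
  fixes f :: "real^'n \<Rightarrow> 'b::real_normed_vector"
  assumes f: "smooth_on UNIV f"
  shows "partials is (\<lambda>x. f (a + r *\<^sub>R x)) = (\<lambda>x. r ^ length is *\<^sub>R partials is f (a + r *\<^sub>R x))"
    and "((\<lambda>x. r ^ length is *\<^sub>R partials is f (a + r *\<^sub>R x)) has_derivative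
       (\<lambda>v. r ^ length is *\<^sub>R frechet_derivative (partials is f) (at (a + r *\<^sub>R x)) (r *\<^sub>R v))) (at x)"
proof -
  have D: "((\<lambda>x. r ^ length is *\<^sub>R partials is f (a + r *\<^sub>R x)) has_derivative
       (\<lambda>v. r ^ length is *\<^sub>R frechet_derivative (partials is f) (at (a + r *\<^sub>R x)) (r *\<^sub>R v))) (at x)" for x "is"
    by (intro has_derivative_scaleR_right has_derivative_compose[OF _ smooth_on_partials[OF f]])
      (auto intro!: derivative_eq_intros)
  then show "((\<lambda>x. r ^ length is *\<^sub>R partials is f (a + r *\<^sub>R x)) has_derivative
       (\<lambda>v. r ^ length is *\<^sub>R frechet_derivative (partials is f) (at (a + r *\<^sub>R x)) (r *\<^sub>R v))) (at x)" .
  show "partials is (\<lambda>x. f (a + r *\<^sub>R x)) = (\<lambda>x. r ^ length is *\<^sub>R partials is f (a + r *\<^sub>R x))"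
  proof (induction "is")
    case (Cons i "is")
    have l: "linear (frechet_derivative (partials is f) (at y))" for y
      using smooth_on_partials[OF f, of "is" y] has_derivative_linear by blast
    show ?case
      by (subst partials_eqI[OF Cons D]) (auto simp: linear_cmul[OF l] mult.commute)
  qed simp
qed

lemma smooth_on_affine:
  fixes f :: "real^'n \<Rightarrow> 'b::real_normed_vector"
  assumes "smooth_on UNIV f"
  shows "smooth_on UNIV (\<lambda>x. f (a + r *\<^sub>R x))"
  unfolding smooth_on_def partials_affine(1)[OF assms]
  by (intro allI ballI differentiableI[OF partials_affine(2)[OF assms]])

lemma smooth_on_of_real:
  fixes f :: "real^'n \<Rightarrow> real"
  assumes f: "smooth_on UNIV f"
  shows "smooth_on UNIV (\<lambda>x. complex_of_real (f x))"
proof -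
  have D: "((\<lambda>x. complex_of_real (partials is f x)) has_derivative
       (\<lambda>v. complex_of_real (frechet_derivative (partials is f) (at x) v))) (at x)" for x "is"
    by (intro has_derivative_of_real smooth_on_partials[OF f])
  have eq: "partials is (\<lambda>x. complex_of_real (f x)) = (\<lambda>x. complex_of_real (partials is f x))" for "is"
  proof (induction "is")
    case (Cons i "is")
    show ?case by (subst partials_eqI[OF Cons D]) auto
  qed simp
  show ?thesis unfolding smooth_on_def eq by (intro allI ballI differentiableI[OF D])
qed

lemma smooth_on_mult:
  fixes f g :: "real^'n \<Rightarrow> 'b::real_normed_algebra"
  assumes f: "smooth_on UNIV f" and g: "smooth_on UNIV g"
  shows "smooth_on UNIV (\<lambda>x. f x * g x)"
proof -
  \<comment> \<open>\<open>L\<close> lists the pairs of multi-indices of a fully expanded Leibniz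
    sum, with repetitions. Differentiating such a sum gives another of the same shape, so the
    existence of a list suffices for all orders.\<close>
  define \<Phi> where "\<Phi> = (\<lambda>L x. \<Sum>(p, q)\<leftarrow>L. partials p f x * partials q g x)"
  have D: "(\<Phi> L has_derivative (\<lambda>v. \<Sum>(p, q)\<leftarrow>L. partials p f x * frechet_derivative (partials q g) (at x) v
       + frechet_derivative (partials p f) (at x) v * partials q g x)) (at x)" for L x
  proof (induction L)
    case (Cons a L)
    obtain p q where a: "a = (p, q)" by force
    show ?case using has_derivative_add[OF has_derivative_mult[OF smooth_on_partials[OF f, of p x] smooth_on_partials[OF g, of q x]] Cons]
      unfolding \<Phi>_def a by simp
  qed (simp add: \<Phi>_def)
  have ex: "\<exists>L. partials is (\<lambda>x. f x * g x) = \<Phi> L" for "is"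
  proof (induction "is")
    case Nil
    show ?case by (rule exI[of _ "[([], [])]"]) (auto simp: \<Phi>_def)
  next
    case (Cons i "is")
    then obtain L where L: "partials is (\<lambda>x. f x * g x) = \<Phi> L" by blast
    have "partials (i # is) (\<lambda>x. f x * g x) x = \<Phi> (concat (map (\<lambda>(p, q). [(p, i # q), (i # p, q)]) L)) x" for x
    proof -
      have "partials (i # is) (\<lambda>x. f x * g x) x = (\<Sum>(p, q)\<leftarrow>L. partials p f x * frechet_derivative (partials q g) (at x) (axis i 1)
       + frechet_derivative (partials p f) (at x) (axis i 1) * partials q g x)"
        by (subst partials_eqI[OF L D]) simp
      also have "\<dots> = \<Phi> (concat (map (\<lambda>(p, q). [(p, i # q), (i # p, q)]) L)) x"
        unfolding \<Phi>_def by (induction L) (auto simp: add.assoc)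
      finally show ?thesis .
    qed
    then show ?case by (intro exI[of _ "concat (map (\<lambda>(p, q). [(p, i # q), (i # p, q)]) L)"] ext)
  qed
  show ?thesis unfolding smooth_on_def
  proof (intro allI ballI)
    fix "is" :: "'n list" and x :: "real^'n"
    obtain L where "partials is (\<lambda>x. f x * g x) = \<Phi> L" using ex by blast
    then show "partials is (\<lambda>x. f x * g x) differentiable at x" using differentiableI[OF D[of L x]] by simp
  qed
qed

lemma partials_eq_0:
  fixes f :: "real^'n \<Rightarrow> 'b::real_normed_vector"
  assumes "x \<notin> fun_support f"
  shows "partials is f x = 0"
  using assms
proof (induction "is" arbitrary: x)
  case Nil
  then show ?case using closure_subset[of "{x. f x \<noteq> 0}"] by (auto simp: fun_support_def)
next
  case (Cons i "is")
  have "open (- fun_support f)" unfolding fun_support_def by (intro open_Compl closed_closure)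
  have "(partials is f has_derivative (\<lambda>v. 0)) (at x)"
    by (rule has_derivative_transform_within_open[OF has_derivative_const[of 0] \<open>open (- fun_support f)\<close>])
      (use Cons in auto)
  from fun_cong[OF frechet_derivative_at[OF this], of "axis i 1"] show ?case by simp
qed

lemma integrable_continuous_compact_support:
  fixes f :: "real^'n \<Rightarrow> complex"
  assumes c: "continuous_on UNIV f" and S: "compact S" and z: "\<And>x. x \<notin> S \<Longrightarrow> f x = 0"
  shows "integrable lborel f"
proof -
  have "integrable lborel (\<lambda>x. indicator S x *\<^sub>R f x)"
    using S c by (intro borel_integrable_compact) (auto intro: continuous_on_subset)
  moreover have "(\<lambda>x. indicator S x *\<^sub>R f x) = f" using z by (auto simp: indicator_def fun_eq_iff)
  ultimately show ?thesis by simp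
qed

lemma bounded_continuous_compact_support:
  fixes f :: "'a::topological_space \<Rightarrow> 'b::real_normed_vector"
  assumes c: "continuous_on UNIV f" and S: "compact S" and z: "\<And>x. x \<notin> S \<Longrightarrow> f x = 0"
  obtains B where "B \<ge> 0" "\<And>x. norm (f x) \<le> B"
proof -
  have "compact (f ` S)" using c S by (intro compact_continuous_image) (auto intro: continuous_on_subset)
  then obtain B where B: "\<And>x. x \<in> S \<Longrightarrow> norm (f x) \<le> B"
    using compact_imp_bounded bounded_iff by (metis imageI)
  show thesis
  proof (rule that[of "max B 0"])
    show "norm (f x) \<le> max B 0" for x using B[of x] z[of x] by (cases "x \<in> S") auto
  qed simp
qed

lemma integrable_partials:
  assumes "h \<in> test_functions"
  shows "integrable lborel (partials is h)"
proof (rule integrable_continuous_compact_support)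
  show "continuous_on UNIV (partials is h)" "compact (fun_support h)"
    using assms continuous_on_partials by (auto simp: test_functions_def)
  show "partials is h x = 0" if "x \<notin> fun_support h" for x using that by (rule partials_eq_0)
qed

section \<open>Decay of the transform of a test function\<close>

lemma tendsto_difference_quotient_cis:
  assumes "r \<longlonglongrightarrow> 0" "\<And>n. r n \<noteq> 0"
  shows "(\<lambda>n. (cis (a * r n) - 1) / complex_of_real (r n)) \<longlonglongrightarrow> \<i> * complex_of_real a"
proof -
  have "((\<lambda>z. exp (\<i> * complex_of_real a * z)) has_field_derivative \<i> * complex_of_real a) (at 0)"
    by (auto intro!: derivative_eq_intros)
  then have "((\<lambda>h. (exp (\<i> * complex_of_real a * h) - 1) / h) \<longlongrightarrow> \<i> * complex_of_real a) (at 0)"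
    by (simp add: DERIV_def)
  moreover have "filterlim (\<lambda>n. complex_of_real (r n)) (at 0) sequentially"
    using assms tendsto_of_real[OF assms(1), where 'a=complex] by (auto simp: filterlim_at)
  ultimately have "(\<lambda>n. (exp (\<i> * complex_of_real a * complex_of_real (r n)) - 1) / complex_of_real (r n)) \<longlonglongrightarrow> \<i> * complex_of_real a"
    by (rule filterlim_compose)
  then show ?thesis by (simp add: cis_conv_exp mult.assoc)
qed

text \<open>Instead of integrating by parts, translation is used: the transform of a difference
  quotient of \<open>g\<close> is a scalar multiple of that of \<open>g\<close>, and letting the
  step tend to 0 on both sides gives the formula.\<close>

lemma inv_fourier_derivative:
  fixes g d :: "real^'n \<Rightarrow> complex"
  assumes D: "\<And>x. (g has_derivative D x) (at x)" and c: "continuous_on UNIV (\<lambda>x. D x (axis i 1))"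
    and S: "compact S" and z: "\<And>x. x \<notin> S \<Longrightarrow> g x = 0" "\<And>x. x \<notin> S \<Longrightarrow> D x (axis i 1) = 0"
  shows "inv_fourier (\<lambda>x. D x (axis i 1)) x = - 2 * pi * \<i> * (x $ i) * inv_fourier g x"
proof -
  let ?e = "axis i 1 :: real^'n"
  define d where "d = (\<lambda>x. D x ?e)"
  have gc: "continuous_on UNIV g" using D has_derivative_continuous by (metis continuous_at_imp_continuous_on)
  have [measurable]: "g \<in> borel_measurable borel" using gc by (rule borel_measurable_continuous_onI)
  have dc: "continuous_on UNIV d" using c by (simp add: d_def)
  have [measurable]: "d \<in> borel_measurable borel" using dc by (rule borel_measurable_continuous_onI)
  have gi: "integrable lborel g" by (rule integrable_continuous_compact_support[OF gc S z(1)])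
  obtain B where B: "B \<ge> 0" "\<And>x. norm (d x) \<le> B"
    using bounded_continuous_compact_support[OF dc S] z(2) unfolding d_def by blast
  obtain R where R: "\<And>x. x \<in> S \<Longrightarrow> norm x \<le> R" using S compact_imp_bounded bounded_iff by metis
  define r where "r = (\<lambda>n. inverse (real (Suc n)))"
  have r: "0 < r n" "r n \<le> 1" for n by (auto simp: r_def inverse_le_1_iff)
  have r0: "r \<longlonglongrightarrow> 0" unfolding r_def by (rule LIMSEQ_inverse_real_of_nat)
  define q where "q = (\<lambda>n \<xi>. (g (\<xi> + r n *\<^sub>R ?e) - g \<xi>) / complex_of_real (r n))"
  have line: "((\<lambda>t. g (\<xi> + t *\<^sub>R ?e)) has_vector_derivative d (\<xi> + t *\<^sub>R ?e)) (at t within T)" for \<xi> t T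
  proof -
    have "((\<lambda>t. \<xi> + t *\<^sub>R ?e) has_derivative (\<lambda>s. s *\<^sub>R ?e)) (at t within T)" by (auto intro!: derivative_eq_intros)
    from has_derivative_compose[OF this D[of "\<xi> + t *\<^sub>R ?e"]]
    have "((\<lambda>t. g (\<xi> + t *\<^sub>R ?e)) has_derivative (\<lambda>s. D (\<xi> + t *\<^sub>R ?e) (s *\<^sub>R ?e))) (at t within T)" .
    moreover have "D (\<xi> + t *\<^sub>R ?e) (s *\<^sub>R ?e) = s *\<^sub>R d (\<xi> + t *\<^sub>R ?e)" for s
      unfolding d_def using linear_cmul[OF has_derivative_linear[OF D]] by blast
    ultimately show ?thesis by (simp add: has_vector_derivative_def)
  qed
  have q_lim: "(\<lambda>n. q n \<xi>) \<longlonglongrightarrow> d \<xi>" for \<xi>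
  proof -
    have "((\<lambda>t. g (\<xi> + t *\<^sub>R ?e)) has_vector_derivative d \<xi>) (at 0)" using line[of \<xi> 0 UNIV] by simp
    then have "((\<lambda>h. norm (g (\<xi> + h *\<^sub>R ?e) - g \<xi> - h *\<^sub>R d \<xi>) / norm h) \<longlongrightarrow> 0) (at 0)"
      by (simp add: has_vector_derivative_def has_derivative_at)
    moreover have "filterlim r (at 0) sequentially" using r r0 by (auto simp: filterlim_at less_imp_neq[symmetric])
    ultimately have "(\<lambda>n. norm (g (\<xi> + r n *\<^sub>R ?e) - g \<xi> - r n *\<^sub>R d \<xi>) / norm (r n)) \<longlonglongrightarrow> 0"
      by (rule filterlim_compose)
    moreover have "norm (g (\<xi> + r n *\<^sub>R ?e) - g \<xi> - r n *\<^sub>R d \<xi>) / norm (r n) = norm (q n \<xi> - d \<xi>)" for n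
    proof -
      have "q n \<xi> - d \<xi> = (g (\<xi> + r n *\<^sub>R ?e) - g \<xi> - r n *\<^sub>R d \<xi>) / complex_of_real (r n)"
        using r[of n] by (simp add: q_def scaleR_conv_of_real field_simps)
      then show ?thesis by (simp add: norm_divide)
    qed
    ultimately have "(\<lambda>n. norm (q n \<xi> - d \<xi>)) \<longlonglongrightarrow> 0" by simp
    then show ?thesis by (rule LIM_zero_cancel[OF tendsto_norm_zero_cancel])
  qed
  \<comment> \<open>The mean value inequality along the axis bounds the quotient by
    \<open>B\<close>. The steps are at most 1, so all quotients vanish outside the ball of radius R
    + 1, which makes the dominating function integrable.\<close>
  have q_bd: "norm (q n \<xi>) \<le> B * indicator (cball 0 (R + 1)) \<xi>" for n \<xi>
  proof (cases "\<xi> \<in> cball 0 (R + 1)")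
    case True
    have "norm (g (\<xi> + r n *\<^sub>R ?e) - g (\<xi> + 0 *\<^sub>R ?e)) \<le> B * norm (r n - 0)"
    proof (rule differentiable_bound[where f="\<lambda>t. g (\<xi> + t *\<^sub>R ?e)" and x="r n" and y=0 and S=UNIV and f'="\<lambda>t s. s *\<^sub>R d (\<xi> + t *\<^sub>R ?e)"])
      show "((\<lambda>t. g (\<xi> + t *\<^sub>R ?e)) has_derivative (\<lambda>s. s *\<^sub>R d (\<xi> + t *\<^sub>R ?e))) (at t)" for t
        using line[of \<xi> t UNIV] by (simp add: has_vector_derivative_def)
      show "onorm (\<lambda>s. s *\<^sub>R d (\<xi> + t *\<^sub>R ?e)) \<le> B" for t
        using B(2) by (intro onorm_le) (simp add: mult.commute[of B] mult_left_mono)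
    qed auto
    then have "norm (g (\<xi> + r n *\<^sub>R ?e) - g \<xi>) \<le> B * r n" using r[of n] by simp
    then have "norm (g (\<xi> + r n *\<^sub>R ?e) - g \<xi>) / r n \<le> B" using r(1)[of n] by (simp only: pos_divide_le_eq)
    moreover have "norm (q n \<xi>) = norm (g (\<xi> + r n *\<^sub>R ?e) - g \<xi>) / r n"
      unfolding q_def norm_divide norm_of_real using r(1)[of n] by simp
    ultimately show ?thesis using True by (simp only: indicator_simps mult_1_right)
  next
    case False
    then have n: "norm \<xi> > R + 1" by (simp add: dist_norm)
    have "norm \<xi> \<le> norm (\<xi> + r n *\<^sub>R ?e) + norm (r n *\<^sub>R ?e)"
      using norm_triangle_ineq4[of "\<xi> + r n *\<^sub>R ?e" "r n *\<^sub>R ?e"] by simp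
    then have "norm (\<xi> + r n *\<^sub>R ?e) > R" using n r[of n] by simp
    then have "g (\<xi> + r n *\<^sub>R ?e) = 0" "g \<xi> = 0" using R z(1) n by force+
    then show ?thesis using False by (simp add: q_def)
  qed
  have qm: "q n \<in> borel_measurable borel" for n unfolding q_def by measurable
  have lim1: "(\<lambda>n. inv_fourier (q n) x) \<longlonglongrightarrow> inv_fourier d x"
    unfolding inv_fourier_eq[OF qm] inv_fourier_eq[OF \<open>d \<in> borel_measurable borel\<close>]
  proof (rule integral_dominated_convergence[where w="\<lambda>\<xi>. B * indicator (cball 0 (R + 1)) \<xi>"])
    show "integrable lborel (\<lambda>\<xi>::real^'n. B * indicator (cball 0 (R + 1)) \<xi>)"
      by (intro integrable_mult_right integrable_real_indicator emeasure_bounded_finite) auto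
    show "AE \<xi> in lborel. (\<lambda>n. q n \<xi> * cis (2 * pi * (x \<bullet> \<xi>))) \<longlonglongrightarrow> d \<xi> * cis (2 * pi * (x \<bullet> \<xi>))"
      by (intro AE_I2 tendsto_intros q_lim)
    show "AE \<xi> in lborel. norm (q n \<xi> * cis (2 * pi * (x \<bullet> \<xi>))) \<le> B * indicator (cball 0 (R + 1)) \<xi>" for n
      using q_bd by (simp add: norm_mult)
  qed (use qm in \<open>auto intro!: borel_measurable_times measurable_cis_inner\<close>)
  have qe: "inv_fourier (q n) x = (cis ((- 2 * pi * x $ i) * r n) - 1) / complex_of_real (r n) * inv_fourier g x" for n
  proof -
    let ?c = "\<lambda>\<xi>. cis (2 * pi * (x \<bullet> \<xi>))"
    have gci: "integrable lborel (\<lambda>\<xi>. g \<xi> * ?c \<xi>)" using gi by (intro integrable_bounded_mult[where B=1]) auto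
    have sh: "g (\<xi> + r n *\<^sub>R ?e) * ?c \<xi> = cis ((- 2 * pi * x $ i) * r n) * (g (\<xi> + r n *\<^sub>R ?e) * ?c (\<xi> + r n *\<^sub>R ?e))" for \<xi>
    proof -
      have "?c \<xi> = cis ((- 2 * pi * x $ i) * r n) * ?c (\<xi> + r n *\<^sub>R ?e)"
        by (simp add: cis_mult inner_add_right inner_axis algebra_simps)
      then show ?thesis by simp
    qed
    have gci2: "integrable lborel (\<lambda>\<xi>. g (\<xi> + r n *\<^sub>R ?e) * ?c \<xi>)"
      unfolding sh using gci lborel_integral_shift(6)[of "\<lambda>\<xi>. g \<xi> * ?c \<xi>" "r n *\<^sub>R ?e"]
      by (intro integrable_mult_right) simp
    have "inv_fourier (q n) x = (\<integral>\<xi>. (g (\<xi> + r n *\<^sub>R ?e) * ?c \<xi> - g \<xi> * ?c \<xi>) / complex_of_real (r n) \<partial>lborel)"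
      unfolding inv_fourier_eq[OF qm] by (simp add: q_def field_simps)
    also have "\<dots> = ((\<integral>\<xi>. g (\<xi> + r n *\<^sub>R ?e) * ?c \<xi> \<partial>lborel) - (\<integral>\<xi>. g \<xi> * ?c \<xi> \<partial>lborel)) / complex_of_real (r n)"
      using gci gci2 by simp
    also have "(\<integral>\<xi>. g (\<xi> + r n *\<^sub>R ?e) * ?c \<xi> \<partial>lborel) = cis ((- 2 * pi * x $ i) * r n) * (\<integral>\<xi>. g \<xi> * ?c \<xi> \<partial>lborel)"
      unfolding sh integral_mult_right_zero
      using lborel_integral_shift(5)[of "\<lambda>\<xi>. g \<xi> * ?c \<xi>" "r n *\<^sub>R ?e"] by simp
    finally show ?thesis by (simp add: inv_fourier_eq field_simps)
  qed
  have rn: "r n \<noteq> 0" for n using r(1)[of n] by simp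
  have "(\<lambda>n. inv_fourier (q n) x) \<longlonglongrightarrow> \<i> * complex_of_real (- 2 * pi * x $ i) * inv_fourier g x"
    unfolding qe by (intro tendsto_mult tendsto_const tendsto_difference_quotient_cis r0 rn)
  with lim1 have "inv_fourier d x = \<i> * complex_of_real (- 2 * pi * x $ i) * inv_fourier g x"
    by (rule LIMSEQ_unique)
  then show ?thesis by (simp add: d_def mult_ac)
qed

lemma integrable_inverse_square:
  "integrable lborel (\<lambda>x::real. complex_of_real (1 / (1 + x\<^sup>2)))"
proof -
  let ?f = "\<lambda>x::real. 1 / (1 + x\<^sup>2)"
  have "set_integrable lborel {0<..} ?f"
    using integrable_I0i_1_div_plus_square by (simp add: interval_lebesgue_integrable_def einterval_def zero_ereal_def greaterThan_def)
  then have "integrable lborel (\<lambda>x::real. indicator {0<..} x * ?f x)"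
    unfolding set_integrable_def real_scaleR_def .
  then have i: "integrable lborel (\<lambda>x::real. complex_of_real (indicator {0<..} x * ?f x))"
    by (rule integrable_of_real)
  then have "integrable lborel (\<lambda>x::real. complex_of_real (indicator {0<..} x * ?f x) + complex_of_real (indicator {0<..} (- x) * ?f (- x)))"
    using lborel_integral_shift(8)[of "\<lambda>x::real. complex_of_real (indicator {0<..} x * ?f x)"]
    by (intro Bochner_Integration.integrable_add) auto
  moreover have "AE x in lborel. complex_of_real (indicator {0<..} x * ?f x) + complex_of_real (indicator {0<..} (- x) * ?f (- x)) = complex_of_real (?f x)"
    using AE_lborel_singleton[of "0::real"] by eventually_elim (auto simp: indicator_def)
  ultimately show ?thesis
    by (subst (asm) integrable_cong_AE[where g="\<lambda>x. complex_of_real (?f x)"]) auto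
qed

text \<open>Each derivative of \<open>h\<close> in direction i contributes a factor 2 pi |x_i| to
  the transform, so the transform is bounded by a multiple of the inverse of the product of all 1 +
  x_i^2. That weight is integrable because it is a tensor product of functions of one
  variable.\<close>

theorem integrable_inv_fourier_test:
  fixes h :: "real^'n \<Rightarrow> complex"
  assumes h: "h \<in> test_functions"
  shows "integrable lborel (inv_fourier h)"
proof -
  let ?N = "CARD('n)"
  have s: "smooth_on UNIV h" and S: "compact (fun_support h)" using h by (auto simp: test_functions_def)
  have hi: "integrable lborel h" using integrable_partials[OF h, of "[]"] by simp
  have [measurable]: "h \<in> borel_measurable borel" using hi by auto
  have step: "inv_fourier (partials (i # is) h) x = - 2 * pi * \<i> * (x $ i) * inv_fourier (partials is h) x" for i "is" x
    using inv_fourier_derivative[OF smooth_on_partials[OF s, of "is"] _ S, of i x] continuous_on_partials[OF s, of "i # is"]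
      partials_eq_0[of _ h "is"] partials_eq_0[of _ h "i # is"] by simp
  have pow: "inv_fourier (partials (replicate k i) h) x = (- 2 * pi * \<i> * (x $ i)) ^ k * inv_fourier h x" for i k x
  proof (induction k)
    case (Suc k)
    have "inv_fourier (partials (replicate (Suc k) i) h) x = - 2 * pi * \<i> * (x $ i) * inv_fourier (partials (replicate k i) h) x"
      by (simp only: replicate_Suc step)
    then show ?case by (simp only: Suc power_Suc mult.assoc)
  qed simp
  define C where "C = (\<lambda>k i. \<integral>\<xi>. norm (partials (replicate k i) h \<xi>) \<partial>lborel)"
  have C: "\<bar>x $ i\<bar> ^ k * norm (inv_fourier h x) \<le> C k i" for i k x
  proof -
    have "\<bar>x $ i\<bar> ^ k * norm (inv_fourier h x) \<le> (2 * pi * \<bar>x $ i\<bar>) ^ k * norm (inv_fourier h x)"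
      using pi_ge_two by (intro mult_right_mono power_mono) (auto simp: mult_le_cancel_right1 intro: order_trans[of _ "2 * pi"])
    also have "\<dots> = norm (inv_fourier (partials (replicate k i) h) x)"
      unfolding pow by (simp add: norm_mult norm_power abs_mult)
    also have "\<dots> \<le> C k i" unfolding C_def by (rule norm_inv_fourier_le[OF integrable_partials[OF h]])
    finally show ?thesis .
  qed
  define K where "K = 2 ^ ?N * (\<Sum>i\<in>UNIV. C 0 i + C (2 * ?N) i)"
  have C0: "0 \<le> C k i" for k i unfolding C_def by (intro integral_nonneg_AE) auto
  define w where "w = (\<lambda>x::real^'n. \<Prod>b\<in>Basis. complex_of_real (1 / (1 + (x \<bullet> b)\<^sup>2)))"
  have w: "integrable lborel w" unfolding w_def by (intro lborel_prod_integral(2) integrable_inverse_square)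
  have nw: "norm (w x) = inverse (\<Prod>i\<in>UNIV. 1 + (x $ i)\<^sup>2)" for x
  proof -
    have "norm (w x) = (\<Prod>b\<in>Basis. inverse (1 + (x \<bullet> b)\<^sup>2))"
      unfolding w_def prod_norm[symmetric] by (intro prod.cong refl) (simp add: norm_divide inverse_eq_divide del: of_real_add of_real_divide)
    also have "\<dots> = (\<Prod>i\<in>UNIV. inverse (1 + (x $ i)\<^sup>2))"
    proof -
      have B: "(Basis :: (real^'n) set) = range (\<lambda>i. axis i 1)" by (auto simp: Basis_vec_def)
      have inj: "inj (\<lambda>i. axis i (1::real) :: real^'n)" by (auto simp: inj_def axis_eq_axis)
      show ?thesis unfolding B prod.reindex[OF inj] o_def by (simp add: inner_axis)
    qed
    finally show ?thesis by (simp add: prod_inversef[symmetric] o_def)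
  qed
  have bd: "norm (inv_fourier h x) \<le> norm (K * w x)" for x
  proof -
    \<comment> \<open>Derivatives in one direction suffice: every factor of the weight is at most 1
      + m, with m the square of the largest coordinate, and (1 + m)^n \<le> 2^n (1 + m^n). So only
      the orders 0 and 2n occur.\<close>
    define m where "m = Max (range (\<lambda>i. (x $ i)\<^sup>2))"
    have "m \<in> range (\<lambda>i. (x $ i)\<^sup>2)" unfolding m_def by (intro Max_in) auto
    then obtain i0 where i0: "m = (x $ i0)\<^sup>2" by auto
    have m: "(x $ i)\<^sup>2 \<le> m" for i unfolding m_def by (intro Max_ge) auto
    have m0: "0 \<le> m" by (simp add: i0)
    have "(\<Prod>i\<in>UNIV. 1 + (x $ i)\<^sup>2) \<le> (\<Prod>i\<in>(UNIV::'n set). 1 + m)"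
      using m by (intro prod_mono) auto
    also have "\<dots> = (1 + m) ^ ?N" by simp
    also have "\<dots> \<le> 2 ^ ?N * (1 + m ^ ?N)"
    proof (cases "m \<le> 1")
      case True
      have "(1 + m) ^ ?N \<le> 2 ^ ?N" using True m0 by (intro power_mono) auto
      also have "\<dots> \<le> 2 ^ ?N * (1 + m ^ ?N)" using m0 by simp
      finally show ?thesis .
    next
      case False
      have "(1 + m) ^ ?N \<le> (2 * m) ^ ?N" using False m0 by (intro power_mono) auto
      also have "\<dots> \<le> 2 ^ ?N * (1 + m ^ ?N)" using m0 by (simp add: power_mult_distrib)
      finally show ?thesis .
    qed
    finally have "(\<Prod>i\<in>UNIV. 1 + (x $ i)\<^sup>2) * norm (inv_fourier h x) \<le> 2 ^ ?N * (1 + m ^ ?N) * norm (inv_fourier h x)"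
      by (intro mult_right_mono) auto
    also have "\<dots> = 2 ^ ?N * (\<bar>x $ i0\<bar> ^ 0 * norm (inv_fourier h x) + \<bar>x $ i0\<bar> ^ (2 * ?N) * norm (inv_fourier h x))"
    proof -
      have pm: "m ^ ?N = \<bar>x $ i0\<bar> ^ (2 * ?N)" by (simp only: i0 power_mult power2_abs)
      show ?thesis unfolding pm by (simp add: algebra_simps)
    qed
    also have "\<dots> \<le> 2 ^ ?N * (C 0 i0 + C (2 * ?N) i0)"
      using C[of x i0 0] C[of x i0 "2 * ?N"] by (intro mult_left_mono add_mono) simp_all
    also have "\<dots> \<le> K" unfolding K_def
      using C0 by (intro mult_left_mono member_le_sum[where f="\<lambda>i. C 0 i + C (2 * ?N) i"]) auto
    finally have le: "(\<Prod>i\<in>UNIV. 1 + (x $ i)\<^sup>2) * norm (inv_fourier h x) \<le> K" .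
    have pp: "(\<Prod>i\<in>UNIV. 1 + (x $ i)\<^sup>2) > 0" by (intro prod_pos) (auto intro: add_pos_nonneg)
    have "0 \<le> K" unfolding K_def using C0 by (intro mult_nonneg_nonneg sum_nonneg add_nonneg_nonneg) auto
    then show ?thesis using le pp by (simp add: norm_mult nw field_simps)
  qed
  show ?thesis
  proof (rule Bochner_Integration.integrable_bound[where f="\<lambda>x. K * w x"])
    show "integrable lborel (\<lambda>x. complex_of_real K * w x)" using w by simp
    show "AE x in lborel. norm (inv_fourier h x) \<le> norm (complex_of_real K * w x)" using bd by simp
  qed simp
qed

subsection \<open>Inverse powers of a dilation matrix\<close>

text \<open>A contraction by |l| with a forcing term tending to 0. Once the forcing is below (e/2)(1
  - |l|), the level e/2 is preserved, and what remains of the initial value decays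
  geometrically.\<close>

lemma tendsto_0_linear_recurrence:
  fixes x y :: "nat \<Rightarrow> complex"
  assumes x: "\<And>k. x (Suc k) = l * x k + y k" and l: "norm l < 1" and y: "y \<longlonglongrightarrow> 0"
  shows "x \<longlonglongrightarrow> 0"
proof (rule LIMSEQ_I)
  fix e :: real assume e: "e > 0"
  define q where "q = norm l"
  have q: "0 \<le> q" "q < 1" using l by (auto simp: q_def)
  obtain K where K: "\<And>k. k \<ge> K \<Longrightarrow> norm (y k) < e / 2 * (1 - q)"
    using LIMSEQ_D[OF y, of "e / 2 * (1 - q)"] e q by auto
  have bd: "norm (x (K + n)) \<le> e / 2 + q ^ n * norm (x K)" for n
  proof (induction n)
    case (Suc n)
    have "norm (x (K + Suc n)) \<le> q * norm (x (K + n)) + norm (y (K + n))"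
      using norm_triangle_ineq[of "l * x (K + n)" "y (K + n)"] by (simp add: x norm_mult q_def)
    also have "\<dots> \<le> q * (e / 2 + q ^ n * norm (x K)) + e / 2 * (1 - q)"
      using Suc q K[of "K + n"] by (intro add_mono mult_left_mono) auto
    also have "\<dots> = e / 2 + q ^ Suc n * norm (x K)" by (simp add: field_simps)
    finally show ?case .
  qed (use e in auto)
  have "(\<lambda>n. q ^ n * norm (x K)) \<longlonglongrightarrow> 0 * norm (x K)"
    using q by (intro tendsto_intros LIMSEQ_realpow_zero)
  then obtain N where N: "\<And>n. n \<ge> N \<Longrightarrow> \<bar>q ^ n * norm (x K)\<bar> < e / 2"
    using LIMSEQ_D[of "\<lambda>n. q ^ n * norm (x K)" 0 "e / 2"] e by auto
  show "\<exists>no. \<forall>n\<ge>no. norm (x n - 0) < e"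
  proof (intro exI[of _ "K + N"] allI impI)
    fix n assume n: "n \<ge> K + N"
    have "norm (x (K + (n - K))) \<le> e / 2 + q ^ (n - K) * norm (x K)" by (rule bd)
    also have "\<dots> < e"
    proof -
      have "\<bar>q ^ (n - K) * norm (x K)\<bar> < e / 2" using n by (intro N) linarith
      then show ?thesis by linarith
    qed
    finally show "norm (x n - 0) < e" using n by simp
  qed
qed

section \<open>Orbits of a linear map and annihilating polynomials\<close>

context
  fixes L :: "complex^'n \<Rightarrow> complex^'n"
  assumes L_add: "\<And>u v. L (u + v) = L u + L v" and L_scale: "\<And>c v. L (c *s v) = c *s L v"
begin

text \<open>This is p(L) v. The vector stays an argument, so a polynomial that annihilates one orbit
  is enough and no polynomial in matrices has to be formed.\<close>

definition poly_apply :: "complex poly \<Rightarrow> complex^'n \<Rightarrow> complex^'n" where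
  "poly_apply p v = (\<Sum>i\<le>degree p. coeff p i *s (L ^^ i) v)"

lemma L_zero: "L 0 = 0" using L_scale[of 0 0] by simp

lemma L_pow_add: "(L ^^ k) (u + v) = (L ^^ k) u + (L ^^ k) v"
  by (induction k) (auto simp: L_add)

lemma L_pow_scale: "(L ^^ k) (c *s v) = c *s (L ^^ k) v"
  by (induction k) (auto simp: L_scale)

lemma L_pow_diff: "(L ^^ k) (u - v) = (L ^^ k) u - (L ^^ k) v"
  using L_pow_add[of k "u - v" v] by (simp add: algebra_simps)

lemma poly_apply_eq: "degree p \<le> n \<Longrightarrow> poly_apply p v = (\<Sum>i\<le>n. coeff p i *s (L ^^ i) v)"
  unfolding poly_apply_def by (intro sum.mono_neutral_left) (auto simp: coeff_eq_0)

lemma L_sum: "L (sum f S) = (\<Sum>i\<in>S. L (f i))"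
  by (induction S rule: infinite_finite_induct) (auto simp: L_zero L_add)

lemma L_poly_apply: "L (poly_apply p v) = poly_apply p (L v)"
  unfolding poly_apply_def by (simp add: L_sum L_scale funpow_swap1)

lemma poly_apply_diff_arg: "poly_apply p (u - v) = poly_apply p u - poly_apply p v"
  unfolding poly_apply_def by (simp add: L_pow_diff vec.scale_right_diff_distrib sum_subtractf)

lemma poly_apply_scale_arg: "poly_apply p (c *s v) = c *s poly_apply p v"
  unfolding poly_apply_def
  by (simp add: L_pow_scale vec.scale_sum_right mult.commute)

text \<open>Moving a linear factor from the polynomial onto the vector is what drives the induction
  on the degree.\<close>

lemma poly_apply_linear_factor:
  "poly_apply ([:- l, 1:] * q) v = poly_apply q (L v - l *s v)"
proof -
  have d: "degree ([:- l, 1:] * q) \<le> Suc (degree q)"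
    using degree_mult_le[of "[:- l, 1:]" q] by simp
  have c: "coeff ([:- l, 1:] * q) i = coeff (pCons 0 q) i - l * coeff q i" for i by simp
  have "poly_apply ([:- l, 1:] * q) v = (\<Sum>i\<le>Suc (degree q). coeff (pCons 0 q) i *s (L ^^ i) v - l *s (coeff q i *s (L ^^ i) v))"
    unfolding poly_apply_eq[OF d] c by (simp add: vec.scale_left_diff_distrib)
  also have "\<dots> = (\<Sum>i\<le>Suc (degree q). coeff (pCons 0 q) i *s (L ^^ i) v) - l *s (\<Sum>i\<le>Suc (degree q). coeff q i *s (L ^^ i) v)"
    by (simp only: sum_subtractf vec.scale_sum_right)
  also have "(\<Sum>i\<le>Suc (degree q). coeff q i *s (L ^^ i) v) = poly_apply q v"
    by (rule poly_apply_eq[symmetric]) simp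
  also have "(\<Sum>i\<le>Suc (degree q). coeff (pCons 0 q) i *s (L ^^ i) v) = poly_apply q (L v)"
    unfolding sum.atMost_Suc_shift poly_apply_def by (simp add: funpow_swap1)
  finally show ?thesis by (simp add: poly_apply_diff_arg poly_apply_scale_arg)
qed

text \<open>Stands in for the Jordan form. Split a factor X - l off the annihilating polynomial. If
  l is an eigenvalue, then |l| < 1 and L^(k+1) v = l L^k v + L^k (L v - l v), where the last vector
  is annihilated by the quotient. If l is no eigenvalue, the quotient annihilates \<open>v\<close>
  already.\<close>

lemma powers_tendsto_0_if_annihilated:
  assumes eig: "\<And>l v. v \<noteq> 0 \<Longrightarrow> L v = l *s v \<Longrightarrow> norm l < 1"
  shows "p \<noteq> 0 \<Longrightarrow> poly_apply p v = 0 \<Longrightarrow> (\<lambda>k. (L ^^ k) v $ i) \<longlonglongrightarrow> 0"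
proof (induction "degree p" arbitrary: p v rule: less_induct)
  case less
  show ?case
  proof (cases "degree p = 0")
    case True
    then have "coeff p 0 *s v = 0" "coeff p 0 \<noteq> 0"
      using less.prems leading_coeff_neq_0[of p] by (auto simp: poly_apply_def)
    then have "v = 0" by (simp add: vec.scale_eq_0_iff)
    moreover have "(L ^^ k) 0 = 0" for k by (induction k) (auto simp: L_zero)
    ultimately show ?thesis by simp
  next
    case False
    then have "\<exists>l. poly p l = 0"
      by (intro fundamental_theorem_of_algebra_alt) (auto simp: degree_pCons_eq_if)
    then obtain l q where q: "p = [:- l, 1:] * q" by (auto simp: poly_eq_0_iff_dvd dvd_def)
    have q0: "q \<noteq> 0" using q less.prems by auto
    have dq: "degree q < degree p" unfolding q using q0 by (subst degree_mult_eq) auto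
    have a: "poly_apply q (L v - l *s v) = 0" using less.prems(2) unfolding q poly_apply_linear_factor .
    show ?thesis
    proof (cases "\<exists>u. u \<noteq> 0 \<and> L u = l *s u")
      case True
      then have l: "norm l < 1" using eig by blast
      have y: "(\<lambda>k. (L ^^ k) (L v - l *s v) $ i) \<longlonglongrightarrow> 0" by (rule less.hyps[OF dq q0 a])
      show ?thesis
      proof (rule tendsto_0_linear_recurrence[OF _ l y])
        show "(L ^^ Suc k) v $ i = l * (L ^^ k) v $ i + (L ^^ k) (L v - l *s v) $ i" for k
          by (simp add: L_pow_diff L_pow_scale funpow_swap1)
      qed
    next
      case False
      have "L (poly_apply q v) = l *s poly_apply q v"
        using a by (simp add: poly_apply_diff_arg poly_apply_scale_arg L_poly_apply)
      then have "poly_apply q v = 0" using False by blast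
      then show ?thesis by (rule less.hyps[OF dq q0])
    qed
  qed
qed

text \<open>More iterates than dimensions. Dependence is a property of sets of vectors, so two
  coinciding iterates form a separate case, settled by the difference of two monomials.\<close>

lemma ex_annihilating_poly: "\<exists>p. p \<noteq> 0 \<and> poly_apply p v = 0"
proof -
  let ?n = "CARD('n)" let ?f = "\<lambda>i. (L ^^ i) v"
  have "\<exists>c :: nat \<Rightarrow> complex. (\<exists>i\<le>?n. c i \<noteq> 0) \<and> (\<Sum>i\<le>?n. c i *s ?f i) = 0"
  proof (cases "inj_on ?f {..?n}")
    case True
    have "card (?f ` {..?n}) = Suc ?n" using card_image[OF True] by simp
    then have "vec.dependent (?f ` {..?n})"
      using vec.independent_card_le_dim[of "?f ` {..?n}" UNIV] vec_dim_card[where 'a=complex and 'n='n] by auto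
    then obtain u where u: "\<exists>w\<in>?f ` {..?n}. u w \<noteq> 0" "(\<Sum>w\<in>?f ` {..?n}. u w *s w) = 0"
      by (subst (asm) vec.dependent_finite) auto
    show ?thesis
    proof (intro exI[of _ "\<lambda>i. u (?f i)"] conjI)
      show "\<exists>i\<le>?n. u (?f i) \<noteq> 0" using u(1) by auto
      show "(\<Sum>i\<le>?n. u (?f i) *s ?f i) = 0" using u(2) by (subst (asm) sum.reindex[OF True]) (simp add: o_def)
    qed
  next
    case False
    then obtain i j where ij: "i \<le> ?n" "j \<le> ?n" "i \<noteq> j" "?f i = ?f j" by (auto simp: inj_on_def)
    show ?thesis
    proof (intro exI[of _ "\<lambda>k. (if k = i then 1 else 0) - (if k = j then 1 else 0)"] conjI)
      show "\<exists>k\<le>?n. (if k = i then 1 else 0) - (if k = j then 1 else 0) \<noteq> (0::complex)"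
        using ij by (intro exI[of _ i]) auto
      show "(\<Sum>k\<le>?n. ((if k = i then 1 else 0) - (if k = j then 1 else 0)) *s ?f k) = 0"
        using ij by (simp add: vec.scale_left_diff_distrib sum_subtractf if_distrib[of "\<lambda>c. c *s _"] cong: if_cong)
    qed
  qed
  then obtain c :: "nat \<Rightarrow> complex" where c: "\<exists>i\<le>?n. c i \<noteq> 0" "(\<Sum>i\<le>?n. c i *s ?f i) = 0" by blast
  define p where "p = (\<Sum>i\<le>?n. monom (c i) i)"
  have co: "coeff p i = (if i \<le> ?n then c i else 0)" for i
    unfolding p_def by (simp add: coeff_sum)
  have "p \<noteq> 0" using c(1) co by (metis coeff_0)
  moreover have "degree p \<le> ?n" using co by (intro degree_le) auto
  then have "poly_apply p v = 0" using c(2) by (subst poly_apply_eq) (auto simp: co cong: sum.cong_simp)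
  ultimately show ?thesis by blast
qed

lemma powers_tendsto_0:
  assumes "\<And>l v. v \<noteq> 0 \<Longrightarrow> L v = l *s v \<Longrightarrow> norm l < 1"
  shows "(\<lambda>k. (L ^^ k) v $ i) \<longlonglongrightarrow> 0"
proof -
  obtain p where p: "p \<noteq> 0" "poly_apply p v = 0" using ex_annihilating_poly by blast
  show ?thesis by (rule powers_tendsto_0_if_annihilated[OF _ p]) (rule assms)
qed

end

section \<open>Matrix powers and the contraction by the inverse dilation\<close>

lemma mat_power_add: "mat_power A (m + n) = mat_power A m ** mat_power A n"
  by (induction m) (auto simp: matrix_mul_assoc)

lemma mat_power_commute: "mat_power A m ** mat_power A n = mat_power A n ** mat_power A m"
  by (metis mat_power_add add.commute)

lemma det_mat_power: "det (mat_power A n) = det A ^ n"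
  by (induction n) (auto simp: det_mul)

lemma matrix_inv_unique:
  fixes A B :: "real^'n^'n"
  assumes "A ** B = mat 1"
  shows "matrix_inv A = B" "det A \<noteq> 0"
proof -
  have "det A * det B = 1" using assms by (metis det_I det_mul)
  then show A: "det A \<noteq> 0" by auto
  have "matrix_inv A ** (A ** B) = B" using matrix_inv_mult(2)[OF A] by (simp add: matrix_mul_assoc)
  then show "matrix_inv A = B" by (simp add: assms)
qed

lemma matrix_inv_mat_power:
  fixes A :: "real^'n^'n"
  assumes A: "det A \<noteq> 0"
  shows "matrix_inv (mat_power A k) = mat_power (matrix_inv A) k"
proof (rule matrix_inv_unique)
  show "mat_power A k ** mat_power (matrix_inv A) k = mat 1"
  proof (induction k)
    case (Suc k)
    have "mat_power A (Suc k) ** mat_power (matrix_inv A) (Suc k) = A ** (mat_power A k ** mat_power (matrix_inv A) k) ** matrix_inv A"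
      using mat_power_commute[of "matrix_inv A" 1 k] by (simp add: matrix_mul_assoc)
    then show ?case using Suc matrix_inv_mult(1)[OF A] by simp
  qed simp
qed

definition cmat :: "real^'n^'m \<Rightarrow> complex^'n^'m" where
  "cmat A = (\<chi> i j. complex_of_real (A $ i $ j))"

lemma cmat_mult: "cmat (A ** B) = cmat A ** cmat B"
  by (simp add: cmat_def matrix_matrix_mult_def vec_eq_iff)

lemma cmat_1: "cmat (mat 1) = mat 1"
  by (simp add: cmat_def mat_def vec_eq_iff)

lemma cmat_power: "cmat (mat_power A k) *v v = ((\<lambda>v. cmat A *v v) ^^ k) v"
  by (induction k) (auto simp: cmat_1 cmat_mult matrix_vector_mul_assoc[symmetric])

lemma dilation_det_nz:
  fixes M :: "real^'n^'n"
  assumes "dilation_matrix M"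
  shows "det M \<noteq> 0"
proof
  assume "det M = 0"
  then obtain x :: "real^'n" where x: "x \<noteq> 0" "M *v x = 0"
    using invertible_det_nz[of M] matrix_left_invertible_ker[of M] invertible_left_inverse[of M] by metis
  define v where "v = (\<chi> i. complex_of_real (x $ i))"
  have "v \<noteq> 0" using x(1) by (auto simp: v_def vec_eq_iff)
  moreover have "(\<chi> i j. complex_of_real (M $ i $ j)) *v v = 0 *s v"
  proof -
    have "(\<Sum>j\<in>UNIV. M $ i $ j * x $ j) = 0" for i
      using x(2) by (simp add: matrix_vector_mult_def vec_eq_iff)
    then have "(\<Sum>j\<in>UNIV. complex_of_real (M $ i $ j) * complex_of_real (x $ j)) = 0" for i
      by (metis (mono_tags, lifting) of_real_0 of_real_mult of_real_sum sum.cong)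
    then show ?thesis by (simp add: v_def matrix_vector_mult_def vec_eq_iff)
  qed
  ultimately have "complex_eigenvalue M 0" unfolding complex_eigenvalue_def by blast
  then show False using assms by (force simp: dilation_matrix_def)
qed

text \<open>An eigenvalue of the inverse is the reciprocal of one of \<open>M\<close>, so the
  spectral condition carries over to orbits of the inverse; the entries are read off from the orbits
  of the unit vectors.\<close>

theorem dilation_inverse_powers_tendsto_0:
  fixes M :: "real^'n^'n"
  assumes M: "dilation_matrix M"
  shows "(\<lambda>k. matrix_inv (mat_power M k) $ i $ j) \<longlonglongrightarrow> 0"
proof -
  note d = dilation_det_nz[OF M]
  define B where "B = matrix_inv M"
  have MB: "cmat M ** cmat B = mat 1"
    using matrix_inv_mult(1)[OF d] by (simp add: B_def cmat_1 flip: cmat_mult)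
  have "(\<lambda>k. ((\<lambda>v. cmat B *v v) ^^ k) (axis j 1) $ i) \<longlonglongrightarrow> 0"
  proof (rule powers_tendsto_0)
    show "cmat B *v (u + v) = cmat B *v u + cmat B *v v" for u v by (rule matrix_vector_right_distrib)
    show "cmat B *v (c *s v) = c *s (cmat B *v v)" for c v by (simp add: vec.scale)
    fix l :: complex and v :: "complex^'n"
    assume v: "v \<noteq> 0" "cmat B *v v = l *s v"
    have "v = cmat M *v (cmat B *v v)" by (simp add: matrix_vector_mul_assoc MB)
    also have "\<dots> = l *s (cmat M *v v)" by (simp add: v(2) vec.scale)
    finally have eq: "l *s (cmat M *v v) = v" by simp
    then have l: "l \<noteq> 0" using v(1) by auto
    have "cmat M *v v = inverse l *s (l *s (cmat M *v v))" using l by simp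
    then have "cmat M *v v = inverse l *s v" by (simp only: eq)
    then have "complex_eigenvalue M (inverse l)" unfolding complex_eigenvalue_def cmat_def using v(1) by blast
    then have "norm (inverse l) > 1" using M by (auto simp: dilation_matrix_def)
    then show "norm l < 1" using l by (simp add: norm_divide norm_inverse field_simps)
  qed
  then have "(\<lambda>k. (cmat (mat_power B k) *v axis j 1) $ i) \<longlonglongrightarrow> 0"
    by (simp add: cmat_power)
  then have "(\<lambda>k. complex_of_real (mat_power B k $ i $ j)) \<longlonglongrightarrow> 0"
    by (simp add: matrix_vector_mult_def axis_def if_distrib cmat_def cong: if_cong)
  then show ?thesis unfolding matrix_inv_mat_power[OF d] B_def[symmetric]
    using tendsto_Re by fastforce
qed

lemma unit_cube_scaled_iff: "r > 0 \<Longrightarrow> x \<in> (\<lambda>y. r *\<^sub>R y) ` unit_cube \<longleftrightarrow> (\<forall>i. \<bar>x $ i\<bar> \<le> r / 2)"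
proof (safe)
  fix y :: "real^'n" and i assume "r > 0" "y \<in> unit_cube"
  then show "\<bar>(r *\<^sub>R y) $ i\<bar> \<le> r / 2" by (auto simp: unit_cube_def abs_mult intro: mult_left_mono[of _ "1/2", simplified])
next
  assume "r > 0" "\<forall>i. \<bar>x $ i\<bar> \<le> r / 2"
  then show "x \<in> (\<lambda>y. r *\<^sub>R y) ` unit_cube"
    by (intro image_eqI[of _ _ "(1 / r) *\<^sub>R x"]) (auto simp: unit_cube_def abs_mult field_simps)
qed

text \<open>Row sums of the transposed inverse power bound its action on the cube, and they tend to
  0 together with the entries. The radius \<delta> is free because near-best sequences may be taken
  in shrunken spectral cubes.\<close>

lemma dilation_unit_cube:
  fixes M :: "real^'n^'n"
  assumes M: "dilation_matrix M" and \<delta>: "\<delta> > 0"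
  obtains N where "\<And>k x. k \<ge> N \<Longrightarrow> x \<in> unit_cube \<Longrightarrow>
     transpose (matrix_inv (mat_power M k)) *v x \<in> (\<lambda>y. \<delta> *\<^sub>R y) ` unit_cube"
proof -
  let ?a = "\<lambda>k i j. matrix_inv (mat_power M k) $ i $ j"
  have "(\<lambda>k. \<Sum>i\<in>UNIV. \<Sum>j\<in>UNIV. \<bar>?a k i j\<bar>) \<longlonglongrightarrow> (\<Sum>i\<in>(UNIV::'n set). \<Sum>j\<in>(UNIV::'n set). \<bar>0\<bar>)"
    by (intro tendsto_sum tendsto_rabs dilation_inverse_powers_tendsto_0[OF M])
  then have "(\<lambda>k. \<Sum>i\<in>UNIV. \<Sum>j\<in>UNIV. \<bar>?a k i j\<bar>) \<longlonglongrightarrow> 0" by simp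
  then obtain N where N: "\<And>k. k \<ge> N \<Longrightarrow> (\<Sum>i\<in>UNIV. \<Sum>j\<in>UNIV. \<bar>?a k i j\<bar>) < \<delta>"
    using LIMSEQ_D[of _ 0 \<delta>] \<delta> by (metis abs_less_iff diff_zero real_norm_def)
  show thesis
  proof (rule that)
    fix k and x :: "real^'n" assume k: "k \<ge> N" and x: "x \<in> unit_cube"
    show "transpose (matrix_inv (mat_power M k)) *v x \<in> (\<lambda>y. \<delta> *\<^sub>R y) ` unit_cube"
      unfolding unit_cube_scaled_iff[OF \<delta>]
    proof
      fix i
      have "(transpose (matrix_inv (mat_power M k)) *v x) $ i = (\<Sum>j\<in>UNIV. ?a k j i * x $ j)"
        by (simp add: vector_matrix_mult_def mult.commute)
      also have "\<bar>\<dots>\<bar> \<le> (\<Sum>j\<in>UNIV. \<bar>?a k j i\<bar> * (1 / 2))"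
      proof (rule order_trans[OF sum_abs], rule sum_mono)
        fix j
        have "\<bar>x $ j\<bar> \<le> 1 / 2" using x by (simp add: unit_cube_def)
        then show "\<bar>?a k j i * x $ j\<bar> \<le> \<bar>?a k j i\<bar> * (1 / 2)"
          unfolding abs_mult by (rule mult_left_mono) simp
      qed
      also have "\<dots> = (\<Sum>j\<in>UNIV. \<bar>?a k j i\<bar>) / 2" by (simp add: sum_divide_distrib)
      also have "(\<Sum>j\<in>UNIV. \<bar>?a k j i\<bar>) \<le> (\<Sum>j\<in>UNIV. \<Sum>i\<in>UNIV. \<bar>?a k j i\<bar>)"
        by (intro sum_mono member_le_sum) auto
      finally show "\<bar>(transpose (matrix_inv (mat_power M k)) *v x) $ i\<bar> \<le> \<delta> / 2"
        using N[OF k] by linarith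
    qed
  qed
qed

subsection \<open>Uniqueness of Fourier coefficients on the torus\<close>

lemma lattice_vec_add: "lattice_vec (k + l) = lattice_vec k + lattice_vec l"
  by (simp add: lattice_vec_def vec_eq_iff)

lemma lattice_vec_uminus: "lattice_vec (- k) = - lattice_vec k"
  by (simp add: lattice_vec_def vec_eq_iff)

lemma lattice_vec_0 [simp]: "lattice_vec 0 = 0"
  by (simp add: lattice_vec_def vec_eq_iff)

section \<open>Density of trigonometric polynomials\<close>

inductive trig_poly :: "(real^'n \<Rightarrow> complex) \<Rightarrow> bool" where
  char: "trig_poly (\<lambda>x. c * cis (2 * pi * (lattice_vec k \<bullet> x)))"
| add: "trig_poly f \<Longrightarrow> trig_poly g \<Longrightarrow> trig_poly (\<lambda>x. f x + g x)"

lemma trig_poly_const: "trig_poly (\<lambda>x. c)"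
  using trig_poly.char[of c 0] by simp

lemma trig_poly_mult: "trig_poly f \<Longrightarrow> trig_poly g \<Longrightarrow> trig_poly (\<lambda>x. f x * g x)"
proof (induction f rule: trig_poly.induct)
  case (char c k)
  then show ?case
  proof (induction g rule: trig_poly.induct)
    case (char d l)
    have "(\<lambda>x. c * cis (2 * pi * (lattice_vec k \<bullet> x)) * (d * cis (2 * pi * (lattice_vec l \<bullet> x)))) =
      (\<lambda>x. (c * d) * cis (2 * pi * (lattice_vec (k + l) \<bullet> x)))"
      by (simp add: lattice_vec_add inner_add_left distrib_left cis_mult[symmetric] mult_ac)
    then show ?case using trig_poly.char by metis
  qed (auto simp: distrib_left intro: trig_poly.add)
qed (auto simp: distrib_right intro: trig_poly.add)

lemma trig_poly_sum: "(\<And>i. i \<in> I \<Longrightarrow> trig_poly (f i)) \<Longrightarrow> trig_poly (\<lambda>x. \<Sum>i\<in>I. f i x)"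
  by (induction I rule: infinite_finite_induct) (auto intro: trig_poly.add trig_poly_const)

text \<open>The torus embedded as a product of circles, cosines in one component and sines in the
  other. Two points have the same image exactly when they differ by a lattice vector, and
  polynomials in the image coordinates pull back to trigonometric polynomials.\<close>

definition circle_map :: "real^'n \<Rightarrow> (real^'n) \<times> (real^'n)" where
  "circle_map x = (\<chi> i. cos (2 * pi * x $ i), \<chi> i. sin (2 * pi * x $ i))"

lemma continuous_on_circle_map: "continuous_on S circle_map"
  unfolding circle_map_def by (intro continuous_intros)

lemma lattice_vec_axis: "lattice_vec (axis i 1) \<bullet> x = x $ i" "lattice_vec (- axis i 1) \<bullet> x = - x $ i"
proof -
  have "lattice_vec (axis i 1) = axis i 1" by (auto simp: lattice_vec_def axis_def vec_eq_iff)
  then show "lattice_vec (axis i 1) \<bullet> x = x $ i" "lattice_vec (- axis i 1) \<bullet> x = - x $ i"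
    by (simp_all add: inner_axis' lattice_vec_uminus)
qed

lemma trig_poly_cos_sin:
  "trig_poly (\<lambda>x. complex_of_real (cos (2 * pi * x $ i)))"
  "trig_poly (\<lambda>x. complex_of_real (sin (2 * pi * x $ i)))"
proof -
  have "(\<lambda>x. complex_of_real (cos (2 * pi * x $ i))) = (\<lambda>x. (1/2) * cis (2 * pi * (lattice_vec (axis i 1) \<bullet> x)) + (1/2) * cis (2 * pi * (lattice_vec (- axis i 1) \<bullet> x)))"
    by (auto simp: fun_eq_iff lattice_vec_axis complex_eq_iff)
  then show "trig_poly (\<lambda>x. complex_of_real (cos (2 * pi * x $ i)))"
    by (simp only:) (intro trig_poly.intros)
  have "(\<lambda>x. complex_of_real (sin (2 * pi * x $ i))) = (\<lambda>x. (-\<i>/2) * cis (2 * pi * (lattice_vec (axis i 1) \<bullet> x)) + (\<i>/2) * cis (2 * pi * (lattice_vec (- axis i 1) \<bullet> x)))"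
    by (auto simp: fun_eq_iff lattice_vec_axis complex_eq_iff)
  then show "trig_poly (\<lambda>x. complex_of_real (sin (2 * pi * x $ i)))"
    by (simp only:) (intro trig_poly.intros)
qed

lemma trig_poly_real_polynomial:
  fixes g :: "(real^'n) \<times> (real^'n) \<Rightarrow> real"
  assumes "real_polynomial_function g"
  shows "trig_poly (\<lambda>x. complex_of_real (g (circle_map x)))"
  using assms
proof (induction g rule: real_polynomial_function.induct)
  case (linear h)
  interpret h: bounded_linear h by fact
  have hs: "h (u, v) = (\<Sum>i\<in>UNIV. u $ i * h (axis i 1, 0) + v $ i * h (0, axis i 1))" for u v
  proof -
    have "(u, v) = (\<Sum>i\<in>UNIV. (u $ i) *\<^sub>R (axis i 1, 0) + (v $ i) *\<^sub>R (0, axis i 1))"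
      by (simp add: prod_eq_iff sum.distrib fst_sum snd_sum scaleR_prod_def vec_eq_iff axis_def if_distrib cong: if_cong)
    then have "h (u, v) = h (\<Sum>i\<in>UNIV. (u $ i) *\<^sub>R (axis i 1, 0) + (v $ i) *\<^sub>R (0, axis i 1))" by simp
    then show ?thesis by (simp only: h.sum h.add h.scaleR real_scaleR_def)
  qed
  have "(\<lambda>x. complex_of_real (h (circle_map x))) =
    (\<lambda>x. \<Sum>i\<in>UNIV. complex_of_real (cos (2 * pi * x $ i)) * complex_of_real (h (axis i 1, 0)) + complex_of_real (sin (2 * pi * x $ i)) * complex_of_real (h (0, axis i 1)))"
    unfolding circle_map_def
    by (subst hs) simp
  then show ?case
    by (simp only:) (intro trig_poly_sum trig_poly.add trig_poly_mult trig_poly_cos_sin trig_poly_const)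
qed (auto intro: trig_poly_const trig_poly.add trig_poly_mult)

text \<open>Half open, so that the integer translates tile the space exactly once; translates of the
  closed \<open>unit_cube\<close> would overlap in faces.\<close>

definition half_cube :: "(real^'n) set" where
  "half_cube = {x. \<forall>i. - (1/2) \<le> x $ i \<and> x $ i < 1/2}"

lemma half_cube_borel [measurable]: "half_cube \<in> sets borel"
proof -
  have "half_cube = (\<Inter>i. {x::real^'n. - (1/2) \<le> x $ i} \<inter> {x. x $ i < 1/2})" by (auto simp: half_cube_def)
  also have "\<dots> \<in> sets borel"
    by (intro sets.countable_INT'' sets.Int borel_closed borel_open closed_Collect_le open_Collect_less continuous_intros) auto
  finally show ?thesis .
qed

lemma half_cube_bounded: "bounded (half_cube :: (real^'n) set)"
proof -
  have "half_cube \<subseteq> cbox (\<chi> i. - (1/2)) (\<chi> i. 1/2)" by (auto simp: half_cube_def mem_box_cart less_imp_le)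
  then show ?thesis using bounded_cbox bounded_subset by blast
qed

lemma half_cube_decompose:
  fixes x :: "real^'n"
  obtains y k where "y \<in> half_cube" "x = y + lattice_vec k"
proof -
  define k :: "int^'n" where "k = (\<chi> i. \<lfloor>x $ i + 1/2\<rfloor>)"
  have "- (1/2) \<le> x $ i - real_of_int \<lfloor>x $ i + 1/2\<rfloor> \<and> x $ i - real_of_int \<lfloor>x $ i + 1/2\<rfloor> < 1/2" for i
    using floor_correct[of "x $ i + 1/2"] by linarith
  then have "x - lattice_vec k \<in> half_cube" by (simp add: half_cube_def k_def lattice_vec_def)
  then show thesis by (rule that[of _ k]) simp
qed

lemma integrable_half_cube:
  fixes f :: "real^'n \<Rightarrow> complex"
  assumes "continuous_on UNIV f"
  shows "integrable lborel (\<lambda>x. indicator half_cube x * f x)"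
proof -
  let ?K = "cbox (\<chi> i. - (1/2)) (\<chi> i. 1/2) :: (real^'n) set"
  have "integrable lborel (\<lambda>x. indicator ?K x *\<^sub>R f x)"
    using assms by (intro borel_integrable_compact) (auto intro: continuous_on_subset)
  then have "integrable lborel (\<lambda>x. (indicator ?K x *\<^sub>R f x) * indicator half_cube x)"
    by (rule integrable_bounded_mult[where B=1]) (auto simp: indicator_def)
  moreover have "(indicator ?K x *\<^sub>R f x) * indicator half_cube x = indicator half_cube x * f x" for x
    by (auto simp: indicator_def half_cube_def mem_box_cart less_imp_le)
  ultimately show ?thesis by simp
qed

lemma trig_poly_continuous: "trig_poly f \<Longrightarrow> continuous_on UNIV f"
  by (induction rule: trig_poly.induct) (auto intro!: continuous_intros)

lemma circle_map_eqD:
  assumes "circle_map x = circle_map y"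
  obtains k where "x = y + lattice_vec k"
proof -
  have "\<exists>n::int. x $ i = y $ i + real_of_int n" for i
  proof -
    have "sin (2 * pi * x $ i) = sin (2 * pi * y $ i) \<and> cos (2 * pi * x $ i) = cos (2 * pi * y $ i)"
      using assms by (auto simp: circle_map_def vec_eq_iff)
    then obtain n :: int where "2 * pi * x $ i = 2 * pi * y $ i + 2 * pi * real_of_int n"
      by (auto simp: sin_cos_eq_iff)
    then have "2 * pi * x $ i = 2 * pi * (y $ i + real_of_int n)" by (simp add: distrib_left)
    then show ?thesis by auto
  qed
  then obtain n where n: "\<And>i. x $ i = y $ i + real_of_int (n i)" by metis
  show thesis by (rule that[of "\<chi> i. n i"]) (simp add: vec_eq_iff lattice_vec_def n)
qed

text \<open>A periodic \<open>P\<close> factors through the compact image of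
  \<open>circle_map\<close>; the factor is continuous because preimages of closed sets are images of
  compact sets. Stone-Weierstrass on that image then supplies the approximation.\<close>

lemma periodic_trig_approx_real:
  fixes P :: "real^'n \<Rightarrow> real"
  assumes c: "continuous_on UNIV P" and per: "\<And>x k. P (x + lattice_vec k) = P x" and e: "e > 0"
  obtains T where "trig_poly T" "\<And>x. norm (complex_of_real (P x) - T x) < e"
proof -
  let ?K = "cbox (\<chi> i. - (1/2)) (\<chi> i. 1/2) :: (real^'n) set"
  define S where "S = circle_map ` ?K"
  have S: "compact S" unfolding S_def by (intro compact_continuous_image continuous_on_circle_map) auto
  define f where "f = (\<lambda>y. P (SOME x. circle_map x = y))"
  have f: "f (circle_map x) = P x" for x
  proof -
    have "circle_map (SOME z. circle_map z = circle_map x) = circle_map x" by (rule someI) simp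
    from circle_map_eqD[OF this] obtain k where "(SOME z. circle_map z = circle_map x) = x + lattice_vec k" .
    then show ?thesis unfolding f_def by (simp add: per)
  qed
  have "continuous_on S f"
  proof (subst continuous_on_closed_vimage[OF compact_imp_closed[OF S]], intro allI impI)
    fix B :: "real set" assume B: "closed B"
    have "f -` B \<inter> S = circle_map ` (?K \<inter> P -` B)" unfolding S_def by (auto simp: f)
    moreover have "closed (P -` B)" using c B by (simp add: continuous_on_closed_vimage)
    then have "compact (circle_map ` (?K \<inter> P -` B))"
      by (intro compact_continuous_image continuous_on_circle_map compact_Int_closed) auto
    ultimately show "closed (f -` B \<inter> S)" by (simp add: compact_imp_closed)
  qed
  then obtain g where g: "real_polynomial_function g" "\<And>y. y \<in> S \<Longrightarrow> \<bar>f y - g y\<bar> < e"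
    using Stone_Weierstrass_real_polynomial_function[OF S _ e] by blast
  show thesis
  proof (rule that[OF trig_poly_real_polynomial[OF g(1)]])
    fix x :: "real^'n"
    obtain y k where y: "y \<in> half_cube" "x = y + lattice_vec k" by (rule half_cube_decompose)
    have cm: "circle_map x = circle_map y"
    proof -
      have "cos (2 * pi * (y $ i + real_of_int (k $ i))) = cos (2 * pi * y $ i)"
        "sin (2 * pi * (y $ i + real_of_int (k $ i))) = sin (2 * pi * y $ i)" for i
        using sin_cos_eq_iff[of "2 * pi * (y $ i + real_of_int (k $ i))" "2 * pi * y $ i"] by (auto simp: distrib_left)
      then show ?thesis by (simp add: circle_map_def y(2) lattice_vec_def vec_eq_iff)
    qed
    have "y \<in> ?K" using y(1) by (auto simp: half_cube_def mem_box_cart less_imp_le)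
    then have "circle_map y \<in> S" by (auto simp: S_def)
    from g(2)[OF this] have "\<bar>P x - g (circle_map x)\<bar> < e" unfolding cm f by (simp add: y(2) per)
    then show "norm (complex_of_real (P x) - complex_of_real (g (circle_map x))) < e"
      by (simp flip: of_real_diff)
  qed
qed

section \<open>Orthogonality of the characters\<close>

lemma integral_character_interval:
  fixes m :: int
  shows "integrable lborel (\<lambda>t::real. indicator {- (1/2)..<1/2} t * cis (2 * pi * real_of_int m * t))"
    and "m \<noteq> 0 \<Longrightarrow> (\<integral>t. indicator {- (1/2)..<1/2} t * cis (2 * pi * real_of_int m * t) \<partial>lborel) = 0"
proof -
  let ?c = "\<lambda>t::real. cis (2 * pi * real_of_int m * t)"
  have ae: "AE t in lborel. indicator {- (1/2)..1/2} t *\<^sub>R ?c t = indicator {- (1/2)..<1/2} t * ?c t"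
    using AE_lborel_singleton[of "1/2::real"] by eventually_elim (auto simp: indicator_def)
  have cc: "continuous_on S ?c" for S by (intro continuous_intros)
  have m: "(\<lambda>t. indicator {- (1/2)..<1/2} t * ?c t) \<in> borel_measurable lborel"
    "(\<lambda>t. indicator {- (1/2)..1/2} t *\<^sub>R ?c t) \<in> borel_measurable lborel"
    using borel_measurable_continuous_onI[OF cc] by auto
  have "integrable lborel (\<lambda>t. indicator {- (1/2)..1/2} t *\<^sub>R ?c t)"
    by (intro borel_integrable_compact cc) auto
  then show "integrable lborel (\<lambda>t. indicator {- (1/2)..<1/2} t * ?c t)"
    using integrable_cong_AE[OF m(2) m(1) ae] by simp
  assume m0: "m \<noteq> 0"
  define a where "a = 2 * pi * real_of_int m"
  have a0: "a \<noteq> 0" using m0 by (simp add: a_def)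
  define F where "F = (\<lambda>t. cis (a * t) / (\<i> * complex_of_real a))"
  have "(F has_vector_derivative cis (a * t)) (at t within {- (1/2)..1/2})" for t
  proof -
    have "((\<lambda>z. exp (\<i> * complex_of_real a * z) / (\<i> * complex_of_real a)) has_field_derivative exp (\<i> * complex_of_real a * complex_of_real t)) (at (complex_of_real t))"
      using a0 by (auto intro!: derivative_eq_intros)
    from has_vector_derivative_real_field[OF this] show ?thesis
      by (simp add: F_def cis_conv_exp mult.assoc has_vector_derivative_at_within)
  qed
  then have "has_bochner_integral lborel (\<lambda>t. indicator {- (1/2)..1/2} t *\<^sub>R cis (a * t)) (F (1/2) - F (- (1/2)))"
    by (intro has_bochner_integral_FTC_Icc) (auto intro!: continuous_intros)
  moreover have "F (1/2) = F (- (1/2))"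
  proof -
    have "cis (a * (1/2)) = cis (a * (- (1/2)) + 2 * pi * real_of_int m)" by (simp add: a_def)
    also have "\<dots> = cis (a * (- (1/2)))" unfolding cis_mult[symmetric] by (subst cis_multiple_2pi) auto
    finally show ?thesis by (simp add: F_def)
  qed
  ultimately have "(\<integral>t. indicator {- (1/2)..1/2} t *\<^sub>R ?c t \<partial>lborel) = 0"
    by (simp add: has_bochner_integral_iff a_def)
  then show "(\<integral>t. indicator {- (1/2)..<1/2} t * ?c t \<partial>lborel) = 0"
    using integral_cong_AE[OF m(2) m(1) ae] by simp
qed

lemma integral_character_half_cube:
  fixes k :: "int^'n"
  assumes k: "k \<noteq> 0"
  shows "(\<integral>x. indicator half_cube x * cis (2 * pi * (lattice_vec k \<bullet> x)) \<partial>lborel) = 0"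
proof -
  have B: "(Basis :: (real^'n) set) = (\<lambda>i. axis i 1) ` UNIV" by (auto simp: Basis_vec_def)
  have in_Ints: "\<exists>m::int. lattice_vec k \<bullet> b = real_of_int m" if "b \<in> Basis" for b
    using that by (auto simp: B inner_axis lattice_vec_def)
  define h where "h = (\<lambda>b t. indicator {- (1/2)..<1/2::real} t * cis (2 * pi * (lattice_vec k \<bullet> b) * t))"
  have hi: "integrable lborel (h b)" if "b \<in> Basis" for b
    using in_Ints[OF that] integral_character_interval(1) by (auto simp: h_def)
  have "indicator half_cube x * cis (2 * pi * (lattice_vec k \<bullet> x)) = (\<Prod>b\<in>Basis. h b (x \<bullet> b))" for x
  proof -
    have "(\<Prod>b\<in>Basis. indicator {- (1/2)..<1/2} (x \<bullet> b)) = (indicator half_cube x :: complex)"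
    proof (cases "x \<in> half_cube")
      case True
      then show ?thesis by (auto simp: half_cube_def B inner_axis intro!: prod.neutral)
    next
      case False
      then obtain i where "x \<bullet> axis i 1 \<notin> {- (1/2)..<1/2}" by (auto simp: half_cube_def inner_axis)
      then have "indicator {- (1/2)..<1/2} (x \<bullet> axis i 1) = (0::complex)" by (auto simp: indicator_def)
      moreover have "axis i 1 \<in> (Basis :: (real^'n) set)" by (simp add: B)
      ultimately show ?thesis using False by (intro trans[OF prod_zero]) auto
    qed
    moreover have "cis (2 * pi * (lattice_vec k \<bullet> x)) = (\<Prod>b\<in>Basis. cis (2 * pi * (lattice_vec k \<bullet> b) * (x \<bullet> b)))"
      by (subst euclidean_inner) (simp add: cis_sum sum_distrib_left mult.assoc)
    ultimately show ?thesis by (simp add: h_def prod.distrib)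
  qed
  then have "(\<integral>x. indicator half_cube x * cis (2 * pi * (lattice_vec k \<bullet> x)) \<partial>lborel) = (\<Prod>b\<in>Basis. \<integral>t. h b t \<partial>lborel)"
    by (simp add: lborel_prod_integral(1)[OF hi])
  also have "\<dots> = 0"
  proof -
    obtain i where i: "k $ i \<noteq> 0" using k by (auto simp: vec_eq_iff)
    have "(\<integral>t. h (axis i 1) t \<partial>lborel) = 0"
      using integral_character_interval(2)[OF i] by (simp add: h_def inner_axis lattice_vec_def)
    moreover have "axis i 1 \<in> (Basis :: (real^'n) set)" by (simp add: B)
    ultimately show ?thesis by (intro prod_zero) auto
  qed
  finally show ?thesis .
qed

text \<open>Subtracting the mean makes \<open>Q\<close> orthogonal to every character, the trivial
  one included. Replacing conj Q by a uniformly close trigonometric polynomial shows that the square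
  integral of \<open>Q\<close> over the cube is below any e, hence 0, and continuity makes
  \<open>Q\<close> vanish.\<close>

theorem periodic_const:
  fixes P :: "real^'n \<Rightarrow> complex"
  assumes c: "continuous_on UNIV P" and per: "\<And>x k. P (x + lattice_vec k) = P x"
    and z: "\<And>k. k \<noteq> 0 \<Longrightarrow> (\<integral>x. indicator half_cube x * (P x * cis (2 * pi * (lattice_vec k \<bullet> x))) \<partial>lborel) = 0"
  shows "P x = (\<integral>x. indicator half_cube x * P x \<partial>lborel)"
proof -
  define a where "a = (\<integral>x. indicator half_cube x * P x \<partial>lborel)"
  define Q where "Q = (\<lambda>x. P x - a)"
  have Qc: "continuous_on UNIV Q" unfolding Q_def using c by (intro continuous_intros)
  have Qper: "Q (x + lattice_vec k) = Q x" for x k by (simp add: Q_def per)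
  have vol: "(\<integral>x. indicator half_cube x \<partial>(lborel :: (real^'n) measure)) = (1::real)"
  proof -
    let ?l = "(\<chi> i. - (1/2)) :: real^'n" let ?u = "(\<chi> i. 1/2) :: real^'n"
    have "box ?l ?u \<subseteq> half_cube" "half_cube \<subseteq> cbox ?l ?u" by (auto simp: half_cube_def mem_box_cart less_imp_le)
    then have "emeasure lborel (box ?l ?u) \<le> emeasure lborel (half_cube :: (real^'n) set)" "emeasure lborel (half_cube :: (real^'n) set) \<le> emeasure lborel (cbox ?l ?u)"
      by (simp_all add: emeasure_mono)
    moreover have "?l \<bullet> b \<le> ?u \<bullet> b" if "b \<in> Basis" for b
      using that by (auto simp: Basis_vec_def inner_axis)
    moreover have "(?u - ?l) \<bullet> b = 1" if "b \<in> Basis" for b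
      using that by (auto simp: Basis_vec_def inner_axis)
    ultimately have "emeasure lborel (half_cube :: (real^'n) set) = 1"
      by (simp add: emeasure_lborel_box emeasure_lborel_cbox)
    then show ?thesis by (simp add: measure_def)
  qed
  have chi0: "(\<integral>x. indicator half_cube x * (cis (2 * pi * (lattice_vec k \<bullet> x))) \<partial>lborel) = 0" if "k \<noteq> 0" for k :: "int^'n"
    using that by (rule integral_character_half_cube)
  have Q0: "(\<integral>x. indicator half_cube x * (Q x * cis (2 * pi * (lattice_vec k \<bullet> x))) \<partial>lborel) = 0" for k :: "int^'n"
  proof -
    have i1: "integrable lborel (\<lambda>x. indicator half_cube x * (P x * cis (2 * pi * (lattice_vec k \<bullet> x))))"
      using c by (intro integrable_half_cube continuous_intros)
    have i2: "integrable lborel (\<lambda>x. indicator half_cube x * (a * cis (2 * pi * (lattice_vec k \<bullet> x))))"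
      by (intro integrable_half_cube continuous_intros)
    have "(\<integral>x. indicator half_cube x * (Q x * cis (2 * pi * (lattice_vec k \<bullet> x))) \<partial>lborel) =
       (\<integral>x. indicator half_cube x * (P x * cis (2 * pi * (lattice_vec k \<bullet> x))) \<partial>lborel) - (\<integral>x. indicator half_cube x * (a * cis (2 * pi * (lattice_vec k \<bullet> x))) \<partial>lborel)"
      unfolding Q_def left_diff_distrib right_diff_distrib by (rule Bochner_Integration.integral_diff[OF i1 i2])
    also have "(\<integral>x. indicator half_cube x * (a * cis (2 * pi * (lattice_vec k \<bullet> x))) \<partial>lborel) =
       a * (\<integral>x. indicator half_cube x * cis (2 * pi * (lattice_vec k \<bullet> x)) \<partial>lborel)"
      by (subst integral_mult_right_zero[symmetric]) (simp only: mult.left_commute)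
    finally have eq: "(\<integral>x. indicator half_cube x * (Q x * cis (2 * pi * (lattice_vec k \<bullet> x))) \<partial>lborel) =
      (\<integral>x. indicator half_cube x * (P x * cis (2 * pi * (lattice_vec k \<bullet> x))) \<partial>lborel) - a * (\<integral>x. indicator half_cube x * cis (2 * pi * (lattice_vec k \<bullet> x)) \<partial>lborel)" .
    show ?thesis
    proof (cases "k = 0")
      case True
      have "(\<integral>x. indicator half_cube x \<partial>(lborel :: (real^'n) measure)) = complex_of_real (\<integral>x. indicator half_cube x \<partial>(lborel :: (real^'n) measure))"
      proof -
        have "complex_of_real (indicator A y) = indicator A y" for A and y :: "real^'n" by (auto simp: indicator_def)
        then show ?thesis by (simp only: integral_complex_of_real[symmetric])
      qed
      then have one: "(\<integral>x. indicator half_cube x \<partial>(lborel :: (real^'n) measure)) = (1::complex)" unfolding vol by simp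
      have "(\<integral>x. indicator half_cube x * cis (2 * pi * (lattice_vec k \<bullet> x)) \<partial>lborel) = (\<integral>x. indicator half_cube x \<partial>(lborel :: (real^'n) measure) :: complex)"
        using True by (intro Bochner_Integration.integral_cong) auto
      then show ?thesis unfolding eq using one True by (simp add: a_def del: integral_indicator)
    qed (unfold eq, use z chi0 in simp)
  qed
  have QT: "(\<integral>x. indicator half_cube x * (Q x * T x) \<partial>lborel) = 0" if "trig_poly T" for T
    using that
  proof (induction rule: trig_poly.induct)
    case (char d k)
    have "(\<integral>x. indicator half_cube x * (Q x * (d * cis (2 * pi * (lattice_vec k \<bullet> x)))) \<partial>lborel)
      = d * (\<integral>x. indicator half_cube x * (Q x * cis (2 * pi * (lattice_vec k \<bullet> x))) \<partial>lborel)"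
      by (subst integral_mult_right_zero[symmetric]) (simp only: mult.left_commute[of d])
    then show ?case by (simp add: Q0)
  next
    case (add f g)
    have "integrable lborel (\<lambda>x. indicator half_cube x * (Q x * f x))" "integrable lborel (\<lambda>x. indicator half_cube x * (Q x * g x))"
      using Qc trig_poly_continuous add.hyps by (auto intro!: integrable_half_cube continuous_intros)
    then show ?case using add.IH by (simp add: distrib_left)
  qed
  define J where "J = (\<integral>x. norm (indicator half_cube x * Q x) \<partial>lborel)"
  have Qi: "integrable lborel (\<lambda>x. indicator half_cube x * Q x)" by (rule integrable_half_cube[OF Qc])
  have nQ: "norm (\<integral>x. indicator half_cube x * (Q x * cnj (Q x)) \<partial>lborel) \<le> e * J" if e: "e > 0" for e
  proof -
    obtain T1 where T1: "trig_poly T1" "\<And>x. norm (complex_of_real (Re (Q x)) - T1 x) < e / 2"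
      using periodic_trig_approx_real[of "\<lambda>x. Re (Q x)" "e / 2"] Qc Qper e by (auto intro!: continuous_intros)
    obtain T2 where T2: "trig_poly T2" "\<And>x. norm (complex_of_real (Im (Q x)) - T2 x) < e / 2"
      using periodic_trig_approx_real[of "\<lambda>x. Im (Q x)" "e / 2"] Qc Qper e by (auto intro!: continuous_intros)
    define T where "T = (\<lambda>x. T1 x + (- \<i>) * T2 x)"
    have T: "trig_poly T" unfolding T_def by (intro trig_poly.add trig_poly_mult trig_poly_const T1 T2)
    have d: "norm (cnj (Q x) - T x) \<le> e" for x
    proof -
      have "cnj (Q x) - T x = (complex_of_real (Re (Q x)) - T1 x) - \<i> * (complex_of_real (Im (Q x)) - T2 x)"
        by (simp add: T_def complex_eq_iff)
      also have "norm \<dots> \<le> norm (complex_of_real (Re (Q x)) - T1 x) + norm (\<i> * (complex_of_real (Im (Q x)) - T2 x))"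
        by (rule norm_triangle_ineq4)
      also have "\<dots> \<le> e" using T1(2)[of x] T2(2)[of x] by (simp add: norm_mult)
      finally show ?thesis .
    qed
    have i1: "integrable lborel (\<lambda>x. indicator half_cube x * (Q x * cnj (Q x)))"
      using Qc by (intro integrable_half_cube continuous_intros)
    have i2: "integrable lborel (\<lambda>x. indicator half_cube x * (Q x * T x))"
      using Qc trig_poly_continuous[OF T] by (intro integrable_half_cube continuous_intros)
    have "(\<integral>x. indicator half_cube x * (Q x * cnj (Q x)) \<partial>lborel) = (\<integral>x. indicator half_cube x * (Q x * cnj (Q x)) - indicator half_cube x * (Q x * T x) \<partial>lborel)"
      using Bochner_Integration.integral_diff[OF i1 i2] QT[OF T] by simp
    also have "\<dots> = (\<integral>x. (indicator half_cube x * Q x) * (cnj (Q x) - T x) \<partial>lborel)"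
      by (simp add: algebra_simps)
    also have "norm \<dots> \<le> e * J" unfolding J_def by (rule norm_integral_mult_le[OF Qi d])
    finally show ?thesis .
  qed
  have "(\<integral>x. indicator half_cube x * (Q x * cnj (Q x)) \<partial>lborel) = 0"
  proof -
    have J: "0 \<le> J" unfolding J_def by (intro integral_nonneg_AE) auto
    have "norm (\<integral>x. indicator half_cube x * (Q x * cnj (Q x)) \<partial>lborel) \<le> 0 + e" if "e > 0" for e
    proof -
      have "e / (J + 1) * J \<le> e" using J that by (simp add: field_simps)
      then show ?thesis using nQ[of "e / (J + 1)"] J that by force
    qed
    then have "norm (\<integral>x. indicator half_cube x * (Q x * cnj (Q x)) \<partial>lborel) \<le> 0" by (rule field_le_epsilon)
    then show ?thesis by simp
  qed
  moreover have sq: "indicator half_cube x * (Q x * cnj (Q x)) = complex_of_real (indicator half_cube x * (norm (Q x))\<^sup>2)" for x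
    by (auto simp: indicator_def complex_norm_square[symmetric])
  ultimately have "complex_of_real (\<integral>x. indicator half_cube x * (norm (Q x))\<^sup>2 \<partial>lborel) = 0"
    by (simp only: integral_complex_of_real)
  then have J0: "(\<integral>x. indicator half_cube x * (norm (Q x))\<^sup>2 \<partial>lborel) = 0" by simp
  have "integrable lborel (\<lambda>x. complex_of_real (indicator half_cube x * (norm (Q x))\<^sup>2))"
    unfolding sq[symmetric] using Qc by (intro integrable_half_cube continuous_intros)
  then have "integrable lborel (\<lambda>x. indicator half_cube x * (norm (Q x))\<^sup>2)"
    using complex_of_real_integrable_eq by blast
  then have AE: "AE x in lborel. indicator half_cube x * (norm (Q x))\<^sup>2 = (0::real)"
    using J0 by (subst (asm) integral_nonneg_eq_0_iff_AE) auto
  let ?U = "box (\<chi> i. - (1/2)) (\<chi> i. 1/2) \<inter> {x. Q x \<noteq> 0}"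
  have oU: "open ?U" using Qc by (intro open_Int open_Collect_neq) (auto intro: continuous_intros)
  have "?U = {}"
  proof (rule ccontr)
    assume "?U \<noteq> {}"
    then obtain x r where r: "r > 0" "ball x r \<subseteq> ?U" using oU open_contains_ball by (metis ex_in_conv)
    have "AE y in lborel. y \<notin> ball x r"
      using AE
    proof eventually_elim
      case (elim y)
      show ?case
      proof
        assume "y \<in> ball x r"
        then have "y \<in> ?U" using r by blast
        moreover have "y \<in> half_cube" using \<open>y \<in> ?U\<close> by (auto simp: half_cube_def mem_box_cart less_imp_le)
        ultimately show False using elim by simp
      qed
    qed
    then have "ball x r \<in> null_sets lborel" by (subst (asm) AE_iff_null_sets[symmetric]) auto
    then have "measure lborel (ball x r) = 0" by (simp add: measure_def null_sets_def)
    then show False using content_ball_pos[OF r(1), of x] by simp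
  qed
  then have Qbox: "Q x = 0" if "x \<in> box (\<chi> i. - (1/2)) (\<chi> i. 1/2)" for x using that by auto
  have Qcbox: "Q x = 0" if x: "x \<in> half_cube" for x
  proof -
    \<comment> \<open>The faces of the half-open cube are reached from the open box by shrinking
      towards 0.\<close>
    have "(\<lambda>n. Q ((1 - inverse (real (Suc n))) *\<^sub>R x)) \<longlonglongrightarrow> Q ((1 - 0) *\<^sub>R x)"
      by (intro continuous_on_tendsto_compose[OF Qc] tendsto_intros LIMSEQ_inverse_real_of_nat) auto
    moreover have "Q ((1 - inverse (real (Suc n))) *\<^sub>R x) = 0" for n
    proof (rule Qbox, simp only: mem_box_cart vec_lambda_beta vector_scaleR_component real_scaleR_def, intro allI)
      fix i
      define t where "t = 1 - inverse (1 + real n)"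
      have t: "0 \<le> t" "t < 1" by (auto simp: t_def field_simps)
      have xi: "\<bar>x $ i\<bar> \<le> 1/2" using x unfolding half_cube_def mem_Collect_eq by (meson abs_leI less_imp_le minus_le_iff)
      have "\<bar>t * x $ i\<bar> \<le> t * (1/2)" unfolding abs_mult using t xi by (simp only: abs_of_nonneg mult_left_mono)
      also have "\<dots> < 1/2" using t by simp
      finally have "- (1 / 2) < t * x $ i \<and> t * x $ i < 1 / 2" by linarith
      then show "- (1 / 2) < (1 - inverse (real (Suc n))) * x $ i \<and> (1 - inverse (real (Suc n))) * x $ i < 1 / 2"
        by (simp add: t_def)
    qed
    ultimately show ?thesis by (simp add: LIMSEQ_const_iff)
  qed
  obtain y k where "y \<in> half_cube" "x = y + lattice_vec k" by (rule half_cube_decompose)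
  then have "Q x = 0" using Qcbox Qper by simp
  then show ?thesis by (simp add: Q_def a_def)
qed

subsection \<open>Band-limited functions\<close>

abbreviation spec_cube :: "real^'n^'n \<Rightarrow> (real^'n) set" where
  "spec_cube A \<equiv> (\<lambda>x. transpose A *v x) ` unit_cube"

lemma unit_cube_eq_cbox: "unit_cube = cbox (\<chi> i. - (1/2)) (\<chi> i. 1/2)"
proof -
  have "\<bar>t\<bar> \<le> 1/2 \<longleftrightarrow> - (1/2) \<le> t \<and> t \<le> 1/2" for t :: real by linarith
  then show ?thesis by (simp only: unit_cube_def mem_box_cart set_eq_iff mem_Collect_eq vec_lambda_beta) simp
qed

lemma compact_unit_cube: "compact unit_cube"
  by (simp add: unit_cube_eq_cbox compact_cbox)

lemma compact_spec_cube: "compact (spec_cube A)"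
  by (intro compact_continuous_image compact_unit_cube matrix_vector_mult_linear_continuous_on)

lemma spec_cube_iff:
  assumes "det A \<noteq> 0"
  shows "\<xi> \<in> spec_cube A \<longleftrightarrow> matrix_inv (transpose A) *v \<xi> \<in> unit_cube"
proof -
  have A: "det (transpose A) \<noteq> 0" using assms by (simp add: det_transpose)
  show ?thesis
  proof
    assume "\<xi> \<in> spec_cube A"
    then obtain x where "x \<in> unit_cube" "\<xi> = transpose A *v x" by blast
    then show "matrix_inv (transpose A) *v \<xi> \<in> unit_cube" by (simp only: matrix_inv_vector[OF A])
  next
    assume "matrix_inv (transpose A) *v \<xi> \<in> unit_cube"
    then show "\<xi> \<in> spec_cube A" by (rule rev_image_eqI) (simp only: matrix_inv_vector[OF A])
  qed
qed

lemma fun_support_subset: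
  assumes "closed S" "\<And>x. x \<notin> S \<Longrightarrow> f x = 0"
  shows "fun_support f \<subseteq> S"
  unfolding fun_support_def using assms by (intro closure_minimal) auto

lemma dist_fourier_fun_dist:
  fixes g h :: "real^'n \<Rightarrow> complex"
  assumes g: "continuous_on UNIV g" and h: "h \<in> test_functions"
  shows "dist_fourier (fun_dist g) h = (\<integral>x. inv_fourier h x * cnj (g x) \<partial>lborel)"
proof -
  have "continuous_on UNIV (inv_fourier h)"
    using integrable_partials[OF h, of "[]"] by (intro continuous_on_inv_fourier) simp
  then show ?thesis unfolding dist_fourier_def fun_dist_def
    using g by (intro integral_lebesgue_borel borel_measurable_continuous_onI continuous_intros)
qed

text \<open>The complement of the compact spectral cube is itself one of the open sets in
  \<open>dist_support\<close>, so one vanishing statement on it covers the whole support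
  condition.\<close>

lemma bandI:
  fixes g :: "real^'n \<Rightarrow> complex"
  assumes g: "continuous_on UNIV g" "bounded (range g)"
    and z: "\<And>h. h \<in> test_functions \<Longrightarrow> fun_support h \<inter> spec_cube A = {} \<Longrightarrow> (\<integral>x. inv_fourier h x * cnj (g x) \<partial>lborel) = 0"
  shows "g \<in> band A"
proof -
  let ?U = "- spec_cube A"
  have "open ?U" using compact_spec_cube compact_imp_closed by (metis open_Compl)
  moreover have "dist_fourier (fun_dist g) h = 0" if "h \<in> test_functions" "fun_support h \<subseteq> ?U" for h
    using that by (subst dist_fourier_fun_dist[OF g(1)]) (auto intro!: z)
  ultimately have "dist_support (dist_fourier (fun_dist g)) \<subseteq> spec_cube A"
    unfolding dist_support_def by blast
  then show ?thesis using g by (simp add: band_def)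
qed

lemma bandD:
  assumes "g \<in> band A"
  shows "continuous_on UNIV g" "bounded (range g)" "dist_support (dist_fourier (fun_dist g)) \<subseteq> spec_cube A"
  using assms by (auto simp: band_def)

lemma band_bounded:
  assumes "g \<in> band A"
  obtains B where "B \<ge> 0" "\<And>x. norm (g x) \<le> B"
proof -
  obtain B where "\<And>x. norm (g x) \<le> B" using bandD(2)[OF assms] by (auto simp: bounded_iff)
  then show thesis using that[of B] norm_ge_zero order_trans by metis
qed

lemma cutoff_test_function:
  assumes "cutoff \<eta>"
  shows "(\<lambda>x. complex_of_real (\<eta> x)) \<in> test_functions"
    and "\<And>x. x \<notin> (\<lambda>y. 2 *\<^sub>R y) ` unit_cube \<Longrightarrow> \<eta> x = 0" and "\<And>x. x \<in> unit_cube \<Longrightarrow> \<eta> x = 1"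
    and "continuous_on UNIV \<eta>"
proof -
  show z: "\<And>x. x \<notin> (\<lambda>y. 2 *\<^sub>R y) ` unit_cube \<Longrightarrow> \<eta> x = 0" and "\<And>x. x \<in> unit_cube \<Longrightarrow> \<eta> x = 1"
    using assms by (auto simp: cutoff_def)
  have s: "smooth_on UNIV \<eta>" using assms by (simp add: cutoff_def)
  have K: "compact ((\<lambda>y::real^'a. 2 *\<^sub>R y) ` unit_cube)" by (intro compact_scaling compact_unit_cube)
  have "fun_support (\<lambda>x. complex_of_real (\<eta> x)) \<subseteq> (\<lambda>y. 2 *\<^sub>R y) ` unit_cube"
    using z K by (intro fun_support_subset compact_imp_closed) auto
  then have "compact (fun_support (\<lambda>x. complex_of_real (\<eta> x)))"
    using bounded_subset[OF compact_imp_bounded[OF K]] by (simp add: compact_eq_bounded_closed fun_support_def)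
  then show "(\<lambda>x. complex_of_real (\<eta> x)) \<in> test_functions"
    using smooth_on_of_real[OF s] by (simp add: test_functions_def)
  show "continuous_on UNIV \<eta>" using continuous_on_partials[OF s, of "[]"] by simp
qed

section \<open>Test functions by scaling and squaring\<close>

lemma test_functionI:
  assumes "smooth_on UNIV h" "\<And>x. x \<notin> cball z r \<Longrightarrow> h x = 0"
  shows "h \<in> test_functions" "fun_support h \<subseteq> cball z r"
proof -
  show "fun_support h \<subseteq> cball z r" using assms(2) by (intro fun_support_subset) auto
  then have "bounded (fun_support h)" using bounded_cball bounded_subset by blast
  then have "compact (fun_support h)" by (simp add: compact_eq_bounded_closed fun_support_def)
  then show "h \<in> test_functions" using assms(1) by (simp add: test_functions_def)
qed

text \<open>As e tends to 0 the bump contracts to the point z, while its transform, apart from the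
  normalization e^n, tends to a character times the constant \<open>inv_fourier h 0\<close>. In this
  way test functions see single frequencies.\<close>

lemma test_function_affine:
  fixes h :: "real^'n \<Rightarrow> complex" and z :: "real^'n"
  assumes h: "h \<in> test_functions" and R: "\<And>x. norm x > R \<Longrightarrow> h x = 0" and e: "e > 0"
  defines "k \<equiv> (\<lambda>x. h ((- (1 / e)) *\<^sub>R z + (1 / e) *\<^sub>R x))"
  shows "k \<in> test_functions" "fun_support k \<subseteq> cball z (e * R)"
    and "inv_fourier k y = complex_of_real (e ^ CARD('n)) * (cis (2 * pi * (y \<bullet> z)) * inv_fourier h (e *\<^sub>R y))"
proof -
  have s: "smooth_on UNIV h" using h by (simp add: test_functions_def)
  have ks: "smooth_on UNIV k" unfolding k_def by (rule smooth_on_affine[OF s])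
  have kz: "k x = 0" if "x \<notin> cball z (e * R)" for x
  proof -
    have "norm ((- (1 / e)) *\<^sub>R z + (1 / e) *\<^sub>R x) = norm ((1 / e) *\<^sub>R (x - z))"
      by (simp add: algebra_simps)
    also have "\<dots> = norm (x - z) / e" using e by simp
    also have "\<dots> > R" using that e by (simp add: dist_norm norm_minus_commute field_simps)
    finally show ?thesis unfolding k_def by (rule R)
  qed
  show "k \<in> test_functions" "fun_support k \<subseteq> cball z (e * R)" using test_functionI[OF ks kz] by auto
  have [measurable]: "h \<in> borel_measurable borel" using integrable_partials[OF h, of "[]"] by auto
  have km[measurable]: "k \<in> borel_measurable borel" unfolding k_def by measurable
  have "(\<integral>x. k (z + e *\<^sub>R x) * cis (2 * pi * (y \<bullet> (z + e *\<^sub>R x))) \<partial>lborel) = inv_fourier k y / complex_of_real (\<bar>e\<bar> ^ DIM(real^'n))"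
    using e by (subst lborel_integral_affine(1)[of e "\<lambda>x. k x * cis (2 * pi * (y \<bullet> x))" z]) (auto simp: inv_fourier_eq)
  moreover have "k (z + e *\<^sub>R x) * cis (2 * pi * (y \<bullet> (z + e *\<^sub>R x))) = cis (2 * pi * (y \<bullet> z)) * (h x * cis (2 * pi * ((e *\<^sub>R y) \<bullet> x)))" for x
    using e by (simp add: k_def scaleR_add_right inner_add_right distrib_left cis_mult[symmetric] mult_ac)
  ultimately have "inv_fourier k y / complex_of_real (e ^ CARD('n)) = cis (2 * pi * (y \<bullet> z)) * inv_fourier h (e *\<^sub>R y)"
    using e by (simp add: inv_fourier_eq)
  then show "inv_fourier k y = complex_of_real (e ^ CARD('n)) * (cis (2 * pi * (y \<bullet> z)) * inv_fourier h (e *\<^sub>R y))"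
    using e by (simp add: field_simps)
qed

text \<open>The cut-off may change sign, so its own integral could vanish. Its square equals 1 on
  the unit cube, which has volume 1, so the transform of the square at 0 is at least 1.\<close>

lemma ex_bump:
  fixes \<eta> :: "real^'n \<Rightarrow> real"
  assumes "cutoff \<eta>"
  obtains h :: "real^'n \<Rightarrow> complex" and R where "h \<in> test_functions" "R > 0" "\<And>x. norm x > R \<Longrightarrow> h x = 0" "inv_fourier h 0 \<noteq> 0"
proof -
  note c = cutoff_test_function[OF assms]
  define h where "h = (\<lambda>x. complex_of_real (\<eta> x) * complex_of_real (\<eta> x))"
  obtain R where R: "\<And>x. x \<in> (\<lambda>y. 2 *\<^sub>R y) ` (unit_cube :: (real^'n) set) \<Longrightarrow> norm x \<le> R"
    using compact_imp_bounded[OF compact_scaling[OF compact_unit_cube, of 2]] unfolding bounded_iff by blast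
  have hz: "h x = 0" if "norm x > max R 1" for x
    using R[of x] c(2)[of x] that by (force simp: h_def)
  have hs: "smooth_on UNIV h" unfolding h_def using c(1) by (intro smooth_on_mult) (auto simp: test_functions_def)
  have ht: "h \<in> test_functions" using hz by (intro test_functionI(1)[OF hs, of 0 "max R 1"]) (auto simp: not_le)
  have hi: "integrable lborel h" using integrable_partials[OF ht, of "[]"] by simp
  have hr: "h x = complex_of_real ((\<eta> x)\<^sup>2)" for x by (simp add: h_def power2_eq_square)
  have "integrable lborel (\<lambda>x. complex_of_real ((\<eta> x)\<^sup>2))" using hi by (simp add: hr[abs_def])
  then have ri: "integrable lborel (\<lambda>x. (\<eta> x)\<^sup>2)" using complex_of_real_integrable_eq by blast
  have "inv_fourier h 0 = complex_of_real (\<integral>x. (\<eta> x)\<^sup>2 \<partial>lborel)"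
    using hi by (subst inv_fourier_eq) (auto simp: hr integral_complex_of_real[symmetric])
  moreover have "(\<integral>x. (\<eta> x)\<^sup>2 \<partial>lborel) > 0"
  proof -
    have "measure lborel (unit_cube :: (real^'n) set) = 1"
      unfolding unit_cube_eq_cbox measure_lborel_cbox_eq by (auto simp: Basis_vec_def inner_axis intro!: prod.neutral)
    have "(1::real) = (\<integral>x. indicator unit_cube x \<partial>(lborel :: (real^'n) measure))"
      by (simp add: \<open>measure lborel unit_cube = 1\<close>)
    also have "\<dots> \<le> (\<integral>x. (\<eta> x)\<^sup>2 \<partial>lborel)"
    proof (rule integral_mono[OF _ ri])
      show "integrable lborel (indicator unit_cube :: real^'n \<Rightarrow> real)"
        using borel_compact[OF compact_unit_cube] compact_imp_bounded[OF compact_unit_cube]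
        by (intro integrable_real_indicator emeasure_bounded_finite) auto
      show "indicator unit_cube x \<le> (\<eta> x)\<^sup>2" for x using c(3)[of x] by (cases "x \<in> unit_cube") auto
    qed
    finally show ?thesis by linarith
  qed
  ultimately have h0: "inv_fourier h 0 \<noteq> 0" by simp
  show thesis
  proof (rule that[of h "max R 1"])
    show "h x = 0" if "norm x > max R 1" for x using that by (rule hz)
  qed (use ht h0 in auto)
qed

section \<open>Multipliers that vanish on the spectrum\<close>

context
  fixes \<eta> :: "real^'n \<Rightarrow> real"
  assumes \<eta>: "cutoff \<eta>"
begin

text \<open>Pairing the translates of a small bump with the spectrum of \<open>g\<close> gives \<open>0\<close> at every point of
  \<open>C\<close>; integrating this against \<open>l\<close> replaces a partition of unity.\<close>

lemma band_annihilates_off_spectrum: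
  fixes g l :: "real^'n \<Rightarrow> complex"
  assumes g: "g \<in> band A" and l: "integrable lborel l" and C: "compact C" "C \<inter> spec_cube A = {}"
    and lC: "\<And>\<xi>. \<xi> \<notin> C \<Longrightarrow> l \<xi> = 0" and Li: "integrable lborel (inv_fourier l)"
  shows "(\<integral>x. inv_fourier l x * cnj (g x) \<partial>lborel) = 0"
proof -
  have [measurable]: "g \<in> borel_measurable borel" using bandD(1)[OF g] by (rule borel_measurable_continuous_onI)
  have [measurable]: "l \<in> borel_measurable borel" using l by auto
  have cnjm[measurable]: "(\<lambda>x. cnj (g x)) \<in> borel_measurable borel"
    using bandD(1)[OF g] by (intro borel_measurable_continuous_onI continuous_intros)
  obtain B where B: "B \<ge> 0" "\<And>x. norm (g x) \<le> B" using band_bounded[OF g] by blast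
  obtain h :: "real^'n \<Rightarrow> complex" and R where h: "h \<in> test_functions" "R > 0" "\<And>x. norm x > R \<Longrightarrow> h x = 0" "inv_fourier h 0 \<noteq> 0"
    using ex_bump[OF \<eta>] by metis
  have hi: "integrable lborel h" using integrable_partials[OF h(1), of "[]"] by simp
  have [measurable]: "h \<in> borel_measurable borel" using hi by auto
  have Hi: "integrable lborel (inv_fourier h)" by (rule integrable_inv_fourier_test[OF h(1)])
  define \<U> where "\<U> = {U. open U \<and> (\<forall>h\<in>test_functions. fun_support h \<subseteq> U \<longrightarrow> dist_fourier (fun_dist g) h = 0)}"
  have "C \<subseteq> \<Union>\<U>"
    using bandD(3)[OF g] C(2) unfolding dist_support_def \<U>_def by blast
  \<comment> \<open>A Lebesgue number of the cover: every ball of radius d about a point of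
    \<open>C\<close> lies in a single open set on which the distribution vanishes, so a small bump
    is tested against one set only.\<close>
  then obtain d where d: "d > 0" "\<And>x. x \<in> C \<Longrightarrow> \<exists>G\<in>\<U>. ball x d \<subseteq> G"
    using Heine_Borel_lemma[OF C(1)] unfolding \<U>_def by (metis (mono_tags, lifting) mem_Collect_eq)
  define e where "e = (\<lambda>n. d / (2 * R) * inverse (real (Suc n)))"
  have e0: "e \<longlonglongrightarrow> 0"
    unfolding e_def using tendsto_mult[OF tendsto_const[of "d / (2 * R)"] LIMSEQ_inverse_real_of_nat] by simp
  have ep: "e n > 0" for n using d h by (simp add: e_def)
  have eR: "e n * R < d" for n
  proof -
    have "e n * R = d / 2 * inverse (real (Suc n))" using h(2) by (simp add: e_def)
    also have "\<dots> \<le> d / 2 * 1" using d by (intro mult_left_mono) (auto simp: inverse_le_1_iff)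
    finally show ?thesis using d by simp
  qed
  have gb: "integrable lborel (\<lambda>y. inv_fourier h (e n *\<^sub>R y) * cnj (g y))" for n
  proof -
    have "integrable lborel (\<lambda>y. inv_fourier h (0 + e n *\<^sub>R y))"
      using Hi ep[of n] by (subst lborel_integral_affine(2)) auto
    then show ?thesis using B by (intro integrable_bounded_mult[where B=B]) auto
  qed
  have pt: "(\<integral>y. (inv_fourier h (e n *\<^sub>R y) * cnj (g y)) * cis (2 * pi * (y \<bullet> z)) \<partial>lborel) = 0" if z: "z \<in> C" for z n
  proof -
    let ?k = "\<lambda>x. h ((- (1 / e n)) *\<^sub>R z + (1 / e n) *\<^sub>R x)"
    note k = test_function_affine[OF h(1) h(3) ep[of n], where z=z]
    obtain G where G: "G \<in> \<U>" "ball z d \<subseteq> G" using d(2)[OF z] by blast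
    have "fun_support ?k \<subseteq> G" using k(2) G(2) eR[of n] by force
    then have "dist_fourier (fun_dist g) ?k = 0" using G(1) k(1) by (auto simp: \<U>_def)
    then have "(\<integral>y. inv_fourier ?k y * cnj (g y) \<partial>lborel) = 0"
      by (simp only: dist_fourier_fun_dist[OF bandD(1)[OF g] k(1)])
    moreover have "inv_fourier ?k y * cnj (g y) = complex_of_real (e n ^ CARD('n)) * ((inv_fourier h (e n *\<^sub>R y) * cnj (g y)) * cis (2 * pi * (y \<bullet> z)))" for y
    proof -
      have "a * (b * c) * d = a * ((c * d) * b)" for a b c d :: complex by (simp add: mult_ac)
      then show ?thesis by (subst k(3))
    qed
    ultimately have "complex_of_real (e n ^ CARD('n)) * (\<integral>y. (inv_fourier h (e n *\<^sub>R y) * cnj (g y)) * cis (2 * pi * (y \<bullet> z)) \<partial>lborel) = 0"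
      by (simp only: integral_mult_right_zero)
    then show ?thesis using ep[of n] by simp
  qed
  \<comment> \<open>Fubini writes the pairing as an integral of l(\<zeta>) times the pairing at the
    frequency \<zeta>. The second factor vanishes for \<zeta> in \<open>C\<close>, the first outside
    \<open>C\<close>.\<close>
  have z: "(\<integral>y. (inv_fourier l y * cnj (g y)) * inv_fourier h (e n *\<^sub>R y) \<partial>lborel) = 0" for n
  proof -
    have "(\<integral>y. (inv_fourier l y * cnj (g y)) * inv_fourier h (e n *\<^sub>R y) \<partial>lborel) =
       (\<integral>y. (inv_fourier h (e n *\<^sub>R y) * cnj (g y)) * (\<integral>\<zeta>. l \<zeta> * cis (2 * pi * (y \<bullet> \<zeta>)) \<partial>lborel) \<partial>lborel)"
      by (simp add: inv_fourier_eq[OF \<open>l \<in> borel_measurable borel\<close>] mult_ac)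
    also have "\<dots> = (\<integral>\<zeta>. l \<zeta> * (\<integral>y. (inv_fourier h (e n *\<^sub>R y) * cnj (g y)) * cis (2 * pi * (y \<bullet> \<zeta>)) \<partial>lborel) \<partial>lborel)"
      by (rule Fubini_kernel[OF gb l, where B=1]) auto
    also have "\<dots> = (\<integral>\<zeta>. 0 \<partial>(lborel :: (real^'n) measure))"
    proof (rule Bochner_Integration.integral_cong[OF refl])
      show "l \<zeta> * (\<integral>y. (inv_fourier h (e n *\<^sub>R y) * cnj (g y)) * cis (2 * pi * (y \<bullet> \<zeta>)) \<partial>lborel) = 0" for \<zeta>
        using lC[of \<zeta>] pt[of \<zeta> n] by (cases "\<zeta> \<in> C") auto
    qed
    finally show ?thesis by simp
  qed
  have Lg: "integrable lborel (\<lambda>y. inv_fourier l y * cnj (g y))"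
    using Li B by (intro integrable_bounded_mult[where B=B]) auto
  define K where "K = (\<integral>\<xi>. norm (h \<xi>) \<partial>lborel)"
  have K: "norm (inv_fourier h x) \<le> K" for x unfolding K_def by (rule norm_inv_fourier_le[OF hi])
  \<comment> \<open>Flattening: the transform of \<open>h\<close> at e n y tends to its value at 0,
    which is nonzero and can then be cancelled.\<close>
  have "(\<lambda>n. \<integral>y. (inv_fourier l y * cnj (g y)) * inv_fourier h (e n *\<^sub>R y) \<partial>lborel) \<longlonglongrightarrow> (\<integral>y. (inv_fourier l y * cnj (g y)) * inv_fourier h 0 \<partial>lborel)"
  proof (rule integral_dominated_convergence[where w="\<lambda>y. norm (inv_fourier l y * cnj (g y)) * K"])
    show "AE y in lborel. (\<lambda>n. (inv_fourier l y * cnj (g y)) * inv_fourier h (e n *\<^sub>R y)) \<longlonglongrightarrow> (inv_fourier l y * cnj (g y)) * inv_fourier h 0"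
    proof (intro AE_I2 tendsto_mult tendsto_const)
      fix y :: "real^'n"
      have "(\<lambda>n. e n *\<^sub>R y) \<longlonglongrightarrow> 0 *\<^sub>R y" using e0 by (intro tendsto_intros)
      then show "(\<lambda>n. inv_fourier h (e n *\<^sub>R y)) \<longlonglongrightarrow> inv_fourier h 0"
        by (intro continuous_on_tendsto_compose[OF continuous_on_inv_fourier[OF hi]]) auto
    qed
    show "AE y in lborel. norm ((inv_fourier l y * cnj (g y)) * inv_fourier h (e n *\<^sub>R y)) \<le> norm (inv_fourier l y * cnj (g y)) * K" for n
      using K by (intro AE_I2) (simp only: norm_mult mult_left_mono norm_ge_zero mult_nonneg_nonneg)
    show "integrable lborel (\<lambda>y. norm (inv_fourier l y * cnj (g y)) * K)" using Lg by (intro integrable_mult_left integrable_norm)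
  qed measurable
  then have "(\<integral>y. (inv_fourier l y * cnj (g y)) * inv_fourier h 0 \<partial>lborel) = 0"
    unfolding z by (simp add: LIMSEQ_const_iff)
  then show ?thesis using h(4) by simp
qed

text \<open>A multiplier that merely vanishes on the spectrum is dilated so as to vanish near it;
  the spectrum is convex and contains \<open>0\<close> in its interior.\<close>

lemma band_annihilates:
  fixes g l :: "real^'n \<Rightarrow> complex"
  assumes A: "det A \<noteq> 0" and g: "g \<in> band A" and l: "integrable lborel l"
    and lR: "\<And>\<xi>. norm \<xi> > R \<Longrightarrow> l \<xi> = 0" and lA: "\<And>\<xi>. \<xi> \<in> spec_cube A \<Longrightarrow> l \<xi> = 0"
    and Li: "integrable lborel (inv_fourier l)"
  shows "(\<integral>x. inv_fourier l x * cnj (g x) \<partial>lborel) = 0"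
proof -
  have gc: "continuous_on UNIV g" by (rule bandD(1)[OF g])
  have [measurable]: "g \<in> borel_measurable borel" using gc by (rule borel_measurable_continuous_onI)
  have [measurable]: "l \<in> borel_measurable borel" using l by auto
  have cnjm[measurable]: "(\<lambda>x. cnj (g x)) \<in> borel_measurable borel"
    using bandD(1)[OF g] by (intro borel_measurable_continuous_onI continuous_intros)
  obtain B where B: "B \<ge> 0" "\<And>x. norm (g x) \<le> B" using band_bounded[OF g] by blast
  let ?T = "matrix_inv (transpose A)"
  have z: "(\<integral>y. inv_fourier l y * cnj (g (r *\<^sub>R y)) \<partial>lborel) = 0" if r: "0 < r" "r < 1" for r
  proof -
    \<comment> \<open>The dilate \<open>m\<close> of \<open>l\<close> defined below vanishes on the
      cube enlarged by 1 / r and outside the ball of radius R / r. What is left is compact, and it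
      is disjoint from the cube because 1 / (2 r) > 1 / 2.\<close>
    define C where "C = cball 0 (R / r) \<inter> (\<Union>i. {\<xi>. 1 / (2 * r) \<le> \<bar>(?T *v \<xi>) $ i\<bar>})"
    have "closed {\<xi>. 1 / (2 * r) \<le> \<bar>(?T *v \<xi>) $ i\<bar>}" for i
      by (intro closed_Collect_le continuous_intros matrix_vector_mult_linear_continuous_on)
    then have C: "compact C" unfolding C_def by (intro compact_Int_closed closed_UN) auto
    have CA: "C \<inter> spec_cube A = {}"
    proof (rule ccontr)
      assume "C \<inter> spec_cube A \<noteq> {}"
      then obtain \<xi> i where \<xi>: "\<xi> \<in> spec_cube A" "1 / (2 * r) \<le> \<bar>(?T *v \<xi>) $ i\<bar>" unfolding C_def by blast
      then have "\<bar>(?T *v \<xi>) $ i\<bar> \<le> 1 / 2" using spec_cube_iff[OF A] by (auto simp: unit_cube_def)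
      then have "1 / (2 * r) \<le> 1 / 2" using \<xi>(2) by linarith
      then show False using r by (simp add: field_simps)
    qed
    define m where "m = (\<lambda>\<xi>. l (0 + r *\<^sub>R \<xi>))"
    have [measurable]: "m \<in> borel_measurable borel" unfolding m_def by measurable
    have mi: "integrable lborel m" unfolding m_def using l r by (subst lborel_integral_affine(2)) auto
    have mC: "m \<xi> = 0" if "\<xi> \<notin> C" for \<xi>
    proof (cases "\<xi> \<in> cball 0 (R / r)")
      case True
      then have "\<bar>(?T *v \<xi>) $ i\<bar> < 1 / (2 * r)" for i using that unfolding C_def by (auto simp: not_le)
      then have "\<bar>(?T *v (r *\<^sub>R \<xi>)) $ i\<bar> \<le> 1 / 2" for i
        using r by (simp add: matrix_vector_mult_scaleR abs_mult field_simps less_imp_le)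
      then have "r *\<^sub>R \<xi> \<in> spec_cube A" unfolding spec_cube_iff[OF A] by (simp add: unit_cube_def)
      then show ?thesis by (simp add: m_def lA)
    next
      case False
      then have "norm (r *\<^sub>R \<xi>) > R" using r by (simp add: dist_norm field_simps)
      then show ?thesis by (simp add: m_def lR)
    qed
    have Im: "inv_fourier l y / complex_of_real (\<bar>r\<bar> ^ DIM(real^'n)) = inv_fourier m (r *\<^sub>R y)" for y
    proof -
      have "inv_fourier m (r *\<^sub>R y) = (\<integral>\<xi>. l (0 + r *\<^sub>R \<xi>) * cis (2 * pi * (y \<bullet> (0 + r *\<^sub>R \<xi>))) \<partial>lborel)"
        by (subst inv_fourier_eq) (auto simp: m_def)
      also have "\<dots> = inv_fourier l y / complex_of_real (\<bar>r\<bar> ^ DIM(real^'n))"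
        using r by (subst lborel_integral_affine(1)[of r "\<lambda>\<xi>. l \<xi> * cis (2 * pi * (y \<bullet> \<xi>))" 0]) (auto simp: inv_fourier_eq)
      finally show ?thesis by simp
    qed
    have "integrable lborel (\<lambda>y. inv_fourier m (0 + r *\<^sub>R y))"
      using Li by (simp add: Im[symmetric] integrable_divide)
    then have Imi: "integrable lborel (inv_fourier m)"
      using r by (subst (asm) lborel_integral_affine(2)) auto
    have "(\<integral>x. inv_fourier m x * cnj (g x) \<partial>lborel) = 0"
      by (rule band_annihilates_off_spectrum[OF g mi C CA mC Imi])
    then have "(\<integral>y. inv_fourier m (0 + r *\<^sub>R y) * cnj (g (0 + r *\<^sub>R y)) \<partial>lborel) = 0"
      using r by (subst lborel_integral_affine(1)[of r "\<lambda>x. inv_fourier m x * cnj (g x)" 0]) auto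
    then show ?thesis using r by (simp add: Im[symmetric])
  qed
  \<comment> \<open>Two successors keep r n positive; with one of them the first value would be
    0.\<close>
  define r where "r = (\<lambda>n. 1 - inverse (real (Suc (Suc n))))"
  have r: "0 < r n" "r n < 1" for n by (auto simp: r_def field_simps)
  have r1: "r \<longlonglongrightarrow> 1"
    unfolding r_def using tendsto_diff[OF tendsto_const[of 1] LIMSEQ_Suc[OF LIMSEQ_inverse_real_of_nat]] by simp
  have "(\<lambda>n. \<integral>y. inv_fourier l y * cnj (g (r n *\<^sub>R y)) \<partial>lborel) \<longlonglongrightarrow> (\<integral>y. inv_fourier l y * cnj (g y) \<partial>lborel)"
  proof (rule integral_dominated_convergence[where w="\<lambda>y. norm (inv_fourier l y) * B"])
    show "AE y in lborel. (\<lambda>n. inv_fourier l y * cnj (g (r n *\<^sub>R y))) \<longlonglongrightarrow> inv_fourier l y * cnj (g y)"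
    proof (intro AE_I2 tendsto_mult tendsto_const tendsto_cnj)
      fix y :: "real^'n"
      have "(\<lambda>n. r n *\<^sub>R y) \<longlonglongrightarrow> 1 *\<^sub>R y" using r1 by (intro tendsto_intros)
      then show "(\<lambda>n. g (r n *\<^sub>R y)) \<longlonglongrightarrow> g y"
        by (intro continuous_on_tendsto_compose[OF gc]) auto
    qed
    show "AE y in lborel. norm (inv_fourier l y * cnj (g (r n *\<^sub>R y))) \<le> norm (inv_fourier l y) * B" for n
      using B by (intro AE_I2) (simp only: norm_mult complex_mod_cnj mult_left_mono norm_ge_zero)
    show "integrable lborel (\<lambda>y. norm (inv_fourier l y) * B)" using Li by (intro integrable_mult_left integrable_norm)
    show "(\<lambda>y. inv_fourier l y * cnj (g (r n *\<^sub>R y))) \<in> borel_measurable lborel" for n by measurable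
  qed measurable
  then show ?thesis unfolding z[OF r] by (simp add: LIMSEQ_const_iff)
qed

text \<open>Up to conjugation, the value at x is the pairing of \<open>g\<close> with the kernel
  reflected at x. The symbol of that kernel is conj l times a character, which vanishes wherever
  \<open>l\<close> does.\<close>

lemma conv_band_eq_0:
  fixes g l :: "real^'n \<Rightarrow> complex"
  assumes A: "det A \<noteq> 0" and g: "g \<in> band A" and l: "integrable lborel l"
    and lR: "\<And>\<xi>. norm \<xi> > R \<Longrightarrow> l \<xi> = 0" and lA: "\<And>\<xi>. \<xi> \<in> spec_cube A \<Longrightarrow> l \<xi> = 0"
    and Li: "integrable lborel (inv_fourier l)"
  shows "conv (inv_fourier l) g x = 0"
proof -
  have gm[measurable]: "g \<in> borel_measurable borel" using bandD(1)[OF g] by (rule borel_measurable_continuous_onI)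
  have [measurable]: "l \<in> borel_measurable borel" using l by auto
  have cm: "cnj \<in> borel_measurable borel" by (intro borel_measurable_continuous_onI continuous_intros)
  have [measurable]: "(\<lambda>\<xi>. cnj (l \<xi>)) \<in> borel_measurable borel" by (rule measurable_compose[OF _ cm]) simp
  define m where "m = (\<lambda>\<xi>. cnj (l \<xi>) * cis (- 2 * pi * (x \<bullet> \<xi>)))"
  have [measurable]: "m \<in> borel_measurable borel" unfolding m_def by measurable
  have cl: "integrable lborel (\<lambda>\<xi>. cnj (l \<xi>))" using l by simp
  have mi: "integrable lborel m" unfolding m_def using cl by (intro integrable_bounded_mult[where B=1]) auto
  have Im: "inv_fourier m y = cnj (inv_fourier l (x - y))" for y
  proof -
    have "cnj (inv_fourier l (x - y)) = (\<integral>\<xi>. cnj (l \<xi> * cis (2 * pi * ((x - y) \<bullet> \<xi>))) \<partial>lborel)"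
      unfolding inv_fourier_eq[OF \<open>l \<in> borel_measurable borel\<close>] by (rule Bochner_Integration.integral_cnj[symmetric])
    also have "\<dots> = (\<integral>\<xi>. m \<xi> * cis (2 * pi * (y \<bullet> \<xi>)) \<partial>lborel)"
      by (intro Bochner_Integration.integral_cong refl)
        (simp add: m_def cis_cnj cis_mult mult.assoc inner_diff_left right_diff_distrib)
    also have "\<dots> = inv_fourier m y" by (simp add: inv_fourier_eq)
    finally show ?thesis by simp
  qed
  have "integrable lborel (\<lambda>y. inv_fourier l (x - y))" using Li by (simp add: lborel_integral_shift)
  then have Imi: "integrable lborel (inv_fourier m)" by (simp add: Im[abs_def])
  have "(\<integral>y. inv_fourier m y * cnj (g y) \<partial>lborel) = 0"
    by (rule band_annihilates[OF A g mi _ _ Imi, of R]) (auto simp: m_def lR lA)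
  then have "cnj (\<integral>y. inv_fourier l (x - y) * g y \<partial>lborel) = 0"
    unfolding Bochner_Integration.integral_cnj[symmetric] Im complex_cnj_mult .
  then show ?thesis by (simp add: conv_eq)
qed

end

text \<open>The factors have the symbols h(-\<xi>) and conj l(-\<xi>), so the convolution theorem
  reduces the claim to their product. Reflection and conjugation are those of the pairing of a test
  symbol with a convolution, which decides about membership in \<open>band A\<close>.\<close>

lemma conv_test_disjoint:
  fixes h l :: "real^'n \<Rightarrow> complex"
  assumes h: "h \<in> test_functions" and l: "integrable lborel l"
    and z: "\<And>\<xi>. h \<xi> * cnj (l \<xi>) = 0"
  shows "conv (\<lambda>x. inv_fourier h (- x)) (\<lambda>x. cnj (inv_fourier l x)) = (\<lambda>x. 0)"
proof -
  have hs: "smooth_on UNIV h" and hS: "compact (fun_support h)" using h by (auto simp: test_functions_def)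
  have hi: "integrable lborel h" using integrable_partials[OF h, of "[]"] by simp
  have hc: "continuous_on UNIV h" using continuous_on_partials[OF hs, of "[]"] by simp
  obtain B where B: "B \<ge> 0" "\<And>x. norm (h x) \<le> B"
    using bounded_continuous_compact_support[OF hc hS] partials_eq_0[of _ h "[]"] by auto
  have Hi: "integrable lborel (inv_fourier h)" by (rule integrable_inv_fourier_test[OF h])
  have [measurable]: "h \<in> borel_measurable borel" "l \<in> borel_measurable borel" using hi l by auto
  have ai: "integrable lborel (\<lambda>x. inv_fourier h (- x))" using Hi by (simp add: lborel_integral_shift)
  have Fa: "fourier (\<lambda>x. inv_fourier h (- x)) \<xi> = h (- \<xi>)" for \<xi>
  proof -
    have "fourier (\<lambda>x. inv_fourier h (- x)) \<xi> = (\<integral>x. inv_fourier h (- x) * cis (- 2 * pi * ((- x) \<bullet> (- \<xi>))) \<partial>lborel)"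
      by (subst fourier_eq) auto
    also have "\<dots> = (\<integral>x. inv_fourier h x * cis (- 2 * pi * (x \<bullet> (- \<xi>))) \<partial>lborel)"
      by (rule lborel_integral_shift(7)[of "\<lambda>x. inv_fourier h x * cis (- 2 * pi * (x \<bullet> (- \<xi>)))"]) measurable
    also have "\<dots> = fourier (inv_fourier h) (- \<xi>)" by (subst fourier_eq) auto
    also have "\<dots> = h (- \<xi>)" by (rule fourier_inversion[OF hi hc B(2) Hi])
    finally show ?thesis .
  qed
  define b where "b = (\<lambda>\<xi>. cnj (l (- \<xi>)))"
  have bi: "integrable lborel b" unfolding b_def using l by (simp add: lborel_integral_shift)
  then have [measurable]: "b \<in> borel_measurable borel" by auto
  have Ib: "inv_fourier b x = cnj (inv_fourier l x)" for x
  proof -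
    have "cnj (inv_fourier l x) = (\<integral>\<xi>. cnj (l \<xi> * cis (2 * pi * (x \<bullet> \<xi>))) \<partial>lborel)"
      unfolding inv_fourier_eq[OF \<open>l \<in> borel_measurable borel\<close>] by (rule Bochner_Integration.integral_cnj[symmetric])
    also have "\<dots> = (\<integral>\<xi>. b (- \<xi>) * cis (2 * pi * (x \<bullet> (- \<xi>))) \<partial>lborel)"
      unfolding b_def by (intro Bochner_Integration.integral_cong refl) (simp add: cis_cnj)
    also have "\<dots> = inv_fourier b x"
      using lborel_integral_shift(7)[of "\<lambda>\<xi>. b \<xi> * cis (2 * pi * (x \<bullet> \<xi>))"] by (simp add: inv_fourier_eq)
    finally show ?thesis by simp
  qed
  have "conv (\<lambda>x. inv_fourier h (- x)) (inv_fourier b) = inv_fourier (\<lambda>\<xi>. fourier (\<lambda>x. inv_fourier h (- x)) \<xi> * b \<xi>)"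
    by (rule inv_fourier_fourier_mult[OF ai bi, symmetric])
  also have "\<dots> = inv_fourier (\<lambda>\<xi>. 0)"
  proof -
    have "(\<lambda>\<xi>. h (- \<xi>) * cnj (l (- \<xi>))) = (\<lambda>\<xi>. 0)" by (intro ext z)
    then show ?thesis unfolding Fa b_def by (simp only:)
  qed
  also have "\<dots> = (\<lambda>x. 0)" by (auto simp: inv_fourier_def)
  finally show ?thesis by (simp add: Ib[abs_def])
qed

text \<open>The symbol \<open>h\<close> is transported by the transpose of \<open>B\<close>. It then
  enters \<open>band_annihilates_off_spectrum\<close> as an integrable symbol of compact support off
  the spectrum of \<open>T\<close>, so that iterated partial derivatives do not have to be followed
  through a linear map.\<close>

lemma band_dilate:
  fixes T :: "real^'n \<Rightarrow> complex"
  assumes \<eta>: "cutoff (\<eta> :: real^'n \<Rightarrow> real)" and A: "det A \<noteq> 0" and B: "det B \<noteq> 0" and T: "T \<in> band A"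
  shows "(\<lambda>x. T (B *v x)) \<in> band (A ** B)"
proof (rule bandI)
  note Tc = bandD(1)[OF T]
  have Tm[measurable]: "T \<in> borel_measurable borel" using Tc by (rule borel_measurable_continuous_onI)
  show "continuous_on UNIV (\<lambda>x. T (B *v x))"
    by (rule continuous_on_compose2[OF Tc]) (auto intro: matrix_vector_mult_linear_continuous_on)
  show "bounded (range (\<lambda>x. T (B *v x)))" using bandD(2)[OF T] by (rule bounded_subset) auto
  fix h :: "real^'n \<Rightarrow> complex" assume h: "h \<in> test_functions" and hz: "fun_support h \<inter> spec_cube (A ** B) = {}"
  have Bt: "det (transpose B) \<noteq> 0" using B by (simp add: det_transpose)
  have hi: "integrable lborel h" using integrable_partials[OF h, of "[]"] by simp
  have [measurable]: "h \<in> borel_measurable borel" using hi by auto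
  have cm: "cnj \<in> borel_measurable borel" by (intro borel_measurable_continuous_onI continuous_intros)
  have [measurable]: "(\<lambda>x. cnj (T x)) \<in> borel_measurable borel" by (rule measurable_compose[OF _ cm]) simp
  have Hi: "integrable lborel (inv_fourier h)" by (rule integrable_inv_fourier_test[OF h])
  obtain c where c: "c > 0"
    "\<And>f :: real^'n \<Rightarrow> complex. f \<in> borel_measurable borel \<Longrightarrow> (\<integral>x. f (B *v x) \<partial>lborel) = c *\<^sub>R (\<integral>x. f x \<partial>lborel)"
    "\<And>f :: real^'n \<Rightarrow> complex. f \<in> borel_measurable borel \<Longrightarrow> integrable lborel (\<lambda>x. f (B *v x)) \<longleftrightarrow> integrable lborel f"
    "\<And>f :: real^'n \<Rightarrow> complex. f \<in> borel_measurable borel \<Longrightarrow>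
       (\<integral>x. f (matrix_inv (transpose B) *v x) \<partial>lborel) = (1 / c) *\<^sub>R (\<integral>x. f x \<partial>lborel)"
    "\<And>f :: real^'n \<Rightarrow> complex. f \<in> borel_measurable borel \<Longrightarrow>
       integrable lborel (\<lambda>x. f (matrix_inv (transpose B) *v x)) \<longleftrightarrow> integrable lborel f"
    using lborel_integral_matrix[OF B] by blast
  define l where "l = (\<lambda>\<xi>. h (transpose B *v \<xi>))"
  have lm[measurable]: "l \<in> borel_measurable borel" unfolding l_def by measurable
  have hl: "h \<xi> = l (matrix_inv (transpose B) *v \<xi>)" for \<xi> unfolding l_def by (simp only: matrix_inv_vector[OF Bt])
  have li: "integrable lborel l" using c(5)[OF lm] hi by (simp only: hl[symmetric])
  have Il: "inv_fourier h x = (1 / c) *\<^sub>R inv_fourier l (B *v x)" for x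
  proof -
    have "x \<bullet> \<xi> = (B *v x) \<bullet> (matrix_inv (transpose B) *v \<xi>)" for \<xi>
    proof -
      have "(B *v x) \<bullet> (matrix_inv (transpose B) *v \<xi>) = (matrix_inv (transpose B) *v \<xi>) \<bullet> (B *v x)" by (rule inner_commute)
      also have "\<dots> = \<xi> \<bullet> x" by (simp only: inner_matrix_vector matrix_inv_vector[OF Bt])
      finally show ?thesis by (simp add: inner_commute)
    qed
    then have "inv_fourier h x = (\<integral>\<xi>. l (matrix_inv (transpose B) *v \<xi>) * cis (2 * pi * ((B *v x) \<bullet> (matrix_inv (transpose B) *v \<xi>))) \<partial>lborel)"
      by (subst inv_fourier_eq) (auto simp only: hl \<open>h \<in> borel_measurable borel\<close>)
    also have "\<dots> = (1 / c) *\<^sub>R (\<integral>\<xi>. l \<xi> * cis (2 * pi * ((B *v x) \<bullet> \<xi>)) \<partial>lborel)"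
      by (rule c(4)[of "\<lambda>\<xi>. l \<xi> * cis (2 * pi * ((B *v x) \<bullet> \<xi>))"]) measurable
    finally show ?thesis by (simp only: inv_fourier_eq[OF lm])
  qed
  have "integrable lborel (\<lambda>x. c *\<^sub>R inv_fourier h x)" using Hi by simp
  then have "integrable lborel (\<lambda>x. inv_fourier l (B *v x))" using c(1) by (simp add: Il)
  then have Ili: "integrable lborel (inv_fourier l)" by (subst (asm) c(3)) auto
  define C where "C = (\<lambda>x. matrix_inv (transpose B) *v x) ` fun_support h"
  have C: "compact C" unfolding C_def using h
    by (intro compact_continuous_image matrix_vector_mult_linear_continuous_on) (auto simp: test_functions_def)
  have CA: "C \<inter> spec_cube A = {}"
  proof (rule ccontr)
    assume "C \<inter> spec_cube A \<noteq> {}"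
    then obtain x t where x: "x \<in> fun_support h" "t \<in> unit_cube" "matrix_inv (transpose B) *v x = transpose A *v t"
      unfolding C_def by blast
    have "x = transpose B *v (matrix_inv (transpose B) *v x)" by (simp only: matrix_inv_vector[OF Bt])
    also have "\<dots> = transpose (A ** B) *v t"
      unfolding x(3) matrix_transpose_mul by (simp only: matrix_vector_mul_assoc)
    finally show False using hz x by blast
  qed
  have lC: "l \<xi> = 0" if "\<xi> \<notin> C" for \<xi>
  proof -
    have "transpose B *v \<xi> \<notin> fun_support h"
    proof
      assume "transpose B *v \<xi> \<in> fun_support h"
      then have "\<xi> \<in> C" unfolding C_def by (rule rev_image_eqI) (simp only: matrix_inv_vector[OF Bt])
      then show False using that by simp
    qed
    from partials_eq_0[OF this, of "[]"] show ?thesis by (simp add: l_def)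
  qed
  have "(\<integral>x. inv_fourier h x * cnj (T (B *v x)) \<partial>lborel) = (1 / c) *\<^sub>R (\<integral>x. inv_fourier l (B *v x) * cnj (T (B *v x)) \<partial>lborel)"
    by (simp only: Il mult_scaleR_left integral_scaleR_right)
  also have "(\<integral>x. inv_fourier l (B *v x) * cnj (T (B *v x)) \<partial>lborel) = c *\<^sub>R (\<integral>x. inv_fourier l x * cnj (T x) \<partial>lborel)"
    by (rule c(2)[of "\<lambda>x. inv_fourier l x * cnj (T x)"]) measurable
  also have "(\<integral>x. inv_fourier l x * cnj (T x) \<partial>lborel) = 0"
    by (rule band_annihilates_off_spectrum[OF \<eta> T li C CA lC Ili])
  finally show "(\<integral>x. inv_fourier h x * cnj (T (B *v x)) \<partial>lborel) = 0" by simp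
qed

text \<open>A converse of \<open>bandI\<close>. The definition of the support covers the complement
  by open sets of vanishing that may differ from point to point; the annihilation lemma glues this
  local information.\<close>

lemma band_vanishes:
  fixes g h :: "real^'n \<Rightarrow> complex"
  assumes \<eta>: "cutoff (\<eta> :: real^'n \<Rightarrow> real)" and g: "g \<in> band A"
    and h: "h \<in> test_functions" "fun_support h \<inter> spec_cube A = {}"
  shows "(\<integral>x. inv_fourier h x * cnj (g x) \<partial>lborel) = 0"
  using h partials_eq_0[of _ h "[]"] integrable_partials[OF h(1), of "[]"] integrable_inv_fourier_test[OF h(1)]
  by (intro band_annihilates_off_spectrum[OF \<eta> g, where C="fun_support h"]) (auto simp: test_functions_def)

text \<open>Serves the case of vanishing best error: there \<open>f\<close> is a uniform limit of
  elements of the band and has to be its own approximant. The pairing with an integrable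
  \<open>inv_fourier h\<close> passes to uniform limits.\<close>

lemma band_closed:
  fixes f :: "real^'n \<Rightarrow> complex"
  assumes \<eta>: "cutoff (\<eta> :: real^'n \<Rightarrow> real)"
    and a: "\<And>e. e > 0 \<Longrightarrow> \<exists>T\<in>band A. \<forall>x. norm (f x - T x) \<le> e"
  shows "f \<in> band A"
proof -
  obtain T where T: "\<And>n. T n \<in> band A" "\<And>n x. norm (f x - T n x) \<le> inverse (real (Suc n))"
    using a[of "inverse (real (Suc n))" for n] by (metis inverse_positive_iff_positive of_nat_0_less_iff zero_less_Suc)
  have ul: "uniform_limit UNIV T f sequentially"
  proof (rule uniform_limitI)
    fix e :: real assume "e > 0"
    then have "\<forall>\<^sub>F n in sequentially. inverse (real (Suc n)) < e"
      using LIMSEQ_inverse_real_of_nat by (rule order_tendstoD(2)[rotated])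
    then show "\<forall>\<^sub>F n in sequentially. \<forall>x\<in>UNIV. dist (T n x) (f x) < e"
      using T(2) by (auto simp: dist_norm norm_minus_commute elim!: eventually_mono intro: le_less_trans)
  qed
  have fc: "continuous_on UNIV f"
    by (rule uniform_limit_theorem[OF _ ul]) (use bandD(1)[OF T(1)] in auto)
  obtain B where B: "B \<ge> 0" "\<And>x. norm (T 0 x) \<le> B" using band_bounded[OF T(1)] by blast
  have fb: "norm (f x) \<le> B + 1" for x
    using T(2)[of x 0] B(2)[of x] norm_triangle_ineq[of "f x - T 0 x" "T 0 x"] by simp
  show ?thesis
  proof (rule bandI[OF fc])
    show "bounded (range f)" using fb by (auto simp: bounded_iff)
    fix h :: "real^'n \<Rightarrow> complex" assume h: "h \<in> test_functions" "fun_support h \<inter> spec_cube A = {}"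
    have Hi: "integrable lborel (inv_fourier h)" by (rule integrable_inv_fourier_test[OF h(1)])
    have cm: "(\<lambda>x. cnj (u x)) \<in> borel_measurable lborel" if "continuous_on UNIV u" for u :: "real^'n \<Rightarrow> complex"
      using borel_measurable_continuous_onI[of "\<lambda>x. cnj (u x)"] that by (auto intro!: continuous_intros)
    let ?J = "\<integral>x. norm (inv_fourier h x) \<partial>lborel"
    have bd: "norm (\<integral>x. inv_fourier h x * cnj (f x) \<partial>lborel) \<le> inverse (real (Suc n)) * ?J" for n
    proof -
      obtain C where C: "\<And>x. norm (T n x) \<le> C" using band_bounded[OF T(1)] by blast
      have i1: "integrable lborel (\<lambda>x. inv_fourier h x * cnj (f x))"
        using fb cm[OF fc] by (intro integrable_bounded_mult[OF Hi]) auto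
      have i2: "integrable lborel (\<lambda>x. inv_fourier h x * cnj (T n x))"
        using C cm[OF bandD(1)[OF T(1)]] by (intro integrable_bounded_mult[OF Hi]) auto
      have "(\<integral>x. inv_fourier h x * cnj (f x) \<partial>lborel) = (\<integral>x. inv_fourier h x * cnj (f x) \<partial>lborel) - (\<integral>x. inv_fourier h x * cnj (T n x) \<partial>lborel)"
        by (simp add: band_vanishes[OF \<eta> T(1) h])
      also have "\<dots> = (\<integral>x. inv_fourier h x * cnj (f x - T n x) \<partial>lborel)"
        by (simp add: right_diff_distrib Bochner_Integration.integral_diff[OF i1 i2, symmetric])
      also have "norm \<dots> \<le> inverse (real (Suc n)) * ?J"
        by (rule norm_integral_mult_le[OF Hi]) (use T(2) in \<open>simp only: complex_mod_cnj\<close>)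
      finally show ?thesis .
    qed
    have "(\<lambda>n. inverse (real (Suc n)) * ?J) \<longlonglongrightarrow> 0 * ?J"
      by (intro tendsto_mult tendsto_const LIMSEQ_inverse_real_of_nat)
    then have "norm (\<integral>x. inv_fourier h x * cnj (f x) \<partial>lborel) \<le> 0 * ?J"
      using bd by (intro LIMSEQ_le_const) auto
    then show "(\<integral>x. inv_fourier h x * cnj (f x) \<partial>lborel) = 0" by simp
  qed
qed

text \<open>\<open>F\<close> is only bounded and its transform need not be a function, so the
  multiplier is moved: associativity turns the pairing with a test symbol into a convolution of two
  kernels whose symbols are nowhere nonzero together.\<close>

lemma band_conv:
  fixes F l :: "real^'n \<Rightarrow> complex"
  assumes l: "integrable lborel l" and lA: "\<And>\<xi>. \<xi> \<notin> spec_cube A \<Longrightarrow> l \<xi> = 0"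
    and Li: "integrable lborel (inv_fourier l)"
    and F: "continuous_on UNIV F" "\<And>x. norm (F x) \<le> B"
  shows "conv (inv_fourier l) F \<in> band A"
proof (rule bandI)
  have Fm[measurable]: "F \<in> borel_measurable borel" using F(1) by (rule borel_measurable_continuous_onI)
  have [measurable]: "l \<in> borel_measurable borel" using l by auto
  have cm: "cnj \<in> borel_measurable borel" by (intro borel_measurable_continuous_onI continuous_intros)
  have [measurable]: "(\<lambda>x. cnj (F x)) \<in> borel_measurable borel" by (rule measurable_compose[OF _ cm]) simp
  have [measurable]: "(\<lambda>x. cnj (inv_fourier l x)) \<in> borel_measurable borel" by (rule measurable_compose[OF _ cm]) simp
  show "continuous_on UNIV (conv (inv_fourier l) F)" by (rule continuous_on_conv[OF Li F])
  show "bounded (range (conv (inv_fourier l) F))"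
    using norm_conv_le[OF Li Fm F(2)] by (auto simp: bounded_iff)
  fix h :: "real^'n \<Rightarrow> complex" assume h: "h \<in> test_functions" "fun_support h \<inter> spec_cube A = {}"
  have Hi: "integrable lborel (inv_fourier h)" by (rule integrable_inv_fourier_test[OF h(1)])
  then have [measurable]: "inv_fourier h \<in> borel_measurable borel" by auto
  let ?a = "\<lambda>x. inv_fourier h (- x)" let ?b = "\<lambda>x. cnj (inv_fourier l x)" let ?g = "\<lambda>x. cnj (F x)"
  have ai: "integrable lborel ?a" using Hi by (simp add: lborel_integral_shift)
  have bi: "integrable lborel ?b" using Li by simp
  have "h \<xi> * cnj (l \<xi>) = 0" for \<xi>
    using lA[of \<xi>] h(2) partials_eq_0[of \<xi> h "[]"] by (cases "\<xi> \<in> spec_cube A") auto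
  then have z: "conv ?a ?b = (\<lambda>x. 0)" by (rule conv_test_disjoint[OF h(1) l])
  have cj: "conv ?b ?g y = cnj (conv (inv_fourier l) F y)" for y
    by (simp add: conv_eq Bochner_Integration.integral_cnj[symmetric] del: Bochner_Integration.integral_cnj)
  have "(\<integral>x. inv_fourier h x * cnj (conv (inv_fourier l) F x) \<partial>lborel) = conv ?a (conv ?b ?g) 0"
    by (simp add: conv_eq[of ?a] cj)
  also have "conv ?a (conv ?b ?g) = conv (conv ?a ?b) ?g"
    by (rule conv_assoc[OF ai bi, symmetric]) (use F(2) in auto)
  also have "\<dots> 0 = 0" unfolding z by (simp add: conv_eq)
  finally show "(\<integral>x. inv_fourier h x * cnj (conv (inv_fourier l) F x) \<partial>lborel) = 0" .
qed

subsection \<open>Lattice sums\<close>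

text \<open>Uniform convergence on the unit cube makes the periodization of |\<phi>| continuous
  there, hence bounded. A shift of the summation index carries the bound to every x.\<close>

lemma LC_sum_bound:
  fixes \<phi> :: "real^'n \<Rightarrow> complex"
  assumes \<phi>: "\<phi> \<in> LC"
  obtains C where "C \<ge> 0" "\<And>x S. finite S \<Longrightarrow> (\<Sum>k\<in>S. norm (\<phi> (x + lattice_vec k))) \<le> C"
proof -
  have c: "continuous_on UNIV \<phi>" using \<phi> by (simp add: LC_def)
  obtain l where l: "uniform_limit unit_cube (\<lambda>F x. \<Sum>k\<in>F. norm (\<phi> (x + lattice_vec k))) l (finite_subsets_at_top (UNIV :: (int^'n) set))"
    using \<phi> compact_unit_cube by (auto simp: LC_def)
  have "continuous_on unit_cube l"
    by (rule uniform_limit_theorem[OF _ l])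
      (auto intro!: always_eventually continuous_intros continuous_on_compose2[OF c])
  then have "compact (l ` unit_cube)" by (intro compact_continuous_image compact_unit_cube)
  then obtain C where C: "\<And>x. x \<in> unit_cube \<Longrightarrow> norm (l x) \<le> C"
    using compact_imp_bounded bounded_iff by (metis imageI)
  have le: "(\<Sum>k\<in>S. norm (\<phi> (x + lattice_vec k))) \<le> C" if x: "x \<in> unit_cube" and S: "finite S" for x S
  proof -
    have "((\<lambda>F. \<Sum>k\<in>F. norm (\<phi> (x + lattice_vec k))) \<longlongrightarrow> l x) (finite_subsets_at_top UNIV)"
      using tendsto_uniform_limitI[OF l x] .
    moreover have "\<forall>\<^sub>F F in finite_subsets_at_top UNIV. (\<Sum>k\<in>S. norm (\<phi> (x + lattice_vec k))) \<le> (\<Sum>k\<in>F. norm (\<phi> (x + lattice_vec k)))"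
      unfolding eventually_finite_subsets_at_top using S by (intro exI[of _ S]) (auto intro!: sum_mono2)
    ultimately have "(\<Sum>k\<in>S. norm (\<phi> (x + lattice_vec k))) \<le> l x"
      by (rule tendsto_lowerbound) simp
    then show ?thesis using C[OF x] by simp
  qed
  show thesis
  proof (rule that[of C])
    have "(0::real^'n) \<in> unit_cube" by (simp add: unit_cube_def)
    from C[OF this] show "C \<ge> 0" using norm_ge_zero order_trans by blast
    fix x :: "real^'n" and S :: "(int^'n) set" assume S: "finite S"
    obtain y m where y: "y \<in> half_cube" "x = y + lattice_vec m" by (rule half_cube_decompose)
    have "\<bar>y $ i\<bar> \<le> 1/2" for i
    proof -
      have "- (1/2) \<le> y $ i \<and> y $ i < 1/2" using y(1) by (simp add: half_cube_def)
      then show ?thesis by linarith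
    qed
    then have "y \<in> unit_cube" by (simp add: unit_cube_def)
    have "(\<Sum>k\<in>S. norm (\<phi> (x + lattice_vec k))) = (\<Sum>k\<in>(\<lambda>k. m + k) ` S. norm (\<phi> (y + lattice_vec k)))"
      by (subst sum.reindex) (auto simp: y(2) lattice_vec_add add.assoc inj_on_def)
    also have "\<dots> \<le> C" using S by (intro le \<open>y \<in> unit_cube\<close>) auto
    finally show "(\<Sum>k\<in>S. norm (\<phi> (x + lattice_vec k))) \<le> C" .
  qed
qed

text \<open>Collects the readings of one absolutely convergent family: unordered sum, integral over
  the counting measure, and nonnegative integral of the norms. Sums can then take part in Fubini as
  integrals.\<close>

lemma bounded_sums_abs_summable:
  fixes f :: "'a \<Rightarrow> complex"
  assumes "\<And>S. finite S \<Longrightarrow> (\<Sum>k\<in>S. norm (f k)) \<le> C"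
  shows "(\<lambda>k. norm (f k)) summable_on UNIV" "integrable (count_space UNIV) f" "f summable_on UNIV"
    "(\<integral>k. f k \<partial>count_space UNIV) = (\<Sum>\<^sub>\<infinity>k. f k)" "(\<Sum>\<^sub>\<infinity>k. norm (f k)) \<le> C"
    "(\<integral>\<^sup>+k. ennreal (norm (f k)) \<partial>count_space UNIV) \<le> ennreal C"
proof -
  show 1: "(\<lambda>k. norm (f k)) summable_on UNIV"
    using assms by (intro nonneg_bdd_above_summable_on) (auto intro!: bdd_aboveI2)
  then have 2: "Infinite_Set_Sum.abs_summable_on f UNIV" using abs_summable_equivalent by blast
  then show 3: "integrable (count_space UNIV) f" by (simp add: abs_summable_on_def)
  show "f summable_on UNIV" using 1 by (rule abs_summable_summable)
  show "(\<integral>k. f k \<partial>count_space UNIV) = (\<Sum>\<^sub>\<infinity>k. f k)" using infsetsum_infsum[OF 2] by (simp add: infsetsum_def)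
  show 5: "(\<Sum>\<^sub>\<infinity>k. norm (f k)) \<le> C" by (rule infsum_le_finite_sums[OF 1 assms])
  have n2: "Infinite_Set_Sum.abs_summable_on (\<lambda>k. norm (f k)) UNIV" using 2 by simp
  have "(\<integral>\<^sup>+k. ennreal (norm (f k)) \<partial>count_space UNIV) = ennreal (\<integral>k. norm (f k) \<partial>count_space UNIV)"
    using 3 by (intro nn_integral_eq_integral) auto
  also have "(\<integral>k. norm (f k) \<partial>count_space UNIV) = (\<Sum>\<^sub>\<infinity>k. norm (f k))"
    using infsetsum_infsum[OF n2] by (simp add: infsetsum_def)
  finally show "(\<integral>\<^sup>+k. ennreal (norm (f k)) \<partial>count_space UNIV) \<le> ennreal C"
    using 5 by (simp add: ennreal_leI)
qed

lemma lattice_sum_bounds: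
  fixes \<phi> :: "real^'n \<Rightarrow> complex"
  assumes C: "\<And>x S. finite S \<Longrightarrow> (\<Sum>k\<in>S. norm (\<phi> (x + lattice_vec k))) \<le> C"
    and c: "\<And>k. norm (c k) \<le> B" and B: "B \<ge> 0" and S: "finite S"
  shows "(\<Sum>k\<in>S. norm (c k * \<phi> (x + lattice_vec k))) \<le> B * C"
proof -
  have "(\<Sum>k\<in>S. norm (c k * \<phi> (x + lattice_vec k))) \<le> (\<Sum>k\<in>S. B * norm (\<phi> (x + lattice_vec k)))"
    using c by (intro sum_mono) (simp add: norm_mult mult_right_mono)
  also have "\<dots> = B * (\<Sum>k\<in>S. norm (\<phi> (x + lattice_vec k)))" by (simp add: sum_distrib_left)
  also have "\<dots> \<le> B * C" using B C[OF S] by (intro mult_left_mono) auto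
  finally show ?thesis .
qed

lemma norm_lattice_sum_le:
  fixes \<phi> :: "real^'n \<Rightarrow> complex"
  assumes C: "\<And>x S. finite S \<Longrightarrow> (\<Sum>k\<in>S. norm (\<phi> (x + lattice_vec k))) \<le> C"
    and c: "\<And>k. norm (c k) \<le> B" and B: "B \<ge> 0"
  shows "norm (\<Sum>\<^sub>\<infinity>k. c k * \<phi> (x + lattice_vec k)) \<le> B * C"
proof -
  note b = bounded_sums_abs_summable[OF lattice_sum_bounds[OF C c B]]
  have "norm (\<Sum>\<^sub>\<infinity>k. c k * \<phi> (x + lattice_vec k)) \<le> (\<Sum>\<^sub>\<infinity>k. norm (c k * \<phi> (x + lattice_vec k)))"
    by (rule norm_infsum_bound) (rule b(1))
  also have "\<dots> \<le> B * C" by (rule b(5))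
  finally show ?thesis .
qed

text \<open>The coefficients may vary with t, as the Poisson argument requires. They are bounded, so
  the tails are governed by those of the sum of |\<phi>|, which are uniformly small on compact
  balls; the partial sums therefore converge uniformly there.\<close>

lemma continuous_on_lattice_sum:
  fixes \<phi> :: "real^'n \<Rightarrow> complex" and c :: "int^'n \<Rightarrow> real^'n \<Rightarrow> complex"
  assumes \<phi>: "\<phi> \<in> LC" and cc: "\<And>k. continuous_on UNIV (c k)" and cB: "\<And>k t. norm (c k t) \<le> B" and B: "B \<ge> 0"
  shows "continuous_on UNIV (\<lambda>t. \<Sum>\<^sub>\<infinity>k. c k t * \<phi> (t + lattice_vec k))"
proof -
  have \<phi>c: "continuous_on UNIV \<phi>" using \<phi> by (simp add: LC_def)
  obtain C where C: "C \<ge> 0" "\<And>x S. finite S \<Longrightarrow> (\<Sum>k\<in>S. norm (\<phi> (x + lattice_vec k))) \<le> C"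
    using LC_sum_bound[OF \<phi>] by blast
  let ?W = "\<lambda>t. \<Sum>\<^sub>\<infinity>k. c k t * \<phi> (t + lattice_vec k)"
  have "continuous_on (cball t0 1) ?W" for t0
  proof -
    obtain l where l: "uniform_limit (cball t0 1) (\<lambda>F x. \<Sum>k\<in>F. norm (\<phi> (x + lattice_vec k))) l (finite_subsets_at_top (UNIV :: (int^'n) set))"
      using \<phi> compact_cball[of t0 1] unfolding LC_def by blast
    have l_eq: "l t = (\<Sum>\<^sub>\<infinity>k. norm (\<phi> (t + lattice_vec k)))" if "t \<in> cball t0 1" for t
      using tendsto_uniform_limitI[OF l that] by (intro infsumI[symmetric]) (simp add: has_sum_def)
    have "uniform_limit (cball t0 1) (\<lambda>S t. \<Sum>k\<in>S. c k t * \<phi> (t + lattice_vec k)) ?W (finite_subsets_at_top UNIV)"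
    proof (rule uniform_limitI)
      fix e :: real assume e: "e > 0"
      have "\<forall>\<^sub>F S in finite_subsets_at_top UNIV. \<forall>t\<in>cball t0 1. dist (\<Sum>k\<in>S. norm (\<phi> (t + lattice_vec k))) (l t) < e / (B + 1)"
        using uniform_limitD[OF l, of "e / (B + 1)"] e B by simp
      moreover have "\<forall>\<^sub>F S in finite_subsets_at_top (UNIV :: (int^'n) set). finite S"
        by (intro eventually_finite_subsets_at_top_weakI)
      ultimately show "\<forall>\<^sub>F S in finite_subsets_at_top UNIV. \<forall>t\<in>cball t0 1. dist (\<Sum>k\<in>S. c k t * \<phi> (t + lattice_vec k)) (?W t) < e"
      proof eventually_elim
        case (elim S)
        show ?case
        proof
          fix t assume t: "t \<in> cball t0 1"
          let ?f = "\<lambda>k. c k t * \<phi> (t + lattice_vec k)" let ?n = "\<lambda>k. norm (\<phi> (t + lattice_vec k))"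
          note b = bounded_sums_abs_summable[OF lattice_sum_bounds[OF C(2), where c="\<lambda>k. c k t" and x=t and B=B, OF _ cB B]]
          note b1 = bounded_sums_abs_summable[OF C(2)[of _ t]]
          have S: "finite S" using elim(2) .
          have "?W t - (\<Sum>k\<in>S. ?f k) = infsum ?f (UNIV - S)"
          proof -
            have "infsum ?f (UNIV - S) = ?W t - infsum ?f S"
              by (rule infsum_Diff[OF b(3) summable_on_finite[OF S] subset_UNIV])
            then show ?thesis by (simp only: infsum_finite[OF S])
          qed
          also have "norm \<dots> \<le> (\<Sum>\<^sub>\<infinity>k\<in>UNIV - S. norm (?f k))"
            by (rule norm_infsum_bound) (rule summable_on_subset_banach[OF b(1) subset_UNIV])
          also have "\<dots> \<le> (\<Sum>\<^sub>\<infinity>k\<in>UNIV - S. B * ?n k)"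
            using cB by (intro infsum_mono summable_on_cmult_right summable_on_subset_banach[OF b(1) subset_UNIV] summable_on_subset_banach[OF b1(1) subset_UNIV])
              (simp_all add: norm_mult mult_right_mono)
          also have "\<dots> = B * (\<Sum>\<^sub>\<infinity>k\<in>UNIV - S. ?n k)" by (rule infsum_cmult_right'[of B ?n])
          also have "(\<Sum>\<^sub>\<infinity>k\<in>UNIV - S. ?n k) = l t - (\<Sum>k\<in>S. ?n k)"
          proof -
            have "(\<Sum>\<^sub>\<infinity>k\<in>UNIV - S. ?n k) = (\<Sum>\<^sub>\<infinity>k. ?n k) - (\<Sum>\<^sub>\<infinity>k\<in>S. ?n k)"
              by (rule infsum_Diff[OF b1(1) summable_on_finite[OF S] subset_UNIV])
            then show ?thesis by (simp only: l_eq[OF t] infsum_finite[OF S])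
          qed
          also have "B * \<dots> \<le> B * (e / (B + 1))"
          proof (rule mult_left_mono[OF _ B])
            have "dist (\<Sum>k\<in>S. ?n k) (l t) < e / (B + 1)" using elim(1) t by blast
            then show "l t - (\<Sum>k\<in>S. ?n k) \<le> e / (B + 1)" unfolding dist_real_def by linarith
          qed
          also have "\<dots> < e" using e B by (simp add: field_simps)
          finally show "dist (\<Sum>k\<in>S. ?f k) (?W t) < e" by (simp add: dist_norm norm_minus_commute)
        qed
      qed
    qed
    then show ?thesis
      by (rule uniform_limit_theorem[rotated])
        (auto intro!: always_eventually continuous_intros continuous_on_compose2[OF \<phi>c] continuous_on_subset[OF cc])
  qed
  then have "isCont ?W t0" for t0
    by (intro continuous_on_interior[of "cball t0 1"]) auto
  then show ?thesis by (intro continuous_at_imp_continuous_on) auto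
qed

section \<open>Interchanging lattice sums and integrals\<close>

interpretation lattice_pair: pair_sigma_finite "count_space (UNIV :: (int^'n) set)" "lborel :: (real^'n) measure"
proof -
  interpret a: sigma_finite_measure "count_space (UNIV :: (int^'n) set)"
    by (rule sigma_finite_measure_count_space)
  show "pair_sigma_finite (count_space (UNIV :: (int^'n) set)) (lborel :: (real^'n) measure)" ..
qed

lemma lattice_pair_measurable:
  fixes f :: "int^'n \<Rightarrow> real^'n \<Rightarrow> 'a::topological_space"
  assumes "\<And>k. f k \<in> borel_measurable borel"
  shows "case_prod f \<in> borel_measurable (count_space UNIV \<Otimes>\<^sub>M lborel)"
proof (rule measurable_pair_measure_countable1)
  show "countable (UNIV :: (int^'n) set)" by simp
  show "(\<lambda>y. case_prod f (x, y)) \<in> borel_measurable lborel" for x using assms[of x] by simp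
qed

lemma lattice_Fubini:
  fixes f :: "int^'n \<Rightarrow> real^'n \<Rightarrow> complex"
  assumes f: "\<And>k. f k \<in> borel_measurable borel"
    and b: "\<And>t S. finite S \<Longrightarrow> (\<Sum>k\<in>S. norm (f k t)) \<le> w t" and w: "integrable lborel w"
  shows "integrable (count_space UNIV \<Otimes>\<^sub>M lborel) (case_prod f)"
    and "(\<integral>k. (\<integral>t. f k t \<partial>lborel) \<partial>count_space UNIV) = (\<integral>t. (\<Sum>\<^sub>\<infinity>k. f k t) \<partial>lborel)"
proof -
  note m = lattice_pair_measurable[OF f]
  have w0: "0 \<le> w t" for t using b[of "{}" t] by simp
  have "(\<integral>\<^sup>+p. ennreal (norm (case_prod f p)) \<partial>(count_space UNIV \<Otimes>\<^sub>M lborel))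
      = (\<integral>\<^sup>+t. \<integral>\<^sup>+k. ennreal (norm (f k t)) \<partial>count_space UNIV \<partial>lborel)"
    using m by (subst lattice_pair.nn_integral_snd[symmetric]) (auto simp: split_beta')
  also have "\<dots> \<le> (\<integral>\<^sup>+t. ennreal (w t) \<partial>lborel)"
    by (intro nn_integral_mono bounded_sums_abs_summable(6) b)
  also have "\<dots> < \<infinity>" using w w0 by (subst nn_integral_eq_integral) auto
  finally show i: "integrable (count_space UNIV \<Otimes>\<^sub>M lborel) (case_prod f)"
    using m by (auto simp: integrable_iff_bounded)
  show "(\<integral>k. (\<integral>t. f k t \<partial>lborel) \<partial>count_space UNIV) = (\<integral>t. (\<Sum>\<^sub>\<infinity>k. f k t) \<partial>lborel)"
    by (subst lattice_pair.Fubini_integral[OF i, symmetric]) (simp add: bounded_sums_abs_summable(4)[OF b])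
qed

lemma half_cube_unique:
  fixes t :: "real^'n"
  obtains k0 where "t - lattice_vec k0 \<in> half_cube" "\<And>k. t - lattice_vec k \<in> half_cube \<Longrightarrow> k = k0"
proof -
  obtain y k0 where y: "y \<in> half_cube" "t = y + lattice_vec k0" by (rule half_cube_decompose)
  show thesis
  proof (rule that[of k0])
    show "t - lattice_vec k0 \<in> half_cube" using y by simp
    fix k assume k: "t - lattice_vec k \<in> half_cube"
    have "k $ i = k0 $ i" for i
    proof -
      have "\<bar>real_of_int (k $ i) - real_of_int (k0 $ i)\<bar> < 1"
      proof -
        have a: "- (1/2) \<le> y $ i \<and> y $ i < 1/2" using y(1) by (simp add: half_cube_def)
        have "- (1/2) \<le> (t - lattice_vec k) $ i \<and> (t - lattice_vec k) $ i < 1/2" using k unfolding half_cube_def by blast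
        moreover have "(t - lattice_vec k) $ i = y $ i + real_of_int (k0 $ i) - real_of_int (k $ i)"
          by (simp add: y(2) lattice_vec_def)
        ultimately show ?thesis using a by linarith
      qed
      then have "\<bar>real_of_int (k $ i - k0 $ i)\<bar> < 1" by simp
      then have "\<bar>k $ i - k0 $ i\<bar> < 1" by linarith
      then show ?thesis by simp
    qed
    then show "k = k0" by (simp add: vec_eq_iff)
  qed
qed

text \<open>Cut \<open>F\<close> into its pieces \<open>g k\<close> over the translates of the
  half-open cube and move each back to the cube as \<open>f k\<close>. Moving changes no integral,
  the pieces sum to \<open>F\<close> at every point, and the bound on the periodization makes the
  whole family integrable, hence also \<open>F\<close>.\<close>

lemma lattice_unfold:
  fixes F :: "real^'n \<Rightarrow> complex"
  assumes F[measurable]: "F \<in> borel_measurable borel"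
    and C: "\<And>t S. finite S \<Longrightarrow> (\<Sum>k\<in>S. norm (F (t + lattice_vec k))) \<le> C"
  shows "integrable lborel F"
    and "(\<integral>t. F t \<partial>lborel) = (\<integral>t. indicator half_cube t * (\<Sum>\<^sub>\<infinity>k. F (t + lattice_vec k)) \<partial>lborel)"
proof -
  define f where "f = (\<lambda>k t. indicator half_cube t * F (t + lattice_vec k))"
  have fm: "f k \<in> borel_measurable borel" for k unfolding f_def by measurable
  have C0: "0 \<le> C" using C[of "{}" 0] by simp
  have fb: "(\<Sum>k\<in>S. norm (f k t)) \<le> C * indicator half_cube t" if "finite S" for S t
    using C[OF that, of t] by (auto simp: f_def norm_mult indicator_def)
  have hw: "integrable lborel (\<lambda>t. C * indicator (half_cube :: (real^'n) set) t)"
    using half_cube_bounded by (intro integrable_mult_right integrable_real_indicator emeasure_bounded_finite) auto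
  note fub = lattice_Fubini[OF fm fb hw]
  define g where "g = (\<lambda>k t. indicator half_cube (t - lattice_vec k) * F t)"
  have gm: "g k \<in> borel_measurable borel" for k unfolding g_def by measurable
  have gf: "g k t = f k (t - lattice_vec k)" for k t by (simp add: f_def g_def)
  have gp: "case_prod g \<in> borel_measurable (count_space UNIV \<Otimes>\<^sub>M lborel)" by (rule lattice_pair_measurable[OF gm])
  have fp: "case_prod f \<in> borel_measurable (count_space UNIV \<Otimes>\<^sub>M lborel)" by (rule lattice_pair_measurable[OF fm])
  have sh: "(\<integral>\<^sup>+t. ennreal (norm (g k t)) \<partial>lborel) = (\<integral>\<^sup>+t. ennreal (norm (f k t)) \<partial>lborel)" for k
  proof -
    have "(\<integral>\<^sup>+t. ennreal (norm (f k t)) \<partial>lborel) = (\<integral>\<^sup>+t. ennreal (norm (f k t)) \<partial>distr lborel borel ((+) (- lattice_vec k)))"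
      by (simp add: lborel_distr_plus)
    also have "\<dots> = (\<integral>\<^sup>+t. ennreal (norm (g k t)) \<partial>lborel)"
      using fm[of k] by (subst nn_integral_distr) (auto simp: gf)
    finally show ?thesis by simp
  qed
  have "(\<integral>\<^sup>+p. ennreal (norm (case_prod g p)) \<partial>(count_space UNIV \<Otimes>\<^sub>M lborel)) = (\<integral>\<^sup>+k. \<integral>\<^sup>+t. ennreal (norm (g k t)) \<partial>lborel \<partial>count_space UNIV)"
    using gp by (subst lborel.nn_integral_fst[symmetric]) (auto simp: split_beta')
  also have "\<dots> = (\<integral>\<^sup>+p. ennreal (norm (case_prod f p)) \<partial>(count_space UNIV \<Otimes>\<^sub>M lborel))"
    unfolding sh using fp by (subst lborel.nn_integral_fst[symmetric]) (auto simp: split_beta')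
  also have "\<dots> < \<infinity>" using fub(1) by (simp add: integrable_iff_bounded)
  finally have gi: "integrable (count_space UNIV \<Otimes>\<^sub>M lborel) (case_prod g)"
    using gp by (auto simp: integrable_iff_bounded)
  have gs: "(\<integral>k. g k t \<partial>count_space UNIV) = F t" for t
  proof -
    obtain k0 where k0: "t - lattice_vec k0 \<in> half_cube" "\<And>k. t - lattice_vec k \<in> half_cube \<Longrightarrow> k = k0"
      by (rule half_cube_unique[of t]) blast
    have "g k t = indicator {k0} k *\<^sub>R F t" for k
    proof (cases "k = k0")
      case True
      then show ?thesis using k0(1) by (simp add: g_def)
    next
      case False
      then have "t - lattice_vec k \<notin> half_cube" using k0(2) by blast
      then show ?thesis using False by (simp add: g_def)
    qed
    then have "(\<integral>k. g k t \<partial>count_space UNIV) = (\<integral>k. indicator {k0} k *\<^sub>R F t \<partial>count_space UNIV)"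
      by (simp only:)
    also have "\<dots> = F t" by (subst integral_scaleR_left) auto
    finally show ?thesis .
  qed
  have "integrable lborel (\<lambda>t. \<integral>k. g k t \<partial>count_space UNIV)"
    by (rule lattice_pair.integrable_snd[OF gi])
  then show "integrable lborel F" by (simp add: gs)
  have "(\<integral>t. F t \<partial>lborel) = (\<integral>t. \<integral>k. g k t \<partial>count_space UNIV \<partial>lborel)" by (simp add: gs)
  also have "\<dots> = (\<integral>k. \<integral>t. g k t \<partial>lborel \<partial>count_space UNIV)" by (rule lattice_pair.Fubini_integral[OF gi])
  also have "\<dots> = (\<integral>k. \<integral>t. f k t \<partial>lborel \<partial>count_space UNIV)"
    unfolding gf by (intro Bochner_Integration.integral_cong refl lborel_integral_shift(3) fm)
  also have "\<dots> = (\<integral>t. (\<Sum>\<^sub>\<infinity>k. f k t) \<partial>lborel)" by (rule fub(2))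
  finally show "(\<integral>t. F t \<partial>lborel) = (\<integral>t. indicator half_cube t * (\<Sum>\<^sub>\<infinity>k. F (t + lattice_vec k)) \<partial>lborel)"
    by (simp add: f_def infsum_cmult_right')
qed

section \<open>Poisson summation for band-limited functions\<close>

lemma cis_lattice: "cis (2 * pi * (lattice_vec k \<bullet> lattice_vec m)) = 1"
proof -
  have "lattice_vec k \<bullet> lattice_vec m = real_of_int (\<Sum>i\<in>UNIV. k $ i * m $ i)"
    by (simp add: inner_vec_def lattice_vec_def)
  then show ?thesis by (simp only:) (rule cis_multiple_2pi, simp only: Ints_of_int)
qed

text \<open>For fixed x, the periodization \<open>W\<close> of \<phi>(t) G(x - t) in t has as its
  Fourier coefficients the values at x of the convolutions of the modulated \<phi> with
  \<open>G\<close>. All but the one at 0 vanish by assumption, so \<open>W\<close> is constant and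
  equal to that one. At t = x the samples of \<open>G\<close> fall on the lattice and
  \<open>W\<close> becomes the sum on the left.\<close>

theorem sampling:
  fixes \<phi> G :: "real^'n \<Rightarrow> complex"
  assumes \<phi>: "\<phi> \<in> LC" and G: "continuous_on UNIV G" "\<And>x. norm (G x) \<le> B" "B \<ge> 0"
    and z: "\<And>k x. k \<noteq> 0 \<Longrightarrow> conv (\<lambda>y. \<phi> y * cis (2 * pi * (lattice_vec k \<bullet> y))) G x = 0"
  shows "(\<Sum>\<^sub>\<infinity>k. G (- lattice_vec k) * \<phi> (x + lattice_vec k)) = conv \<phi> G x"
proof -
  have \<phi>c: "continuous_on UNIV \<phi>" using \<phi> by (simp add: LC_def)
  have \<phi>m[measurable]: "\<phi> \<in> borel_measurable borel" using \<phi>c by (rule borel_measurable_continuous_onI)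
  have Gm[measurable]: "G \<in> borel_measurable borel" using G(1) by (rule borel_measurable_continuous_onI)
  obtain C where C: "C \<ge> 0" "\<And>x S. finite S \<Longrightarrow> (\<Sum>k\<in>S. norm (\<phi> (x + lattice_vec k))) \<le> C"
    using LC_sum_bound[OF \<phi>] by blast
  define F where "F = (\<lambda>y. \<phi> y * G (x - y))"
  define W where "W = (\<lambda>t. \<Sum>\<^sub>\<infinity>k. G (x - t - lattice_vec k) * \<phi> (t + lattice_vec k))"
  have Wc: "continuous_on UNIV W" unfolding W_def
    by (rule continuous_on_lattice_sum[OF \<phi> _ G(2,3)]) (auto intro!: continuous_intros continuous_on_compose2[OF G(1)])
  have Wp: "W (t + lattice_vec m) = W t" for t m
  proof -
    have "W t = infsum ((\<lambda>k. G (x - t - lattice_vec k) * \<phi> (t + lattice_vec k)) \<circ> (\<lambda>k. m + k)) UNIV"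
      unfolding W_def by (subst infsum_reindex[symmetric]) (auto simp: surj_plus inj_on_def)
    then show ?thesis by (simp add: W_def o_def lattice_vec_add algebra_simps)
  qed
  have unf: "(\<integral>t. F t * cis (2 * pi * (lattice_vec m \<bullet> t)) \<partial>lborel) = (\<integral>t. indicator half_cube t * (W t * cis (2 * pi * (lattice_vec m \<bullet> t))) \<partial>lborel)" for m
  proof -
    have per: "cis (2 * pi * (lattice_vec m \<bullet> (t + lattice_vec k))) = cis (2 * pi * (lattice_vec m \<bullet> t))" for t k
      by (simp add: inner_add_right distrib_left cis_mult[symmetric] cis_lattice)
    have b: "(\<Sum>k\<in>S. norm (F (t + lattice_vec k) * cis (2 * pi * (lattice_vec m \<bullet> (t + lattice_vec k))))) \<le> B * C" if "finite S" for S t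
    proof -
      have "(\<Sum>k\<in>S. norm (G (x - (t + lattice_vec k)) * \<phi> (t + lattice_vec k))) \<le> B * C"
        using lattice_sum_bounds[OF C(2) _ G(3) that, of "\<lambda>k. G (x - (t + lattice_vec k))" t] G(2) by blast
      then show ?thesis by (simp add: F_def norm_mult mult.commute)
    qed
    have Fm: "(\<lambda>t. F t * cis (2 * pi * (lattice_vec m \<bullet> t))) \<in> borel_measurable borel"
      unfolding F_def by measurable
    have "(\<Sum>\<^sub>\<infinity>k. F (t + lattice_vec k) * cis (2 * pi * (lattice_vec m \<bullet> (t + lattice_vec k)))) = W t * cis (2 * pi * (lattice_vec m \<bullet> t))" for t
      unfolding per infsum_cmult_left' W_def by (simp add: F_def mult.commute algebra_simps)
    then show ?thesis using lattice_unfold(2)[OF Fm b] by simp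
  qed
  have "W x = (\<integral>t. indicator half_cube t * W t \<partial>lborel)"
  proof (rule periodic_const[OF Wc Wp])
    fix m :: "int^'n" assume m: "m \<noteq> 0"
    have "(\<integral>t. F t * cis (2 * pi * (lattice_vec m \<bullet> t)) \<partial>lborel) = conv (\<lambda>y. \<phi> y * cis (2 * pi * (lattice_vec m \<bullet> y))) G x"
      by (simp add: conv_eq' F_def mult_ac)
    then show "(\<integral>t. indicator half_cube t * (W t * cis (2 * pi * (lattice_vec m \<bullet> t))) \<partial>lborel) = 0"
      using z[OF m] unf by simp
  qed
  also have "\<dots> = (\<integral>t. F t \<partial>lborel)" using unf[of 0] by simp
  also have "\<dots> = conv \<phi> G x" by (simp add: conv_eq' F_def)
  finally show ?thesis by (simp add: W_def)
qed

lemma LC_integrable: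
  fixes \<phi> :: "real^'n \<Rightarrow> complex"
  assumes \<phi>: "\<phi> \<in> LC"
  shows "integrable lborel \<phi>"
proof -
  have "continuous_on UNIV \<phi>" using \<phi> by (simp add: LC_def)
  then have "\<phi> \<in> borel_measurable borel" by (rule borel_measurable_continuous_onI)
  moreover obtain C where "\<And>x S. finite S \<Longrightarrow> (\<Sum>k\<in>S. norm (\<phi> (x + lattice_vec k))) \<le> C"
    using LC_sum_bound[OF \<phi>] by blast
  ultimately show ?thesis by (rule lattice_unfold(1))
qed

text \<open>By continuity the transform vanishes on the faces of the cube as well, since stretching
  \<xi> leads outside. The faces matter because the cube shares them with its integer
  translates.\<close>

lemma LC_band_fourier:
  fixes \<phi> :: "real^'n \<Rightarrow> complex"
  assumes \<phi>: "\<phi> \<in> LC" and s: "fun_support (fourier \<phi>) \<subseteq> unit_cube"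
  shows "\<And>\<xi>. \<xi> \<notin> unit_cube \<Longrightarrow> fourier \<phi> \<xi> = 0" "\<And>\<xi> i. \<bar>\<xi> $ i\<bar> \<ge> 1/2 \<Longrightarrow> fourier \<phi> \<xi> = 0"
    "integrable lborel (fourier \<phi>)" "inv_fourier (fourier \<phi>) = \<phi>"
proof -
  note \<phi>i = LC_integrable[OF \<phi>]
  have \<phi>c: "continuous_on UNIV \<phi>" using \<phi> by (simp add: LC_def)
  have Fc: "continuous_on UNIV (fourier \<phi>)" by (rule continuous_on_fourier[OF \<phi>i])
  show z: "\<And>\<xi>. \<xi> \<notin> unit_cube \<Longrightarrow> fourier \<phi> \<xi> = 0"
    using s partials_eq_0[of _ "fourier \<phi>" "[]"] by auto
  show Fi: "integrable lborel (fourier \<phi>)"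
    by (rule integrable_continuous_compact_support[OF Fc compact_unit_cube z])
  obtain C where C: "C \<ge> 0" "\<And>x S. finite S \<Longrightarrow> (\<Sum>k\<in>S. norm (\<phi> (x + lattice_vec k))) \<le> C"
    using LC_sum_bound[OF \<phi>] by blast
  have "norm (\<phi> x) \<le> C" for x using C(2)[of "{0}" x] by simp
  then show "inv_fourier (fourier \<phi>) = \<phi>" by (rule inv_fourier_fourier[OF \<phi>i \<phi>c _ Fi])
  fix \<xi> :: "real^'n" and i assume i: "\<bar>\<xi> $ i\<bar> \<ge> 1/2"
  have "(\<lambda>n. fourier \<phi> ((1 + inverse (real (Suc n))) *\<^sub>R \<xi>)) \<longlonglongrightarrow> fourier \<phi> ((1 + 0) *\<^sub>R \<xi>)"
    by (intro continuous_on_tendsto_compose[OF Fc] tendsto_intros LIMSEQ_inverse_real_of_nat) auto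
  moreover have "fourier \<phi> ((1 + inverse (real (Suc n))) *\<^sub>R \<xi>) = 0" for n
  proof (rule z)
    have p: "inverse (real (Suc n)) > 0" by simp
    have "\<bar>((1 + inverse (real (Suc n))) *\<^sub>R \<xi>) $ i\<bar> = (1 + inverse (real (Suc n))) * \<bar>\<xi> $ i\<bar>"
      using p by (simp only: vector_scaleR_component real_scaleR_def abs_mult abs_of_pos add_pos_pos zero_less_one)
    also have "\<dots> > 1 * \<bar>\<xi> $ i\<bar>" using i p by (intro mult_strict_right_mono) linarith+
    finally have "\<bar>((1 + inverse (real (Suc n))) *\<^sub>R \<xi>) $ i\<bar> > 1/2" using i by linarith
    then show "(1 + inverse (real (Suc n))) *\<^sub>R \<xi> \<notin> unit_cube" unfolding unit_cube_def by (auto simp: not_le)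
  qed
  ultimately show "fourier \<phi> \<xi> = 0" by (simp add: LIMSEQ_const_iff)
qed

text \<open>Modulation by \<open>k\<close> moves the spectrum of \<phi> to the cube around the
  lattice point of \<open>k\<close>. That cube meets the unit cube in common faces at most, and
  there the moved transform is 0.\<close>

lemma LC_band_modulated:
  fixes \<phi> g :: "real^'n \<Rightarrow> complex"
  assumes \<eta>: "cutoff (\<eta> :: real^'n \<Rightarrow> real)"
    and \<phi>: "\<phi> \<in> LC" and s: "fun_support (fourier \<phi>) \<subseteq> unit_cube" and g: "g \<in> band (mat 1)" and k: "k \<noteq> 0"
  shows "conv (\<lambda>y. \<phi> y * cis (2 * pi * (lattice_vec k \<bullet> y))) g x = 0"
proof -
  note b = LC_band_fourier[OF \<phi> s]
  have \<phi>i: "integrable lborel \<phi>" by (rule LC_integrable[OF \<phi>])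
  have [measurable]: "fourier \<phi> \<in> borel_measurable borel" "\<phi> \<in> borel_measurable borel" using \<phi>i b(3) by auto
  define l where "l = (\<lambda>\<xi>. fourier \<phi> (\<xi> - lattice_vec k))"
  have li: "integrable lborel l" unfolding l_def using b(3) by (simp add: lborel_integral_shift)
  then have lm[measurable]: "l \<in> borel_measurable borel" by auto
  have Il: "inv_fourier l = (\<lambda>y. \<phi> y * cis (2 * pi * (lattice_vec k \<bullet> y)))"
  proof
    fix y
    have "inv_fourier l y = (\<integral>\<xi>. fourier \<phi> (\<xi> - lattice_vec k) * cis (2 * pi * (y \<bullet> ((\<xi> - lattice_vec k) + lattice_vec k))) \<partial>lborel)"
      by (simp add: inv_fourier_eq l_def)
    also have "\<dots> = (\<integral>\<xi>. fourier \<phi> \<xi> * cis (2 * pi * (y \<bullet> (\<xi> + lattice_vec k))) \<partial>lborel)"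
      by (rule lborel_integral_shift(3)[of "\<lambda>\<xi>. fourier \<phi> \<xi> * cis (2 * pi * (y \<bullet> (\<xi> + lattice_vec k)))"]) measurable
    also have "\<dots> = (\<integral>\<xi>. (fourier \<phi> \<xi> * cis (2 * pi * (y \<bullet> \<xi>))) * cis (2 * pi * (lattice_vec k \<bullet> y)) \<partial>lborel)"
      by (simp add: inner_add_right distrib_left cis_mult[symmetric] mult.assoc inner_commute)
    also have "\<dots> = inv_fourier (fourier \<phi>) y * cis (2 * pi * (lattice_vec k \<bullet> y))"
      by (simp add: inv_fourier_eq[of "fourier \<phi>"])
    finally show "inv_fourier l y = \<phi> y * cis (2 * pi * (lattice_vec k \<bullet> y))" by (simp add: b(4))
  qed
  have Ili: "integrable lborel (inv_fourier l)"
    unfolding Il using \<phi>i by (intro integrable_bounded_mult[where B=1]) auto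
  obtain R where R: "\<And>\<xi> :: real^'n. \<xi> \<in> unit_cube \<Longrightarrow> norm \<xi> \<le> (R :: real)"
    using compact_imp_bounded[OF compact_unit_cube] unfolding bounded_iff by blast
  have lR: "l \<xi> = 0" if "norm \<xi> > R + norm (lattice_vec k)" for \<xi>
    unfolding l_def
  proof (rule b(1))
    have "norm \<xi> \<le> norm (\<xi> - lattice_vec k) + norm (lattice_vec k)"
      using norm_triangle_ineq[of "\<xi> - lattice_vec k" "lattice_vec k"] by simp
    then have "norm (\<xi> - lattice_vec k) > R" using that by simp
    then show "\<xi> - lattice_vec k \<notin> unit_cube" using R[of "\<xi> - lattice_vec k"] by linarith
  qed
  have lA: "l \<xi> = 0" if "\<xi> \<in> spec_cube (mat 1)" for \<xi>
  proof -
    have \<xi>: "\<xi> \<in> unit_cube" using that by (auto simp: transpose_mat simp del: transpose_matrix_vector)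
    obtain i where i: "k $ i \<noteq> 0" using k by (auto simp: vec_eq_iff)
    then have "\<bar>k $ i\<bar> \<ge> 1" by linarith
    then have "\<bar>real_of_int (k $ i)\<bar> \<ge> 1" by linarith
    moreover have "\<bar>\<xi> $ i\<bar> \<le> 1/2" using \<xi> by (simp add: unit_cube_def)
    moreover have "(\<xi> - lattice_vec k) $ i = \<xi> $ i - real_of_int (k $ i)" by (simp add: lattice_vec_def)
    ultimately have "\<bar>(\<xi> - lattice_vec k) $ i\<bar> \<ge> 1/2" by linarith
    then show ?thesis unfolding l_def by (rule b(2))
  qed
  have "conv (inv_fourier l) g x = 0"
    by (rule conv_band_eq_0[OF \<eta> _ g li lR lA Ili]) auto
  then show ?thesis by (simp add: Il)
qed

text \<open>A test symbol off the cube annihilates each translate of \<phi> separately, and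
  boundedness of the coefficients dominates the exchange of sum and pairing. This makes a
  quasi-projection a competitor in \<open>best_approx\<close>.\<close>

lemma lattice_sum_band:
  fixes \<phi> :: "real^'n \<Rightarrow> complex"
  assumes \<phi>: "\<phi> \<in> LC" and s: "fun_support (fourier \<phi>) \<subseteq> unit_cube" and c: "\<And>k. norm (c k) \<le> B" and B: "B \<ge> 0"
  shows "(\<lambda>x. \<Sum>\<^sub>\<infinity>k. c k * \<phi> (x + lattice_vec k)) \<in> band (mat 1)"
proof (rule bandI)
  note b = LC_band_fourier[OF \<phi> s]
  obtain C where C: "C \<ge> 0" "\<And>x S. finite S \<Longrightarrow> (\<Sum>k\<in>S. norm (\<phi> (x + lattice_vec k))) \<le> C"
    using LC_sum_bound[OF \<phi>] by blast
  have \<phi>i: "integrable lborel \<phi>" by (rule LC_integrable[OF \<phi>])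
  have cm: "cnj \<in> borel_measurable borel" by (intro borel_measurable_continuous_onI continuous_intros)
  have [measurable]: "\<phi> \<in> borel_measurable borel" using \<phi>i by auto
  have cjm[measurable]: "(\<lambda>x. cnj (\<phi> x)) \<in> borel_measurable borel" by (rule measurable_compose[OF _ cm]) simp
  show "continuous_on UNIV (\<lambda>x. \<Sum>\<^sub>\<infinity>k. c k * \<phi> (x + lattice_vec k))"
    using c by (intro continuous_on_lattice_sum[OF \<phi>, of "\<lambda>k x. c k" B] B) auto
  show "bounded (range (\<lambda>x. \<Sum>\<^sub>\<infinity>k. c k * \<phi> (x + lattice_vec k)))"
    using norm_lattice_sum_le[where c=c, OF C(2) c B] by (auto simp: bounded_iff)
  fix h :: "real^'n \<Rightarrow> complex" assume h: "h \<in> test_functions" "fun_support h \<inter> spec_cube (mat 1) = {}"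
  have Hi: "integrable lborel (inv_fourier h)" by (rule integrable_inv_fourier_test[OF h(1)])
  then have [measurable]: "inv_fourier h \<in> borel_measurable borel" by auto
  have sc: "spec_cube (mat 1 :: real^'n^'n) = unit_cube" by (auto simp: transpose_mat simp del: transpose_matrix_vector)
  have "h \<xi> * cnj (fourier \<phi> \<xi>) = 0" for \<xi>
    using b(1)[of \<xi>] h(2) partials_eq_0[of \<xi> h "[]"] unfolding sc by (cases "\<xi> \<in> unit_cube") auto
  from conv_test_disjoint[OF h(1) b(3) this]
  have z: "conv (\<lambda>x. inv_fourier h (- x)) (\<lambda>x. cnj (\<phi> x)) = (\<lambda>x. 0)" by (simp add: b(4))
  define f where "f = (\<lambda>k x. inv_fourier h x * cnj (c k * \<phi> (x + lattice_vec k)))"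
  have fm: "f k \<in> borel_measurable borel" for k unfolding f_def by (simp only: complex_cnj_mult) measurable
  have f0: "(\<integral>x. f k x \<partial>lborel) = 0" for k
  proof -
    have "(\<integral>x. f k x \<partial>lborel) = cnj (c k) * (\<integral>x. inv_fourier h ((x + lattice_vec k) - lattice_vec k) * cnj (\<phi> (x + lattice_vec k)) \<partial>lborel)"
      by (simp add: f_def mult.left_commute)
    also have "(\<integral>x. inv_fourier h ((x + lattice_vec k) - lattice_vec k) * cnj (\<phi> (x + lattice_vec k)) \<partial>lborel) = (\<integral>x. inv_fourier h (x - lattice_vec k) * cnj (\<phi> x) \<partial>lborel)"
      by (rule lborel_integral_shift(5)[of "\<lambda>x. inv_fourier h (x - lattice_vec k) * cnj (\<phi> x)"]) measurable
    also have "\<dots> = conv (\<lambda>x. inv_fourier h (- x)) (\<lambda>x. cnj (\<phi> x)) (lattice_vec k)"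
      by (simp add: conv_eq)
    finally show ?thesis by (simp add: z)
  qed
  have fb: "(\<Sum>k\<in>S. norm (f k t)) \<le> norm (inv_fourier h t) * (B * C)" if "finite S" for S t
  proof -
    have "(\<Sum>k\<in>S. norm (f k t)) = norm (inv_fourier h t) * (\<Sum>k\<in>S. norm (c k * \<phi> (t + lattice_vec k)))"
      by (simp add: f_def norm_mult sum_distrib_left)
    also have "\<dots> \<le> norm (inv_fourier h t) * (B * C)"
      by (intro mult_left_mono lattice_sum_bounds[OF C(2) c B that]) auto
    finally show ?thesis .
  qed
  have "integrable lborel (\<lambda>t. norm (inv_fourier h t) * (B * C))" using Hi by (intro integrable_mult_left integrable_norm)
  from lattice_Fubini(2)[OF fm fb this] f0
  have "(\<integral>t. (\<Sum>\<^sub>\<infinity>k. f k t) \<partial>lborel) = 0" by simp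
  moreover have "(\<Sum>\<^sub>\<infinity>k. f k t) = inv_fourier h t * cnj (\<Sum>\<^sub>\<infinity>k. c k * \<phi> (t + lattice_vec k))" for t
    unfolding f_def infsum_cmult_right' infsum_cnj ..
  ultimately show "(\<integral>x. inv_fourier h x * cnj (\<Sum>\<^sub>\<infinity>k. c k * \<phi> (x + lattice_vec k)) \<partial>lborel) = 0" by simp
qed

subsection \<open>Best approximation\<close>

lemma sup_norm_le_iff: "0 \<le> B \<Longrightarrow> sup_norm f \<le> ennreal B \<longleftrightarrow> (\<forall>x. norm (f x) \<le> B)"
  by (auto simp: sup_norm_def SUP_le_iff)

lemma norm_le_sup_norm: "ennreal (norm (f x)) \<le> sup_norm f"
  unfolding sup_norm_def by (rule SUP_upper) simp

lemma zero_in_band: "(\<lambda>x. 0) \<in> band A"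
  by (rule bandI) auto

lemma band_mono: "spec_cube A \<subseteq> spec_cube B \<Longrightarrow> band A \<subseteq> band B"
  unfolding band_def by blast

lemma best_approx_antimono: "band A \<subseteq> band B \<Longrightarrow> best_approx B f \<le> best_approx A f"
  unfolding best_approx_def by (rule INF_superset_mono) auto

text \<open>A real number in place of \<open>best_approx\<close>, faithful as soon as
  \<open>f\<close> is bounded, because the zero function is then a competitor at finite distance. An
  infinite value would be read as 0.\<close>

definition best_err :: "real^'n^'n \<Rightarrow> (real^'n \<Rightarrow> complex) \<Rightarrow> real" where
  "best_err A f = enn2real (best_approx A f)"

lemma best_err_nonneg: "0 \<le> best_err A f"
  by (simp add: best_err_def)

lemma best_approx_eq:
  assumes "bounded (range f)"
  shows "best_approx A f = ennreal (best_err A f)"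
proof -
  obtain B where B: "\<And>x. norm (f x) \<le> B" using assms by (auto simp: bounded_iff)
  have B0: "0 \<le> B" using B[of undefined] norm_ge_zero order_trans by blast
  have "best_approx A f \<le> sup_norm (\<lambda>x. f x - 0)"
    unfolding best_approx_def by (rule INF_lower[OF zero_in_band])
  also have "\<dots> \<le> ennreal B" using B by (subst sup_norm_le_iff[OF B0]) simp
  finally have "best_approx A f < \<top>" using le_less_trans ennreal_less_top by blast
  then show ?thesis by (simp add: best_err_def)
qed

lemma best_err_antimono:
  assumes "bounded (range f)" "band A \<subseteq> band B"
  shows "best_err B f \<le> best_err A f"
  using best_approx_antimono[OF assms(2), of f] unfolding best_approx_eq[OF assms(1)]
  by (simp add: best_err_nonneg)

lemma best_err_le:
  assumes "bounded (range f)" "T \<in> band A" "0 \<le> B" "\<And>x. norm (f x - T x) \<le> B"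
  shows "best_err A f \<le> B"
proof -
  have "best_approx A f \<le> sup_norm (\<lambda>x. f x - T x)"
    unfolding best_approx_def by (rule INF_lower[OF assms(2)])
  also have "\<dots> \<le> ennreal B" using assms by (simp add: sup_norm_le_iff)
  finally show ?thesis unfolding best_approx_eq[OF assms(1)] using assms(3) by simp
qed

text \<open>A positive error leaves room for the factor 2. A zero error leaves none, and there
  \<open>f\<close> itself lies in the band because the band is closed under uniform limits.\<close>

lemma ex_near_best:
  fixes f :: "real^'n \<Rightarrow> complex"
  assumes \<eta>: "cutoff (\<eta> :: real^'n \<Rightarrow> real)" and f: "bounded (range f)"
  obtains T where "T \<in> band A" "\<And>x. norm (f x - T x) \<le> 2 * best_err A f"
proof -
  have ex: "\<exists>T\<in>band A. \<forall>x. norm (f x - T x) \<le> best_err A f + e" if e: "e > 0" for e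
  proof -
    have "best_approx A f < ennreal (best_err A f + e)"
      unfolding best_approx_eq[OF f] using e best_err_nonneg[of A f] by (simp add: ennreal_less_iff)
    then obtain T where T: "T \<in> band A" "sup_norm (\<lambda>x. f x - T x) < ennreal (best_err A f + e)"
      unfolding best_approx_def INF_less_iff by blast
    have "\<forall>x. norm (f x - T x) \<le> best_err A f + e"
      using less_imp_le[OF T(2)] e best_err_nonneg[of A f] by (subst (asm) sup_norm_le_iff) auto
    then show ?thesis using T(1) by blast
  qed
  show thesis
  proof (cases "best_err A f = 0")
    case True
    have "f \<in> band A" by (rule band_closed[OF \<eta>]) (use ex True in simp)
    then show thesis by (rule that) (simp add: best_err_nonneg)
  next
    case False
    then have "best_err A f > 0" using best_err_nonneg[of A f] by linarith
    from ex[OF this] show thesis using that by auto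
  qed
qed

lemma near_bestD:
  fixes f :: "real^'n \<Rightarrow> complex"
  assumes nb: "near_best M f \<delta> T" and f: "bounded (range f)"
  obtains c where "c \<ge> 0" "\<And>\<mu>. T \<mu> \<in> band (\<delta> *\<^sub>R mat_power M \<mu>)"
    "\<And>\<mu> x. norm (f x - T \<mu> x) \<le> c * best_err (\<delta> *\<^sub>R mat_power M \<mu>) f"
proof -
  obtain c where c: "\<And>\<mu>. T \<mu> \<in> band (\<delta> *\<^sub>R mat_power M \<mu>)"
     "\<And>\<mu>. sup_norm (\<lambda>x. f x - T \<mu> x) \<le> ennreal c * best_approx (\<delta> *\<^sub>R mat_power M \<mu>) f"
    using nb unfolding near_best_def by blast
  show thesis
  \<comment> \<open>The constant in \<open>near_best\<close> may be negative, where
    \<open>ennreal\<close> reads it as 0; \<open>max c 0\<close> reproduces that value as a real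
    number.\<close>
  proof (rule that[of "max c 0"])
    fix \<mu> x
    have "sup_norm (\<lambda>x. f x - T \<mu> x) \<le> ennreal (max c 0) * ennreal (best_err (\<delta> *\<^sub>R mat_power M \<mu>) f)"
      using c(2)[of \<mu>] unfolding best_approx_eq[OF f] by (cases "c \<ge> 0") (auto simp: max_def ennreal_neg)
    then have "sup_norm (\<lambda>x. f x - T \<mu> x) \<le> ennreal (max c 0 * best_err (\<delta> *\<^sub>R mat_power M \<mu>) f)"
      by (simp add: ennreal_mult best_err_nonneg)
    then show "norm (f x - T \<mu> x) \<le> max c 0 * best_err (\<delta> *\<^sub>R mat_power M \<mu>) f"
      by (subst (asm) sup_norm_le_iff) (auto simp: best_err_nonneg)
  qed (use c in auto)
qed

section \<open>Eventual nesting of the spectral cubes\<close>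

lemma spec_cube_scaleR_iff:
  assumes "\<delta> > 0"
  shows "spec_cube (\<delta> *\<^sub>R A) = (\<lambda>x. transpose A *v x) ` ((\<lambda>y. \<delta> *\<^sub>R y) ` unit_cube)"
proof -
  have "transpose (\<delta> *\<^sub>R A) *v x = transpose A *v (\<delta> *\<^sub>R x)" for x
    by (simp add: vec_eq_iff matrix_vector_mult_def transpose_def mult_ac del: transpose_matrix_vector)
  then show ?thesis by (simp only: image_image)
qed

text \<open>A single step need not enlarge the cube, since the spectral condition controls only high
  powers of the inverse. From \<open>N\<close> steps on, the transposed inverse power maps the unit
  cube into its multiple by \<delta>; as powers of M commute, one \<open>N\<close> serves every
  starting level \<mu>.\<close>

lemma dilation_spec_cube:
  fixes M :: "real^'n^'n"
  assumes M: "dilation_matrix M" and \<delta>: "\<delta> > 0"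
  obtains N where "\<And>k \<mu>. k \<ge> N \<Longrightarrow> spec_cube (mat_power M \<mu>) \<subseteq> spec_cube (\<delta> *\<^sub>R mat_power M (\<mu> + k))"
proof -
  obtain N where N: "\<And>k x. k \<ge> N \<Longrightarrow> x \<in> unit_cube \<Longrightarrow>
     transpose (matrix_inv (mat_power M k)) *v x \<in> (\<lambda>y. \<delta> *\<^sub>R y) ` unit_cube"
    using dilation_unit_cube[OF M \<delta>] by blast
  show thesis
  proof (rule that, rule subsetI)
    fix k \<mu> y assume k: "k \<ge> N" and "y \<in> spec_cube (mat_power M \<mu>)"
    then obtain x where x: "x \<in> unit_cube" "y = transpose (mat_power M \<mu>) *v x" by blast
    have d: "det (mat_power M k) \<noteq> 0" using dilation_det_nz[OF M] by (simp add: det_mat_power)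
    have "transpose (mat_power M (\<mu> + k)) *v (transpose (matrix_inv (mat_power M k)) *v x) =
       transpose (mat_power M \<mu>) *v (transpose (matrix_inv (mat_power M k) ** mat_power M k) *v x)"
      unfolding mat_power_add mat_power_commute[of M \<mu> k] matrix_transpose_mul
      by (simp only: matrix_vector_mul_assoc matrix_mul_assoc)
    also have "\<dots> = y" unfolding matrix_inv_mult(2)[OF d] x(2) by (simp add: transpose_mat del: transpose_matrix_vector)
    finally show "y \<in> spec_cube (\<delta> *\<^sub>R mat_power M (\<mu> + k))"
      unfolding spec_cube_scaleR_iff[OF \<delta>] using N[OF k x(1)] by (metis imageI)
  qed
qed

subsection \<open>The cut-off kernels\<close>

lemma cutoff_scaled_facts:
  fixes \<eta> :: "real^'n \<Rightarrow> real"
  assumes \<eta>: "cutoff \<eta>" and A: "det A \<noteq> 0"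
  shows "\<And>\<xi>. \<xi> \<in> spec_cube A \<Longrightarrow> cutoff_scaled \<eta> A \<xi> = 1"
    and "continuous_on UNIV (cutoff_scaled \<eta> A)"
    and "\<exists>R. \<forall>\<xi>. norm \<xi> > R \<longrightarrow> cutoff_scaled \<eta> A \<xi> = 0"
    and "\<exists>B\<ge>0. \<forall>\<xi>. norm (cutoff_scaled \<eta> A \<xi>) \<le> B"
    and "integrable lborel (cutoff_scaled \<eta> A)"
proof -
  note c = cutoff_test_function[OF \<eta>]
  have At: "det (transpose A) \<noteq> 0" using A by (simp add: det_transpose)
  show "cutoff_scaled \<eta> A \<xi> = 1" if "\<xi> \<in> spec_cube A" for \<xi>
    using that c(3) unfolding spec_cube_iff[OF A] cutoff_scaled_def by simp
  show cc: "continuous_on UNIV (cutoff_scaled \<eta> A)"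
    unfolding cutoff_scaled_def
    by (intro continuous_intros continuous_on_compose2[OF c(4)]) (auto intro: matrix_vector_mult_linear_continuous_on)
  define S where "S = (\<lambda>x. transpose A *v x) ` ((\<lambda>y::real^'n. 2 *\<^sub>R y) ` unit_cube)"
  have S: "compact S" unfolding S_def
    by (intro compact_continuous_image matrix_vector_mult_linear_continuous_on compact_scaling compact_unit_cube)
  have z: "cutoff_scaled \<eta> A \<xi> = 0" if "\<xi> \<notin> S" for \<xi>
  proof -
    have "matrix_inv (transpose A) *v \<xi> \<notin> (\<lambda>y. 2 *\<^sub>R y) ` unit_cube"
    proof
      assume "matrix_inv (transpose A) *v \<xi> \<in> (\<lambda>y. 2 *\<^sub>R y) ` unit_cube"
      then have "\<xi> \<in> S" unfolding S_def by (rule rev_image_eqI) (simp only: matrix_inv_vector[OF At])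
      then show False using that by simp
    qed
    then have "\<eta> (matrix_inv (transpose A) *v \<xi>) = 0" by (rule c(2))
    then show ?thesis by (simp only: cutoff_scaled_def of_real_0)
  qed
  obtain R where "\<And>\<xi>. \<xi> \<in> S \<Longrightarrow> norm \<xi> \<le> R" using compact_imp_bounded[OF S] bounded_iff by metis
  then show "\<exists>R. \<forall>\<xi>. norm \<xi> > R \<longrightarrow> cutoff_scaled \<eta> A \<xi> = 0" using z by (metis not_le)
  show "\<exists>B\<ge>0. \<forall>\<xi>. norm (cutoff_scaled \<eta> A \<xi>) \<le> B"
    using bounded_continuous_compact_support[OF cc S z] by metis
  show "integrable lborel (cutoff_scaled \<eta> A)" by (rule integrable_continuous_compact_support[OF cc S z])
qed

text \<open>\<open>fourier_fun\<close> is a choice up to a null set and only Lebesgue measurable.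
  One Borel version \<open>q\<close> serves all \<open>A\<close> at once, so that symbols belonging
  to different scales can be subtracted pointwise.\<close>

lemma N_conv_representation:
  fixes \<eta> :: "real^'n \<Rightarrow> real"
  assumes \<eta>: "cutoff \<eta>" and \<psi>: "\<exists>g. has_fourier_fun \<psi> g"
  obtains q where "q \<in> borel_measurable borel" "AE \<xi> in lebesgue. fourier_fun \<psi> \<xi> = q \<xi>"
    "\<And>A. det A \<noteq> 0 \<Longrightarrow> integrable lborel (\<lambda>\<xi>. cutoff_scaled \<eta> A \<xi> * cnj (q \<xi>))"
    "\<And>A. det A \<noteq> 0 \<Longrightarrow> N_conv \<eta> A \<psi> = inv_fourier (\<lambda>\<xi>. cutoff_scaled \<eta> A \<xi> * cnj (q \<xi>))"
proof -
  define p where "p = fourier_fun \<psi>"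
  have "has_fourier_fun \<psi> p" unfolding p_def fourier_fun_def using \<psi> by (rule someI_ex)
  then have pm: "p \<in> borel_measurable lebesgue" and pb: "\<And>K. compact K \<Longrightarrow> bounded (p ` K)"
    by (auto simp: has_fourier_fun_def locally_bounded_measurable_def)
  obtain q where q: "q \<in> borel_measurable borel" "AE \<xi> in lebesgue. p \<xi> = q \<xi>"
    using lebesgue_borel_representative[OF pm] by blast
  have cm: "cnj \<in> borel_measurable borel" by (intro borel_measurable_continuous_onI continuous_intros)
  have cq: "(\<lambda>\<xi>. cnj (q \<xi>)) \<in> borel_measurable borel" by (rule measurable_compose[OF q(1) cm])
  have cp: "(\<lambda>\<xi>. cnj (p \<xi>)) \<in> borel_measurable lebesgue" by (rule measurable_compose[OF pm cm])
  have main: "integrable lborel (\<lambda>\<xi>. cutoff_scaled \<eta> A \<xi> * cnj (q \<xi>)) \<and> N_conv \<eta> A \<psi> = inv_fourier (\<lambda>\<xi>. cutoff_scaled \<eta> A \<xi> * cnj (q \<xi>))"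
    if A: "det A \<noteq> 0" for A
  proof
    note cs = cutoff_scaled_facts[OF \<eta> A]
    let ?l = "\<lambda>\<xi>. cutoff_scaled \<eta> A \<xi> * cnj (q \<xi>)" let ?k = "\<lambda>\<xi>. cutoff_scaled \<eta> A \<xi> * cnj (p \<xi>)"
    have csm: "cutoff_scaled \<eta> A \<in> borel_measurable borel" using cs(2) by (rule borel_measurable_continuous_onI)
    have lm: "?l \<in> borel_measurable borel" using csm cq by (intro borel_measurable_times)
    have csl: "cutoff_scaled \<eta> A \<in> borel_measurable lebesgue" using csm by (simp add: measurable_completion)
    have km: "?k \<in> borel_measurable lebesgue" using csl cp by (intro borel_measurable_times)
    have ae: "AE \<xi> in lebesgue. ?k \<xi> = ?l \<xi>" using q(2) by eventually_elim simp
    obtain R where R: "\<And>\<xi>. norm \<xi> > R \<Longrightarrow> cutoff_scaled \<eta> A \<xi> = 0" using cs(3) by blast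
    obtain B where B: "\<And>\<xi>. norm \<xi> \<le> R \<Longrightarrow> norm (p \<xi>) \<le> B"
      using pb[OF compact_cball[of 0 R]] unfolding bounded_iff by (metis imageI mem_cball_0)
    have "integrable lebesgue (\<lambda>\<xi>. cutoff_scaled \<eta> A \<xi>)"
      using cs(5) csm by (simp add: integrable_lebesgue_borel)
    \<comment> \<open>\<open>p\<close> is bounded only on compact sets. The indicator of a ball
      outside which the cut-off vanishes makes the second factor globally bounded and leaves the
      product unchanged.\<close>
    then have "integrable lebesgue (\<lambda>\<xi>. cutoff_scaled \<eta> A \<xi> * (cnj (p \<xi>) * indicator (cball 0 R) \<xi>))"
    proof (rule integrable_bounded_mult[where B="\<bar>B\<bar>"])
      show "(\<lambda>\<xi>. cnj (p \<xi>) * indicator (cball 0 R) \<xi>) \<in> borel_measurable lebesgue"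
        by (intro borel_measurable_times cp borel_measurable_indicator) simp
      show "norm (cnj (p \<xi>) * indicator (cball 0 R) \<xi>) \<le> \<bar>B\<bar>" for \<xi>
      proof (cases "norm \<xi> \<le> R")
        case True
        then have "norm (p \<xi>) \<le> \<bar>B\<bar>" using B[OF True] by linarith
        then show ?thesis using True by (simp add: norm_mult)
      qed simp
    qed
    moreover have "(\<lambda>\<xi>. cutoff_scaled \<eta> A \<xi> * (cnj (p \<xi>) * indicator (cball 0 R) \<xi>)) = ?k"
      using R by (auto simp: fun_eq_iff indicator_def)
    ultimately have "integrable lebesgue ?k" by simp
    then have "integrable lebesgue ?l"
      using integrable_cong_AE[OF km _ ae] lm by (simp add: measurable_completion)
    then show "integrable lborel ?l" using lm by (simp add: integrable_lebesgue_borel)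
    show "N_conv \<eta> A \<psi> = inv_fourier ?l"
    proof
      fix x :: "real^'n"
      have em: "(\<lambda>\<xi>. cis (2 * pi * (x \<bullet> \<xi>))) \<in> borel_measurable lebesgue"
        using measurable_cis_inner by (simp add: measurable_completion)
      show "N_conv \<eta> A \<psi> x = inv_fourier ?l x"
        unfolding N_conv_def inv_fourier_def p_def[symmetric]
      proof (rule integral_cong_AE)
        show "(\<lambda>\<xi>. ?k \<xi> * cis (2 * pi * (x \<bullet> \<xi>))) \<in> borel_measurable lebesgue"
          by (rule borel_measurable_times[OF km em])
        show "(\<lambda>\<xi>. ?l \<xi> * cis (2 * pi * (x \<bullet> \<xi>))) \<in> borel_measurable lebesgue"
          by (rule borel_measurable_times[OF _ em]) (use lm in \<open>simp add: measurable_completion\<close>)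
        show "AE \<xi> in lebesgue. ?k \<xi> * cis (2 * pi * (x \<bullet> \<xi>)) = ?l \<xi> * cis (2 * pi * (x \<bullet> \<xi>))"
          using ae by eventually_elim simp
      qed
    qed
  qed
  show thesis by (rule that[OF q(1)]) (use q(2) main in \<open>auto simp: p_def\<close>)
qed

text \<open>Both cut-offs equal 1 on the smaller cube, so the difference of the two symbols vanishes
  on the spectrum of \<open>T\<close>. A kernel may therefore be replaced by a later one as soon as
  the cubes are nested.\<close>

lemma conv_N_conv_eq:
  fixes \<eta> :: "real^'n \<Rightarrow> real"
  assumes \<eta>: "cutoff \<eta>" and \<psi>: "\<exists>g. has_fourier_fun \<psi> g"
    and A: "det A \<noteq> 0" and B: "det B \<noteq> 0" and T: "T \<in> band A" and s: "spec_cube A \<subseteq> spec_cube B"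
    and iA: "integrable lborel (N_conv \<eta> A \<psi>)" and iB: "integrable lborel (N_conv \<eta> B \<psi>)"
  shows "conv (N_conv \<eta> A \<psi>) T x = conv (N_conv \<eta> B \<psi>) T x"
proof -
  obtain q where q0: "q \<in> borel_measurable borel" and "AE \<xi> in lebesgue. fourier_fun \<psi> \<xi> = q \<xi>"
    and q: "\<And>A. det A \<noteq> 0 \<Longrightarrow> integrable lborel (\<lambda>\<xi>. cutoff_scaled \<eta> A \<xi> * cnj (q \<xi>))"
    "\<And>A. det A \<noteq> 0 \<Longrightarrow> N_conv \<eta> A \<psi> = inv_fourier (\<lambda>\<xi>. cutoff_scaled \<eta> A \<xi> * cnj (q \<xi>))"
    by (rule N_conv_representation[OF \<eta> \<psi>]) (rule that)
  let ?l = "\<lambda>A \<xi>. cutoff_scaled \<eta> A \<xi> * cnj (q \<xi>)"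
  note iq = q(1)[OF A] q(1)[OF B]
  have I: "inv_fourier (\<lambda>\<xi>. ?l A \<xi> - ?l B \<xi>) y = N_conv \<eta> A \<psi> y - N_conv \<eta> B \<psi> y" for y
  proof -
    have i: "integrable lborel (\<lambda>\<xi>. ?l D \<xi> * cis (2 * pi * (y \<bullet> \<xi>)))" if "det D \<noteq> 0" for D
      by (rule integrable_bounded_mult[OF q(1)[OF that], where B=1])
        (use measurable_cis_inner(1)[of "2 * pi" y] in auto)
    have m: "?l D \<in> borel_measurable borel" if "det D \<noteq> 0" for D using q(1)[OF that] by auto
    have "inv_fourier (\<lambda>\<xi>. ?l A \<xi> - ?l B \<xi>) y = (\<integral>\<xi>. ?l A \<xi> * cis (2 * pi * (y \<bullet> \<xi>)) - ?l B \<xi> * cis (2 * pi * (y \<bullet> \<xi>)) \<partial>lborel)"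
      using m[OF A] m[OF B] by (subst inv_fourier_eq) (auto simp: left_diff_distrib)
    also have "\<dots> = N_conv \<eta> A \<psi> y - N_conv \<eta> B \<psi> y"
      unfolding q(2)[OF A] q(2)[OF B] inv_fourier_eq[OF m[OF A]] inv_fourier_eq[OF m[OF B]]
      by (rule Bochner_Integration.integral_diff[OF i[OF A] i[OF B]])
    finally show ?thesis .
  qed
  have If: "inv_fourier (\<lambda>\<xi>. ?l A \<xi> - ?l B \<xi>) = (\<lambda>y. N_conv \<eta> A \<psi> y - N_conv \<eta> B \<psi> y)" by (intro ext I)
  obtain RA where RA: "\<And>\<xi>. norm \<xi> > RA \<Longrightarrow> cutoff_scaled \<eta> A \<xi> = 0" using cutoff_scaled_facts(3)[OF \<eta> A] by blast
  obtain RB where RB: "\<And>\<xi>. norm \<xi> > RB \<Longrightarrow> cutoff_scaled \<eta> B \<xi> = 0" using cutoff_scaled_facts(3)[OF \<eta> B] by blast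
  have "conv (inv_fourier (\<lambda>\<xi>. ?l A \<xi> - ?l B \<xi>)) T x = 0"
  proof (rule conv_band_eq_0[OF \<eta> A T, where R="max RA RB"])
    show "integrable lborel (\<lambda>\<xi>. ?l A \<xi> - ?l B \<xi>)" using iq by simp
    show "?l A \<xi> - ?l B \<xi> = 0" if "norm \<xi> > max RA RB" for \<xi> using RA[of \<xi>] RB[of \<xi>] that by simp
    show "?l A \<xi> - ?l B \<xi> = 0" if "\<xi> \<in> spec_cube A" for \<xi>
      using cutoff_scaled_facts(1)[OF \<eta> A that] cutoff_scaled_facts(1)[OF \<eta> B subsetD[OF s that]] by simp
    show "integrable lborel (inv_fourier (\<lambda>\<xi>. ?l A \<xi> - ?l B \<xi>))" 
      unfolding If by (rule Bochner_Integration.integrable_diff[OF iA iB])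
  qed
  moreover obtain C where C: "\<And>x. norm (T x) \<le> C" using band_bounded[OF T] by blast
  have Tm: "T \<in> borel_measurable borel" using bandD(1)[OF T] by (rule borel_measurable_continuous_onI)
  have "conv (inv_fourier (\<lambda>\<xi>. ?l A \<xi> - ?l B \<xi>)) T x = conv (N_conv \<eta> A \<psi>) T x - conv (N_conv \<eta> B \<psi>) T x"
    unfolding If by (rule conv_diff_left[OF iA iB Tm C])
  ultimately show ?thesis by simp
qed

subsection \<open>The limit defining the coefficient functionals\<close>

text \<open>Consecutive terms need not be comparable, because the spectral cubes are not nested; both are
  compared with a term far enough out.\<close>

lemma gap_summable_limit:
  fixes a :: "nat \<Rightarrow> complex" and A E :: "nat \<Rightarrow> real"
  assumes A0: "\<And>n. 0 \<le> A n" and E0: "\<And>n. 0 \<le> E n" and c0: "c0 \<ge> 0" and c1: "c1 \<ge> 1"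
    and grow: "\<And>n p. A (n + p) \<le> c1 ^ p * A n"
    and step: "\<And>\<mu> p. p \<ge> N \<Longrightarrow> norm (a (\<mu> + p) - a \<mu>) \<le> 2 * c0 * (A (\<mu> + p) * (E (\<mu> + p) + E \<mu>))"
    and sm: "summable (\<lambda>n. A n * E n)"
  obtains L where "a \<longlonglongrightarrow> L" "norm (L - a 0) \<le> 4 * c0 * (1 + c1 ^ (N + 1)) * (\<Sum>n. A n * E n)"
proof -
  define e where "e = (\<lambda>n. A n * E n)"
  define C where "C = c1 ^ (N + 1)"
  have se: "summable e" using sm by (simp add: e_def)
  have e0: "0 \<le> e n" for n unfolding e_def by (rule mult_nonneg_nonneg[OF A0 E0])
  have CN: "c1 ^ N \<le> C" unfolding C_def using c1 by (simp add: mult_le_cancel_right1)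
  \<comment> \<open>a n and a (n + 1) lie N + 1 and N steps below the common index n + N + 1. The
    growth bound trades the weight at that index for the weight at n or at n + 1.\<close>
  have d: "norm (a (Suc n) - a n) \<le> 2 * c0 * (2 * e (n + (N + 1)) + C * e n + C * e (n + 1))" for n
  proof -
    have 1: "norm (a (n + (N + 1)) - a n) \<le> 2 * c0 * (A (n + (N + 1)) * (E (n + (N + 1)) + E n))"
      by (rule step) simp
    have 2: "norm (a (Suc n + N) - a (Suc n)) \<le> 2 * c0 * (A (Suc n + N) * (E (Suc n + N) + E (Suc n)))"
      by (rule step) simp
    have s: "Suc n + N = n + (N + 1)" by simp
    have "A (n + (N + 1)) * E n \<le> C * e n"
      using mult_right_mono[OF grow[of n "N + 1"] E0] by (simp add: C_def e_def mult.assoc)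
    moreover have "A (n + (N + 1)) * E (Suc n) \<le> C * e (n + 1)"
    proof -
      have "A (n + (N + 1)) * E (Suc n) \<le> (c1 ^ N * A (Suc n)) * E (Suc n)"
        using mult_right_mono[OF grow[of "Suc n" N] E0] by (simp only: s)
      also have "\<dots> = c1 ^ N * e (n + 1)" by (simp add: e_def)
      also have "\<dots> \<le> C * e (n + 1)" by (rule mult_right_mono[OF CN e0])
      finally show ?thesis .
    qed
    ultimately have "A (n + (N + 1)) * (E (n + (N + 1)) + E n) + A (n + (N + 1)) * (E (n + (N + 1)) + E (Suc n))
        \<le> 2 * e (n + (N + 1)) + C * e n + C * e (n + 1)"
      by (simp only: distrib_left e_def)
    then have "2 * c0 * (A (n + (N + 1)) * (E (n + (N + 1)) + E n) + A (n + (N + 1)) * (E (n + (N + 1)) + E (Suc n)))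
        \<le> 2 * c0 * (2 * e (n + (N + 1)) + C * e n + C * e (n + 1))"
      using c0 by (intro mult_left_mono) auto
    then
    have 3: "2 * c0 * (A (n + (N + 1)) * (E (n + (N + 1)) + E n)) + 2 * c0 * (A (n + (N + 1)) * (E (n + (N + 1)) + E (Suc n)))
        \<le> 2 * c0 * (2 * e (n + (N + 1)) + C * e n + C * e (n + 1))" by (simp only: distrib_left)
    have "norm (a (Suc n) - a n) \<le> norm (a (n + (N + 1)) - a n) + norm (a (n + (N + 1)) - a (Suc n))"
      using norm_triangle_ineq4[of "a (n + (N + 1)) - a n" "a (n + (N + 1)) - a (Suc n)"] by simp
    then show ?thesis using 1 2 3 unfolding s by linarith
  qed
  let ?b = "\<lambda>n. 2 * c0 * (2 * e (n + (N + 1)) + C * e n + C * e (n + 1))"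
  have i1: "summable (\<lambda>n. e (n + m))" "(\<Sum>n. e (n + m)) \<le> suminf e" for m
  proof -
    show "summable (\<lambda>n. e (n + m))" by (rule summable_ignore_initial_segment[OF se])
    show "(\<Sum>n. e (n + m)) \<le> suminf e"
      using suminf_minus_initial_segment[OF se, of m] sum_nonneg[of "{..<m}" e] e0 by simp
  qed
  have C0: "0 \<le> C" unfolding C_def using c1 by simp
  have b_sums: "?b sums (2 * c0 * (2 * (\<Sum>n. e (n + (N + 1))) + C * suminf e + C * (\<Sum>n. e (n + 1))))"
    by (intro sums_mult sums_add summable_sums i1(1) se)
  then have sb: "summable ?b" by (rule sums_summable)
  have "suminf ?b = 2 * c0 * (2 * (\<Sum>n. e (n + (N + 1))) + C * suminf e + C * (\<Sum>n. e (n + 1)))"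
    using b_sums by (rule sums_unique[symmetric])
  \<comment> \<open>Shifted tails are at most the full sum; 2 c0 (2 + C + C) is the stated 4 c0 (1 +
    C).\<close>
  also have "\<dots> \<le> 2 * c0 * (2 * suminf e + C * suminf e + C * suminf e)"
    using c0 C0 i1(2)[of "N + 1"] i1(2)[of 1] by (intro mult_left_mono add_mono) auto
  also have "\<dots> = 4 * c0 * (1 + C) * suminf e" by (simp add: algebra_simps)
  finally have sum_b: "suminf ?b \<le> 4 * c0 * (1 + C) * suminf e" .
  have sd: "summable (\<lambda>n. a (Suc n) - a n)"
    by (rule summable_comparison_test'[OF sb, of 0]) (rule d)
  define L where "L = a 0 + (\<Sum>n. a (Suc n) - a n)"
  have lim: "a \<longlonglongrightarrow> L"
  proof -
    have "(\<lambda>n. a 0 + (\<Sum>m<n. a (Suc m) - a m)) \<longlonglongrightarrow> L"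
      unfolding L_def by (intro tendsto_add tendsto_const summable_LIMSEQ[OF sd])
    moreover have "a 0 + (\<Sum>m<n. a (Suc m) - a m) = a n" for n
      by (subst sum_lessThan_telescope[of a]) simp
    ultimately show ?thesis by simp
  qed
  have "norm (\<Sum>n. a (Suc n) - a n) \<le> suminf ?b"
    by (rule norm_suminf_le[OF d sb])
  then have "norm (L - a 0) \<le> 4 * c0 * (1 + c1 ^ (N + 1)) * (\<Sum>n. A n * E n)"
    using sum_b by (simp add: L_def C_def e_def)
  with lim show thesis by (rule that)
qed

text \<open>Here \<open>E\<close> only tends to 0 and may fail to be summable. The step estimate
  holds over every distance p \<ge> N with the same weight: two far terms are compared through one
  common later term, which gives convergence, and a far term is compared with the first in one step,
  which leaves only E 0 in the limit.\<close>

lemma gap_const_limit: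
  fixes u :: "nat \<Rightarrow> complex" and E :: "nat \<Rightarrow> real" and a c0 :: real
  assumes a0: "a > 0" and c0: "c0 \<ge> 0" and er0: "E \<longlonglongrightarrow> 0"
    and step: "\<And>\<mu> p. p \<ge> N \<Longrightarrow> norm (u (\<mu> + p) - u \<mu>) \<le> 2 * c0 * (a * (E (\<mu> + p) + E \<mu>))"
  obtains L where "u \<longlonglongrightarrow> L" "norm (L - u 0) \<le> 2 * c0 * a * E 0"
proof -
  have st: "norm (u (m + p) - u m) \<le> 2 * c0 * a * (E (m + p) + E m)" if "p \<ge> N" for m p
    using step[OF that, of m] by (simp add: mult.assoc)
  have "Cauchy u"
  proof (rule CauchyI)
    fix e :: real assume e: "e > 0"
    \<comment> \<open>Two step estimates with two errors each add up to 8 c0 a t; the 1 keeps the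
      quotient defined and the inequality strict.\<close>
    define t where "t = e / (8 * c0 * a + 1)"
    have t: "t > 0" unfolding t_def using e c0 a0 by (intro divide_pos_pos add_nonneg_pos mult_nonneg_nonneg) auto
    obtain n0 where n0: "\<And>n. n \<ge> n0 \<Longrightarrow> E n < t"
      using order_tendstoD(2)[OF er0 t] unfolding eventually_sequentially by blast
    show "\<exists>n0. \<forall>m\<ge>n0. \<forall>n\<ge>n0. norm (u m - u n) < e"
    proof (intro exI[of _ n0] allI impI)
      fix m n assume mn: "m \<ge> n0" "n \<ge> n0"
      have 1: "norm (u (m + (n + N)) - u m) \<le> 2 * c0 * a * (E (m + (n + N)) + E m)" by (rule st) simp
      have 2: "norm (u (n + (m + N)) - u n) \<le> 2 * c0 * a * (E (n + (m + N)) + E n)" by (rule st) simp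
      have s: "n + (m + N) = m + (n + N)" by simp
      have "norm (u m - u n) \<le> norm (u (m + (n + N)) - u n) + norm (u (m + (n + N)) - u m)"
        using norm_triangle_ineq4[of "u (m + (n + N)) - u n" "u (m + (n + N)) - u m"] by simp
      also have "\<dots> \<le> 2 * c0 * a * (t + t) + 2 * c0 * a * (t + t)"
        using c0 a0 mn n0
        by (intro add_mono order_trans[OF 1] order_trans[OF 2[unfolded s]] mult_left_mono) (auto intro!: less_imp_le)
      also have "\<dots> = (8 * c0 * a) * t" by simp
      also have "\<dots> < (8 * c0 * a + 1) * t" using t by (intro mult_strict_right_mono) auto
      also have "\<dots> = e"
      proof -
        have "8 * c0 * a + 1 > 0" using c0 a0 by (intro add_nonneg_pos mult_nonneg_nonneg) auto
        then show ?thesis by (simp add: t_def)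
      qed
      finally show "norm (u m - u n) < e" .
    qed
  qed
  then obtain L where lim: "u \<longlonglongrightarrow> L" using Cauchy_convergent convergent_def by blast
  have "norm (L - u 0) \<le> 2 * c0 * a * (0 + E 0)"
  proof (rule LIMSEQ_le)
    show "(\<lambda>n. norm (u n - u 0)) \<longlonglongrightarrow> norm (L - u 0)" by (intro tendsto_intros lim)
    show "(\<lambda>n. 2 * c0 * a * (E n + E 0)) \<longlonglongrightarrow> 2 * c0 * a * (0 + E 0)" by (intro tendsto_intros er0)
    show "\<exists>n0. \<forall>n\<ge>n0. norm (u n - u 0) \<le> 2 * c0 * a * (E n + E 0)"
      using st[of _ 0] by auto
  qed
  then have "norm (L - u 0) \<le> 2 * c0 * a * E 0" by simp
  with lim show thesis by (rule that)
qed

section \<open>Near-best sequences of one fixed function\<close>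

context
  fixes \<eta> :: "real^'n \<Rightarrow> real" and M :: "real^'n^'n" and \<psi> :: "(real^'n \<Rightarrow> complex) \<Rightarrow> complex"
    and \<alpha> :: "real^'n^'n \<Rightarrow> real" and c0 c1 :: real and F :: "real^'n \<Rightarrow> complex" and T0 :: "nat \<Rightarrow> real^'n \<Rightarrow> complex" and N :: nat
  assumes \<eta>: "cutoff \<eta>" and M: "dilation_matrix M" and \<psi>: "\<exists>g. has_fourier_fun \<psi> g"
    and N_int: "\<And>n. integrable lborel (N_conv \<eta> (mat_power M n) \<psi>)"
    and N_le: "\<And>n. (\<integral>x. norm (N_conv \<eta> (mat_power M n) \<psi> x) \<partial>lborel) \<le> c0 * \<alpha> (mat_power M n)"
    and \<alpha>_pos: "\<And>n. \<alpha> (mat_power M n) > 0" and c0: "c0 \<ge> 0" and c1: "c1 \<ge> 1"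
    and \<alpha>_step: "\<And>n. \<alpha> (mat_power M (Suc n)) \<le> c1 * \<alpha> (mat_power M n)"
    and Fc: "continuous_on UNIV F" and Fb: "bounded (range F)"
    and T0: "\<And>n. T0 n \<in> band (mat_power M n)" "\<And>n x. norm (F x - T0 n x) \<le> 2 * best_err (mat_power M n) F"
    and N: "\<And>k \<mu>. k \<ge> N \<Longrightarrow> spec_cube (mat_power M \<mu>) \<subseteq> spec_cube (mat_power M (\<mu> + k))"
begin

abbreviation (input) "al n \<equiv> \<alpha> (mat_power M n)"
abbreviation (input) "er n \<equiv> best_err (mat_power M n) F"
abbreviation (input) "ker n \<equiv> N_conv \<eta> (mat_power M n) \<psi>"

lemma alpha_growth: "al (n + p) \<le> c1 ^ p * al n"
proof (induction p)
  case (Suc p)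
  have "al (n + Suc p) \<le> c1 * al (n + p)" using \<alpha>_step[of "n + p"] by simp
  also have "\<dots> \<le> c1 * (c1 ^ p * al n)" using Suc c1 by (intro mult_left_mono) auto
  finally show ?case by (simp add: mult.assoc)
qed simp

lemma det_power_nz: "det (mat_power M n) \<noteq> 0"
  using dilation_det_nz[OF M] by (simp add: det_mat_power)

lemma conv_ker_diff:
  assumes T: "T \<in> band A" and T': "T' \<in> band A'" and d: "\<And>x. norm (F x - T x) \<le> d" "\<And>x. norm (F x - T' x) \<le> d'"
  shows "norm (conv (ker n) T x - conv (ker n) T' x) \<le> c0 * al n * (d + d')"
proof -
  obtain C where C: "\<And>x. norm (T x) \<le> C" using band_bounded[OF T] by blast
  obtain C' where C': "\<And>x. norm (T' x) \<le> C'" using band_bounded[OF T'] by blast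
  have m: "T \<in> borel_measurable borel" "T' \<in> borel_measurable borel"
    using bandD(1)[OF T] bandD(1)[OF T'] by (auto intro: borel_measurable_continuous_onI)
  have "norm (T y - T' y) \<le> d + d'" for y
    using norm_triangle_ineq4[of "F y - T' y" "F y - T y"] d(1)[of y] d(2)[of y] by simp
  then have "norm (conv (ker n) (\<lambda>x. T x - T' x) x) \<le> (d + d') * (\<integral>x. norm (ker n x) \<partial>lborel)"
    using m by (intro norm_conv_le[OF N_int]) auto
  also have "\<dots> \<le> (d + d') * (c0 * al n)"
  proof (rule mult_left_mono[OF N_le])
    have "0 \<le> d" using d(1)[of 0] norm_ge_zero order_trans by blast
    moreover have "0 \<le> d'" using d(2)[of 0] norm_ge_zero order_trans by blast
    ultimately show "0 \<le> d + d'" by simp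
  qed
  finally show ?thesis by (simp only: conv_diff_right[OF N_int m(1) C m(2) C'] mult.commute)
qed

lemma near_best_T0: "near_best M F 1 T0"
  unfolding near_best_def
proof (intro exI[of _ 2] allI conjI)
  fix \<mu>
  show "T0 \<mu> \<in> band (1 *\<^sub>R mat_power M \<mu>)" using T0(1) by simp
  have "sup_norm (\<lambda>x. F x - T0 \<mu> x) \<le> ennreal (2 * er \<mu>)"
    using T0(2) by (subst sup_norm_le_iff) (auto simp: best_err_nonneg)
  also have "\<dots> = ennreal 2 * ennreal (er \<mu>)" by (rule ennreal_mult) (auto simp: best_err_nonneg)
  finally show "sup_norm (\<lambda>x. F x - T0 \<mu> x) \<le> ennreal 2 * best_approx (1 *\<^sub>R mat_power M \<mu>) F"
    by (simp add: best_approx_eq[OF Fb])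
qed

lemma conv_ker_commute:
  assumes "T \<in> band A"
  shows "conv T (ker n) = conv (ker n) T"
  using borel_measurable_integrable[OF N_int[of n]] borel_measurable_continuous_onI[OF bandD(1)[OF assms]]
  by (intro conv_commute) auto

text \<open>Every admissible sequence is compared with \<open>T0\<close>. For p large the shrunken
  cube at level \<mu> + p contains the cube at level \<mu>, so T (\<mu> + p) is as close to
  \<open>F\<close> as a multiple of the error at \<mu>, and the growth of \<alpha> over p steps
  costs the factor \<open>c1 ^ p\<close>. The difference is thus controlled by terms of \<alpha> E,
  which tend to 0. Uniqueness comes from \<open>T0\<close> being admissible with \<delta> =
  1.\<close>

lemma pairing0_eq:
  assumes e0: "(\<lambda>n. al n * er n) \<longlonglongrightarrow> 0"
    and L: "(\<lambda>n. conv (ker n) (T0 n) (- lattice_vec k)) \<longlonglongrightarrow> L"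
  shows "pairing0 \<eta> M F \<psi> k = L"
  unfolding pairing0_def
proof (rule the_equality)
  let ?P = "\<lambda>L. \<forall>\<delta> T. 0 < \<delta> \<and> \<delta> \<le> 1 \<and> near_best M F \<delta> T \<longrightarrow>
     (\<lambda>\<mu>. conv (T \<mu>) (ker \<mu>) (- lattice_vec k)) \<longlonglongrightarrow> L"
  show "?P L"
  proof (intro allI impI, elim conjE)
    fix \<delta> T assume \<delta>: "0 < \<delta>" "\<delta> \<le> 1" and nb: "near_best M F \<delta> T"
    obtain c where c: "c \<ge> 0" "\<And>\<mu>. T \<mu> \<in> band (\<delta> *\<^sub>R mat_power M \<mu>)"
      "\<And>\<mu> x. norm (F x - T \<mu> x) \<le> c * best_err (\<delta> *\<^sub>R mat_power M \<mu>) F"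
      using near_bestD[OF nb Fb] by blast
    obtain p where p: "\<And>k \<mu>. k \<ge> p \<Longrightarrow> spec_cube (mat_power M \<mu>) \<subseteq> spec_cube (\<delta> *\<^sub>R mat_power M (\<mu> + k))"
      using dilation_spec_cube[OF M \<delta>(1)] by blast
    have er: "best_err (\<delta> *\<^sub>R mat_power M (\<mu> + p)) F \<le> er \<mu>" for \<mu>
      by (rule best_err_antimono[OF Fb band_mono[OF p]]) simp
    have T1: "norm (F x - T (\<mu> + p) x) \<le> c * er \<mu>" for \<mu> x
      using c(3)[of x "\<mu> + p"] mult_left_mono[OF er[of \<mu>] c(1)] by linarith
    let ?a = "\<lambda>n. conv (ker n) (T0 n) (- lattice_vec k)" let ?b = "\<lambda>n. conv (ker n) (T n) (- lattice_vec k)"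
    have bd: "norm (?b (\<mu> + p) - ?a (\<mu> + p)) \<le> c0 * (c * c1 ^ p) * (al \<mu> * er \<mu>) + 2 * c0 * (al (\<mu> + p) * er (\<mu> + p))" for \<mu>
    proof -
      have "norm (?b (\<mu> + p) - ?a (\<mu> + p)) \<le> c0 * al (\<mu> + p) * (c * er \<mu> + 2 * er (\<mu> + p))"
        by (rule conv_ker_diff[OF c(2) T0(1) T1 T0(2)])
      also have "\<dots> = c0 * (c * er \<mu>) * al (\<mu> + p) + 2 * c0 * (al (\<mu> + p) * er (\<mu> + p))"
        by (simp add: algebra_simps)
      also have "c0 * (c * er \<mu>) * al (\<mu> + p) \<le> c0 * (c * er \<mu>) * (c1 ^ p * al \<mu>)"
        by (intro mult_left_mono alpha_growth mult_nonneg_nonneg c0 c(1) best_err_nonneg)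
      finally show ?thesis by (simp add: mult_ac)
    qed
    have "(\<lambda>\<mu>. c0 * (c * c1 ^ p) * (al \<mu> * er \<mu>) + 2 * c0 * (al (\<mu> + p) * er (\<mu> + p))) \<longlonglongrightarrow> c0 * (c * c1 ^ p) * 0 + 2 * c0 * 0"
      by (intro tendsto_add tendsto_mult tendsto_const e0 LIMSEQ_ignore_initial_segment[OF e0])
    then have w0: "(\<lambda>\<mu>. c0 * (c * c1 ^ p) * (al \<mu> * er \<mu>) + 2 * c0 * (al (\<mu> + p) * er (\<mu> + p))) \<longlonglongrightarrow> 0"
      by (simp only: mult_zero_right add_0_right)
    have "(\<lambda>\<mu>. ?b (\<mu> + p) - ?a (\<mu> + p)) \<longlonglongrightarrow> 0"
      by (rule Lim_null_comparison[OF always_eventually[OF allI[OF bd]] w0])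
    from tendsto_add[OF this LIMSEQ_ignore_initial_segment[OF L, of p]]
    have "(\<lambda>\<mu>. ?b (\<mu> + p)) \<longlonglongrightarrow> L" by (simp only: diff_add_cancel add_0_left)
    then have "?b \<longlonglongrightarrow> L" by (rule LIMSEQ_offset)
    then show "(\<lambda>\<mu>. conv (T \<mu>) (ker \<mu>) (- lattice_vec k)) \<longlonglongrightarrow> L"
      by (simp only: conv_ker_commute[OF c(2)])
  qed
  fix L' assume P': "?P L'"
  have "(\<lambda>\<mu>. conv (T0 \<mu>) (ker \<mu>) (- lattice_vec k)) \<longlonglongrightarrow> L'"
    by (rule mp[OF spec[OF spec[OF P', of 1], of T0]]) (intro conjI near_best_T0 zero_less_one order_refl)
  then have "(\<lambda>\<mu>. conv (ker \<mu>) (T0 \<mu>) (- lattice_vec k)) \<longlonglongrightarrow> L'"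
    by (simp only: conv_ker_commute[OF T0(1)])
  then show "L' = L" using L by (rule LIMSEQ_unique)
qed

text \<open>For p \<ge> N the kernel at \<mu> may be replaced on T0 \<mu> by the one at \<mu> + p;
  then both terms share one kernel and only the distance of the two approximants is left.\<close>

lemma conv_ker_step:
  assumes "p \<ge> N"
  shows "norm (conv (ker (\<mu> + p)) (T0 (\<mu> + p)) x - conv (ker \<mu>) (T0 \<mu>) x) \<le> 2 * c0 * (al (\<mu> + p) * (er (\<mu> + p) + er \<mu>))"
proof -
  have eq: "conv (ker \<mu>) (T0 \<mu>) x = conv (ker (\<mu> + p)) (T0 \<mu>) x"
    by (rule conv_N_conv_eq[OF \<eta> \<psi> det_power_nz det_power_nz T0(1) N[OF assms] N_int N_int])
  have "norm (conv (ker (\<mu> + p)) (T0 (\<mu> + p)) x - conv (ker (\<mu> + p)) (T0 \<mu>) x) \<le> c0 * al (\<mu> + p) * (2 * er (\<mu> + p) + 2 * er \<mu>)"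
    by (rule conv_ker_diff[OF T0(1) T0(1) T0(2) T0(2)])
  then show ?thesis unfolding eq by (simp add: algebra_simps)
qed

lemma pairing0_summable:
  assumes sm: "summable (\<lambda>n. al n * er n)"
  shows "norm (pairing0 \<eta> M F \<psi> k - conv (ker 0) (T0 0) (- lattice_vec k)) \<le> 4 * c0 * (1 + c1 ^ (N + 1)) * (\<Sum>n. al n * er n)"
proof -
  obtain L where L: "(\<lambda>n. conv (ker n) (T0 n) (- lattice_vec k)) \<longlonglongrightarrow> L"
    "norm (L - conv (ker 0) (T0 0) (- lattice_vec k)) \<le> 4 * c0 * (1 + c1 ^ (N + 1)) * (\<Sum>n. al n * er n)"
    by (rule gap_summable_limit[where A="\<lambda>n. al n" and E="\<lambda>n. er n" and N=N and a="\<lambda>n. conv (ker n) (T0 n) (- lattice_vec k)", OF less_imp_le[OF \<alpha>_pos] best_err_nonneg c0 c1 alpha_growth conv_ker_step sm])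
  have "pairing0 \<eta> M F \<psi> k = L"
    by (rule pairing0_eq[OF summable_LIMSEQ_zero[OF sm] L(1)])
  then show ?thesis using L(2) by simp
qed

lemma pairing0_const:
  assumes al: "\<And>n. al n = a" and er0: "er \<longlonglongrightarrow> 0"
  shows "norm (pairing0 \<eta> M F \<psi> k - conv (ker 0) (T0 0) (- lattice_vec k)) \<le> 2 * c0 * a * er 0"
proof -
  have a0: "a > 0" using \<alpha>_pos[of 0] unfolding al .
  obtain L where L: "(\<lambda>n. conv (ker n) (T0 n) (- lattice_vec k)) \<longlonglongrightarrow> L"
    "norm (L - conv (ker 0) (T0 0) (- lattice_vec k)) \<le> 2 * c0 * a * er 0"
    by (rule gap_const_limit[where E="\<lambda>n. er n" and N=N and u="\<lambda>n. conv (ker n) (T0 n) (- lattice_vec k)", OF a0 c0 er0 conv_ker_step[unfolded al]])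
  have "(\<lambda>n. al n * er n) \<longlonglongrightarrow> 0" unfolding al using tendsto_mult[OF tendsto_const er0, of a] by simp
  from pairing0_eq[OF this L(1)] show ?thesis using L(2) by simp
qed

end

subsection \<open>Convergence of the best approximations\<close>

text \<open>A symbol composed with the inverse transpose of \<open>A\<close> has its kernel composed
  with \<open>A\<close> and normalized so as to keep its integral, so convolution with it commutes
  with the dilation. By this rule both the smoothing means and the differential operator are brought
  to scale zero.\<close>

lemma matrix_scaling:
  fixes A :: "real^'n^'n" and l :: "real^'n \<Rightarrow> complex"
  assumes A: "det A \<noteq> 0" and lm: "l \<in> borel_measurable borel"
  shows "integrable lborel l \<Longrightarrow> integrable lborel (\<lambda>\<xi>. l (matrix_inv (transpose A) *v \<xi>))"
    and "integrable lborel (inv_fourier l) \<Longrightarrow> integrable lborel (inv_fourier (\<lambda>\<xi>. l (matrix_inv (transpose A) *v \<xi>)))"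
    and "T \<in> borel_measurable borel \<Longrightarrow>
      conv (inv_fourier (\<lambda>\<xi>. l (matrix_inv (transpose A) *v \<xi>))) T x = conv (inv_fourier l) (\<lambda>y. T (matrix_inv A *v y)) (A *v x)"
proof -
  note [measurable] = lm
  have At: "det (transpose A) \<noteq> 0" using A by (simp add: det_transpose)
  obtain c where c: "c > 0"
    "\<And>f :: real^'n \<Rightarrow> complex. f \<in> borel_measurable borel \<Longrightarrow> (\<integral>x. f (A *v x) \<partial>lborel) = c *\<^sub>R (\<integral>x. f x \<partial>lborel)"
    "\<And>f :: real^'n \<Rightarrow> complex. f \<in> borel_measurable borel \<Longrightarrow> integrable lborel (\<lambda>x. f (A *v x)) \<longleftrightarrow> integrable lborel f"
    "\<And>f :: real^'n \<Rightarrow> complex. f \<in> borel_measurable borel \<Longrightarrow>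
       (\<integral>x. f (matrix_inv (transpose A) *v x) \<partial>lborel) = (1 / c) *\<^sub>R (\<integral>x. f x \<partial>lborel)"
    "\<And>f :: real^'n \<Rightarrow> complex. f \<in> borel_measurable borel \<Longrightarrow>
       integrable lborel (\<lambda>x. f (matrix_inv (transpose A) *v x)) \<longleftrightarrow> integrable lborel f"
    using lborel_integral_matrix[OF A] by blast
  let ?m = "\<lambda>\<xi>. l (matrix_inv (transpose A) *v \<xi>)"
  have mm: "?m \<in> borel_measurable borel" by measurable
  show "integrable lborel l \<Longrightarrow> integrable lborel ?m" using c(5)[OF lm] by blast
  have Im: "inv_fourier ?m = (\<lambda>x. (1 / c) *\<^sub>R inv_fourier l (A *v x))"
  proof
    fix x
    have "x \<bullet> \<xi> = (A *v x) \<bullet> (matrix_inv (transpose A) *v \<xi>)" for \<xi>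
    proof -
      have "(A *v x) \<bullet> (matrix_inv (transpose A) *v \<xi>) = (matrix_inv (transpose A) *v \<xi>) \<bullet> (A *v x)" by (rule inner_commute)
      also have "\<dots> = \<xi> \<bullet> x" by (simp only: inner_matrix_vector matrix_inv_vector[OF At])
      finally show ?thesis by (simp add: inner_commute)
    qed
    then have "inv_fourier ?m x = (\<integral>\<xi>. l (matrix_inv (transpose A) *v \<xi>) * cis (2 * pi * ((A *v x) \<bullet> (matrix_inv (transpose A) *v \<xi>))) \<partial>lborel)"
      by (subst inv_fourier_eq[OF mm]) simp
    also have "\<dots> = (1 / c) *\<^sub>R (\<integral>\<xi>. l \<xi> * cis (2 * pi * ((A *v x) \<bullet> \<xi>)) \<partial>lborel)"
      by (rule c(4)[of "\<lambda>\<xi>. l \<xi> * cis (2 * pi * ((A *v x) \<bullet> \<xi>))"]) measurable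
    finally show "inv_fourier ?m x = (1 / c) *\<^sub>R inv_fourier l (A *v x)" by (simp only: inv_fourier_eq[OF lm])
  qed
  show "integrable lborel (inv_fourier l) \<Longrightarrow> integrable lborel (inv_fourier ?m)"
    unfolding Im using c(3)[OF borel_measurable_inv_fourier[OF lm]] by (intro integrable_scaleR_right) blast
  assume Tm[measurable]: "T \<in> borel_measurable borel"
  let ?f = "\<lambda>y. inv_fourier l (A *v x - y) * T (matrix_inv A *v y)"
  have "conv (inv_fourier ?m) T x = (\<integral>y. inv_fourier ?m (x - y) * T y \<partial>lborel)"
    by (rule conv_eq[OF borel_measurable_inv_fourier[OF mm] Tm])
  also have "\<dots> = (\<integral>y. (1 / c) *\<^sub>R ?f (A *v y) \<partial>lborel)"
    unfolding Im by (simp add: matrix_inv_vector[OF A] matrix_vector_mult_diff_distrib)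
  also have "\<dots> = (1 / c) *\<^sub>R c *\<^sub>R (\<integral>y. ?f y \<partial>lborel)"
    unfolding integral_scaleR_right by (subst c(2)) auto
  also have "\<dots> = (\<integral>y. ?f y \<partial>lborel)" using c(1) by simp
  also have "\<dots> = conv (inv_fourier l) (\<lambda>y. T (matrix_inv A *v y)) (A *v x)"
    by (subst conv_eq) auto
  finally show "conv (inv_fourier ?m) T x = conv (inv_fourier l) (\<lambda>y. T (matrix_inv A *v y)) (A *v x)" .
qed

lemma norm_matrix_vector_le:
  fixes A :: "real^'n^'m"
  shows "norm (A *v y) \<le> (\<Sum>i\<in>UNIV. \<Sum>j\<in>UNIV. \<bar>A $ i $ j\<bar>) * norm y"
proof -
  have "norm (A *v y) \<le> (\<Sum>i\<in>UNIV. \<bar>(A *v y) $ i\<bar>)" by (rule norm_le_l1_cart)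
  also have "\<dots> \<le> (\<Sum>i\<in>UNIV. \<Sum>j\<in>UNIV. \<bar>A $ i $ j\<bar> * norm y)"
  proof (rule sum_mono)
    fix i
    have "\<bar>(A *v y) $ i\<bar> \<le> (\<Sum>j\<in>UNIV. \<bar>A $ i $ j * y $ j\<bar>)"
      unfolding matrix_vector_mult_def by (simp add: sum_abs)
    also have "\<dots> \<le> (\<Sum>j\<in>UNIV. \<bar>A $ i $ j\<bar> * norm y)"
      unfolding abs_mult by (intro sum_mono mult_left_mono component_le_norm_cart) auto
    finally show "\<bar>(A *v y) $ i\<bar> \<le> (\<Sum>j\<in>UNIV. \<bar>A $ i $ j\<bar> * norm y)" .
  qed
  finally show ?thesis by (simp add: sum_distrib_right)
qed

lemma tail_integral_tendsto_0:
  fixes V :: "real^'n \<Rightarrow> complex"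
  assumes V: "integrable lborel V"
  shows "(\<lambda>m. \<integral>y. norm (V y) * indicator (- cball 0 (real m)) y \<partial>lborel) \<longlonglongrightarrow> 0"
proof -
  have "(\<lambda>m. \<integral>y. norm (V y) * indicator (- cball 0 (real m)) y \<partial>lborel) \<longlonglongrightarrow> (\<integral>y. 0 \<partial>(lborel :: (real^'n) measure))"
  proof (rule integral_dominated_convergence[where w="\<lambda>y. norm (V y)"])
    show "AE y in lborel. (\<lambda>m. norm (V y) * indicator (- cball 0 (real m)) y) \<longlonglongrightarrow> 0"
    proof (rule AE_I2)
      fix y :: "real^'n"
      obtain m0 :: nat where m0: "norm y \<le> real m0" using real_arch_simple by blast
      have "\<forall>\<^sub>F m in sequentially. norm (V y) * indicator (- cball 0 (real m)) y = 0"
        using eventually_ge_at_top[of m0]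
      proof eventually_elim
        case (elim m)
        then have "norm y \<le> real m" using m0 by linarith
        then show ?case by simp
      qed
      then show "(\<lambda>m. norm (V y) * indicator (- cball 0 (real m)) y) \<longlonglongrightarrow> 0" by (rule tendsto_eventually)
    qed
    show "AE y in lborel. norm (norm (V y) * indicator (- cball 0 (real m)) y) \<le> norm (V y)" for m
      by (rule AE_I2) (simp add: indicator_def)
    have "- cball (0::real^'n) (real m) \<in> sets borel" for m by simp
    then show "(\<lambda>y. norm (V y) * indicator (- cball 0 (real m)) y) \<in> borel_measurable lborel" for m
      using V by (intro borel_measurable_times borel_measurable_indicator) auto
  qed (use V in auto)
  then show ?thesis by simp
qed

text \<open>Compare \<open>F\<close> with its mean against a kernel of integral 1 dilated by M^n.
  The mean is band-limited to the required cube, and F(x) minus the mean is the integral of V(y)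
  (F(x) - F(x - M^(-n) y)): on bounded y uniform continuity applies because M^(-n) tends to 0, and
  elsewhere the tail of \<open>V\<close> is small.\<close>

theorem best_err_tendsto_0:
  fixes F :: "real^'n \<Rightarrow> complex"
  assumes \<eta>: "cutoff (\<eta> :: real^'n \<Rightarrow> real)" and M: "dilation_matrix M" and F: "F \<in> BUC"
  shows "(\<lambda>n. best_err (mat_power M n) F) \<longlonglongrightarrow> 0"
proof -
  have Fu: "uniformly_continuous_on UNIV F" and Fb: "bounded (range F)" using F by (auto simp: BUC_def)
  have Fc: "continuous_on UNIV F" by (rule uniformly_continuous_imp_continuous[OF Fu])
  have Fm[measurable]: "F \<in> borel_measurable borel" using Fc by (rule borel_measurable_continuous_onI)
  obtain B where B: "\<And>x. norm (F x) \<le> B" using Fb by (auto simp: bounded_iff)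
  have B0: "0 \<le> B" using B[of 0] norm_ge_zero order_trans by blast
  note cf = cutoff_test_function[OF \<eta>]
  \<comment> \<open>The cut-off lives on twice the cube; the factor 2 in its argument brings the
    support into the cube itself, and v 0 = 1 normalizes the kernel.\<close>
  define v where "v = (\<lambda>\<xi>. complex_of_real (\<eta> (0 + 2 *\<^sub>R \<xi>)))"
  have vs: "smooth_on UNIV v" unfolding v_def
    by (rule smooth_on_affine[of "\<lambda>\<xi>. complex_of_real (\<eta> \<xi>)"]) (use cf(1) in \<open>simp add: test_functions_def\<close>)
  have vz: "v \<xi> = 0" if "\<xi> \<notin> unit_cube" for \<xi>
  proof -
    have "0 + 2 *\<^sub>R \<xi> \<notin> (\<lambda>y. 2 *\<^sub>R y) ` unit_cube" using that by auto
    from cf(2)[OF this] show ?thesis by (simp add: v_def)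
  qed
  obtain R0 where R0: "\<And>\<xi> :: real^'n. \<xi> \<in> unit_cube \<Longrightarrow> norm \<xi> \<le> R0"
    using compact_imp_bounded[OF compact_unit_cube] unfolding bounded_iff by blast
  have vt: "v \<in> test_functions"
  proof (rule test_functionI(1)[OF vs, of 0 R0])
    show "v x = 0" if "x \<notin> cball 0 R0" for x using vz[of x] R0[of x] that by (cases "x \<in> unit_cube") (auto simp: not_le)
  qed
  have vi: "integrable lborel v" using integrable_partials[OF vt, of "[]"] by simp
  have vm: "v \<in> borel_measurable borel" using vi by auto
  have vc: "continuous_on UNIV v" using continuous_on_partials[OF vs, of "[]"] by simp
  define V where "V = inv_fourier v"
  have Vi: "integrable lborel V" unfolding V_def by (rule integrable_inv_fourier_test[OF vt])
  have Vm[measurable]: "V \<in> borel_measurable borel" using Vi by auto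
  have V1: "(\<integral>y. V y \<partial>lborel) = 1"
  proof -
    obtain Bv where Bv: "\<And>x. norm (v x) \<le> Bv" using bounded_continuous_compact_support[OF vc compact_unit_cube vz] by metis
    have "fourier V 0 = v 0" unfolding V_def by (rule fourier_inversion[OF vi vc Bv]) (use Vi in \<open>simp add: V_def\<close>)
    moreover have "v 0 = 1" using cf(3)[of 0] by (simp add: v_def unit_cube_def)
    ultimately show ?thesis by (simp add: fourier_eq)
  qed
  define J where "J = (\<integral>y. norm (V y) \<partial>lborel)"
  have J0: "0 \<le> J" unfolding J_def by (intro integral_nonneg_AE) auto
  have claim: "\<exists>n0. \<forall>n\<ge>n0. best_err (mat_power M n) F \<le> e" if e: "e > 0" for e
  proof -
    \<comment> \<open>The allowance e is split evenly: e1 against the norm \<open>J\<close> of the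
      kernel for bounded y, and t below against the oscillation 2 B for the tail.\<close>
    define e1 where "e1 = e / (2 * (J + 1))"
    have e1: "e1 > 0" "e1 * J \<le> e / 2"
    proof -
      show "e1 > 0" unfolding e1_def using e J0 by (intro divide_pos_pos) auto
      then have "e1 * J \<le> e1 * (J + 1)" by simp
      also have "\<dots> = e / 2" using J0 by (simp add: e1_def field_simps)
      finally show "e1 * J \<le> e / 2" .
    qed
    define t where "t = e / (4 * (B + 1))"
    have t: "t > 0" "2 * B * t \<le> e / 2"
    proof -
      show "t > 0" unfolding t_def using e B0 by (intro divide_pos_pos) auto
      then have "2 * B * t \<le> 2 * (B + 1) * t" by (simp add: mult_right_mono)
      also have "\<dots> = e / 2" using B0 by (simp add: t_def field_simps)
      finally show "2 * B * t \<le> e / 2" .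
    qed
    obtain m :: nat where m: "(\<integral>y. norm (V y) * indicator (- cball 0 (real m)) y \<partial>lborel) < t"
      using order_tendstoD(2)[OF tail_integral_tendsto_0[OF Vi] t(1)] unfolding eventually_sequentially by blast
    obtain d where d: "d > 0" "\<And>x x'. dist x' x < d \<Longrightarrow> dist (F x') (F x) < e1"
      using Fu e1(1) unfolding uniformly_continuous_on_def by (metis UNIV_I)
    define s where "s = (\<lambda>n. \<Sum>i\<in>UNIV. \<Sum>j\<in>UNIV. \<bar>matrix_inv (mat_power M n) $ i $ j\<bar>)"
    have s0: "0 \<le> s n" for n unfolding s_def by (intro sum_nonneg) auto
    have "s \<longlonglongrightarrow> (\<Sum>i\<in>(UNIV::'n set). \<Sum>j\<in>(UNIV::'n set). \<bar>0\<bar>)"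
      unfolding s_def by (intro tendsto_sum tendsto_rabs dilation_inverse_powers_tendsto_0[OF M])
    then have "s \<longlonglongrightarrow> 0" by simp
    from order_tendstoD(2)[OF this, of "d / (real m + 1)"] d(1)
    obtain n0 where n0: "\<And>n. n \<ge> n0 \<Longrightarrow> s n < d / (real m + 1)"
      unfolding eventually_sequentially by auto
    have "best_err (mat_power M n) F \<le> e" if n: "n \<ge> n0" for n
    proof -
      define A where "A = mat_power M n"
      have A: "det A \<noteq> 0" unfolding A_def using dilation_det_nz[OF M] by (simp add: det_mat_power)
      let ?l = "\<lambda>\<xi>. v (matrix_inv (transpose A) *v \<xi>)"
      have li: "integrable lborel ?l" by (rule matrix_scaling(1)[OF A vm vi])
      have Li: "integrable lborel (inv_fourier ?l)" by (rule matrix_scaling(2)[OF A vm]) (use Vi in \<open>simp add: V_def\<close>)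
      have lz: "?l \<xi> = 0" if "\<xi> \<notin> spec_cube A" for \<xi> using that vz unfolding spec_cube_iff[OF A] by simp
      have Sb: "conv (inv_fourier ?l) F \<in> band A" by (rule band_conv[OF li lz Li Fc B])
      have "norm (F x - conv (inv_fourier ?l) F x) \<le> e" for x
      proof -
        let ?F = "\<lambda>y. F (matrix_inv A *v y)"
        have Fm2: "?F \<in> borel_measurable borel" by measurable
        have "conv (inv_fourier ?l) F x = conv V ?F (A *v x)"
          unfolding V_def by (rule matrix_scaling(3)[OF A vm Fm])
        also have "\<dots> = (\<integral>y. V y * F (x - matrix_inv A *v y) \<partial>lborel)"
          unfolding conv_eq'[OF Vm Fm2] by (simp add: matrix_vector_mult_diff_distrib matrix_inv_vector[OF A])
        finally have Sx: "conv (inv_fourier ?l) F x = (\<integral>y. V y * F (x - matrix_inv A *v y) \<partial>lborel)" .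
        have i1: "integrable lborel (\<lambda>y. V y * F (x - matrix_inv A *v y))"
          by (rule integrable_bounded_mult[OF Vi _ B]) measurable
        have i2: "integrable lborel (\<lambda>y. V y * F x)" using Vi by simp
        have i3: "integrable lborel (\<lambda>y. norm (V y) * indicator (- cball 0 (real m)) y)"
          by (rule Bochner_Integration.integrable_bound[OF integrable_norm[OF Vi]])
            (auto simp: indicator_def intro!: borel_measurable_times borel_measurable_indicator)
        have "F x - conv (inv_fourier ?l) F x = (\<integral>y. V y * F x \<partial>lborel) - (\<integral>y. V y * F (x - matrix_inv A *v y) \<partial>lborel)"
          unfolding Sx using V1 by simp
        also have "\<dots> = (\<integral>y. V y * F x - V y * F (x - matrix_inv A *v y) \<partial>lborel)"
          by (rule Bochner_Integration.integral_diff[OF i2 i1, symmetric])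
        also have "norm \<dots> \<le> (\<integral>y. norm (V y * F x - V y * F (x - matrix_inv A *v y)) \<partial>lborel)" by simp
        also have "\<dots> \<le> (\<integral>y. norm (V y) * e1 + 2 * B * (norm (V y) * indicator (- cball 0 (real m)) y) \<partial>lborel)"
        proof (rule integral_mono)
          show "integrable lborel (\<lambda>y. norm (V y * F x - V y * F (x - matrix_inv A *v y)))"
            by (intro integrable_norm Bochner_Integration.integrable_diff i1 i2)
          show "integrable lborel (\<lambda>y. norm (V y) * e1 + 2 * B * (norm (V y) * indicator (- cball 0 (real m)) y))"
            by (intro Bochner_Integration.integrable_add integrable_mult_left integrable_mult_right i3 integrable_norm Vi)
          fix y :: "real^'n"
          have eq: "norm (V y * F x - V y * F (x - matrix_inv A *v y)) = norm (V y) * norm (F x - F (x - matrix_inv A *v y))"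
            by (simp only: right_diff_distrib[symmetric] norm_mult)
          have "norm (F x - F (x - matrix_inv A *v y)) \<le> e1 + 2 * B * indicator (- cball 0 (real m)) y"
          proof (cases "norm y \<le> real m")
            case True
            have "norm (matrix_inv A *v y) \<le> s n * norm y"
              unfolding s_def A_def by (rule norm_matrix_vector_le)
            also have "\<dots> \<le> s n * (real m + 1)" using True s0 by (intro mult_left_mono) auto
            also have "\<dots> < d" using n0[OF n] by (simp add: pos_less_divide_eq)
            finally have "dist x (x - matrix_inv A *v y) < d" by (simp add: dist_norm)
            from d(2)[OF this] show ?thesis using True by (simp add: dist_norm)
          next
            case False
            have "norm (F x - F (x - matrix_inv A *v y)) \<le> B + B"
              by (rule order_trans[OF norm_triangle_ineq4 add_mono[OF B B]])
            then show ?thesis using False e1(1) by simp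
          qed
          then have "norm (V y) * norm (F x - F (x - matrix_inv A *v y)) \<le> norm (V y) * (e1 + 2 * B * indicator (- cball 0 (real m)) y)"
            by (rule mult_left_mono) simp
          then show "norm (V y * F x - V y * F (x - matrix_inv A *v y)) \<le> norm (V y) * e1 + 2 * B * (norm (V y) * indicator (- cball 0 (real m)) y)"
            unfolding eq by (simp only: distrib_left mult_ac)
        qed
        also have "\<dots> = J * e1 + 2 * B * (\<integral>y. norm (V y) * indicator (- cball 0 (real m)) y \<partial>lborel)"
          using i3 Vi by (simp add: J_def)
        also have "\<dots> \<le> e / 2 + 2 * B * t"
          using e1(2) m B0 by (intro add_mono mult_left_mono) (auto simp: mult.commute)
        also have "\<dots> \<le> e" using t(2) by linarith
        finally show ?thesis .
      qed
      then show ?thesis using best_err_le[OF Fb Sb] e unfolding A_def by (simp add: less_imp_le)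
    qed
    then show ?thesis by blast
  qed
  show ?thesis
  proof (rule LIMSEQ_I)
    fix r :: real assume r: "r > 0"
    then obtain n0 where "\<And>n. n \<ge> n0 \<Longrightarrow> best_err (mat_power M n) F \<le> r / 2" using claim[of "r / 2"] by auto
    then show "\<exists>n0. \<forall>n\<ge>n0. norm (best_err (mat_power M n) F - 0) < r"
      using r by (intro exI[of _ n0]) (force simp: best_err_nonneg)
  qed
qed

subsection \<open>The differential operator at scale zero\<close>

lemma mat_1_facts:
  "matrix_inv (mat 1 :: real^'n^'n) = mat 1" "spec_cube (mat 1 :: real^'n^'n) = unit_cube"
  "cutoff_scaled \<eta> (mat 1 :: real^'n^'n) \<xi> = complex_of_real (\<eta> \<xi>)"
proof -
  show i: "matrix_inv (mat 1 :: real^'n^'n) = mat 1" by (rule matrix_inv_unique) simp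
  show "spec_cube (mat 1 :: real^'n^'n) = unit_cube" by (simp add: transpose_mat del: transpose_matrix_vector)
  show "cutoff_scaled \<eta> (mat 1 :: real^'n^'n) \<xi> = complex_of_real (\<eta> \<xi>)"
    by (simp add: cutoff_scaled_def transpose_mat i del: transpose_matrix_vector)
qed

text \<open>\<open>wiener\<close> is stated with the exponential of i(x, \<xi>), while
  \<open>fourier\<close> carries -2 pi i. The substitution by -2 pi turns one into the other, and (2
  pi)^n offsets its Jacobian.\<close>

lemma wiener_fourier_form:
  fixes w :: "real^'n \<Rightarrow> complex"
  assumes "w \<in> wiener"
  obtains \<kappa> where "integrable lborel \<kappa>" "fourier \<kappa> = w"
proof -
  obtain W where W: "integrable lebesgue W" "\<And>\<xi>. w \<xi> = (\<integral>\<zeta>. W \<zeta> * cis (\<xi> \<bullet> \<zeta>) \<partial>lebesgue)"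
    using assms by (auto simp: wiener_def)
  obtain U where U: "U \<in> borel_measurable borel" "AE x in lebesgue. W x = U x"
    using lebesgue_borel_representative[OF borel_measurable_integrable[OF W(1)]] by blast
  note [measurable] = U(1)
  have Ul: "U \<in> borel_measurable lebesgue" using U(1) by (simp add: measurable_completion)
  have "integrable lebesgue U"
    using integrable_cong_AE[OF borel_measurable_integrable[OF W(1)] Ul U(2)] W(1) by simp
  then have Ui: "integrable lborel U" using U(1) by (simp add: integrable_lebesgue_borel)
  have cm: "(\<lambda>\<zeta>. cis (\<xi> \<bullet> \<zeta>)) \<in> borel_measurable borel" for \<xi> :: "real^'n"
    using measurable_cis_inner(1)[of 1 \<xi>] by simp
  have wU: "w \<xi> = (\<integral>\<zeta>. U \<zeta> * cis (\<xi> \<bullet> \<zeta>) \<partial>lborel)" for \<xi>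
  proof -
    have cl: "(\<lambda>\<zeta>. cis (\<xi> \<bullet> \<zeta>)) \<in> borel_measurable lebesgue" using cm by (simp add: measurable_completion)
    have "w \<xi> = (\<integral>\<zeta>. U \<zeta> * cis (\<xi> \<bullet> \<zeta>) \<partial>lebesgue)"
      unfolding W(2)
    proof (rule integral_cong_AE)
      show "(\<lambda>\<zeta>. W \<zeta> * cis (\<xi> \<bullet> \<zeta>)) \<in> borel_measurable lebesgue"
        by (rule borel_measurable_times[OF borel_measurable_integrable[OF W(1)] cl])
      show "(\<lambda>\<zeta>. U \<zeta> * cis (\<xi> \<bullet> \<zeta>)) \<in> borel_measurable lebesgue" by (rule borel_measurable_times[OF Ul cl])
      show "AE \<zeta> in lebesgue. W \<zeta> * cis (\<xi> \<bullet> \<zeta>) = U \<zeta> * cis (\<xi> \<bullet> \<zeta>)" using U(2) by eventually_elim simp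
    qed
    also have "\<dots> = (\<integral>\<zeta>. U \<zeta> * cis (\<xi> \<bullet> \<zeta>) \<partial>lborel)"
      by (rule integral_lebesgue_borel[OF borel_measurable_times[OF U(1) cm]])
    finally show ?thesis .
  qed
  define \<kappa> where "\<kappa> = (\<lambda>x. complex_of_real ((2 * pi) ^ CARD('n)) * U (0 + (- 2 * pi) *\<^sub>R x))"
  have "integrable lborel (\<lambda>x. U (0 + (- 2 * pi) *\<^sub>R x))"
    using Ui by (subst lborel_integral_affine(2)) auto
  then have \<kappa>i: "integrable lborel \<kappa>" unfolding \<kappa>_def by (rule integrable_mult_right)
  then have \<kappa>m: "\<kappa> \<in> borel_measurable borel" by auto
  have "fourier \<kappa> \<xi> = w \<xi>" for \<xi>
  proof -
    have "fourier \<kappa> \<xi> = (\<integral>x. complex_of_real ((2 * pi) ^ CARD('n)) * (U (0 + (- 2 * pi) *\<^sub>R x) * cis (\<xi> \<bullet> (0 + (- 2 * pi) *\<^sub>R x))) \<partial>lborel)"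
      unfolding fourier_eq[OF \<kappa>m] by (simp add: \<kappa>_def inner_commute mult.assoc)
    also have "\<dots> = complex_of_real ((2 * pi) ^ CARD('n)) * ((\<integral>\<zeta>. U \<zeta> * cis (\<xi> \<bullet> \<zeta>) \<partial>lborel) / complex_of_real (\<bar>- 2 * pi\<bar> ^ DIM(real^'n)))"
      unfolding integral_mult_right_zero
      by (subst lborel_integral_affine(1)[of "- 2 * pi" "\<lambda>\<zeta>. U \<zeta> * cis (\<xi> \<bullet> \<zeta>)" 0]) (use cm in auto)
    also have "\<dots> = w \<xi>" by (simp add: wU)
    finally show ?thesis .
  qed
  then show thesis using that[OF \<kappa>i] by blast
qed

text \<open>The multiplier \<open>\<rho> \<eta>\<close> factors as \<open>w (v - (fourier \<phi>) (\<eta> cnj (fourier \<psi>)))\<close>, where \<open>v = 1\<close> on the support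
  of \<open>\<eta>\<close>. So \<open>D(\<rho>) g\<close> is an \<open>L\<^sub>1\<close> kernel convolved with \<open>g - Q g\<close>.\<close>

lemma differential_bound:
  fixes \<phi> \<rho> :: "real^'n \<Rightarrow> complex" and \<psi> :: "(real^'n \<Rightarrow> complex) \<Rightarrow> complex"
  assumes \<eta>: "cutoff (\<eta> :: real^'n \<Rightarrow> real)" and \<phi>: "\<phi> \<in> LC" and s: "fun_support (fourier \<phi>) \<subseteq> unit_cube"
    and \<psi>: "\<exists>g. has_fourier_fun \<psi> g" and Ni: "integrable lborel (N_conv \<eta> (mat 1) \<psi>)"
    and \<rho>: "\<rho> \<in> borel_measurable borel"
    and nz: "AE \<xi> in lebesgue. 1 - fourier \<phi> \<xi> * cnj (fourier_fun \<psi> \<xi>) \<noteq> 0"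
    and w: "w \<in> wiener"
      "AE \<xi> in lebesgue. complex_of_real (\<eta> \<xi>) * (\<rho> \<xi> / (1 - fourier \<phi> \<xi> * cnj (fourier_fun \<psi> \<xi>))) = w \<xi>"
  obtains C where "C \<ge> 0" "\<And>g B x. g \<in> band (mat 1) \<Longrightarrow>
    (\<And>x. norm (g x - (\<Sum>\<^sub>\<infinity>k. conv (N_conv \<eta> (mat 1) \<psi>) g (- lattice_vec k) * \<phi> (x + lattice_vec k))) \<le> B) \<Longrightarrow>
    norm (conv (inv_fourier (\<lambda>\<xi>. \<rho> \<xi> * complex_of_real (\<eta> \<xi>))) g x) \<le> C * B"
proof -
  note cf = cutoff_test_function[OF \<eta>]
  note b = LC_band_fourier[OF \<phi> s]
  have \<phi>i: "integrable lborel \<phi>" by (rule LC_integrable[OF \<phi>])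
  have \<phi>m: "\<phi> \<in> borel_measurable borel" using \<phi>i by auto
  have fm: "fourier \<phi> \<in> borel_measurable borel" using b(3) by auto
  have d1: "det (mat 1 :: real^'n^'n) \<noteq> 0" by simp
  obtain q where q0: "q \<in> borel_measurable borel" and q1: "AE \<xi> in lebesgue. fourier_fun \<psi> \<xi> = q \<xi>"
    and q2: "\<And>A. det A \<noteq> 0 \<Longrightarrow> integrable lborel (\<lambda>\<xi>. cutoff_scaled \<eta> A \<xi> * cnj (q \<xi>))"
    and q3: "\<And>A. det A \<noteq> 0 \<Longrightarrow> N_conv \<eta> A \<psi> = inv_fourier (\<lambda>\<xi>. cutoff_scaled \<eta> A \<xi> * cnj (q \<xi>))"
    by (rule N_conv_representation[OF \<eta> \<psi>]) (rule that)
  define l where "l = (\<lambda>\<xi>. complex_of_real (\<eta> \<xi>) * cnj (q \<xi>))"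
  have li: "integrable lborel l" using q2[OF d1] by (simp add: l_def mat_1_facts)
  have lm: "l \<in> borel_measurable borel" using li by auto
  define N0 where "N0 = N_conv \<eta> (mat 1) \<psi>"
  have N0: "N0 = inv_fourier l" using q3[OF d1] by (simp add: N0_def l_def mat_1_facts)
  have N0i: "integrable lborel N0" using Ni by (simp add: N0_def)
  have N0m: "N0 \<in> borel_measurable borel" using N0i by auto
  obtain \<kappa> where \<kappa>: "integrable lborel \<kappa>" "fourier \<kappa> = w" by (rule wiener_fourier_form[OF w(1)])
  have \<kappa>m: "\<kappa> \<in> borel_measurable borel" using \<kappa>(1) by auto
  \<comment> \<open>The constant 1 in the denominator is not the transform of an integrable
    function. \<eta>(\<xi>/2) replaces it, being 1 on twice the cube and having an integrable
    kernel.\<close>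
  define v where "v = (\<lambda>\<xi>. complex_of_real (\<eta> (0 + (1/2) *\<^sub>R \<xi>)))"
  have vs: "smooth_on UNIV v" unfolding v_def
    by (rule smooth_on_affine[of "\<lambda>\<xi>. complex_of_real (\<eta> \<xi>)"]) (use cf(1) in \<open>simp add: test_functions_def\<close>)
  obtain R0 where R0: "\<And>\<xi> :: real^'n. \<xi> \<in> (\<lambda>y. 2 *\<^sub>R y) ` unit_cube \<Longrightarrow> norm \<xi> \<le> R0"
    using compact_imp_bounded[OF compact_scaling[OF compact_unit_cube, of 2]] unfolding bounded_iff by blast
  have vt: "v \<in> test_functions"
  proof (rule test_functionI(1)[OF vs, of 0 "2 * R0"])
    fix x :: "real^'n" assume "x \<notin> cball 0 (2 * R0)"
    then have "norm (0 + (1/2) *\<^sub>R x) > R0" by simp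
    then have "0 + (1/2) *\<^sub>R x \<notin> (\<lambda>y. 2 *\<^sub>R y) ` unit_cube" using R0 not_le by blast
    from cf(2)[OF this] show "v x = 0" by (simp add: v_def)
  qed
  have vi: "integrable lborel v" using integrable_partials[OF vt, of "[]"] by simp
  have v1: "v \<xi> = 1" if "\<xi> \<in> (\<lambda>y. 2 *\<^sub>R y) ` unit_cube" for \<xi>
    using that cf(3) by (auto simp: v_def)
  define V where "V = inv_fourier v"
  have Vi: "integrable lborel V" unfolding V_def by (rule integrable_inv_fourier_test[OF vt])
  have Vm: "V \<in> borel_measurable borel" using Vi by auto
  have half: "\<xi> \<in> (\<lambda>y. 2 *\<^sub>R y) ` unit_cube" if "\<xi> \<in> unit_cube" for \<xi> :: "real^'n"
    unfolding unit_cube_scaled_iff[OF zero_less_numeral]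
  proof
    fix i
    have "\<bar>\<xi> $ i\<bar> \<le> 1/2" using that by (simp add: unit_cube_def)
    then show "\<bar>\<xi> $ i\<bar> \<le> 2/2" by simp
  qed
  let ?D = "inv_fourier (\<lambda>\<xi>. \<rho> \<xi> * complex_of_real (\<eta> \<xi>))"
  have \<phi>li: "integrable lborel (\<lambda>\<xi>. fourier \<phi> \<xi> * l \<xi>)"
    using integrable_bounded_mult[OF li _ norm_fourier_le[OF \<phi>i]] fm by (simp add: mult.commute)
  have D_eq: "?D = conv \<kappa> (inv_fourier (\<lambda>\<xi>. v \<xi> - fourier \<phi> \<xi> * l \<xi>))"
  proof -
    have "?D = inv_fourier (\<lambda>\<xi>. fourier \<kappa> \<xi> * (v \<xi> - fourier \<phi> \<xi> * l \<xi>))"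
    proof
      fix x :: "real^'n"
      let ?e = "\<lambda>\<xi>. cis (2 * pi * (x \<bullet> \<xi>))"
      have em: "?e \<in> borel_measurable borel" by (rule measurable_cis_inner(1))
      have \<eta>m: "(\<lambda>\<xi>. complex_of_real (\<eta> \<xi>)) \<in> borel_measurable borel"
        using cf(4) by (intro borel_measurable_continuous_onI continuous_intros)
      show "?D x = inv_fourier (\<lambda>\<xi>. fourier \<kappa> \<xi> * (v \<xi> - fourier \<phi> \<xi> * l \<xi>)) x"
        unfolding inv_fourier_def
      proof (rule integral_cong_AE)
        show "(\<lambda>\<xi>. \<rho> \<xi> * complex_of_real (\<eta> \<xi>) * ?e \<xi>) \<in> borel_measurable lebesgue"
          using borel_measurable_times[OF borel_measurable_times[OF \<rho> \<eta>m] em] by (simp add: measurable_completion)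
        have "(\<lambda>\<xi>. fourier \<kappa> \<xi> * (v \<xi> - fourier \<phi> \<xi> * l \<xi>) * ?e \<xi>) \<in> borel_measurable borel"
          using borel_measurable_fourier[OF \<kappa>m] vi fm lm em by (intro borel_measurable_times borel_measurable_diff) auto
        then show "(\<lambda>\<xi>. fourier \<kappa> \<xi> * (v \<xi> - fourier \<phi> \<xi> * l \<xi>) * ?e \<xi>) \<in> borel_measurable lebesgue"
          by (simp add: measurable_completion)
        show "AE \<xi> in lebesgue. \<rho> \<xi> * complex_of_real (\<eta> \<xi>) * ?e \<xi> = fourier \<kappa> \<xi> * (v \<xi> - fourier \<phi> \<xi> * l \<xi>) * ?e \<xi>"
          using nz w(2) q1
        proof eventually_elim
          case (elim \<xi>)
          have "\<rho> \<xi> * complex_of_real (\<eta> \<xi>) = fourier \<kappa> \<xi> * (v \<xi> - fourier \<phi> \<xi> * l \<xi>)"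
          proof (cases "\<xi> \<in> (\<lambda>y. 2 *\<^sub>R y) ` unit_cube")
            case True
            \<comment> \<open>The cut-off inside \<open>l\<close> is 1 wherever the transform of
              \<phi> can be nonzero, so it may be dropped next to that factor.\<close>
            have "fourier \<phi> \<xi> * l \<xi> = fourier \<phi> \<xi> * cnj (q \<xi>)"
              using b(1)[of \<xi>] cf(3)[of \<xi>] by (cases "\<xi> \<in> unit_cube") (auto simp: l_def)
            then have "fourier \<kappa> \<xi> * (v \<xi> - fourier \<phi> \<xi> * l \<xi>) = complex_of_real (\<eta> \<xi>) * (\<rho> \<xi> / (1 - fourier \<phi> \<xi> * cnj (q \<xi>))) * (1 - fourier \<phi> \<xi> * cnj (q \<xi>))"
              using elim by (simp add: v1[OF True] \<kappa>(2))
            also have "\<dots> = \<rho> \<xi> * complex_of_real (\<eta> \<xi>)"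
            proof -
              have cancel: "a * (r / z) * z = r * a" if "z \<noteq> 0" for a r z :: complex using that by simp
              show ?thesis by (rule cancel) (use elim(1) in \<open>simp only: elim(3) not_False_eq_True\<close>)
            qed
            finally show ?thesis by simp
          next
            case False
            then have "\<eta> \<xi> = 0" by (rule cf(2))
            then show ?thesis using elim by (simp add: \<kappa>(2))
          qed
          then show ?case by simp
        qed
      qed
    qed
    also have "\<dots> = conv \<kappa> (inv_fourier (\<lambda>\<xi>. v \<xi> - fourier \<phi> \<xi> * l \<xi>))"
      by (rule inv_fourier_fourier_mult[OF \<kappa>(1)]) (use vi \<phi>li in simp)
    finally show ?thesis .
  qed
  define P where "P = (\<lambda>x. V x - conv \<phi> N0 x)"
  have \<phi>N: "integrable lborel (conv \<phi> N0)" by (rule integrable_conv[OF \<phi>i N0i])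
  have Pi: "integrable lborel P" unfolding P_def using Vi \<phi>N by simp
  have P_eq: "inv_fourier (\<lambda>\<xi>. v \<xi> - fourier \<phi> \<xi> * l \<xi>) = P"
  proof
    fix x :: "real^'n"
    let ?e = "\<lambda>\<xi>. cis (2 * pi * (x \<bullet> \<xi>))"
    have em: "?e \<in> borel_measurable lborel" using measurable_cis_inner(1)[of "2 * pi" x] by simp
    have i1: "integrable lborel (\<lambda>\<xi>. v \<xi> * ?e \<xi>)" by (rule integrable_bounded_mult[OF vi em, where B=1]) simp
    have i2: "integrable lborel (\<lambda>\<xi>. fourier \<phi> \<xi> * l \<xi> * ?e \<xi>)" by (rule integrable_bounded_mult[OF \<phi>li em, where B=1]) simp
    have "inv_fourier (\<lambda>\<xi>. v \<xi> - fourier \<phi> \<xi> * l \<xi>) x = (\<integral>\<xi>. v \<xi> * ?e \<xi> - fourier \<phi> \<xi> * l \<xi> * ?e \<xi> \<partial>lborel)"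
      using vi \<phi>li by (subst inv_fourier_eq) (auto simp: left_diff_distrib)
    also have "\<dots> = inv_fourier v x - inv_fourier (\<lambda>\<xi>. fourier \<phi> \<xi> * l \<xi>) x"
      using vi \<phi>li by (subst Bochner_Integration.integral_diff[OF i1 i2]) (auto simp: inv_fourier_eq)
    also have "inv_fourier (\<lambda>\<xi>. fourier \<phi> \<xi> * l \<xi>) = conv \<phi> N0"
      unfolding N0 by (rule inv_fourier_fourier_mult[OF \<phi>i li])
    finally show "inv_fourier (\<lambda>\<xi>. v \<xi> - fourier \<phi> \<xi> * l \<xi>) x = P x" by (simp add: P_def V_def)
  qed
  \<comment> \<open>\<open>v\<close> is 1 on the spectrum of \<phi>, so \<open>V\<close> reproduces
    \<phi>. This lets \<open>V\<close> be taken out as a common left factor of V g and \<phi> G,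
    which leaves the bounded difference of \<open>g\<close> and its quasi-projection.\<close>
  have V\<phi>: "conv V \<phi> = \<phi>"
  proof -
    have "conv V \<phi> = conv \<phi> V" by (rule conv_commute[OF Vm \<phi>m])
    also have "\<dots> = inv_fourier (\<lambda>\<xi>. fourier \<phi> \<xi> * v \<xi>)" unfolding V_def by (rule inv_fourier_fourier_mult[OF \<phi>i vi, symmetric])
    also have "(\<lambda>\<xi>. fourier \<phi> \<xi> * v \<xi>) = fourier \<phi>"
    proof
      show "fourier \<phi> \<xi> * v \<xi> = fourier \<phi> \<xi>" for \<xi>
        using b(1)[of \<xi>] v1[OF half, of \<xi>] by (cases "\<xi> \<in> unit_cube") auto
    qed
    finally show ?thesis by (simp only: b(4))
  qed
  define J1 where "J1 = (\<integral>x. norm (\<kappa> x) \<partial>lborel)"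
  define J2 where "J2 = (\<integral>x. norm (V x) \<partial>lborel)"
  have J: "0 \<le> J1" "0 \<le> J2" unfolding J1_def J2_def by (intro integral_nonneg_AE; simp)+
  show thesis
  proof (rule that[of "J1 * J2"])
    show "0 \<le> J1 * J2" using J by simp
    fix g :: "real^'n \<Rightarrow> complex" and B x assume g: "g \<in> band (mat 1)"
      and B: "\<And>x. norm (g x - (\<Sum>\<^sub>\<infinity>k. conv (N_conv \<eta> (mat 1) \<psi>) g (- lattice_vec k) * \<phi> (x + lattice_vec k))) \<le> B"
    have gm: "g \<in> borel_measurable borel" using bandD(1)[OF g] by (rule borel_measurable_continuous_onI)
    obtain Bg where Bg: "Bg \<ge> 0" "\<And>x. norm (g x) \<le> Bg" using band_bounded[OF g] by blast
    define G where "G = conv N0 g"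
    have Gc: "continuous_on UNIV G" unfolding G_def by (rule continuous_on_conv[OF N0i bandD(1)[OF g] Bg(2)])
    have Gm: "G \<in> borel_measurable borel" using Gc by (rule borel_measurable_continuous_onI)
    define BG where "BG = Bg * (\<integral>x. norm (N0 x) \<partial>lborel)"
    have GB: "norm (G x) \<le> BG" for x unfolding G_def BG_def by (rule norm_conv_le[OF N0i gm Bg(2)])
    have BG0: "0 \<le> BG" using GB[of 0] norm_ge_zero order_trans by blast
    \<comment> \<open>\<open>G\<close> itself is not shown to be band-limited; commuting the two
      kernels lets the modulated \<phi> meet \<open>g\<close> first.\<close>
    have z: "conv (\<lambda>y. \<phi> y * cis (2 * pi * (lattice_vec k \<bullet> y))) G x = 0" if k: "k \<noteq> 0" for k x
    proof -
      let ?p = "\<lambda>y. \<phi> y * cis (2 * pi * (lattice_vec k \<bullet> y))"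
      have pi: "integrable lborel ?p"
        by (rule integrable_bounded_mult[OF \<phi>i, where B=1]) (use measurable_cis_inner(1)[of "2 * pi" "lattice_vec k"] in auto)
      have pm: "?p \<in> borel_measurable borel" using pi by auto
      have "conv ?p G = conv (conv ?p N0) g" unfolding G_def by (rule conv_assoc[OF pi N0i gm Bg(2), symmetric])
      also have "conv ?p N0 = conv N0 ?p" by (rule conv_commute[OF pm N0m])
      also have "conv (conv N0 ?p) g = conv N0 (conv ?p g)" by (rule conv_assoc[OF N0i pi gm Bg(2)])
      also have "conv ?p g = (\<lambda>x. 0)" using LC_band_modulated[OF \<eta> \<phi> s g k] by (intro ext)
      also have "conv N0 (\<lambda>x. 0) = (\<lambda>x. 0)" by (intro ext) (simp add: conv_def)
      finally show ?thesis by simp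
    qed
    have Sg: "(\<Sum>\<^sub>\<infinity>k. conv (N_conv \<eta> (mat 1) \<psi>) g (- lattice_vec k) * \<phi> (y + lattice_vec k)) = conv \<phi> G y" for y
      using sampling[OF \<phi> Gc GB BG0 z, of y] by (simp add: G_def N0_def)
    let ?h = "\<lambda>y. g y - conv \<phi> G y"
    have hB: "norm (?h y) \<le> B" for y using B[of y] unfolding Sg .
    have \<phi>Gc: "continuous_on UNIV (conv \<phi> G)" by (rule continuous_on_conv[OF \<phi>i Gc GB])
    have \<phi>Gm: "conv \<phi> G \<in> borel_measurable borel" using \<phi>Gc by (rule borel_measurable_continuous_onI)
    have hm: "?h \<in> borel_measurable borel" using gm \<phi>Gm by simp
    have "conv P g y = conv V ?h y" for y
    proof -
      have "conv P g y = conv V g y - conv (conv \<phi> N0) g y" unfolding P_def by (rule conv_diff_left[OF Vi \<phi>N gm Bg(2)])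
      also have "conv (conv \<phi> N0) g = conv \<phi> G" unfolding G_def by (rule conv_assoc[OF \<phi>i N0i gm Bg(2)])
      also have "\<dots> = conv V (conv \<phi> G)"
        using conv_assoc[OF Vi \<phi>i Gm GB] by (simp only: V\<phi>)
      also have "conv V g y - conv V (conv \<phi> G) y = conv V ?h y"
        by (rule conv_diff_right[OF Vi gm Bg(2) \<phi>Gm norm_conv_le[OF \<phi>i Gm GB], symmetric])
      finally show ?thesis .
    qed
    then have Ph: "conv P g = conv V ?h" by (intro ext)
    have "conv ?D g = conv \<kappa> (conv P g)"
      unfolding D_eq P_eq by (rule conv_assoc[OF \<kappa>(1) Pi gm Bg(2)])
    also have "\<dots> = conv \<kappa> (conv V ?h)" by (simp only: Ph)
    finally have "norm (conv ?D g x) = norm (conv \<kappa> (conv V ?h) x)" by simp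
    also have "\<dots> \<le> (B * J2) * J1"
      unfolding J1_def
    proof (rule norm_conv_le[OF \<kappa>(1)])
      show "conv V ?h \<in> borel_measurable borel" by (rule borel_measurable_conv[OF Vm hm])
      show "norm (conv V ?h y) \<le> B * J2" for y unfolding J2_def by (rule norm_conv_le[OF Vi hm hB])
    qed
    finally show "norm (conv ?D g x) \<le> J1 * J2 * B" by (simp add: mult_ac)
  qed
qed

subsection \<open>Reduction to scale zero\<close>

text \<open>Fourier inversion identifies the transform of \<open>kernel_N\<close> with the scaled
  cut-off. The symbol of the operator is then one fixed function composed with the inverse
  transpose, and the dilation rule for kernels applies.\<close>

lemma diff_op_band_eq:
  fixes A :: "real^'n^'n" and \<rho> T :: "real^'n \<Rightarrow> complex"
  assumes \<eta>: "cutoff (\<eta> :: real^'n \<Rightarrow> real)" and A: "det A \<noteq> 0"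
    and \<rho>: "\<rho> \<in> borel_measurable borel" and T: "T \<in> borel_measurable borel"
  shows "diff_op_band \<eta> A (\<lambda>\<xi>. \<rho> (matrix_inv (transpose A) *v \<xi>)) T x =
    conv (inv_fourier (\<lambda>\<xi>. \<rho> \<xi> * complex_of_real (\<eta> \<xi>))) (\<lambda>y. T (matrix_inv A *v y)) (A *v x)"
proof -
  let ?h = "\<lambda>\<xi>. complex_of_real (\<eta> \<xi>)"
  note h = cutoff_test_function(1)[OF \<eta>] and cs = cutoff_scaled_facts[OF \<eta> A]
  have cs_eq: "cutoff_scaled \<eta> A = (\<lambda>\<xi>. ?h (matrix_inv (transpose A) *v \<xi>))"
    by (rule ext) (simp only: cutoff_scaled_def)
  have hm: "?h \<in> borel_measurable borel" using integrable_partials[OF h, of "[]"] by auto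
  have ki: "integrable lborel (inv_fourier (cutoff_scaled \<eta> A))"
    unfolding cs_eq by (rule matrix_scaling(2)[OF A hm integrable_inv_fourier_test[OF h]])
  obtain B where B: "\<And>\<xi>. norm (cutoff_scaled \<eta> A \<xi>) \<le> B" using cs(4) by blast
  have fk: "fourier (kernel_N \<eta> A) \<xi> = ?h (matrix_inv (transpose A) *v \<xi>)" for \<xi>
    using fourier_inversion[OF cs(5) cs(2) B ki, of \<xi>] by (simp only: kernel_N_def cutoff_scaled_def)
  have lm: "(\<lambda>\<xi>. \<rho> \<xi> * ?h \<xi>) \<in> borel_measurable borel" using \<rho> hm by (rule borel_measurable_times)
  show ?thesis
    unfolding diff_op_band_def diff_op_def fk by (rule matrix_scaling(3)[OF A lm T])
qed

text \<open>The value at 0 is arbitrary, so continuity is available only off the origin; one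
  exceptional point does not affect measurability.\<close>

lemma homogeneous_smooth_measurable:
  assumes "\<rho> \<in> homogeneous_smooth s"
  shows "\<rho> \<in> borel_measurable borel"
proof (rule borel_measurable_continuous_countable_exceptions[of "{0}"])
  have "\<rho> differentiable (at x)" if "x \<noteq> 0" for x
  proof -
    have "\<forall>is. \<forall>x\<in>- {0}. partials is \<rho> differentiable (at x)"
      using assms by (simp add: homogeneous_smooth_def smooth_on_def)
    from this[rule_format, of x "[]"] that show ?thesis by simp
  qed
  then show "continuous_on (- {0}) \<rho>"
    by (intro continuous_at_imp_continuous_on ballI differentiable_imp_continuous_within) auto
qed simp

lemma quasi_proj_eq:
  assumes "det M \<noteq> 0"
  shows "quasi_proj \<eta> M j f \<phi> \<psi> x =
    (\<Sum>\<^sub>\<infinity>k. pairing0 \<eta> M (\<lambda>x. f (matrix_inv (mat_power M j) *v x)) \<psi> k * \<phi> (mat_power M j *v x + lattice_vec k))"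
proof -
  have "\<bar>det M\<bar> powr (- real j / 2) * \<bar>det M\<bar> powr (real j / 2) = 1"
    using assms by (simp add: powr_add[symmetric])
  then have c: "complex_of_real (\<bar>det M\<bar> powr (- real j / 2)) * complex_of_real (\<bar>det M\<bar> powr (real j / 2)) = 1"
    unfolding of_real_mult[symmetric] by simp
  have "complex_of_real (\<bar>det M\<bar> powr (- real j / 2)) * u * (complex_of_real (\<bar>det M\<bar> powr (real j / 2)) * v) = u * v" for u v
    using c by (simp add: mult_ac)
  then show ?thesis unfolding quasi_proj_def pairing_def shifted_dilate_def by (simp only:)
qed

text \<open>Dilation carries competitors for \<open>f\<close> to competitors for the dilate at no
  greater distance. With \<open>A\<close> the power \<nu> + j of M and \<open>B\<close> the inverse
  of the power j, this bounds the errors of F by those of f.\<close>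

lemma best_err_dilate:
  fixes A B :: "real^'n^'n" and f :: "real^'n \<Rightarrow> complex"
  assumes \<eta>: "cutoff (\<eta> :: real^'n \<Rightarrow> real)" and A: "det A \<noteq> 0" and B: "det B \<noteq> 0" and f: "bounded (range f)"
  shows "best_err (A ** B) (\<lambda>x. f (B *v x)) \<le> best_err A f"
proof -
  have F: "bounded (range (\<lambda>x. f (B *v x)))" using f by (rule bounded_subset) auto
  have "best_approx (A ** B) (\<lambda>x. f (B *v x)) \<le> best_approx A f"
    unfolding best_approx_def
  proof (rule INF_greatest)
    fix T assume T: "T \<in> band A"
    have "sup_norm (\<lambda>x. f (B *v x) - T (B *v x)) \<le> sup_norm (\<lambda>x. f x - T x)"
      by (subst sup_norm_def) (intro SUP_least norm_le_sup_norm[of "\<lambda>x. f x - T x"])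
    with INF_lower[OF band_dilate[OF \<eta> A B T], of "\<lambda>g. sup_norm (\<lambda>x. f (B *v x) - g x)"]
    show "(INF g\<in>band (A ** B). sup_norm (\<lambda>x. f (B *v x) - g x)) \<le> sup_norm (\<lambda>x. f x - T x)"
      by (rule order_trans)
  qed
  then show ?thesis
    unfolding best_approx_eq[OF F] best_approx_eq[OF f] by (simp add: best_err_nonneg)
qed

lemma BUC_dilate:
  fixes f :: "real^'n \<Rightarrow> complex" and B :: "real^'n^'n"
  assumes "f \<in> BUC"
  shows "(\<lambda>x. f (B *v x)) \<in> BUC"
proof -
  have "bounded (range (\<lambda>x. f (B *v x)))"
    using assms unfolding BUC_def by (auto intro: bounded_subset)
  moreover have "uniformly_continuous_on UNIV (\<lambda>x. f (B *v x))"
  proof -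
    have "uniformly_continuous_on UNIV (\<lambda>x. B *v x)"
      using bounded_linear.uniformly_continuous_on[OF matrix_vector_mul_bounded_linear uniformly_continuous_on_id] .
    moreover have "uniformly_continuous_on (range (\<lambda>x. B *v x)) f"
      using assms unfolding BUC_def uniformly_continuous_on_def by blast
    ultimately show ?thesis
      using uniformly_continuous_on_compose[of UNIV "\<lambda>x. B *v x" f] by (simp add: o_def)
  qed
  ultimately show ?thesis by (simp add: BUC_def)
qed

lemma distr_classE:
  fixes M :: "real^'n^'n"
  assumes \<eta>: "cutoff (\<eta> :: real^'n \<Rightarrow> real)" and M: "det M \<noteq> 0" and \<psi>: "\<psi> \<in> distr_class \<eta> M \<alpha>" and \<alpha>: "\<And>A. \<alpha> A > 0"
  obtains c0 where "c0 \<ge> 0" "\<exists>g. has_fourier_fun \<psi> g" "\<And>n. integrable lborel (N_conv \<eta> (mat_power M n) \<psi>)"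
    "\<And>n. (\<integral>x. norm (N_conv \<eta> (mat_power M n) \<psi> x) \<partial>lborel) \<le> c0 * \<alpha> (mat_power M n)"
proof -
  have g: "\<exists>g. has_fourier_fun \<psi> g" using \<psi> by (simp add: distr_class_def)
  obtain c where c: "\<And>n. integrable lebesgue (N_conv \<eta> (mat_power M n) \<psi>)"
    "\<And>n. (\<integral>x. norm (N_conv \<eta> (mat_power M n) \<psi> x) \<partial>lebesgue) \<le> c * \<alpha> (mat_power M n)"
    using \<psi> by (auto simp: distr_class_def)
  obtain q where q0: "\<And>A. det A \<noteq> 0 \<Longrightarrow> integrable lborel (\<lambda>\<xi>. cutoff_scaled \<eta> A \<xi> * cnj (q \<xi>))"
    and q: "\<And>A. det A \<noteq> 0 \<Longrightarrow> N_conv \<eta> A \<psi> = inv_fourier (\<lambda>\<xi>. cutoff_scaled \<eta> A \<xi> * cnj (q \<xi>))"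
    by (rule N_conv_representation[OF \<eta> g]) (rule that)
  have d: "det (mat_power M n) \<noteq> 0" for n using M by (simp add: det_mat_power)
  have m: "N_conv \<eta> (mat_power M n) \<psi> \<in> borel_measurable borel" for n
    unfolding q[OF d] using q0[OF d[of n]] by (intro borel_measurable_inv_fourier) auto
  show thesis
  proof (rule that[of "max c 0"])
    fix n
    show "integrable lborel (N_conv \<eta> (mat_power M n) \<psi>)"
      using c(1)[of n] by (simp only: integrable_lebesgue_borel[OF m])
    have "(\<integral>x. norm (N_conv \<eta> (mat_power M n) \<psi> x) \<partial>lborel) = (\<integral>x. norm (N_conv \<eta> (mat_power M n) \<psi> x) \<partial>lebesgue)"
      by (rule integral_lebesgue_borel[symmetric]) (use m in measurable)
    also have "\<dots> \<le> c * \<alpha> (mat_power M n)" by (rule c(2))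
    also have "\<dots> \<le> max c 0 * \<alpha> (mat_power M n)" using \<alpha> by (intro mult_right_mono) (auto intro: less_imp_le)
    finally show "(\<integral>x. norm (N_conv \<eta> (mat_power M n) \<psi> x) \<partial>lborel) \<le> max c 0 * \<alpha> (mat_power M n)" .
  qed (use g in auto)
qed

lemma sum_le_infsum_atLeast:
  fixes h :: "nat \<Rightarrow> ennreal"
  shows "(\<Sum>\<nu><n. h (\<nu> + j)) \<le> infsum h {j..}"
proof -
  have "(\<Sum>\<nu><n. h (\<nu> + j)) = sum h ((\<lambda>\<nu>. \<nu> + j) ` {..<n})"
    by (subst sum.reindex) (auto simp: inj_on_def)
  also have "\<dots> \<le> (SUP F\<in>{F. finite F \<and> F \<subseteq> {j..}}. sum h F)"
    by (rule SUP_upper) auto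
  also have "\<dots> = infsum h {j..}" by (rule nonneg_infsum_complete[symmetric]) simp
  finally show ?thesis .
qed

section \<open>The estimate for one function at one scale\<close>

context
  fixes \<eta> :: "real^'n \<Rightarrow> real" and M :: "real^'n^'n" and \<phi> \<rho> :: "real^'n \<Rightarrow> complex"
    and \<psi> :: "(real^'n \<Rightarrow> complex) \<Rightarrow> complex" and C C1 c0 :: real and N :: nat
    and \<alpha> :: "real^'n^'n \<Rightarrow> real" and f :: "real^'n \<Rightarrow> complex" and j :: nat and \<delta> :: real
  assumes \<eta>: "cutoff \<eta>" and M: "dilation_matrix M" and \<psi>: "\<exists>g. has_fourier_fun \<psi> g"
    and \<phi>: "\<phi> \<in> LC" and s: "fun_support (fourier \<phi>) \<subseteq> unit_cube"
    and C: "C \<ge> 0" "\<And>x S. finite S \<Longrightarrow> (\<Sum>k\<in>S. norm (\<phi> (x + lattice_vec k))) \<le> C"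
    and \<rho>: "\<rho> \<in> borel_measurable borel"
    and C1: "C1 \<ge> 0" "\<And>g B x. g \<in> band (mat 1) \<Longrightarrow>
      (\<And>x. norm (g x - (\<Sum>\<^sub>\<infinity>k. conv (N_conv \<eta> (mat 1) \<psi>) g (- lattice_vec k) * \<phi> (x + lattice_vec k))) \<le> B) \<Longrightarrow>
      norm (conv (inv_fourier (\<lambda>\<xi>. \<rho> \<xi> * complex_of_real (\<eta> \<xi>))) g x) \<le> C1 * B"
    and N: "\<And>k \<mu>. k \<ge> N \<Longrightarrow> spec_cube (mat_power M \<mu>) \<subseteq> spec_cube (mat_power M (\<mu> + k))"
    and N_int: "\<And>n. integrable lborel (N_conv \<eta> (mat_power M n) \<psi>)"
    and N_le: "\<And>n. (\<integral>x. norm (N_conv \<eta> (mat_power M n) \<psi> x) \<partial>lborel) \<le> c0 * \<alpha> (mat_power M n)"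
    and \<alpha>_pos: "\<And>n. \<alpha> (mat_power M n) > 0" and c0: "c0 \<ge> 0"
    and f: "f \<in> BUC"
    and \<delta>: "\<And>x. norm (f x - quasi_proj \<eta> M j f \<phi> \<psi> x) \<le> \<delta>"
begin

abbreviation (input) "P \<equiv> mat_power M j"
abbreviation (input) "F \<equiv> (\<lambda>x. f (matrix_inv (mat_power M j) *v x))"
abbreviation (input) "N0 \<equiv> N_conv \<eta> (mat 1) \<psi>"

lemma det_scale: "det P \<noteq> 0" "det (matrix_inv P) \<noteq> 0"
proof -
  show d: "det P \<noteq> 0" using dilation_det_nz[OF M] by (simp add: det_mat_power)
  show "det (matrix_inv P) \<noteq> 0" by (rule matrix_inv_unique(2)[OF matrix_inv_mult(2)[OF d]])
qed

lemma unit_kernel_integrable: "integrable lborel N0"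
  using N_int[of 0] by simp

lemma quasi_proj_error:
  "norm (F y - (\<Sum>\<^sub>\<infinity>k. pairing0 \<eta> M F \<psi> k * \<phi> (y + lattice_vec k))) \<le> \<delta>"
  using \<delta>[of "matrix_inv P *v y"] unfolding quasi_proj_eq[OF dilation_det_nz[OF M]] matrix_inv_vector(1)[OF det_scale(1)] .

lemma conv_N0_bounded:
  assumes g: "g \<in> band (mat 1)"
  obtains B where "B \<ge> 0" "\<And>x. norm (conv N0 g x) \<le> B"
proof -
  obtain D where D: "D \<ge> 0" "\<And>x. norm (g x) \<le> D" using band_bounded[OF g] by blast
  have gm: "g \<in> borel_measurable borel" by (rule borel_measurable_continuous_onI[OF bandD(1)[OF g]])
  show thesis by (rule that[OF _ norm_conv_le[OF unit_kernel_integrable gm D(2)]]) (use D in simp)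
qed

text \<open>Common to both estimates: the dilate of \<open>g\<close> is the competitor in the
  infimum, and only two quantities are left to supply, the error \<open>B1\<close> of
  \<open>g\<close> and the error \<open>R\<close> of its coefficients. Passing from coefficients to
  the lattice sum costs the factor \<open>C\<close>.\<close>

lemma realization_le:
  assumes g: "g \<in> band (mat 1)" and B1: "\<And>x. norm (F x - g x) \<le> B1"
    and R: "\<And>k. norm (pairing0 \<eta> M F \<psi> k - conv N0 g (- lattice_vec k)) \<le> R"
  shows "realization \<eta> M \<rho> f j \<le> ennreal (B1 + C1 * (B1 + \<delta> + R * C))"
proof -
  let ?p = "pairing0 \<eta> M F \<psi>" and ?q = "\<lambda>k. conv N0 g (- lattice_vec k)"
  let ?T = "\<lambda>x. g (P *v x)"
  have R0: "0 \<le> R" using R[of 0] norm_ge_zero order_trans by blast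
  have B10: "0 \<le> B1" using B1[of 0] norm_ge_zero order_trans by blast
  have \<delta>0: "0 \<le> \<delta>" using \<delta>[of 0] norm_ge_zero order_trans by blast
  obtain B where B: "B \<ge> 0" "\<And>x. norm (conv N0 g x) \<le> B" by (rule conv_N0_bounded[OF g]) (rule that)
  have tri: "norm (u - w) \<le> a + b + c" if "norm (v - q) \<le> b" "norm (v - u) \<le> a" "norm (q - w) \<le> c"
    for u v w q :: complex and a b c
  proof -
    have "u - w = (v - q) - (v - u) + (q - w)" by simp
    then have "norm (u - w) \<le> norm (v - q) + norm (v - u) + norm (q - w)"
      by (metis norm_triangle_le norm_triangle_ineq4 add_right_mono)
    then show ?thesis using that by linarith
  qed
  have g_err: "norm (g x - (\<Sum>\<^sub>\<infinity>k. ?q k * \<phi> (x + lattice_vec k))) \<le> B1 + \<delta> + R * C" for x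
  proof -
    let ?Q = "\<Sum>\<^sub>\<infinity>k. ?p k * \<phi> (x + lattice_vec k)" and ?S = "\<Sum>\<^sub>\<infinity>k. ?q k * \<phi> (x + lattice_vec k)"
    \<comment> \<open>The coefficients of \<open>F\<close> are known only through their distance
      \<open>R\<close> to those of \<open>g\<close>. The sum of the differences and the sum for
      \<open>g\<close> both converge, and their termwise total is the sum for
      \<open>F\<close>.\<close>
    have sd: "(\<lambda>k. (?p k - ?q k) * \<phi> (x + lattice_vec k)) summable_on UNIV"
      by (rule bounded_sums_abs_summable(3)[OF lattice_sum_bounds[OF C(2) R R0]])
    have sq: "(\<lambda>k. ?q k * \<phi> (x + lattice_vec k)) summable_on UNIV"
      by (rule bounded_sums_abs_summable(3)[OF lattice_sum_bounds[OF C(2) B(2) B(1)]])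
    have "(?p k - ?q k) * \<phi> (x + lattice_vec k) + ?q k * \<phi> (x + lattice_vec k) = ?p k * \<phi> (x + lattice_vec k)" for k
      by (simp only: distrib_right[symmetric] diff_add_cancel)
    then have "?Q - ?S = (\<Sum>\<^sub>\<infinity>k. (?p k - ?q k) * \<phi> (x + lattice_vec k))"
      using infsum_add[OF sd sq] by simp
    then have QS: "norm (?Q - ?S) \<le> R * C" using norm_lattice_sum_le[OF C(2) R R0] by simp
    show ?thesis by (rule tri[OF quasi_proj_error[of x] B1[of x] QS])
  qed
  have d1: "det (mat 1 :: real^'n^'n) \<noteq> 0" by simp
  have T: "?T \<in> band P" using band_dilate[OF \<eta> d1 det_scale(1) g] by (simp only: matrix_mul_lid)
  have Tm: "?T \<in> borel_measurable borel" by (rule borel_measurable_continuous_onI[OF bandD(1)[OF T]])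
  have "f x - ?T x = F (P *v x) - g (P *v x)" for x by (simp only: matrix_inv_vector(2)[OF det_scale(1)])
  then have "sup_norm (\<lambda>x. f x - ?T x) \<le> ennreal B1" using B1 by (simp only: sup_norm_le_iff[OF B10] simp_thms)
  moreover have "sup_norm (diff_op_band \<eta> P (\<lambda>\<xi>. \<rho> (matrix_inv (transpose P) *v \<xi>)) ?T) \<le> ennreal (C1 * (B1 + \<delta> + R * C))"
  proof (subst sup_norm_le_iff, safe)
    show "0 \<le> C1 * (B1 + \<delta> + R * C)" using C1(1) B10 \<delta>0 R0 C(1) by simp
    show "norm (diff_op_band \<eta> P (\<lambda>\<xi>. \<rho> (matrix_inv (transpose P) *v \<xi>)) ?T x) \<le> C1 * (B1 + \<delta> + R * C)" for x
      unfolding diff_op_band_eq[OF \<eta> det_scale(1) \<rho> Tm] matrix_inv_vector(1)[OF det_scale(1)] by (rule C1(2)[OF g g_err])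
  qed
  ultimately have "sup_norm (\<lambda>x. f x - ?T x) + sup_norm (diff_op_band \<eta> P (\<lambda>\<xi>. \<rho> (matrix_inv (transpose P) *v \<xi>)) ?T)
      \<le> ennreal B1 + ennreal (C1 * (B1 + \<delta> + R * C))" by (rule add_mono)
  also have "\<dots> = ennreal (B1 + C1 * (B1 + \<delta> + R * C))"
    using C1(1) B10 \<delta>0 R0 C(1) by (intro ennreal_plus[symmetric]) auto
  finally have le: "sup_norm (\<lambda>x. f x - ?T x) + sup_norm (diff_op_band \<eta> P (\<lambda>\<xi>. \<rho> (matrix_inv (transpose P) *v \<xi>)) ?T)
      \<le> ennreal (B1 + C1 * (B1 + \<delta> + R * C))" .
  show ?thesis unfolding realization_def by (rule order_trans[OF INF_lower[OF T]]) (rule le)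
qed

lemma dilated_BUC: "F \<in> BUC" "continuous_on UNIV F" "bounded (range F)"
  using BUC_dilate[OF f] by (auto simp: BUC_def intro: uniformly_continuous_imp_continuous)

lemma ex_near_best_sequence:
  obtains T0 where "\<And>n. T0 n \<in> band (mat_power M n)"
    "\<And>n x. norm (F x - T0 n x) \<le> 2 * best_err (mat_power M n) F"
proof -
  have "\<exists>T. T \<in> band (mat_power M n) \<and> (\<forall>x. norm (F x - T x) \<le> 2 * best_err (mat_power M n) F)" for n
    by (rule ex_near_best[OF \<eta> dilated_BUC(3), of "mat_power M n"]) blast
  then obtain T0 where "\<forall>n. T0 n \<in> band (mat_power M n) \<and> (\<forall>x. norm (F x - T0 n x) \<le> 2 * best_err (mat_power M n) F)"
    by (metis (no_types))
  then show thesis using that by blast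
qed

lemma realization_le_summable:
  assumes c1: "c1 \<ge> 1" and step: "\<And>n. \<alpha> (mat_power M (Suc n)) \<le> c1 * \<alpha> (mat_power M n)"
    and S: "\<And>n. (\<Sum>\<nu><n. \<alpha> (mat_power M \<nu>) * best_err (mat_power M (\<nu> + j)) f) \<le> S"
  shows "realization \<eta> M \<rho> f j \<le> ennreal (C1 * \<delta> + (2 * (1 + C1) / \<alpha> (mat 1) + C1 * C * (4 * c0 * (1 + c1 ^ (N + 1)))) * S)"
proof -
  let ?e = "\<lambda>n. best_err (mat_power M n) F" and ?a = "\<lambda>n. \<alpha> (mat_power M n)"
  define K where "K = 4 * c0 * (1 + c1 ^ (N + 1))"
  have K0: "0 \<le> K" unfolding K_def using c0 c1 by simp
  have fb: "bounded (range f)" using f by (simp add: BUC_def)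
  have er: "?e \<nu> \<le> best_err (mat_power M (\<nu> + j)) f" for \<nu>
  proof -
    have d: "det (mat_power M (\<nu> + j)) \<noteq> 0" using dilation_det_nz[OF M] by (simp add: det_mat_power)
    \<comment> \<open>Here the weight at \<nu> meets the error of \<open>f\<close> at \<nu> + j,
      which is the shift in the series of the theorem.\<close>
    have "mat_power M (\<nu> + j) ** matrix_inv P = mat_power M \<nu>"
      unfolding mat_power_add by (simp only: matrix_mul_assoc[symmetric] matrix_inv_mult(1)[OF det_scale(1)] matrix_mul_rid)
    then show ?thesis using best_err_dilate[OF \<eta> d det_scale(2) fb] by simp
  qed
  have ae0: "0 \<le> ?a n * ?e n" for n 
    using best_err_nonneg less_imp_le[OF \<alpha>_pos[of n]] by (intro mult_nonneg_nonneg)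
  have part: "(\<Sum>\<nu><n. ?a \<nu> * ?e \<nu>) \<le> S" for n
    by (rule order_trans[OF sum_mono S[of n]]) (intro mult_left_mono er less_imp_le \<alpha>_pos)
  have sm: "summable (\<lambda>n. ?a n * ?e n)" by (rule summableI_nonneg_bounded[OF ae0 part])
  have tot: "(\<Sum>n. ?a n * ?e n) \<le> S" by (rule suminf_le_const[OF sm part])
  have a1: "\<alpha> (mat 1) > 0" using \<alpha>_pos[of 0] by simp
  \<comment> \<open>The error at level 0 is the first term of the series divided by its weight;
    hence the \<open>\<alpha> (mat 1)\<close> in the denominator of the constant.\<close>
  have e0: "?e 0 \<le> S / \<alpha> (mat 1)" using part[of 1] a1 by (simp add: pos_le_divide_eq mult.commute)
  obtain T0 where T0: "\<And>n. T0 n \<in> band (mat_power M n)"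
    "\<And>n x. norm (F x - T0 n x) \<le> 2 * best_err (mat_power M n) F" by (rule ex_near_best_sequence) (rule that)
  have g: "T0 0 \<in> band (mat 1)" using T0(1)[of 0] by simp
  have R: "norm (pairing0 \<eta> M F \<psi> k - conv N0 (T0 0) (- lattice_vec k)) \<le> K * S" for k
  proof -
    have "norm (pairing0 \<eta> M F \<psi> k - conv (N_conv \<eta> (mat_power M 0) \<psi>) (T0 0) (- lattice_vec k)) \<le> K * (\<Sum>n. ?a n * ?e n)"
      unfolding K_def
      by (rule pairing0_summable[OF \<eta> M \<psi> N_int N_le \<alpha>_pos c0 c1 step dilated_BUC(2) dilated_BUC(3) T0(1) T0(2) N sm])
    also have "\<dots> \<le> K * S" by (rule mult_left_mono[OF tot K0])
    finally show ?thesis by simp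
  qed
  have "norm (F x - T0 0 x) \<le> 2 * (S / \<alpha> (mat 1))" for x using T0(2)[of x 0] e0 by linarith
  from realization_le[OF g this R]
  have "realization \<eta> M \<rho> f j \<le> ennreal (2 * (S / \<alpha> (mat 1)) + C1 * (2 * (S / \<alpha> (mat 1)) + \<delta> + K * S * C))" .
  also have "2 * (S / \<alpha> (mat 1)) + C1 * (2 * (S / \<alpha> (mat 1)) + \<delta> + K * S * C) = C1 * \<delta> + (2 * (1 + C1) / \<alpha> (mat 1) + C1 * C * K) * S"
    using a1 by (simp add: field_simps)
  finally show ?thesis by (simp only: K_def)
qed

text \<open>The constant collects the error 2 \<delta> of the approximant and \<open>C1\<close>
  times the sum of 2 \<delta>, \<delta> and 2 c0 a C \<delta>.\<close>

lemma realization_le_const: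
  assumes a: "\<And>n. \<alpha> (mat_power M n) = a"
  shows "realization \<eta> M \<rho> f j \<le> ennreal ((2 + 3 * C1 + 2 * C1 * C * c0 * a) * \<delta>)"
proof -
  let ?e = "\<lambda>n. best_err (mat_power M n) F"
  have a0: "a > 0" using \<alpha>_pos[of 0] unfolding a .
  have \<delta>0: "0 \<le> \<delta>" using \<delta>[of 0] norm_ge_zero order_trans by blast
  obtain T0 where T0: "\<And>n. T0 n \<in> band (mat_power M n)"
    "\<And>n x. norm (F x - T0 n x) \<le> 2 * best_err (mat_power M n) F" by (rule ex_near_best_sequence) (rule that)
  have g: "T0 0 \<in> band (mat 1)" using T0(1)[of 0] by simp
  have step: "\<alpha> (mat_power M (Suc n)) \<le> 1 * \<alpha> (mat_power M n)" for n unfolding a by simp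
  have R: "norm (pairing0 \<eta> M F \<psi> k - conv N0 (T0 0) (- lattice_vec k)) \<le> 2 * c0 * a * ?e 0" for k
    using pairing0_const[OF \<eta> M \<psi> N_int N_le \<alpha>_pos c0 order_refl step dilated_BUC(2) dilated_BUC(3) T0(1) T0(2) N a best_err_tendsto_0[OF \<eta> M dilated_BUC(1)], where k=k]
    by simp
  obtain B where B: "B \<ge> 0" "\<And>x. norm (conv N0 (T0 0) x) \<le> B" by (rule conv_N0_bounded[OF g]) (rule that)
  have R0: "0 \<le> 2 * c0 * a * ?e 0" using c0 a0 best_err_nonneg by (intro mult_nonneg_nonneg) auto
  \<comment> \<open>A crude bound that does not enter the final constant: it only places the lattice
    sum in the band, so that the sum competes in the best approximation of \<open>F\<close>.\<close>
  have pb: "norm (pairing0 \<eta> M F \<psi> k) \<le> 2 * c0 * a * ?e 0 + B" for k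
    using norm_triangle_ineq[of "pairing0 \<eta> M F \<psi> k - conv N0 (T0 0) (- lattice_vec k)" "conv N0 (T0 0) (- lattice_vec k)"]
      R[of k] B(2)[of "- lattice_vec k"] by simp
  have Q: "(\<lambda>x. \<Sum>\<^sub>\<infinity>k. pairing0 \<eta> M F \<psi> k * \<phi> (x + lattice_vec k)) \<in> band (mat 1)"
    by (rule lattice_sum_band[OF \<phi> s pb]) (use R0 B(1) in simp)
  have e0: "?e 0 \<le> \<delta>" using best_err_le[OF dilated_BUC(3) Q \<delta>0 quasi_proj_error] by simp
  have R': "norm (pairing0 \<eta> M F \<psi> k - conv N0 (T0 0) (- lattice_vec k)) \<le> 2 * c0 * a * \<delta>" for k
    by (rule order_trans[OF R mult_left_mono[OF e0]]) (use c0 a0 in simp)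
  have "norm (F x - T0 0 x) \<le> 2 * \<delta>" for x using T0(2)[of x 0] e0 by linarith
  from realization_le[OF g this R'] show ?thesis by (simp add: algebra_simps)
qed

end

theorem theorem14:
  fixes M :: "real^'n^'n"
    and s :: real
    and \<eta> :: "real^'n \<Rightarrow> real"
    and \<rho> :: "real^'n \<Rightarrow> complex"
    and \<alpha> :: "real^'n^'n \<Rightarrow> real"
    and \<phi> :: "real^'n \<Rightarrow> complex"
    and \<psi> :: "(real^'n \<Rightarrow> complex) \<Rightarrow> complex"
  assumes "cutoff \<eta>"
    and "s > 0"
    and "\<rho> \<in> homogeneous_smooth s"
    and "dilation_matrix M"
    and "\<alpha> \<in> growth_class M"
    and "\<psi> \<in> distr_class \<eta> M \<alpha>"
    and "\<phi> \<in> LC"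
    and "fun_support (fourier \<phi>) \<subseteq> unit_cube"
    and "AE \<xi> in lebesgue. 1 - fourier \<phi> \<xi> * cnj (fourier_fun \<psi> \<xi>) \<noteq> 0"
    and "\<exists>w\<in>wiener. AE \<xi> in lebesgue.
           complex_of_real (\<eta> \<xi>) * (\<rho> \<xi> / (1 - fourier \<phi> \<xi> * cnj (fourier_fun \<psi> \<xi>))) = w \<xi>"
  shows "(\<exists>c::real. c > 0 \<and> (\<forall>f\<in>besov M \<alpha>. \<forall>j::nat.
            realization \<eta> M \<rho> f j
              \<le> ennreal c * sup_norm (\<lambda>x. f x - quasi_proj \<eta> M j f \<phi> \<psi> x)
                + ennreal c * (\<Sum>\<^sub>\<infinity>n\<in>{j..}. ennreal (\<alpha> (mat_power M (n - j)))
                                  * best_approx (mat_power M n) f)))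
       \<and> (\<psi> \<in> distr_class_const \<eta> M \<longrightarrow>
          (\<exists>c::real. c > 0 \<and> (\<forall>f\<in>BUC. \<forall>j::nat.
            realization \<eta> M \<rho> f j
              \<le> ennreal c * sup_norm (\<lambda>x. f x - quasi_proj \<eta> M j f \<phi> \<psi> x))))"
proof -
  have \<eta>: "cutoff \<eta>" and M: "dilation_matrix M" and \<psi>: "\<psi> \<in> distr_class \<eta> M \<alpha>"
    and \<phi>: "\<phi> \<in> LC" and s: "fun_support (fourier \<phi>) \<subseteq> unit_cube"
    and nz: "AE \<xi> in lebesgue. 1 - fourier \<phi> \<xi> * cnj (fourier_fun \<psi> \<xi>) \<noteq> 0"
    using assms by simp_all
  obtain w where w: "w \<in> wiener" "AE \<xi> in lebesgue.
      complex_of_real (\<eta> \<xi>) * (\<rho> \<xi> / (1 - fourier \<phi> \<xi> * cnj (fourier_fun \<psi> \<xi>))) = w \<xi>"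
    using assms by blast
  have d: "det M \<noteq> 0" by (rule dilation_det_nz[OF M])
  have \<rho>: "\<rho> \<in> borel_measurable borel" by (rule homogeneous_smooth_measurable[OF assms(3)])
  have \<alpha>: "\<And>A. \<alpha> A > 0" using assms(5) by (simp add: growth_class_def)
  obtain c where c: "\<And>n. \<alpha> (mat_power M (n + 1)) \<le> c * \<alpha> (mat_power M n)"
    using assms(5) by (auto simp: growth_class_def)
  \<comment> \<open>\<open>c1\<close> at least 1 makes its powers increasing, so that c1^N may be
    enlarged to c1^(N + 1).\<close>
  define c1 where "c1 = max c 1"
  have c1: "c1 \<ge> 1" by (simp add: c1_def)
  have step: "\<alpha> (mat_power M (Suc n)) \<le> c1 * \<alpha> (mat_power M n)" for n
  proof -
    have "\<alpha> (mat_power M (Suc n)) \<le> c * \<alpha> (mat_power M n)" using c[of n] by simp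
    also have "\<dots> \<le> c1 * \<alpha> (mat_power M n)" using \<alpha> by (intro mult_right_mono) (auto simp: c1_def less_imp_le)
    finally show ?thesis .
  qed
  obtain c0 where c0: "c0 \<ge> 0" and g: "\<exists>g. has_fourier_fun \<psi> g"
    and Ni: "\<And>n. integrable lborel (N_conv \<eta> (mat_power M n) \<psi>)"
    and Nl: "\<And>n. (\<integral>x. norm (N_conv \<eta> (mat_power M n) \<psi> x) \<partial>lborel) \<le> c0 * \<alpha> (mat_power M n)"
    by (rule distr_classE[OF \<eta> d \<psi> \<alpha>]) (rule that)
  have N0i: "integrable lborel (N_conv \<eta> (mat 1) \<psi>)" using Ni[of 0] by simp
  obtain C where C: "C \<ge> 0" "\<And>x S. finite S \<Longrightarrow> (\<Sum>k\<in>S. norm (\<phi> (x + lattice_vec k))) \<le> C"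
    by (rule LC_sum_bound[OF \<phi>]) (rule that)
  obtain C1 where C1: "C1 \<ge> 0" "\<And>g B x. g \<in> band (mat 1) \<Longrightarrow>
      (\<And>x. norm (g x - (\<Sum>\<^sub>\<infinity>k. conv (N_conv \<eta> (mat 1) \<psi>) g (- lattice_vec k) * \<phi> (x + lattice_vec k))) \<le> B) \<Longrightarrow>
      norm (conv (inv_fourier (\<lambda>\<xi>. \<rho> \<xi> * complex_of_real (\<eta> \<xi>))) g x) \<le> C1 * B"
    by (rule differential_bound[OF \<eta> \<phi> s g N0i \<rho> nz w]) (rule that; iprover)
  obtain N where "\<And>k \<mu>. k \<ge> N \<Longrightarrow> spec_cube (mat_power M \<mu>) \<subseteq> spec_cube (1 *\<^sub>R mat_power M (\<mu> + k))"
    by (rule dilation_spec_cube[OF M zero_less_one]) (rule that)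
  then have N: "\<And>k \<mu>. k \<ge> N \<Longrightarrow> spec_cube (mat_power M \<mu>) \<subseteq> spec_cube (mat_power M (\<mu> + k))"
    by (simp only: scaleR_one)
  show ?thesis
  proof (intro conjI impI)
    define K where "K = 2 * (1 + C1) / \<alpha> (mat 1) + C1 * C * (4 * c0 * (1 + c1 ^ (N + 1)))"
    have K: "K \<ge> 0" unfolding K_def using C1(1) C(1) c0 c1 \<alpha>[of "mat 1"] by simp
    show "\<exists>c::real. c > 0 \<and> (\<forall>f\<in>besov M \<alpha>. \<forall>j::nat.
            realization \<eta> M \<rho> f j
              \<le> ennreal c * sup_norm (\<lambda>x. f x - quasi_proj \<eta> M j f \<phi> \<psi> x)
                + ennreal c * (\<Sum>\<^sub>\<infinity>n\<in>{j..}. ennreal (\<alpha> (mat_power M (n - j)))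
                                  * best_approx (mat_power M n) f))"
    \<comment> \<open>One constant for both terms has to dominate \<open>C1\<close> and
      \<open>K\<close>; the 1 makes it positive.\<close>
    proof (rule exI[of _ "1 + C1 + K"], intro conjI ballI allI)
      show c: "1 + C1 + K > 0" using C1(1) K by linarith
      fix f j assume "f \<in> besov M \<alpha>"
      then have f: "f \<in> BUC" by (simp add: besov_def)
      then have fb: "bounded (range f)" by (simp add: BUC_def)
      let ?D = "sup_norm (\<lambda>x. f x - quasi_proj \<eta> M j f \<phi> \<psi> x)"
      define h where "h = (\<lambda>n. ennreal (\<alpha> (mat_power M (n - j))) * best_approx (mat_power M n) f)"
      have "realization \<eta> M \<rho> f j \<le> ennreal (1 + C1 + K) * ?D + ennreal (1 + C1 + K) * infsum h {j..}"
      \<comment> \<open>An infinite right-hand side is settled apart, since the estimates take real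
        \<delta> and \<open>S\<close>. Positivity of the constant matters here, as 0 times infinity
        is 0.\<close>
      proof (cases "?D = \<top> \<or> infsum h {j..} = \<top>")
        case True
        have "ennreal (1 + C1 + K) \<noteq> 0" using c by (simp add: ennreal_eq_0_iff)
        with True show ?thesis by (auto simp: ennreal_mult_eq_top_iff)
      next
        case False
        obtain \<delta> where \<delta>: "\<delta> \<ge> 0" "?D = ennreal \<delta>" using False by (cases ?D) auto
        obtain S where S: "S \<ge> 0" "infsum h {j..} = ennreal S" using False by (cases "infsum h {j..}") auto
        have D: "norm (f x - quasi_proj \<eta> M j f \<phi> \<psi> x) \<le> \<delta>" for x
          using eq_refl[OF \<delta>(2)] unfolding sup_norm_le_iff[OF \<delta>(1)] by blast
        \<comment> \<open>The extended sum is used only through its partial sums, re-indexed from j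
          on, which are real numbers.\<close>
        have "(\<Sum>\<nu><n. \<alpha> (mat_power M \<nu>) * best_err (mat_power M (\<nu> + j)) f) \<le> S" for n
        proof -
          have "ennreal (\<Sum>\<nu><n. \<alpha> (mat_power M \<nu>) * best_err (mat_power M (\<nu> + j)) f) = (\<Sum>\<nu><n. h (\<nu> + j))"
            unfolding h_def best_approx_eq[OF fb]
            by (subst sum_ennreal[symmetric]) (auto simp: ennreal_mult best_err_nonneg less_imp_le[OF \<alpha>])
          also have "\<dots> \<le> ennreal S" unfolding S(2)[symmetric] by (rule sum_le_infsum_atLeast)
          finally show ?thesis using S(1) by simp
        qed
        from realization_le_summable[OF \<eta> M g \<phi> s C \<rho> C1 N Ni Nl \<alpha> c0 f D c1 step this]
        have "realization \<eta> M \<rho> f j \<le> ennreal (C1 * \<delta> + K * S)" unfolding K_def .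
        also have "\<dots> \<le> ennreal ((1 + C1 + K) * \<delta> + (1 + C1 + K) * S)"
          using C1(1) K \<delta>(1) S(1) by (intro ennreal_leI add_mono mult_right_mono) auto
        also have "\<dots> = ennreal (1 + C1 + K) * ?D + ennreal (1 + C1 + K) * infsum h {j..}"
          unfolding \<delta>(2) S(2) using c \<delta>(1) S(1) by (simp add: ennreal_plus ennreal_mult)
        finally show ?thesis .
      qed
      then show "realization \<eta> M \<rho> f j \<le> ennreal (1 + C1 + K) * ?D
          + ennreal (1 + C1 + K) * (\<Sum>\<^sub>\<infinity>n\<in>{j..}. ennreal (\<alpha> (mat_power M (n - j))) * best_approx (mat_power M n) f)"
        unfolding h_def .
    qed
  next
    assume "\<psi> \<in> distr_class_const \<eta> M"
    then obtain a where a: "a > 0" "\<psi> \<in> distr_class \<eta> M (\<lambda>_. a)" by (auto simp: distr_class_const_def)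
    \<comment> \<open>Membership in the constant class comes with its own bound \<open>b\<close> for
      the kernels, so from here on the weight is the constant \<open>a\<close> in place of
      \<alpha>.\<close>
    obtain b where b: "b \<ge> 0" and Na: "\<And>n. (\<integral>x. norm (N_conv \<eta> (mat_power M n) \<psi> x) \<partial>lborel) \<le> b * a"
      by (rule distr_classE[OF \<eta> d a(2) a(1)]) (rule that)
    define K where "K = 2 + 3 * C1 + 2 * C1 * C * b * a"
    have K: "K > 0" unfolding K_def using C1(1) C(1) b a(1) by (intro add_pos_nonneg) auto
    show "\<exists>c::real. c > 0 \<and> (\<forall>f\<in>BUC. \<forall>j::nat.
            realization \<eta> M \<rho> f j
              \<le> ennreal c * sup_norm (\<lambda>x. f x - quasi_proj \<eta> M j f \<phi> \<psi> x))"
    proof (rule exI[of _ K], intro conjI ballI allI K)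
      fix f :: "real^'n \<Rightarrow> complex" and j assume f: "f \<in> BUC"
      let ?D = "sup_norm (\<lambda>x. f x - quasi_proj \<eta> M j f \<phi> \<psi> x)"
      show "realization \<eta> M \<rho> f j \<le> ennreal K * ?D"
      proof (cases "?D = \<top>")
        case True
        then show ?thesis using K by (simp add: ennreal_mult_top)
      next
        case False
        obtain \<delta> where \<delta>: "\<delta> \<ge> 0" "?D = ennreal \<delta>" using False by (cases ?D) auto
        have D: "norm (f x - quasi_proj \<eta> M j f \<phi> \<psi> x) \<le> \<delta>" for x
          using eq_refl[OF \<delta>(2)] unfolding sup_norm_le_iff[OF \<delta>(1)] by blast
        have "realization \<eta> M \<rho> f j \<le> ennreal (K * \<delta>)"
          unfolding K_def
          by (rule realization_le_const[where \<alpha>="\<lambda>_. a", OF \<eta> M g \<phi> s C \<rho> C1 N Ni Na a(1) b f D refl])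
        then show ?thesis unfolding \<delta>(2) using K \<delta>(1) by (simp add: ennreal_mult)
      qed
    qed
  qed
qed

end
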